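(* Let $\sigma:Z\to W$ be a purely odd submersion of smooth superschemes over $S$, and let $\mathcal F$ be a $\mathcal D_Z$-module with underlying $\mathcal O_Z$-module $\mathcal O_Z^{p|q}$ and connection one-form $\omega$, i.e. $\mathcal F=(\mathcal O_Z^{p|q},d+\omega)$ with $d\omega+\omega\wedge\omega=0$. Regarding $\sigma_+(\mathcal F)$ simply as a vector bundle on $W$, its class belongs to $H^1(W,I+\mathfrak{gl}^{p|q}(\mathcal N_W))$, and that class is the image of $\omega_\sigma$ under the connecting homomorphism $$H^0(Z,\mathcal S_\sigma^{p|q})\to H^1(W,I+\mathfrak{gl}^{p|q}(\mathcal N_W)).$$
   Context: Base: $S=\operatorname{Spec}(\Lambda)$, where $\Lambda$ is a fixed supercommutative finite-dimensional nilpotent extension of $\mathbb C$; everything is relative to $S$, in the Zariski or the complex topology. A $\mathcal D_Z$-module is a ($\mathbb Z_2$-graded) sheaf of $\mathcal O_Z$-modules with a flat connection $\nabla$. A submersion $\sigma:Z\to W$ is purely odd if its fibers have dimension $(0|n)$ for some $n$; $Z$ and $W$ then have the same underlying topological space, $\sigma$ is the identity on it, and locally $\mathcal O_Z=\mathcal O_W[\theta_1,\dots,\theta_n]$ with odd fiber coordinates. $\sigma_+(\mathcal F)$ is the subsheaf of $\mathcal F$ killed by $\nabla_v$ for all $v$ tangent to the fibers of $\sigma$, with vector fields on $W$ acting through local lifts; it is a locally free $\mathcal O_W$-module of rank $p|q$ here. $\mathcal N_Z\subset\mathcal O_Z$ is the sheaf of nilpotents (similarly $\mathcal N_W$). $Gl^{p|q}(\mathcal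 O_Z)$ is the sheaf of (even) automorphisms of $\mathcal O_Z^{p|q}$, $I$ the identity matrix, and $I+\mathfrak{gl}^{p|q}(\mathcal N_Z)$ the subgroup sheaf of (even) matrices congruent to $I$ modulo $\mathcal N_Z$ (similarly on $W$). $d_\sigma$ is the relative differential of $Z/W$, and $\omega_\sigma$ is the restriction of $\omega$ to a relative connection form. $\mathcal S_\sigma^{p|q}$ is the sheaf of relative flat connection forms: (odd) relative one-forms $\alpha$ on $Z/W$ with values in $\mathfrak{gl}^{p|q}(\mathcal O_Z)$ with $d_\sigma\alpha+\alpha\wedge\alpha=0$, a sheaf of pointed sets with base point $0$. The connecting map comes from $I+\mathfrak{gl}^{p|q}(\mathcal N_Z)\to\mathcal S_\sigma^{p|q}$, $A\mapsto-d_\sigma A\cdot A^{-1}$, which is surjective with kernel $I+\mathfrak{gl}^{p|q}(\mathcal N_W)$: given a global section $\alpha$, choose local $A_i\in I+\mathfrak{gl}^{p|q}(\mathcal N_Z)$ with $-d_\sigma A_i\cdot A_i^{-1}=\alpha$; the image of $\alpha$ is the class of the cocycle $A_i^{-1}A_j$. The class of a rank $p|q$ vector bundle is the class of the cocycle $g_{ij}$ defined by $f_j=f_ig_{ij}$ for local frames $f_i$; that it belongs to $H^1(W,I+\mathfrak{gl}^{p|q}(\mathcal N_W))$ means that the class in $H^1(W,Gl^{p|q}(\mathcal O_W))$ is the image of the indicated class. *)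

theory Defs
  imports "HOL-Analysis.Analysis" "HOL-Algebra.Subrings" "HOL-Algebra.RingHom"
    "HOL-Combinatorics.Permutations" "HOL-Library.Poly_Mapping"
begin

section \<open>Superrings and the base\<close>

text \<open>Parities are booleans: \<open>False\<close> is even, \<open>True\<close> is odd, the sum of the parities
  \<open>a\<close> and \<open>b\<close> is \<open>a \<noteq> b\<close>, and the exponent of the sign rule is \<open>a \<and> b\<close>.\<close>

record 'a sring = "'a ring" +
  gr :: "bool \<Rightarrow> 'a set"

record 'l base_alg = "'l sring" +
  cst :: "complex \<Rightarrow> 'l"

definition sg :: "('a, 'r) ring_scheme \<Rightarrow> bool \<Rightarrow> 'a \<Rightarrow> 'a" where
  "sg R e x = (if e then \<ominus>\<^bsub>R\<^esub> x else x)"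

definition superring :: "('a, 'r) sring_scheme \<Rightarrow> bool" where
  "superring R \<longleftrightarrow> ring R \<and>
    (\<forall>a. additive_subgroup (gr R a) R) \<and>
    (\<forall>x\<in>carrier R. \<exists>!yz. yz \<in> gr R False \<times> gr R True \<and> x = fst yz \<oplus>\<^bsub>R\<^esub> snd yz) \<and>
    \<one>\<^bsub>R\<^esub> \<in> gr R False \<and>
    (\<forall>a b. \<forall>x\<in>gr R a. \<forall>y\<in>gr R b.
      x \<otimes>\<^bsub>R\<^esub> y \<in> gr R (a \<noteq> b) \<and> x \<otimes>\<^bsub>R\<^esub> y = sg R (a \<and> b) (y \<otimes>\<^bsub>R\<^esub> x))"

definition sring_hom :: "('a, 'r) sring_scheme \<Rightarrow> ('b, 's) sring_scheme \<Rightarrow> ('a \<Rightarrow> 'b) set" where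
  "sring_hom R S = {h \<in> ring_hom R S. \<forall>b. h ` gr R b \<subseteq> gr S b}"

definition complex_ring :: "complex ring" where
  "complex_ring = \<lparr>carrier = UNIV, monoid.mult = (*), one = 1, ring.zero = 0, add = (+)\<rparr>"

definition complex_basis :: "'l base_alg \<Rightarrow> 'l set \<Rightarrow> bool" where
  "complex_basis \<Lambda> E \<longleftrightarrow> finite E \<and> E \<subseteq> carrier \<Lambda> \<and>
    (\<forall>l\<in>carrier \<Lambda>. \<exists>!c. c \<in> E \<rightarrow>\<^sub>E (UNIV :: complex set) \<and>
       l = (\<Oplus>\<^bsub>\<Lambda>\<^esub>b\<in>E. cst \<Lambda> (c b) \<otimes>\<^bsub>\<Lambda>\<^esub> b))"

text \<open>A finite-dimensional supercommutative algebra that is an extension of the complex numbers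
  by a nilpotent ideal, the kernel of the augmentation \<open>\<epsilon>\<close>.\<close>

definition nilpotent_extension :: "'l base_alg \<Rightarrow> bool" where
  "nilpotent_extension \<Lambda> \<longleftrightarrow> superring \<Lambda> \<and>
    cst \<Lambda> \<in> ring_hom complex_ring \<Lambda> \<and> range (cst \<Lambda>) \<subseteq> gr \<Lambda> False \<and>
    (\<exists>E. complex_basis \<Lambda> E) \<and>
    (\<exists>\<epsilon> k. \<epsilon> \<in> ring_hom \<Lambda> complex_ring \<and> (\<forall>z. \<epsilon> (cst \<Lambda> z) = z) \<and>
      (\<forall>ls. set ls \<subseteq> {l \<in> carrier \<Lambda>. \<epsilon> l = 0} \<and> length ls = k \<longrightarrow>
         foldr (\<otimes>\<^bsub>\<Lambda>\<^esub>) ls \<one>\<^bsub>\<Lambda>\<^esub> = \<zero>\<^bsub>\<Lambda>\<^esub>))"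


section \<open>Superspaces over the base\<close>

text \<open>A topological space with a sheaf of supercommutative algebras. As the base is the spectrum
  of \<open>\<Lambda>\<close>, the structure morphism is a homomorphism \<open>smap\<close> from \<open>\<Lambda>\<close> to the global sections.\<close>

record ('x, 'a, 'l) superspace =
  tsp :: "'x topology"
  sec :: "'x set \<Rightarrow> 'a sring"
  res :: "'x set \<Rightarrow> 'x set \<Rightarrow> 'a \<Rightarrow> 'a"
  smap :: "'l \<Rightarrow> 'a"

definition scal :: "('x, 'a, 'l) superspace \<Rightarrow> 'x set \<Rightarrow> 'l \<Rightarrow> 'a" where
  "scal X U l = res X (topspace (tsp X)) U (smap X l)"

definition sub_open :: "'x topology \<Rightarrow> 'x set \<Rightarrow> 'x set \<Rightarrow> bool" where
  "sub_open T U' U \<longleftrightarrow> openin T U' \<and> U' \<subseteq> U"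

definition superspace :: "'l base_alg \<Rightarrow> ('x, 'a, 'l) superspace \<Rightarrow> bool" where
  "superspace \<Lambda> X \<longleftrightarrow>
    (\<forall>U. openin (tsp X) U \<longrightarrow> superring (sec X U)) \<and>
    (\<forall>U V. openin (tsp X) U \<and> sub_open (tsp X) V U \<longrightarrow>
       res X U V \<in> sring_hom (sec X U) (sec X V)) \<and>
    (\<forall>U f. openin (tsp X) U \<and> f \<in> carrier (sec X U) \<longrightarrow> res X U U f = f) \<and>
    (\<forall>U V V' f. openin (tsp X) U \<and> sub_open (tsp X) V U \<and> sub_open (tsp X) V' V \<and>
       f \<in> carrier (sec X U) \<longrightarrow> res X V V' (res X U V f) = res X U V' f) \<and>
    (\<forall>\<U> s. (\<forall>V\<in>\<U>. openin (tsp X) V \<and> s V \<in> carrier (sec X V)) \<and>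
       (\<forall>V\<in>\<U>. \<forall>V'\<in>\<U>. res X V (V \<inter> V') (s V) = res X V' (V \<inter> V') (s V')) \<longrightarrow>
       (\<exists>!f. f \<in> carrier (sec X (\<Union>\<U>)) \<and> (\<forall>V\<in>\<U>. res X (\<Union>\<U>) V f = s V))) \<and>
    smap X \<in> sring_hom \<Lambda> (sec X (topspace (tsp X)))"


section \<open>Local models\<close>

subsection \<open>Open subsets of complex affine space with holomorphic functions\<close>

definition cspace :: "nat \<Rightarrow> (nat \<Rightarrow> complex) set" where
  "cspace m = {z. \<forall>i\<ge>m. z i = 0}"

definition holo :: "nat \<Rightarrow> (nat \<Rightarrow> complex) set \<Rightarrow> ((nat \<Rightarrow> complex) \<Rightarrow> complex) set" where
  "holo m D = {f \<in> extensional D. \<forall>z\<in>D. \<exists>a. \<forall>\<epsilon>>0. \<exists>\<delta>>0. \<forall>w\<in>D.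
     (\<forall>i<m. cmod (w i - z i) < \<delta>) \<longrightarrow>
     cmod (f w - f z - (\<Sum>i<m. a i * (w i - z i))) \<le> \<epsilon> * (\<Sum>i<m. cmod (w i - z i))}"

text \<open>The next two predicates concern a subsheaf \<open>B\<close> of complex algebras of the even part of the
  structure sheaf on \<open>V\<close>: that \<open>(V, B)\<close> is isomorphic, as a space ringed in complex algebras,
  to an open subset of an affine space with its holomorphic functions, respectively
  to a smooth affine scheme.\<close>

definition subsheaf_of_algebras ::
    "'l base_alg \<Rightarrow> ('x, 'a, 'l) superspace \<Rightarrow> 'x set \<Rightarrow> ('x set \<Rightarrow> 'a set) \<Rightarrow> bool" where
  "subsheaf_of_algebras \<Lambda> X V B \<longleftrightarrow>
    (\<forall>U. sub_open (tsp X) U V \<longrightarrow>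
       subring (B U) (sec X U) \<and> B U \<subseteq> gr (sec X U) False \<and>
       range (\<lambda>c. scal X U (cst \<Lambda> c)) \<subseteq> B U \<and>
       (\<forall>U'. sub_open (tsp X) U' U \<longrightarrow> res X U U' ` B U \<subseteq> B U')) \<and>
    (\<forall>\<U> f. (\<forall>U\<in>\<U>. sub_open (tsp X) U V) \<and> f \<in> carrier (sec X (\<Union>\<U>)) \<and>
       (\<forall>U\<in>\<U>. res X (\<Union>\<U>) U f \<in> B U) \<longrightarrow> f \<in> B (\<Union>\<U>))"

definition complex_analytic_model ::
    "'l base_alg \<Rightarrow> ('x, 'a, 'l) superspace \<Rightarrow> 'x set \<Rightarrow> ('x set \<Rightarrow> 'a set) \<Rightarrow> bool" where
  "complex_analytic_model \<Lambda> X V B \<longleftrightarrow>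
    (\<exists>m D \<phi> e. openin (top_of_set (cspace m)) D \<and>
      homeomorphic_map (subtopology (tsp X) V) (top_of_set D) \<phi> \<and>
      (\<forall>U. sub_open (tsp X) U V \<longrightarrow>
        bij_betw (e U) (holo m (\<phi> ` U)) (B U) \<and>
        (\<forall>f\<in>holo m (\<phi> ` U). \<forall>g\<in>holo m (\<phi> ` U).
           e U (\<lambda>z\<in>\<phi> ` U. f z + g z) = e U f \<oplus>\<^bsub>sec X U\<^esub> e U g \<and>
           e U (\<lambda>z\<in>\<phi> ` U. f z * g z) = e U f \<otimes>\<^bsub>sec X U\<^esub> e U g) \<and>
        (\<forall>c. e U (\<lambda>z\<in>\<phi> ` U. c) = scal X U (cst \<Lambda> c)) \<and>
        (\<forall>U' f. sub_open (tsp X) U' U \<and> f \<in> holo m (\<phi> ` U) \<longrightarrow>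
           res X U U' (e U f) = e U' (restrict f (\<phi> ` U')))))"

subsection \<open>Smooth affine schemes over the complex numbers\<close>

type_synonym cpoly = "(nat \<Rightarrow>\<^sub>0 nat) \<Rightarrow>\<^sub>0 complex"

definition cpolys :: "nat \<Rightarrow> cpoly set" where
  "cpolys N = {P. \<forall>m\<in>Poly_Mapping.keys P. Poly_Mapping.keys m \<subseteq> {..<N}}"

definition pdiff :: "nat \<Rightarrow> cpoly \<Rightarrow> cpoly" where
  "pdiff i P = (\<Sum>m\<in>Poly_Mapping.keys P.
     Poly_Mapping.single (m - Poly_Mapping.single i 1)
       (of_nat (Poly_Mapping.lookup m i) * Poly_Mapping.lookup P m))"

definition peval :: "('a, 'r) ring_scheme \<Rightarrow> (complex \<Rightarrow> 'a) \<Rightarrow> (nat \<Rightarrow> 'a) \<Rightarrow> cpoly \<Rightarrow> 'a" where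
  "peval R \<kappa> x P = (\<Oplus>\<^bsub>R\<^esub>m\<in>Poly_Mapping.keys P. \<kappa> (Poly_Mapping.lookup P m) \<otimes>\<^bsub>R\<^esub>
     (\<Otimes>\<^bsub>R\<^esub>i\<in>Poly_Mapping.keys m. x i [^]\<^bsub>R\<^esub> Poly_Mapping.lookup m i))"

definition jacobian_minor :: "nat \<Rightarrow> (nat \<Rightarrow> cpoly) \<Rightarrow> cpoly" where
  "jacobian_minor c F =
     (\<Sum>\<pi> | \<pi> permutes {..<c}. of_int (sign \<pi>) * (\<Prod>i<c. pdiff (\<pi> i) (F i)))"

text \<open>\<open>R\<close> is a quotient of a polynomial ring in \<open>N\<close> variables by \<open>c\<close> equations such that the
  Jacobian minor of the first \<open>c\<close> variables is a unit of \<open>R\<close>. Every smooth variety is covered by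
  spectra of such algebras.\<close>

definition standard_smooth :: "('a, 'r) ring_scheme \<Rightarrow> (complex \<Rightarrow> 'a) \<Rightarrow> bool" where
  "standard_smooth R \<kappa> \<longleftrightarrow>
    (\<exists>N c x F. c \<le> N \<and> x \<in> {..<N} \<rightarrow> carrier R \<and> F \<in> {..<c} \<rightarrow> cpolys N \<and>
      peval R \<kappa> x ` cpolys N = carrier R \<and>
      {P \<in> cpolys N. peval R \<kappa> x P = \<zero>\<^bsub>R\<^esub>} =
        {\<Sum>j<c. Q j * F j | Q. Q \<in> {..<c} \<rightarrow> cpolys N} \<and>
      peval R \<kappa> x (jacobian_minor c F) \<in> Units R)"

definition spec_topology :: "('a, 'r) ring_scheme \<Rightarrow> 'a set topology" where
  "spec_topology R =
     topology_generated_by {{P. primeideal P R \<and> f \<notin> P} | f. f \<in> carrier R}"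

abbreviation subsheaf_ring :: "('x, 'a, 'l) superspace \<Rightarrow> ('x set \<Rightarrow> 'a set) \<Rightarrow> 'x set \<Rightarrow> 'a sring" where
  "subsheaf_ring X B U \<equiv> (sec X U)\<lparr>carrier := B U\<rparr>"

definition invertible_locus ::
    "('x, 'a, 'l) superspace \<Rightarrow> ('x set \<Rightarrow> 'a set) \<Rightarrow> 'x set \<Rightarrow> 'a \<Rightarrow> 'x set" where
  "invertible_locus X B V f =
     \<Union>{U. sub_open (tsp X) U V \<and> res X V U f \<in> Units (subsheaf_ring X B U)}"

text \<open>\<open>(V, B)\<close> is the spectrum of \<open>B V\<close>: a point corresponds to the prime ideal of the functions
  that are not invertible at it, and the sections over the locus \<open>V\<^sub>f\<close> where \<open>f\<close> is invertible
  form the localization of \<open>B V\<close> at \<open>f\<close>.\<close>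

definition affine :: "('x, 'a, 'l) superspace \<Rightarrow> 'x set \<Rightarrow> ('x set \<Rightarrow> 'a set) \<Rightarrow> bool" where
  "affine X V B \<longleftrightarrow>
    homeomorphic_map (subtopology (tsp X) V) (spec_topology (subsheaf_ring X B V))
      (\<lambda>x. {f \<in> B V. x \<notin> invertible_locus X B V f}) \<and>
    (\<forall>f\<in>B V. let V\<^sub>f = invertible_locus X B V f in
      res X V V\<^sub>f f \<in> Units (subsheaf_ring X B V\<^sub>f) \<and>
      (\<forall>g\<in>B V\<^sub>f. \<exists>k::nat. \<exists>a\<in>B V.
         g \<otimes>\<^bsub>sec X V\<^sub>f\<^esub> res X V V\<^sub>f (f [^]\<^bsub>sec X V\<^esub> k) = res X V V\<^sub>f a) \<and>
      (\<forall>a\<in>B V. res X V V\<^sub>f a = \<zero>\<^bsub>sec X V\<^sub>f\<^esub> \<longrightarrow>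
         (\<exists>k::nat. f [^]\<^bsub>sec X V\<^esub> k \<otimes>\<^bsub>sec X V\<^esub> a = \<zero>\<^bsub>sec X V\<^esub>)))"

definition zariski_model ::
    "'l base_alg \<Rightarrow> ('x, 'a, 'l) superspace \<Rightarrow> 'x set \<Rightarrow> ('x set \<Rightarrow> 'a set) \<Rightarrow> bool" where
  "zariski_model \<Lambda> X V B \<longleftrightarrow> affine X V B \<and>
     standard_smooth (subsheaf_ring X B V) (\<lambda>c. scal X V (cst \<Lambda> c))"

subsection \<open>Smooth superschemes\<close>

definition odd_monomial :: "('a, 'r) ring_scheme \<Rightarrow> (nat \<Rightarrow> 'a) \<Rightarrow> nat set \<Rightarrow> 'a" where
  "odd_monomial R \<theta> J = foldr (\<lambda>i y. \<theta> i \<otimes>\<^bsub>R\<^esub> y) (sorted_list_of_set J) \<one>\<^bsub>R\<^esub>"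

datatype setting = Zariski | Complex_Analytic

text \<open>Locally the structure sheaf is the tensor product over the complex numbers of the functions
  \<open>B\<close> on a smooth model, the base \<open>\<Lambda>\<close> and a finite exterior algebra, that is,
  it is free over \<open>B\<close> on the products of a basis \<open>E\<close> of \<open>\<Lambda>\<close> with the monomials
  in odd coordinates \<open>\<theta>\<close>.\<close>

definition smooth_superscheme ::
    "setting \<Rightarrow> 'l base_alg \<Rightarrow> ('x, 'a, 'l) superspace \<Rightarrow> bool" where
  "smooth_superscheme \<tau> \<Lambda> X \<longleftrightarrow> superspace \<Lambda> X \<and>
    (\<forall>x\<in>topspace (tsp X). \<exists>V B n \<theta> E. openin (tsp X) V \<and> x \<in> V \<and>
      subsheaf_of_algebras \<Lambda> X V B \<and>
      (case \<tau> of Zariski \<Rightarrow> zariski_model \<Lambda> X V B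
               | Complex_Analytic \<Rightarrow> complex_analytic_model \<Lambda> X V B) \<and>
      complex_basis \<Lambda> E \<and> (\<forall>i<n. \<theta> i \<in> gr (sec X V) True) \<and>
      (\<forall>U. sub_open (tsp X) U V \<longrightarrow> (\<forall>f\<in>carrier (sec X U).
        \<exists>!c. c \<in> Pow {..<n} \<times> E \<rightarrow>\<^sub>E B U \<and>
          f = (\<Oplus>\<^bsub>sec X U\<^esub>Jl\<in>Pow {..<n} \<times> E. c Jl \<otimes>\<^bsub>sec X U\<^esub>
                (scal X U (snd Jl) \<otimes>\<^bsub>sec X U\<^esub>
                 res X V U (odd_monomial (sec X V) \<theta> (fst Jl)))))))"

text \<open>A purely odd submersion is the identity on the underlying space, so that only its
  comorphism \<open>\<sigma>\<close> appears; \<open>n\<close> is the odd dimension of the fibers.\<close>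

definition purely_odd_submersion ::
    "'l base_alg \<Rightarrow> ('x, 'a, 'l) superspace \<Rightarrow> ('x, 'b, 'l) superspace \<Rightarrow>
     ('x set \<Rightarrow> 'b \<Rightarrow> 'a) \<Rightarrow> bool" where
  "purely_odd_submersion \<Lambda> Z W \<sigma> \<longleftrightarrow> tsp Z = tsp W \<and>
    (\<forall>U. openin (tsp W) U \<longrightarrow> \<sigma> U \<in> sring_hom (sec W U) (sec Z U)) \<and>
    (\<forall>U V f. openin (tsp W) U \<and> sub_open (tsp W) V U \<and> f \<in> carrier (sec W U) \<longrightarrow>
       \<sigma> V (res W U V f) = res Z U V (\<sigma> U f)) \<and>
    (\<forall>l\<in>carrier \<Lambda>. \<sigma> (topspace (tsp W)) (smap W l) = smap Z l) \<and>
    (\<exists>n. \<forall>x\<in>topspace (tsp Z). \<exists>V \<theta>. openin (tsp Z) V \<and> x \<in> V \<and>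
      (\<forall>i<n. \<theta> i \<in> gr (sec Z V) True) \<and>
      (\<forall>U. sub_open (tsp Z) U V \<longrightarrow> (\<forall>f\<in>carrier (sec Z U).
        \<exists>!c. c \<in> Pow {..<n} \<rightarrow>\<^sub>E carrier (sec W U) \<and>
          f = (\<Oplus>\<^bsub>sec Z U\<^esub>J\<in>Pow {..<n}. \<sigma> U (c J) \<otimes>\<^bsub>sec Z U\<^esub>
                res Z V U (odd_monomial (sec Z V) \<theta> J)))))"


section \<open>Vector fields\<close>

text \<open>A vector field over \<open>U\<close> is a derivation over \<open>\<Lambda>\<close> of the structure sheaf restricted to \<open>U\<close>.
  It is made extensional, so that equality of vector fields is equality of functions.\<close>

type_synonym ('x, 'a) vfield = "'x set \<Rightarrow> 'a \<Rightarrow> 'a"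

definition vfields ::
    "'l base_alg \<Rightarrow> ('x, 'a, 'l) superspace \<Rightarrow> 'x set \<Rightarrow> bool \<Rightarrow> ('x, 'a) vfield set" where
  "vfields \<Lambda> X U a = {v.
    (\<forall>U'. \<not> sub_open (tsp X) U' U \<longrightarrow> v U' = (\<lambda>_. undefined)) \<and>
    (\<forall>U'. sub_open (tsp X) U' U \<longrightarrow>
      v U' \<in> carrier (sec X U') \<rightarrow>\<^sub>E carrier (sec X U') \<and>
      (\<forall>f\<in>carrier (sec X U'). \<forall>g\<in>carrier (sec X U').
         v U' (f \<oplus>\<^bsub>sec X U'\<^esub> g) = v U' f \<oplus>\<^bsub>sec X U'\<^esub> v U' g) \<and>
      (\<forall>b. \<forall>f\<in>gr (sec X U') b. v U' f \<in> gr (sec X U') (a \<noteq> b)) \<and>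
      (\<forall>b. \<forall>f\<in>gr (sec X U') b. \<forall>g\<in>carrier (sec X U').
         v U' (f \<otimes>\<^bsub>sec X U'\<^esub> g) =
           (v U' f \<otimes>\<^bsub>sec X U'\<^esub> g) \<oplus>\<^bsub>sec X U'\<^esub> sg (sec X U') (a \<and> b) (f \<otimes>\<^bsub>sec X U'\<^esub> v U' g)) \<and>
      (\<forall>l\<in>carrier \<Lambda>. v U' (scal X U' l) = \<zero>\<^bsub>sec X U'\<^esub>) \<and>
      (\<forall>U''. sub_open (tsp X) U'' U' \<longrightarrow> (\<forall>f\<in>carrier (sec X U').
         res X U' U'' (v U' f) = v U'' (res X U' U'' f))))}"

definition rel_vfields ::
    "'l base_alg \<Rightarrow> ('x, 'a, 'l) superspace \<Rightarrow> ('x, 'b, 'l) superspace \<Rightarrow>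
     ('x set \<Rightarrow> 'b \<Rightarrow> 'a) \<Rightarrow> 'x set \<Rightarrow> bool \<Rightarrow> ('x, 'a) vfield set" where
  "rel_vfields \<Lambda> Z W \<sigma> U a = {v \<in> vfields \<Lambda> Z U a.
     \<forall>U'. sub_open (tsp Z) U' U \<longrightarrow>
       (\<forall>g\<in>carrier (sec W U'). v U' (\<sigma> U' g) = \<zero>\<^bsub>sec Z U'\<^esub>)}"

definition vf_res :: "'x set \<Rightarrow> ('x, 'a) vfield \<Rightarrow> ('x, 'a) vfield" where
  "vf_res U' v = (\<lambda>U''. if U'' \<subseteq> U' then v U'' else (\<lambda>_. undefined))"

definition vf_mk ::
    "('x, 'a, 'l) superspace \<Rightarrow> 'x set \<Rightarrow> ('x set \<Rightarrow> 'a \<Rightarrow> 'a) \<Rightarrow> ('x, 'a) vfield" where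
  "vf_mk X U h = (\<lambda>U'. if sub_open (tsp X) U' U then restrict (h U') (carrier (sec X U'))
                        else (\<lambda>_. undefined))"

definition vf_add ::
    "('x, 'a, 'l) superspace \<Rightarrow> 'x set \<Rightarrow> ('x, 'a) vfield \<Rightarrow> ('x, 'a) vfield \<Rightarrow> ('x, 'a) vfield" where
  "vf_add X U v w = vf_mk X U (\<lambda>U' f. v U' f \<oplus>\<^bsub>sec X U'\<^esub> w U' f)"

definition vf_smult ::
    "('x, 'a, 'l) superspace \<Rightarrow> 'x set \<Rightarrow> 'a \<Rightarrow> ('x, 'a) vfield \<Rightarrow> ('x, 'a) vfield" where
  "vf_smult X U f v = vf_mk X U (\<lambda>U' g. res X U U' f \<otimes>\<^bsub>sec X U'\<^esub> v U' g)"

definition vf_bracket ::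
    "('x, 'a, 'l) superspace \<Rightarrow> 'x set \<Rightarrow> bool \<Rightarrow> ('x, 'a) vfield \<Rightarrow> bool \<Rightarrow> ('x, 'a) vfield \<Rightarrow>
     ('x, 'a) vfield" where
  "vf_bracket X U a v b w =
     vf_mk X U (\<lambda>U' f. v U' (w U' f) \<ominus>\<^bsub>sec X U'\<^esub> sg (sec X U') (a \<and> b) (w U' (v U' f)))"


section \<open>Supermatrices\<close>

text \<open>Elements of the free module of rank \<open>p|q\<close> are columns of right coordinates
  \<open>s = \<Sum>\<^sub>k e\<^sub>k s\<^sub>k\<close>, on which matrices act from the left.
  The basis vector with index \<open>k\<close> is even for \<open>k < p\<close> and odd for \<open>p \<le> k < p + q\<close>.\<close>

type_synonym 'a mat = "nat \<Rightarrow> nat \<Rightarrow> 'a"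

definition mk_mat :: "nat \<Rightarrow> (nat \<Rightarrow> nat \<Rightarrow> 'a) \<Rightarrow> 'a mat" where
  "mk_mat n h = (\<lambda>k l. if k < n \<and> l < n then h k l else undefined)"

definition map_mat :: "nat \<Rightarrow> ('a \<Rightarrow> 'b) \<Rightarrow> 'a mat \<Rightarrow> 'b mat" where
  "map_mat n h M = mk_mat n (\<lambda>k l. h (M k l))"

definition mat_add :: "('a, 'r) ring_scheme \<Rightarrow> nat \<Rightarrow> 'a mat \<Rightarrow> 'a mat \<Rightarrow> 'a mat" where
  "mat_add R n M N = mk_mat n (\<lambda>k l. M k l \<oplus>\<^bsub>R\<^esub> N k l)"

definition mat_mult :: "('a, 'r) ring_scheme \<Rightarrow> nat \<Rightarrow> 'a mat \<Rightarrow> 'a mat \<Rightarrow> 'a mat" where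
  "mat_mult R n M N = mk_mat n (\<lambda>k l. \<Oplus>\<^bsub>R\<^esub>j\<in>{..<n}. M k j \<otimes>\<^bsub>R\<^esub> N j l)"

definition mat_zero :: "('a, 'r) ring_scheme \<Rightarrow> nat \<Rightarrow> 'a mat" where
  "mat_zero R n = mk_mat n (\<lambda>k l. \<zero>\<^bsub>R\<^esub>)"

definition mat_one :: "('a, 'r) ring_scheme \<Rightarrow> nat \<Rightarrow> 'a mat" where
  "mat_one R n = mk_mat n (\<lambda>k l. if k = l then \<one>\<^bsub>R\<^esub> else \<zero>\<^bsub>R\<^esub>)"

definition mat_minus :: "('a, 'r) ring_scheme \<Rightarrow> nat \<Rightarrow> 'a mat \<Rightarrow> 'a mat" where
  "mat_minus R n M = map_mat n (\<lambda>x. \<ominus>\<^bsub>R\<^esub> x) M"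

definition mat_sg :: "('a, 'r) ring_scheme \<Rightarrow> nat \<Rightarrow> bool \<Rightarrow> 'a mat \<Rightarrow> 'a mat" where
  "mat_sg R n e M = map_mat n (sg R e) M"

definition smat :: "('a, 'r) sring_scheme \<Rightarrow> nat \<Rightarrow> nat \<Rightarrow> bool \<Rightarrow> 'a mat set" where
  "smat R p q a = {M. \<forall>k l. if k < p + q \<and> l < p + q
     then M k l \<in> gr R (a \<noteq> ((p \<le> k) \<noteq> (p \<le> l))) else M k l = undefined}"

text \<open>The endomorphism \<open>s \<mapsto> f \<cdot> M s\<close>, with \<open>f\<close> of parity \<open>b\<close>, and the supercommutator of a vector
  field of parity \<open>a\<close>, acting on columns coordinatewise, with the endomorphism \<open>M\<close>. The signs
  arise from moving \<open>f\<close> and the vector field past the basis vector \<open>e\<^sub>k\<close>.\<close>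

definition mat_smult :: "('a, 'r) ring_scheme \<Rightarrow> nat \<Rightarrow> nat \<Rightarrow> bool \<Rightarrow> 'a \<Rightarrow> 'a mat \<Rightarrow> 'a mat" where
  "mat_smult R p q b f M = mk_mat (p + q) (\<lambda>k l. sg R (b \<and> p \<le> k) (f \<otimes>\<^bsub>R\<^esub> M k l))"

definition mat_deriv ::
    "('a, 'r) ring_scheme \<Rightarrow> nat \<Rightarrow> nat \<Rightarrow> bool \<Rightarrow> ('a \<Rightarrow> 'a) \<Rightarrow> 'a mat \<Rightarrow> 'a mat" where
  "mat_deriv R p q a v M = mk_mat (p + q) (\<lambda>k l. sg R (a \<and> p \<le> k) (v (M k l)))"

definition even_mat_monoid :: "('a, 'r) sring_scheme \<Rightarrow> nat \<Rightarrow> nat \<Rightarrow> 'a mat monoid" where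
  "even_mat_monoid R p q =
     \<lparr>carrier = smat R p q False, monoid.mult = mat_mult R (p + q), one = mat_one R (p + q)\<rparr>"

definition GL :: "('x, 'a, 'l) superspace \<Rightarrow> nat \<Rightarrow> nat \<Rightarrow> 'x set \<Rightarrow> 'a mat monoid" where
  "GL X p q U = units_of (even_mat_monoid (sec X U) p q)"

text \<open>The sheaf of nilpotents: its sections are locally nilpotent.\<close>

definition nilpotents :: "('x, 'a, 'l) superspace \<Rightarrow> 'x set \<Rightarrow> 'a set" where
  "nilpotents X U = {f \<in> carrier (sec X U). \<forall>x\<in>U. \<exists>V. sub_open (tsp X) V U \<and> x \<in> V \<and>
     (\<exists>k::nat. res X U V f [^]\<^bsub>sec X V\<^esub> k = \<zero>\<^bsub>sec X V\<^esub>)}"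

definition GL1 :: "('x, 'a, 'l) superspace \<Rightarrow> nat \<Rightarrow> nat \<Rightarrow> 'x set \<Rightarrow> 'a mat monoid" where
  "GL1 X p q U = (even_mat_monoid (sec X U) p q)\<lparr>carrier := {A \<in> smat (sec X U) p q False.
     \<forall>k<p + q. \<forall>l<p + q.
       A k l \<ominus>\<^bsub>sec X U\<^esub> mat_one (sec X U) (p + q) k l \<in> nilpotents X U}\<rparr>"

definition mat_res ::
    "('x, 'a, 'l) superspace \<Rightarrow> nat \<Rightarrow> 'x set \<Rightarrow> 'x set \<Rightarrow> 'a mat \<Rightarrow> 'a mat" where
  "mat_res X n U V = map_mat n (res X U V)"


section \<open>Connection forms\<close>

text \<open>A one-form with values in matrices, over \<open>U\<close> and along the sheaf \<open>T\<close> of graded modules of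
  vector fields, is a compatible family of maps \<open>v \<mapsto> \<langle>v, \<alpha>\<rangle>\<close> on the vector fields over the open
  subsets of \<open>U\<close>, linear over functions multiplied from the left. It is given on homogeneous vector
  fields, whose parity is the second argument. The one-forms considered are those for which
  \<open>\<langle>v, \<alpha>\<rangle>\<close> has the parity of \<open>v\<close>, so that \<open>v + \<langle>v, \<alpha>\<rangle>\<close> is homogeneous; when the degree as
  a form is counted in the parity, these are the odd ones.\<close>

type_synonym ('x, 'a) mform = "'x set \<Rightarrow> bool \<Rightarrow> ('x, 'a) vfield \<Rightarrow> 'a mat"

definition one_forms ::
    "('x, 'a, 'l) superspace \<Rightarrow> ('x set \<Rightarrow> bool \<Rightarrow> ('x, 'a) vfield set) \<Rightarrow> nat \<Rightarrow> nat \<Rightarrow> 'x set \<Rightarrow>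
     ('x, 'a) mform set" where
  "one_forms X T p q U = {\<alpha>.
    (\<forall>U' a v. \<not> (sub_open (tsp X) U' U \<and> v \<in> T U' a) \<longrightarrow> \<alpha> U' a v = undefined) \<and>
    (\<forall>U' a. \<forall>v\<in>T U' a. sub_open (tsp X) U' U \<longrightarrow>
      \<alpha> U' a v \<in> smat (sec X U') p q a \<and>
      (\<forall>w\<in>T U' a. \<alpha> U' a (vf_add X U' v w) = mat_add (sec X U') (p + q) (\<alpha> U' a v) (\<alpha> U' a w)) \<and>
      (\<forall>b. \<forall>f\<in>gr (sec X U') b.
         \<alpha> U' (b \<noteq> a) (vf_smult X U' f v) = mat_smult (sec X U') p q b f (\<alpha> U' a v)) \<and>
      (\<forall>U''. sub_open (tsp X) U'' U' \<longrightarrow>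
         \<alpha> U'' a (vf_res U'' v) = mat_res X (p + q) U' U'' (\<alpha> U' a v)))}"

text \<open>The value of \<open>d\<alpha> + \<alpha> \<and> \<alpha>\<close> on vector fields \<open>v\<close>, \<open>w\<close> over \<open>U\<close> of parities \<open>a\<close>, \<open>b\<close>, where
  \<open>d\<alpha>(v, w) = v \<langle>w, \<alpha>\<rangle> - (-1)\<^sup>a\<^sup>b w \<langle>v, \<alpha>\<rangle> - \<langle>[v, w], \<alpha>\<rangle>\<close> and
  \<open>(\<alpha> \<and> \<alpha>)(v, w) = \<langle>v, \<alpha>\<rangle> \<langle>w, \<alpha>\<rangle> - (-1)\<^sup>a\<^sup>b \<langle>w, \<alpha>\<rangle> \<langle>v, \<alpha>\<rangle>\<close>.\<close>

definition d_form ::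
    "('x, 'a, 'l) superspace \<Rightarrow> nat \<Rightarrow> nat \<Rightarrow> ('x, 'a) mform \<Rightarrow> 'x set \<Rightarrow>
     bool \<Rightarrow> ('x, 'a) vfield \<Rightarrow> bool \<Rightarrow> ('x, 'a) vfield \<Rightarrow> 'a mat" where
  "d_form X p q \<alpha> U a v b w = (let R = sec X U; n = p + q in
     mat_add R n (mat_deriv R p q a (v U) (\<alpha> U b w))
       (mat_minus R n (mat_add R n
         (mat_sg R n (a \<and> b) (mat_deriv R p q b (w U) (\<alpha> U a v)))
         (\<alpha> U (a \<noteq> b) (vf_bracket X U a v b w)))))"

definition wedge_form ::
    "('x, 'a, 'l) superspace \<Rightarrow> nat \<Rightarrow> nat \<Rightarrow> ('x, 'a) mform \<Rightarrow> 'x set \<Rightarrow>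
     bool \<Rightarrow> ('x, 'a) vfield \<Rightarrow> bool \<Rightarrow> ('x, 'a) vfield \<Rightarrow> 'a mat" where
  "wedge_form X p q \<alpha> U a v b w = (let R = sec X U; n = p + q in
     mat_add R n (mat_mult R n (\<alpha> U a v) (\<alpha> U b w))
       (mat_minus R n (mat_sg R n (a \<and> b) (mat_mult R n (\<alpha> U b w) (\<alpha> U a v)))))"

definition flat_forms ::
    "('x, 'a, 'l) superspace \<Rightarrow> ('x set \<Rightarrow> bool \<Rightarrow> ('x, 'a) vfield set) \<Rightarrow> nat \<Rightarrow> nat \<Rightarrow> 'x set \<Rightarrow>
     ('x, 'a) mform set" where
  "flat_forms X T p q U = {\<alpha> \<in> one_forms X T p q U.
     \<forall>U' a b. \<forall>v\<in>T U' a. \<forall>w\<in>T U' b. sub_open (tsp X) U' U \<longrightarrow>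
       mat_add (sec X U') (p + q) (d_form X p q \<alpha> U' a v b w) (wedge_form X p q \<alpha> U' a v b w)
         = mat_zero (sec X U') (p + q)}"

definition form_restrict ::
    "('x, 'a, 'l) superspace \<Rightarrow> ('x set \<Rightarrow> bool \<Rightarrow> ('x, 'a) vfield set) \<Rightarrow> 'x set \<Rightarrow>
     ('x, 'a) mform \<Rightarrow> ('x, 'a) mform" where
  "form_restrict X T U \<alpha> = (\<lambda>U' a v.
     if sub_open (tsp X) U' U \<and> v \<in> T U' a then \<alpha> U' a v else undefined)"

text \<open>The form \<open>- dA \<cdot> A\<^sup>-\<^sup>1\<close>.\<close>

definition neg_dlog ::
    "('x, 'a, 'l) superspace \<Rightarrow> ('x set \<Rightarrow> bool \<Rightarrow> ('x, 'a) vfield set) \<Rightarrow> nat \<Rightarrow> nat \<Rightarrow> 'x set \<Rightarrow>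
     'a mat \<Rightarrow> ('x, 'a) mform" where
  "neg_dlog X T p q U A = form_restrict X T U (\<lambda>U' a v.
     let R = sec X U'; A' = mat_res X (p + q) U U' A in
     mat_minus R (p + q)
       (mat_mult R (p + q) (mat_deriv R p q a (v U') A') (inv\<^bsub>GL X p q U'\<^esub> A')))"


section \<open>Sheaves of modules with connection\<close>

text \<open>Sheaves of graded right modules; only the additive part of \<open>'m ring\<close> is used.\<close>

record ('m, 'a) rmodule = "'m ring" +
  ract :: "'m \<Rightarrow> 'a \<Rightarrow> 'm"
  mgr :: "bool \<Rightarrow> 'm set"

record ('x, 'a, 'm) module_sheaf =
  msec :: "'x set \<Rightarrow> ('m, 'a) rmodule"
  mres :: "'x set \<Rightarrow> 'x set \<Rightarrow> 'm \<Rightarrow> 'm"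

record ('x, 'a, 'm) conn_module = "('x, 'a, 'm) module_sheaf" +
  nabla :: "'x set \<Rightarrow> bool \<Rightarrow> ('x, 'a) vfield \<Rightarrow> 'm \<Rightarrow> 'm"

definition free_rmodule ::
    "('a, 'r) sring_scheme \<Rightarrow> nat \<Rightarrow> nat \<Rightarrow> (nat \<Rightarrow> 'a, 'a) rmodule" where
  "free_rmodule R p q =
    \<lparr>carrier = {..<p + q} \<rightarrow>\<^sub>E carrier R, monoid.mult = undefined, one = undefined,
     ring.zero = (\<lambda>k\<in>{..<p + q}. \<zero>\<^bsub>R\<^esub>),
     add = (\<lambda>s t. \<lambda>k\<in>{..<p + q}. s k \<oplus>\<^bsub>R\<^esub> t k),
     ract = (\<lambda>s f. \<lambda>k\<in>{..<p + q}. s k \<otimes>\<^bsub>R\<^esub> f),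
     mgr = (\<lambda>b. {s \<in> {..<p + q} \<rightarrow>\<^sub>E carrier R. \<forall>k<p + q. s k \<in> gr R (b \<noteq> (p \<le> k))})\<rparr>"

text \<open>The free module with the connection \<open>d + \<omega>\<close>.\<close>

definition free_conn_module ::
    "('x, 'a, 'l) superspace \<Rightarrow> nat \<Rightarrow> nat \<Rightarrow> ('x, 'a) mform \<Rightarrow>
     ('x, 'a, nat \<Rightarrow> 'a) conn_module" where
  "free_conn_module X p q \<omega> =
    \<lparr>msec = (\<lambda>U. free_rmodule (sec X U) p q),
     mres = (\<lambda>U V s. \<lambda>k\<in>{..<p + q}. res X U V (s k)),
     nabla = (\<lambda>U a v s. \<lambda>k\<in>{..<p + q}. sg (sec X U) (a \<and> p \<le> k) (v U (s k)) \<oplus>\<^bsub>sec X U\<^esub>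
       (\<Oplus>\<^bsub>sec X U\<^esub>l\<in>{..<p + q}. \<omega> U a v k l \<otimes>\<^bsub>sec X U\<^esub> s l))\<rparr>"

text \<open>The direct image along a purely odd submersion: the sections annihilated by the
  covariant derivatives along the fibers, as a sheaf of modules on the target.\<close>

definition odd_pushforward ::
    "'l base_alg \<Rightarrow> ('x, 'a, 'l) superspace \<Rightarrow> ('x, 'b, 'l) superspace \<Rightarrow>
     ('x set \<Rightarrow> 'b \<Rightarrow> 'a) \<Rightarrow> ('x, 'a, 'm) conn_module \<Rightarrow> ('x, 'b, 'm) module_sheaf" where
  "odd_pushforward \<Lambda> Z W \<sigma> F =
    \<lparr>msec = (\<lambda>U. let H = {s \<in> carrier (msec F U). \<forall>U' a. \<forall>v\<in>rel_vfields \<Lambda> Z W \<sigma> U' a.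
                    sub_open (tsp Z) U' U \<longrightarrow>
                    nabla F U' a v (mres F U U' s) = \<zero>\<^bsub>msec F U'\<^esub>} in
        \<lparr>carrier = H, monoid.mult = undefined, one = undefined,
         ring.zero = \<zero>\<^bsub>msec F U\<^esub>, add = add (msec F U),
         ract = (\<lambda>s f. ract (msec F U) s (\<sigma> U f)),
         mgr = (\<lambda>b. mgr (msec F U) b \<inter> H)\<rparr>),
     mres = mres F\<rparr>"

text \<open>\<open>f 0, \<dots>, f (p + q - 1)\<close> is a homogeneous basis of \<open>M\<close> restricted to \<open>U\<close>.\<close>

definition frame ::
    "('x, 'b, 'l) superspace \<Rightarrow> ('x, 'b, 'm) module_sheaf \<Rightarrow> nat \<Rightarrow> nat \<Rightarrow> 'x set \<Rightarrow>
     (nat \<Rightarrow> 'm) \<Rightarrow> bool" where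
  "frame W M p q U f \<longleftrightarrow>
    (\<forall>k<p + q. f k \<in> mgr (msec M U) (p \<le> k)) \<and>
    (\<forall>U'. sub_open (tsp W) U' U \<longrightarrow> (\<forall>s\<in>carrier (msec M U').
      \<exists>!c. c \<in> {..<p + q} \<rightarrow>\<^sub>E carrier (sec W U') \<and>
        s = (\<Oplus>\<^bsub>msec M U'\<^esub>k\<in>{..<p + q}. ract (msec M U') (mres M U U' (f k)) (c k))))"


section \<open>Non-abelian first cohomology\<close>

text \<open>Open covers are indexed by the points of the space, with \<open>x \<in> U x\<close>; every open cover has a
  refinement of this form. The cohomology set is the set of classes of cocycles
  which become cohomologous on a common refinement.\<close>

type_synonym ('x, 'g) cochain = "('x \<Rightarrow> 'x set) \<times> ('x \<Rightarrow> 'x \<Rightarrow> 'g)"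

definition point_cover :: "'x topology \<Rightarrow> ('x \<Rightarrow> 'x set) \<Rightarrow> bool" where
  "point_cover T U \<longleftrightarrow> (\<forall>x\<in>topspace T. openin T (U x) \<and> x \<in> U x)"

definition cocycles ::
    "'x topology \<Rightarrow> ('x set \<Rightarrow> 'g monoid) \<Rightarrow> ('x set \<Rightarrow> 'x set \<Rightarrow> 'g \<Rightarrow> 'g) \<Rightarrow>
     ('x, 'g) cochain set" where
  "cocycles T G r = {(U, g). point_cover T U \<and>
    (\<forall>x\<in>topspace T. \<forall>y\<in>topspace T. g x y \<in> carrier (G (U x \<inter> U y))) \<and>
    (\<forall>x\<in>topspace T. \<forall>y\<in>topspace T. \<forall>z\<in>topspace T. let V = U x \<inter> U y \<inter> U z in
       r (U x \<inter> U y) V (g x y) \<otimes>\<^bsub>G V\<^esub> r (U y \<inter> U z) V (g y z) = r (U x \<inter> U z) V (g x z))}"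

definition cohomologous ::
    "'x topology \<Rightarrow> ('x set \<Rightarrow> 'g monoid) \<Rightarrow> ('x set \<Rightarrow> 'x set \<Rightarrow> 'g \<Rightarrow> 'g) \<Rightarrow>
     (('x, 'g) cochain \<times> ('x, 'g) cochain) set" where
  "cohomologous T G r = {((U, g), (V, h)). (U, g) \<in> cocycles T G r \<and> (V, h) \<in> cocycles T G r \<and>
    (\<exists>N \<rho> \<tau> c. point_cover T N \<and>
      (\<forall>x\<in>topspace T. \<rho> x \<in> topspace T \<and> \<tau> x \<in> topspace T \<and>
         N x \<subseteq> U (\<rho> x) \<and> N x \<subseteq> V (\<tau> x) \<and> c x \<in> carrier (G (N x))) \<and>
      (\<forall>x\<in>topspace T. \<forall>y\<in>topspace T. let K = N x \<inter> N y in
         r (N x) K (c x) \<otimes>\<^bsub>G K\<^esub> r (V (\<tau> x) \<inter> V (\<tau> y)) K (h (\<tau> x) (\<tau> y)) =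
         r (U (\<rho> x) \<inter> U (\<rho> y)) K (g (\<rho> x) (\<rho> y)) \<otimes>\<^bsub>G K\<^esub> r (N y) K (c y)))}"

definition H1 ::
    "'x topology \<Rightarrow> ('x set \<Rightarrow> 'g monoid) \<Rightarrow> ('x set \<Rightarrow> 'x set \<Rightarrow> 'g \<Rightarrow> 'g) \<Rightarrow>
     ('x, 'g) cochain set set" where
  "H1 T G r = cocycles T G r // cohomologous T G r"

abbreviation H1_GL1 :: "('x, 'a, 'l) superspace \<Rightarrow> nat \<Rightarrow> nat \<Rightarrow> ('x, 'a mat) cochain set set" where
  "H1_GL1 W p q \<equiv> H1 (tsp W) (GL1 W p q) (mat_res W (p + q))"

abbreviation H1_GL :: "('x, 'a, 'l) superspace \<Rightarrow> nat \<Rightarrow> nat \<Rightarrow> ('x, 'a mat) cochain set set" where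
  "H1_GL W p q \<equiv> H1 (tsp W) (GL W p q) (mat_res W (p + q))"

text \<open>The map induced by the inclusion of \<open>GL1\<close> into \<open>GL\<close>: the class, for the bigger group, of
  the same cocycle.\<close>

definition H1_incl ::
    "('x, 'a, 'l) superspace \<Rightarrow> nat \<Rightarrow> nat \<Rightarrow> ('x, 'a mat) cochain set \<Rightarrow> ('x, 'a mat) cochain set" where
  "H1_incl W p q \<xi> = cohomologous (tsp W) (GL W p q) (mat_res W (p + q)) `` \<xi>"

text \<open>The next two definitions give the set of all cocycles cohomologous to one constructed from
  some choice of local solutions, respectively of local frames. That this set is a cohomology class,
  so that choices exist and the class does not depend on them, is membership in \<open>H1_GL1\<close>,
  respectively in \<open>H1_GL\<close>.\<close>

definition connecting_map ::
    "'l base_alg \<Rightarrow> ('x, 'a, 'l) superspace \<Rightarrow> ('x, 'b, 'l) superspace \<Rightarrow>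
     ('x set \<Rightarrow> 'b \<Rightarrow> 'a) \<Rightarrow> nat \<Rightarrow> nat \<Rightarrow> ('x, 'a) mform \<Rightarrow> ('x, 'b mat) cochain set" where
  "connecting_map \<Lambda> Z W \<sigma> p q \<alpha> = (let T = rel_vfields \<Lambda> Z W \<sigma>; X = topspace (tsp W); n = p + q in
     cohomologous (tsp W) (GL1 W p q) (mat_res W n) ``
     {(U, g). (U, g) \<in> cocycles (tsp W) (GL1 W p q) (mat_res W n) \<and>
        (\<exists>A. (\<forall>x\<in>X. A x \<in> carrier (GL1 Z p q (U x)) \<and>
                neg_dlog Z T p q (U x) (A x) = form_restrict Z T (U x) \<alpha>) \<and>
          (\<forall>x\<in>X. \<forall>y\<in>X. let V = U x \<inter> U y in
             map_mat n (\<sigma> V) (g x y) =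
               inv\<^bsub>GL Z p q V\<^esub> (mat_res Z n (U x) V (A x)) \<otimes>\<^bsub>GL Z p q V\<^esub> mat_res Z n (U y) V (A y)))})"

definition bundle_class ::
    "('x, 'b, 'l) superspace \<Rightarrow> nat \<Rightarrow> nat \<Rightarrow> ('x, 'b, 'm) module_sheaf \<Rightarrow>
     ('x, 'b mat) cochain set" where
  "bundle_class W p q M = (let X = topspace (tsp W); n = p + q in
     cohomologous (tsp W) (GL W p q) (mat_res W n) ``
     {(U, g). (U, g) \<in> cocycles (tsp W) (GL W p q) (mat_res W n) \<and>
        (\<exists>f. (\<forall>x\<in>X. frame W M p q (U x) (f x)) \<and>
          (\<forall>x\<in>X. \<forall>y\<in>X. let V = U x \<inter> U y in
             \<forall>l<n. mres M (U y) V (f y l) =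
               (\<Oplus>\<^bsub>msec M V\<^esub>k\<in>{..<n}. ract (msec M V) (mres M (U x) V (f x k)) (g x y k l))))})"

end

theory Submission
  imports Defs
begin

text \<open>Sections of \<open>F\<close> are columns of functions on \<open>Z\<close>. Multiplied by \<open>A\<close> from the right, the equation
  \<open>- dA \<cdot> A\<^sup>-\<^sup>1 = \<omega>\<^sub>\<sigma>\<close> becomes \<open>dA + \<omega>\<^sub>\<sigma> A = 0\<close>, which says that the columns of \<open>A\<close> are killed by the
  covariant derivatives along the fibers, that is, that they are sections of the direct image
  (\<open>neg_dlog_iff\<close>). They are even a frame of it (\<open>solution_is_frame\<close>): a section of the direct
  image has the form \<open>A c\<close>, and by the Leibniz rule the derivatives of its coordinates \<open>c\<close> along the
  fibers vanish, so that \<open>c\<close> consists of functions on \<open>W\<close> (\<open>constant_along_fibers\<close>).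
  For two solutions the equation \<open>A\<^sub>j = A\<^sub>i g\<^sub>i\<^sub>j\<close> can therefore be read in two ways. It says that
  \<open>g\<^sub>i\<^sub>j = A\<^sub>i\<^sup>-\<^sup>1 A\<^sub>j\<close> is the cocycle of the connecting map, and that \<open>g\<^sub>i\<^sub>j\<close> is the transition matrix
  between frames of the direct image. So every cocycle of the connecting map is also a cocycle of the
  bundle (\<open>solution_cocycles_subset\<close>), and the two classes agree once both are well defined.

  Local solutions exist (\<open>local_solution\<close>) because the fibers are purely odd. Let \<open>\<theta>\<^sub>i\<close> be odd
  coordinates and \<open>D\<^sub>i\<close> the covariant derivative along the partial derivative with respect to
  \<open>\<theta>\<^sub>i\<close>. Flatness says that \<open>D\<^sub>i D\<^sub>j + D\<^sub>j D\<^sub>i = 0\<close>, in particular \<open>D\<^sub>i D\<^sub>i = 0\<close>, and the Leibniz rule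
  says that \<open>D\<^sub>i \<theta>\<^sub>j + \<theta>\<^sub>j D\<^sub>i\<close> is \<open>1\<close> for \<open>i = j\<close> and \<open>0\<close> otherwise. Hence
  \<open>D\<^sub>i \<theta>\<^sub>i = 1 - \<theta>\<^sub>i D\<^sub>i\<close> is a projection to the kernel of \<open>D\<^sub>i\<close> and preserves the kernels of the
  other \<open>D\<^sub>j\<close>. Applied one after another, these operators turn the standard basis into columns which
  are killed by all \<open>D\<^sub>i\<close> and differ from the basis only by nilpotents. The argument is algebraic and is
  the same in the Zariski and in the complex topology.

  The classes do not depend on choices: on a common refinement two systems of frames differ by
  invertible matrices over \<open>W\<close> (\<open>frame_transition\<close>), two systems of solutions by matrices over \<open>W\<close>
  congruent to the identity (\<open>solution_transition\<close>), and these matrices form the cochain that makes the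
  two cocycles cohomologous (\<open>cohomologous_choices\<close>).

  Finally, the matrices congruent to the identity modulo nilpotents have to be a group. A finite set of
  nilpotent homogeneous elements of a supercommutative ring generates a nilpotent ideal
  (\<open>long_products_vanish\<close>), so that such a matrix has locally an inverse, given by the geometric series;
  the local inverses are unique and glue (\<open>GL1_inverse\<close>).\<close>

section \<open>Superalgebras in which two is invertible\<close>

text \<open>With two invertible, an element that equals its negative is zero; in particular odd elements square to
  zero. The sections of a structure sheaf have this property because the base contains the complex
  numbers.\<close>

locale superalg =
  fixes R :: "('a, 'r) sring_scheme" (structure)
  assumes superring: "superring R"
    and half: "\<exists>h\<in>carrier R. h \<oplus> h = \<one>"

sublocale superalg \<subseteq> ring R
  using superring by (simp add: superring_def)

context superalg
begin

lemma gr_subgroup: "additive_subgroup (gr R a) R"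
  using superring by (simp add: superring_def)

lemma gr_closed [simp]: "x \<in> gr R a \<Longrightarrow> x \<in> carrier R"
  using additive_subgroup.a_subset[OF gr_subgroup] by blast

lemma gr_add [simp, intro]: "x \<in> gr R a \<Longrightarrow> y \<in> gr R a \<Longrightarrow> x \<oplus> y \<in> gr R a"
  using additive_subgroup.a_closed[OF gr_subgroup] by blast

lemma gr_zero [simp, intro]: "\<zero> \<in> gr R a"
  using additive_subgroup.zero_closed[OF gr_subgroup] by blast

lemma gr_neg [simp, intro]: "x \<in> gr R a \<Longrightarrow> \<ominus> x \<in> gr R a"
  using additive_subgroup.a_inv_closed[OF gr_subgroup] by blast

lemma gr_minus [simp, intro]: "x \<in> gr R a \<Longrightarrow> y \<in> gr R a \<Longrightarrow> x \<ominus> y \<in> gr R a"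
  by (simp add: minus_eq)

lemma gr_one [simp, intro]: "\<one> \<in> gr R False"
  using superring by (simp add: superring_def)

lemma gr_mult [intro]: "x \<in> gr R a \<Longrightarrow> y \<in> gr R b \<Longrightarrow> x \<otimes> y \<in> gr R (a \<noteq> b)"
  using superring unfolding superring_def by blast

lemma gr_mult': "x \<in> gr R a \<Longrightarrow> y \<in> gr R b \<Longrightarrow> c = (a \<noteq> b) \<Longrightarrow> x \<otimes> y \<in> gr R c"
  using gr_mult by blast

lemma supercomm: "x \<in> gr R a \<Longrightarrow> y \<in> gr R b \<Longrightarrow> x \<otimes> y = sg R (a \<and> b) (y \<otimes> x)"
  using superring unfolding superring_def by blast

lemma gr_finsum: "(\<And>i. i \<in> A \<Longrightarrow> f i \<in> gr R a) \<Longrightarrow> finsum R f A \<in> gr R a"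
proof (induction A rule: infinite_finite_induct)
  case (insert x F)
  then have "f \<in> F \<rightarrow> carrier R" "f x \<in> carrier R" using gr_closed by blast+
  then show ?case using insert by (subst finsum_insert) auto
qed auto

lemma sg_closed [simp, intro]: "x \<in> carrier R \<Longrightarrow> sg R e x \<in> carrier R"
  by (simp add: sg_def)

lemma sg_gr [simp, intro]: "x \<in> gr R a \<Longrightarrow> sg R e x \<in> gr R a"
  by (simp add: sg_def)

lemma sg_False [simp]: "sg R False x = x"
  by (simp add: sg_def)

lemma sg_sg [simp]: "x \<in> carrier R \<Longrightarrow> sg R e (sg R e' x) = sg R (e \<noteq> e') x"
  by (auto simp: sg_def)

lemma sg_add: "x \<in> carrier R \<Longrightarrow> y \<in> carrier R \<Longrightarrow> sg R e (x \<oplus> y) = sg R e x \<oplus> sg R e y"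
  by (auto simp: sg_def minus_add a_comm)

lemma sg_neg: "x \<in> carrier R \<Longrightarrow> sg R e (\<ominus> x) = \<ominus> (sg R e x)"
  by (auto simp: sg_def)

lemma sg_zero [simp]: "sg R e \<zero> = \<zero>"
  by (auto simp: sg_def)

lemma sg_eq_zero [simp]: "x \<in> carrier R \<Longrightarrow> sg R e x = \<zero> \<longleftrightarrow> x = \<zero>"
  by (auto simp: sg_def)

lemma sg_mult_l: "x \<in> carrier R \<Longrightarrow> y \<in> carrier R \<Longrightarrow> sg R e x \<otimes> y = sg R e (x \<otimes> y)"
  by (auto simp: sg_def l_minus)

lemma sg_mult_r: "x \<in> carrier R \<Longrightarrow> y \<in> carrier R \<Longrightarrow> x \<otimes> sg R e y = sg R e (x \<otimes> y)"
  by (auto simp: sg_def r_minus)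

lemma sg_finsum: "f \<in> A \<rightarrow> carrier R \<Longrightarrow> sg R e (finsum R f A) = (\<Oplus>i\<in>A. sg R e (f i))"
proof (induction A rule: infinite_finite_induct)
  case (insert x F)
  then show ?case by (subst (1 2) finsum_insert) (auto simp: sg_add Pi_def)
qed auto

lemma two_zero: assumes "x \<in> carrier R" "x \<oplus> x = \<zero>" shows "x = \<zero>"
proof -
  obtain h where h: "h \<in> carrier R" "h \<oplus> h = \<one>" using half by blast
  have "x = (h \<oplus> h) \<otimes> x" using h assms by simp
  also have "\<dots> = h \<otimes> (x \<oplus> x)" using h(1) assms(1) by (simp add: l_distr r_distr)
  finally show ?thesis using h assms by simp
qed

lemma odd_square: assumes "x \<in> gr R True" shows "x \<otimes> x = \<zero>"
proof (rule two_zero)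
  have "x \<otimes> x = \<ominus> (x \<otimes> x)" using supercomm[OF assms assms] by (simp add: sg_def)
  then show "x \<otimes> x \<oplus> x \<otimes> x = \<zero>"
    by (metis assms gr_closed m_closed r_neg)
qed (use assms in simp)

subsection \<open>Homogeneous components and the grade involution\<close>

definition hpart :: "bool \<Rightarrow> 'a \<Rightarrow> 'a" where
  "hpart b x = (if b then snd else fst)
     (THE yz. yz \<in> gr R False \<times> gr R True \<and> x = fst yz \<oplus> snd yz)"

lemma decomp_ex1:
  "x \<in> carrier R \<Longrightarrow> \<exists>!yz. yz \<in> gr R False \<times> gr R True \<and> x = fst yz \<oplus> snd yz"
  using superring by (simp add: superring_def)

lemma hpart_even_odd:
  assumes "x \<in> carrier R"
  shows "hpart False x \<in> gr R False" "hpart True x \<in> gr R True"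
    "x = hpart False x \<oplus> hpart True x"
  using theI'[OF decomp_ex1[OF assms]] by (auto simp: hpart_def mem_Times_iff)

lemma hpart_gr [simp, intro]: "x \<in> carrier R \<Longrightarrow> hpart b x \<in> gr R b"
  using hpart_even_odd by (cases b) auto

lemma hpart_closed [simp, intro]: "x \<in> carrier R \<Longrightarrow> hpart b x \<in> carrier R"
  using hpart_gr gr_closed by blast

lemma hpart_sum: "x \<in> carrier R \<Longrightarrow> x = hpart b x \<oplus> hpart (\<not> b) x"
  using hpart_even_odd[of x] by (cases b) (auto simp: a_comm)

lemma hpart_unique_aux:
  assumes "y \<in> gr R False" "z \<in> gr R True"
  shows "hpart False (y \<oplus> z) = y \<and> hpart True (y \<oplus> z) = z"
proof -
  have "(THE yz. yz \<in> gr R False \<times> gr R True \<and> y \<oplus> z = fst yz \<oplus> snd yz) = (y, z)"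
    by (rule the1_equality[OF decomp_ex1]) (use assms in auto)
  then show ?thesis by (simp add: hpart_def)
qed

lemma hpart_unique: "y \<in> gr R b \<Longrightarrow> z \<in> gr R (\<not> b) \<Longrightarrow> hpart b (y \<oplus> z) = y"
  using hpart_unique_aux[of y z] hpart_unique_aux[of z y] by (cases b) (auto simp: a_comm)

lemma hpart_same [simp]: "x \<in> gr R b \<Longrightarrow> hpart b x = x"
  using hpart_unique[of x b \<zero>] by simp

lemma hpart_other [simp]: "x \<in> gr R (\<not> b) \<Longrightarrow> hpart b x = \<zero>"
  using hpart_unique[of \<zero> b x] by simp

lemma hpart_add:
  assumes "x \<in> carrier R" "y \<in> carrier R"
  shows "hpart b (x \<oplus> y) = hpart b x \<oplus> hpart b y"
proof -
  have "x \<oplus> y = (hpart b x \<oplus> hpart (\<not> b) x) \<oplus> (hpart b y \<oplus> hpart (\<not> b) y)"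
    using hpart_sum assms by metis
  also have "\<dots> = (hpart b x \<oplus> hpart b y) \<oplus> (hpart (\<not> b) x \<oplus> hpart (\<not> b) y)"
    using assms by (simp add: a_ac)
  finally show ?thesis using hpart_unique assms by (metis gr_add hpart_gr)
qed

text \<open>With the grade involution, the sign rules hold for all elements instead of homogeneous ones, and
  having a given parity becomes an equation, which can be checked locally and after an injective
  homomorphism.\<close>

definition gi :: "'a \<Rightarrow> 'a" where
  "gi x = hpart False x \<ominus> hpart True x"

lemma gi_closed [simp, intro]: "x \<in> carrier R \<Longrightarrow> gi x \<in> carrier R"
  by (simp add: gi_def)

lemma gi_homogeneous: "x \<in> gr R b \<Longrightarrow> gi x = sg R b x"
  by (cases b) (auto simp: gi_def sg_def minus_eq)

lemma gi_add: "x \<in> carrier R \<Longrightarrow> y \<in> carrier R \<Longrightarrow> gi (x \<oplus> y) = gi x \<oplus> gi y"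
  by (simp add: gi_def hpart_add minus_eq minus_add a_ac)

lemma homogeneous_cases [consumes 1, case_names add gr]:
  assumes "x \<in> carrier R"
    and "\<And>x y. P x \<Longrightarrow> P y \<Longrightarrow> x \<in> carrier R \<Longrightarrow> y \<in> carrier R \<Longrightarrow> P (x \<oplus> y)"
    and "\<And>x b. x \<in> gr R b \<Longrightarrow> P x"
  shows "P x"
  using assms hpart_sum[of x False] hpart_gr[of x] by (metis hpart_closed)

lemma gi_mult: 
  assumes "x \<in> carrier R" "y \<in> carrier R"
  shows "gi (x \<otimes> y) = gi x \<otimes> gi y"
  using assms(1)
proof (induction x rule: homogeneous_cases)
  case (gr x a)
  show ?case using assms(2)
  proof (induction y rule: homogeneous_cases)
    case (gr y b)
    then show ?case using \<open>x \<in> gr R a\<close> gi_homogeneous[OF gr_mult[OF \<open>x \<in> gr R a\<close> gr]]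
      by (cases a; cases b) (simp_all add: gi_homogeneous sg_mult_l sg_mult_r)
  qed (use gr in \<open>simp add: r_distr gi_add\<close>)
qed (use assms(2) in \<open>simp add: l_distr gi_add\<close>)

lemma gi_gi [simp]: "x \<in> carrier R \<Longrightarrow> gi (gi x) = x"
proof (induction x rule: homogeneous_cases)
  case (gr x b)
  then show ?case using gi_homogeneous[OF sg_gr[OF gr, of b]] by (simp add: gi_homogeneous)
qed (simp add: gi_add)

lemma gi_zero [simp]: "gi \<zero> = \<zero>"
  using gi_homogeneous[of \<zero> False] by simp

lemma gi_one [simp]: "gi \<one> = \<one>"
  using gi_homogeneous[of \<one> False] by simp

text \<open>Compared by components, the equation says that the component of the other parity equals its
  negative.\<close>

lemma gr_iff_gi: 
  assumes "x \<in> carrier R" shows "x \<in> gr R b \<longleftrightarrow> gi x = sg R b x"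
proof
  assume "gi x = sg R b x"
  define y where "y = hpart b x" 
  define z where "z = hpart (\<not> b) x"
  have yz: "y \<in> gr R b" "z \<in> gr R (\<not> b)" "x = y \<oplus> z" 
    using assms hpart_sum y_def z_def by auto
  have "sg R b y \<oplus> sg R (\<not> b) z = sg R b y \<oplus> sg R b z"
    using \<open>gi x = sg R b x\<close> yz by (simp add: gi_add gi_homogeneous sg_add)
  then have "sg R (\<not> b) z = sg R b z" using yz by (metis add.right_cancel a_comm gr_closed sg_closed)
  then have "z = \<ominus> z" using yz by (cases b) (auto simp: sg_def)
  then have "z \<oplus> z = \<zero>" using yz by (metis gr_closed r_neg)
  then have "z = \<zero>" using two_zero yz gr_closed by blast
  then show "x \<in> gr R b" using yz by simp
qed (simp add: gi_homogeneous)

lemma odd_comm_gi: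
  assumes t: "t \<in> gr R True" and "x \<in> carrier R"
  shows "x \<otimes> t = t \<otimes> gi x"
  using assms(2)
proof (induction x rule: homogeneous_cases)
  case (add x y)
  then show ?case using t by (simp add: gi_add l_distr r_distr)
next
  case (gr x b)
  show ?case using gr t supercomm[OF gr t] by (simp add: gi_homogeneous sg_mult_r)
qed

subsection \<open>Nilpotent homogeneous elements\<close>

definition nil :: "'a set" where
  "nil = {x \<in> carrier R. \<exists>k::nat. x [^] k = \<zero>}"

definition lprod :: "'a list \<Rightarrow> 'a" where
  "lprod xs = foldr (\<otimes>) xs \<one>"

lemma lprod_simps [simp]: "lprod [] = \<one>" "lprod (x # xs) = x \<otimes> lprod xs"
  by (simp_all add: lprod_def)

lemma lprod_closed [simp, intro]: "set xs \<subseteq> carrier R \<Longrightarrow> lprod xs \<in> carrier R"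
  by (induction xs) auto

lemma lprod_append: 
  "set xs \<subseteq> carrier R \<Longrightarrow> set ys \<subseteq> carrier R \<Longrightarrow> lprod (xs @ ys) = lprod xs \<otimes> lprod ys"
  by (induction xs) (auto simp: m_assoc)

lemma pow_Suc_left: "x \<in> carrier R \<Longrightarrow> x [^] Suc k = x \<otimes> x [^] k"
  by (rule nat_pow_Suc2)

lemma pow_gr: "x \<in> gr R a \<Longrightarrow> \<exists>b. x [^] (k::nat) \<in> gr R b"
proof (induction k)
  case (Suc k)
  then show ?case by (auto dest: gr_mult)
qed auto

text \<open>As homogeneous elements commute up to sign, the copies of \<open>x\<close> can be moved to the front.\<close>

lemma lprod_collect:
  assumes "x \<in> gr R a" "\<forall>y\<in>set ls. \<exists>b. y \<in> gr R b"
  shows "\<exists>e. lprod ls = sg R e (x [^] (length (filter ((=) x) ls)) \<otimes> lprod (filter ((\<noteq>) x) ls))"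
  using assms(2)
proof (induction ls)
  case Nil
  show ?case by (rule exI[of _ False]) auto
next
  case (Cons y ls)
  let ?c = "length (filter ((=) x) ls)" and ?p = "lprod (filter ((\<noteq>) x) ls)"
  obtain e where e: "lprod ls = sg R e (x [^] ?c \<otimes> ?p)" using Cons by auto
  have p: "?p \<in> carrier R" using Cons.prems by (intro lprod_closed) auto
  have xc: "x [^] ?c \<in> carrier R" using assms by simp
  obtain b where b: "y \<in> gr R b" using Cons.prems by auto
  show ?case
  proof (cases "x = y")
    case True
    have "lprod (y # ls) = sg R e (x [^] (Suc ?c) \<otimes> ?p)"
      unfolding pow_Suc_left[OF gr_closed[OF assms(1)]]
      using e p xc assms(1) True by (simp add: sg_mult_r m_assoc)
    then show ?thesis using True by (auto simp del: nat_pow_Suc)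
  next
    case False
    obtain b' where b': "x [^] ?c \<in> gr R b'" using pow_gr assms by blast
    have "lprod (y # ls) = sg R e ((y \<otimes> x [^] ?c) \<otimes> ?p)"
      using e p xc b by (simp add: sg_mult_r m_assoc)
    also have "y \<otimes> x [^] ?c = sg R (b \<and> b') (x [^] ?c \<otimes> y)" using supercomm b b' by blast
    finally have "lprod (y # ls) = sg R (e \<noteq> (b \<and> b')) (x [^] ?c \<otimes> (y \<otimes> ?p))"
      using p xc b by (simp add: sg_mult_l m_assoc)
    then show ?thesis using False by auto
  qed
qed

text \<open>A long product contains \<open>x\<close> often enough for its power to vanish or else contains many factors
  from the other elements.\<close>

lemma long_products_vanish:
  assumes "finite X" "\<forall>x\<in>X. x \<in> nil \<and> (\<exists>b. x \<in> gr R b)"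
  shows "\<exists>L. \<forall>ls. set ls \<subseteq> X \<and> L \<le> length ls \<longrightarrow> lprod ls = \<zero>"
  using assms
proof (induction X)
  case empty
  show ?case
  proof (rule exI[of _ 1], intro allI impI)
    fix ls :: "'a list" assume "set ls \<subseteq> {} \<and> 1 \<le> length ls"
    then show "lprod ls = \<zero>" by (cases ls) auto
  qed
next
  case (insert x X)
  obtain L where L: "\<And>ls. set ls \<subseteq> X \<Longrightarrow> L \<le> length ls \<Longrightarrow> lprod ls = \<zero>"
    using insert by auto
  obtain K :: nat and a where K: "x [^] K = \<zero>" "x \<in> gr R a" using insert.prems by (auto simp: nil_def)
  show ?case
  proof (rule exI[of _ "L + K"], intro allI impI, elim conjE)
    fix ls assume ls: "set ls \<subseteq> insert x X" "L + K \<le> length ls"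
    let ?c = "length (filter ((=) x) ls)" and ?f = "filter ((\<noteq>) x) ls"
    have "\<forall>y\<in>set ls. \<exists>b. y \<in> gr R b" using ls insert.prems by blast
    then obtain e where e: "lprod ls = sg R e (x [^] ?c \<otimes> lprod ?f)"
      using lprod_collect[OF K(2)] by blast
    have f: "lprod ?f \<in> carrier R" using ls insert.prems by (intro lprod_closed) (auto simp: nil_def)
    have len: "?c + length ?f = length ls" using sum_length_filter_compl[of "(=) x" ls] by simp
    show "lprod ls = \<zero>"
    proof (cases "K \<le> ?c")
      case True
      then have "x [^] ?c = x [^] K \<otimes> x [^] (?c - K)" using K(2) by (simp add: nat_pow_mult)
      then show ?thesis using e K f by simp
    next
      case False
      then have "lprod ?f = \<zero>" using len ls by (intro L) auto
      then show ?thesis using e K by simp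
    qed
  qed
qed

text \<open>Multiplication by an element of \<open>X\<close> maps \<open>ann X (Suc k)\<close> to \<open>ann X k\<close>. For a finite set \<open>X\<close> of
  nilpotent homogeneous elements the filtration starts with \<open>{\<zero>}\<close> and reaches the whole ring, so that
  \<open>k\<close> serves as the measure of inductions that use the nilpotency of the ideal generated by \<open>X\<close>.\<close>

definition ann :: "'a set \<Rightarrow> nat \<Rightarrow> 'a set" where
  "ann X k = {y \<in> carrier R. \<forall>ls. set ls \<subseteq> X \<and> length ls = k \<longrightarrow> lprod ls \<otimes> y = \<zero>}"

lemma ann_closed: "y \<in> ann X k \<Longrightarrow> y \<in> carrier R"
  by (simp add: ann_def)

lemma ann_zero: "X \<subseteq> carrier R \<Longrightarrow> \<zero> \<in> ann X k"
  by (auto simp: ann_def)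

lemma ann_0: "y \<in> ann X 0 \<Longrightarrow> y = \<zero>"
  by (auto simp: ann_def)

lemma ann_add: "X \<subseteq> carrier R \<Longrightarrow> y \<in> ann X k \<Longrightarrow> z \<in> ann X k \<Longrightarrow> y \<oplus> z \<in> ann X k"
  by (auto simp: ann_def r_distr)

lemma ann_finsum: 
  "X \<subseteq> carrier R \<Longrightarrow> (\<And>i. i \<in> A \<Longrightarrow> f i \<in> ann X k) \<Longrightarrow> finsum R f A \<in> ann X k"
proof (induction A rule: infinite_finite_induct)
  case (insert x F)
  then have "f \<in> F \<rightarrow> carrier R" "f x \<in> carrier R" using ann_closed by blast+
  then show ?case using insert by (subst finsum_insert) (auto simp: ann_add)
qed (auto simp: ann_zero)

lemma ann_Suc: "X \<subseteq> carrier R \<Longrightarrow> x \<in> X \<Longrightarrow> y \<in> ann X (Suc k) \<Longrightarrow> x \<otimes> y \<in> ann X k"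
proof -
  assume X: "X \<subseteq> carrier R" "x \<in> X" "y \<in> ann X (Suc k)"
  have "lprod ls \<otimes> (x \<otimes> y) = \<zero>" if "set ls \<subseteq> X" "length ls = k" for ls
  proof -
    have "set (ls @ [x]) \<subseteq> X" "length (ls @ [x]) = Suc k" using X that by auto
    then have "lprod (ls @ [x]) \<otimes> y = \<zero>" using X(3) unfolding ann_def by blast
    moreover have "lprod (ls @ [x]) = lprod ls \<otimes> lprod [x]"
      using that X by (intro lprod_append) auto
    moreover have "lprod ls \<in> carrier R" "x \<in> carrier R" "y \<in> carrier R"
      using that X ann_closed by auto
    ultimately show ?thesis by (simp add: m_assoc)
  qed
  then show "x \<otimes> y \<in> ann X k" using X by (auto simp: ann_def)
qed

lemma ann_top:
  assumes "finite X" "\<forall>x\<in>X. x \<in> nil \<and> (\<exists>b. x \<in> gr R b)"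
  shows "\<exists>L. ann X L = carrier R"
proof -
  obtain L where "\<And>ls. set ls \<subseteq> X \<Longrightarrow> L \<le> length ls \<Longrightarrow> lprod ls = \<zero>"
    using long_products_vanish[OF assms] by auto
  then show ?thesis by (intro exI[of _ L]) (auto simp: ann_def)
qed

text \<open>Multiplication by \<open>x \<oplus> y\<close> goes down the filtration for \<open>{x, y}\<close>.\<close>

lemma nil_add:
  assumes "x \<in> nil" "y \<in> nil" "x \<in> gr R a" "y \<in> gr R b"
  shows "x \<oplus> y \<in> nil"
proof -
  have X: "{x, y} \<subseteq> carrier R" using assms by auto
  obtain L where L: "ann {x, y} L = carrier R" using ann_top[of "{x, y}"] assms by auto
  have step: "(x \<oplus> y) \<otimes> z \<in> ann {x, y} k" if "z \<in> ann {x, y} (Suc k)" for z k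
    using ann_add[OF X ann_Suc[OF X _ that] ann_Suc[OF X _ that], of x y] X ann_closed[OF that]
    by (simp add: l_distr)
  have "k \<le> L \<Longrightarrow> (x \<oplus> y) [^] k \<in> ann {x, y} (L - k)" for k
  proof (induction k)
    case 0
    then show ?case using L by simp
  next
    case (Suc k)
    have "(x \<oplus> y) \<otimes> (x \<oplus> y) [^] k \<in> ann {x, y} (L - Suc k)"
      using Suc by (intro step) (simp add: Suc_diff_Suc)
    then show ?case using X by (subst pow_Suc_left) auto
  qed
  from this[of L] have "(x \<oplus> y) [^] L = \<zero>" using ann_0 by simp
  then show ?thesis using X by (auto simp: nil_def)
qed

lemma nil_zero: "\<zero> \<in> nil"
  unfolding nil_def by (auto intro!: exI[of _ "1::nat"])

lemma nil_finsum:
  assumes "\<And>i. i \<in> A \<Longrightarrow> f i \<in> nil \<inter> gr R a"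
  shows "finsum R f A \<in> nil"
  using assms
proof (induction A rule: infinite_finite_induct)
  case (insert x F)
  then have fx: "f x \<in> nil" "f x \<in> gr R a" "finsum R f F \<in> gr R a" by (auto intro: gr_finsum)
  have "f \<in> F \<rightarrow> carrier R" using insert.prems gr_closed by blast
  then have "finsum R f (insert x F) = f x \<oplus> finsum R f F"
    using insert.hyps fx gr_closed by (intro finsum_insert)
  moreover have "finsum R f F \<in> nil" using insert by blast
  ultimately show ?case using nil_add[OF fx(1) _ fx(2,3)] by simp
qed (auto simp: nil_zero)

text \<open>The powers of \<open>x \<otimes> y\<close> are the products of the powers up to sign.\<close>

lemma nil_mult:
  assumes "x \<in> nil" "x \<in> gr R a" "y \<in> gr R b"
  shows "x \<otimes> y \<in> nil"
proof -
  obtain K :: nat where K: "x [^] K = \<zero>" using assms by (auto simp: nil_def)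
  have "\<exists>e. (x \<otimes> y) [^] k = sg R e (x [^] k \<otimes> y [^] k)" for k :: nat
  proof (induction k)
    case 0
    show ?case by (rule exI[of _ False]) auto
  next
    case (Suc k)
    then obtain e where e: "(x \<otimes> y) [^] k = sg R e (x [^] k \<otimes> y [^] k)" by blast
    obtain c where c: "y [^] k \<in> gr R c" using pow_gr assms by blast
    note [simp] = gr_closed[OF assms(2)] gr_closed[OF assms(3)]
    have "(x \<otimes> y) [^] Suc k = sg R e (x [^] k \<otimes> (y [^] k \<otimes> x) \<otimes> y)"
      using e assms by (simp add: sg_mult_l m_assoc)
    also have "y [^] k \<otimes> x = sg R (c \<and> a) (x \<otimes> y [^] k)" by (rule supercomm[OF c assms(2)])
    finally have "(x \<otimes> y) [^] Suc k = sg R (e \<noteq> (c \<and> a)) (x [^] Suc k \<otimes> y [^] Suc k)"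
      by (simp add: sg_mult_l sg_mult_r m_assoc)
    then show ?case by blast
  qed
  then obtain e where "(x \<otimes> y) [^] K = sg R e (x [^] K \<otimes> y [^] K)" by blast
  then have "(x \<otimes> y) [^] K = \<zero>" using K assms by simp
  then show ?thesis using assms by (auto simp: nil_def)
qed

lemma nil_odd: "x \<in> gr R True \<Longrightarrow> x \<in> nil"
  using odd_square by (auto simp: nil_def numeral_2_eq_2 intro!: exI[of _ "2::nat"])

end

section \<open>Supermatrices\<close>

definition mats :: "('a, 'r) ring_scheme \<Rightarrow> nat \<Rightarrow> 'a mat set" where
  "mats R n = {M. \<forall>k l. if k < n \<and> l < n then M k l \<in> carrier R else M k l = undefined}"

definition mat_vec :: "('a, 'r) ring_scheme \<Rightarrow> nat \<Rightarrow> 'a mat \<Rightarrow> (nat \<Rightarrow> 'a) \<Rightarrow> nat \<Rightarrow> 'a" where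
  "mat_vec R n M s = (\<lambda>k\<in>{..<n}. \<Oplus>\<^bsub>R\<^esub>j\<in>{..<n}. M k j \<otimes>\<^bsub>R\<^esub> s j)"

definition mcol :: "nat \<Rightarrow> 'a mat \<Rightarrow> nat \<Rightarrow> nat \<Rightarrow> 'a" where
  "mcol n M l = (\<lambda>k\<in>{..<n}. M k l)"

lemma mk_mat_simps [simp]: "k < n \<Longrightarrow> l < n \<Longrightarrow> mk_mat n h k l = h k l"
  by (simp add: mk_mat_def)

lemma mk_mat_in_mats: "(\<And>k l. k < n \<Longrightarrow> l < n \<Longrightarrow> h k l \<in> carrier R) \<Longrightarrow> mk_mat n h \<in> mats R n"
  by (simp add: mk_mat_def mats_def)

lemma matsD: "M \<in> mats R n \<Longrightarrow> k < n \<Longrightarrow> l < n \<Longrightarrow> M k l \<in> carrier R"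
  by (auto simp: mats_def split: if_splits)

lemma mats_eqI:
  assumes "M \<in> mats R n" "N \<in> mats S n" "\<And>k l. k < n \<Longrightarrow> l < n \<Longrightarrow> M k l = N k l"
  shows "M = N"
proof (intro ext)
  fix k l
  have "k < n \<and> l < n \<or> M k l = undefined" "k < n \<and> l < n \<or> N k l = undefined"
    using assms(1,2) unfolding mats_def by (auto split: if_splits)
  then show "M k l = N k l" using assms(3)[of k l] by auto
qed

lemma smatD: "M \<in> smat R p q a \<Longrightarrow> k < p + q \<Longrightarrow> l < p + q \<Longrightarrow> 
    M k l \<in> gr R (a \<noteq> ((p \<le> k) \<noteq> (p \<le> l)))"
  unfolding smat_def by (auto split: if_splits)

lemma mk_mat_in_smat:
  "(\<And>k l. k < p + q \<Longrightarrow> l < p + q \<Longrightarrow> h k l \<in> gr R (a \<noteq> ((p \<le> k) \<noteq> (p \<le> l)))) \<Longrightarrow>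
   mk_mat (p + q) h \<in> smat R p q a"
  unfolding smat_def mk_mat_def by simp

lemma map_mat_simps [simp]: "k < n \<Longrightarrow> l < n \<Longrightarrow> map_mat n h M k l = h (M k l)"
  by (simp add: map_mat_def)

lemma mcol_simps [simp]: "k < n \<Longrightarrow> mcol n M l k = M k l"
  by (simp add: mcol_def)

lemma mat_vec_simps: "k < n \<Longrightarrow> mat_vec R n M s k = (\<Oplus>\<^bsub>R\<^esub>j\<in>{..<n}. M k j \<otimes>\<^bsub>R\<^esub> s j)"
  by (simp add: mat_vec_def)

lemma mat_mult_simps: "k < n \<Longrightarrow> l < n \<Longrightarrow>
   mat_mult R n M N k l = (\<Oplus>\<^bsub>R\<^esub>j\<in>{..<n}. M k j \<otimes>\<^bsub>R\<^esub> N j l)"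
  by (simp add: mat_mult_def)

lemma (in abelian_monoid) finsum_swap:
  assumes "finite A" "finite B" "\<And>i j. i \<in> A \<Longrightarrow> j \<in> B \<Longrightarrow> f i j \<in> carrier G"
  shows "(\<Oplus>i\<in>A. \<Oplus>j\<in>B. f i j) = (\<Oplus>j\<in>B. \<Oplus>i\<in>A. f i j)"
  using assms(1,3)
proof (induction A)
  case (insert x F)
  have "(\<Oplus>i\<in>insert x F. \<Oplus>j\<in>B. f i j) = (\<Oplus>j\<in>B. f x j) \<oplus> (\<Oplus>j\<in>B. \<Oplus>i\<in>F. f i j)"
    using insert by (subst finsum_insert) (auto intro!: finsum_closed)
  also have "\<dots> = (\<Oplus>j\<in>B. f x j \<oplus> (\<Oplus>i\<in>F. f i j))"
    using insert by (intro finsum_addf[symmetric]) (auto intro!: finsum_closed)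
  also have "\<dots> = (\<Oplus>j\<in>B. \<Oplus>i\<in>insert x F. f i j)"
    using insert by (intro finsum_cong') (auto intro!: finsum_closed)
  finally show ?case .
qed simp

context ring
begin

lemma mat_vec_closed: 
  "M \<in> mats R n \<Longrightarrow> s \<in> {..<n} \<rightarrow>\<^sub>E carrier R \<Longrightarrow> mat_vec R n M s \<in> {..<n} \<rightarrow>\<^sub>E carrier R"
  by (auto simp: mat_vec_def matsD PiE_iff intro!: finsum_closed)

lemma mat_mult_closed: "M \<in> mats R n \<Longrightarrow> N \<in> mats R n \<Longrightarrow> mat_mult R n M N \<in> mats R n"
  unfolding mat_mult_def by (intro mk_mat_in_mats finsum_closed) (auto simp: matsD)

lemma mat_add_closed: "M \<in> mats R n \<Longrightarrow> N \<in> mats R n \<Longrightarrow> mat_add R n M N \<in> mats R n"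
  unfolding mat_add_def by (intro mk_mat_in_mats) (auto simp: matsD)

lemma mat_minus_closed: "M \<in> mats R n \<Longrightarrow> mat_minus R n M \<in> mats R n"
  unfolding mat_minus_def map_mat_def by (intro mk_mat_in_mats) (auto simp: matsD)

lemma mat_one_closed: "mat_one R n \<in> mats R n"
  unfolding mat_one_def by (intro mk_mat_in_mats) auto

lemma mat_vec_assoc_entry:
  assumes "M \<in> mats R n" "N \<in> mats R n" "\<And>j. j < n \<Longrightarrow> s j \<in> carrier R" "k < n"
  shows "(\<Oplus>i\<in>{..<n}. mat_mult R n M N k i \<otimes> s i) = (\<Oplus>j\<in>{..<n}. M k j \<otimes> (\<Oplus>i\<in>{..<n}. N j i \<otimes> s i))"
proof -
  note [simp] = matsD[OF assms(1)] matsD[OF assms(2)] assms(3,4)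
  have "(\<Oplus>i\<in>{..<n}. mat_mult R n M N k i \<otimes> s i) 
      = (\<Oplus>i\<in>{..<n}. \<Oplus>j\<in>{..<n}. M k j \<otimes> (N j i \<otimes> s i))"
    by (intro finsum_cong') (auto simp: mat_mult_simps finsum_ldistr m_assoc intro!: finsum_closed finsum_cong')
  also have "\<dots> = (\<Oplus>j\<in>{..<n}. \<Oplus>i\<in>{..<n}. M k j \<otimes> (N j i \<otimes> s i))"
    by (rule finsum_swap) auto
  also have "\<dots> = (\<Oplus>j\<in>{..<n}. M k j \<otimes> (\<Oplus>i\<in>{..<n}. N j i \<otimes> s i))"
    by (intro finsum_cong') (auto simp: finsum_rdistr intro!: finsum_closed)
  finally show ?thesis .
qed

lemma mat_vec_assoc:
  assumes "M \<in> mats R n" "N \<in> mats R n" "s \<in> {..<n} \<rightarrow>\<^sub>E carrier R"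
  shows "mat_vec R n (mat_mult R n M N) s = mat_vec R n M (mat_vec R n N s)"
  by (rule extensionalityI[of _ "{..<n}"])
     (use assms in \<open>auto simp: mat_vec_def mat_vec_assoc_entry PiE_iff matsD intro!: finsum_cong' finsum_closed\<close>)

lemma mat_mult_assoc:
  assumes "M \<in> mats R n" "N \<in> mats R n" "P \<in> mats R n"
  shows "mat_mult R n (mat_mult R n M N) P = mat_mult R n M (mat_mult R n N P)"
proof (rule mats_eqI[of _ R n _ R])
  fix k l assume "k < n" "l < n"
  then show "mat_mult R n (mat_mult R n M N) P k l = mat_mult R n M (mat_mult R n N P) k l"
    using mat_vec_assoc_entry[OF assms(1,2), of "\<lambda>j. P j l" k] assms
    by (auto simp: mat_mult_simps matsD intro!: finsum_cong' finsum_closed)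
qed (use assms mat_mult_closed in auto)

lemma finsum_delta:
  assumes "k < n" "\<And>j::nat. j < n \<Longrightarrow> s j \<in> carrier R"
  shows "(\<Oplus>j\<in>{..<n}. (if k = j then \<one> else \<zero>) \<otimes> s j) = s k"
proof -
  have "(\<Oplus>j\<in>{..<n}. (if k = j then \<one> else \<zero>) \<otimes> s j) = (\<Oplus>j\<in>{..<n}. if k = j then s j else \<zero>)"
    using assms by (intro finsum_cong') auto
  also have "\<dots> = s k" using assms by (intro finsum_singleton) auto
  finally show ?thesis .
qed

lemma finsum_delta_r:
  assumes "k < n" "\<And>j::nat. j < n \<Longrightarrow> s j \<in> carrier R"
  shows "(\<Oplus>j\<in>{..<n}. s j \<otimes> (if j = k then \<one> else \<zero>)) = s k"
proof -
  have "(\<Oplus>j\<in>{..<n}. s j \<otimes> (if j = k then \<one> else \<zero>)) = (\<Oplus>j\<in>{..<n}. if k = j then s j else \<zero>)"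
    using assms by (intro finsum_cong') auto
  also have "\<dots> = s k" using assms by (intro finsum_singleton) auto
  finally show ?thesis .
qed

lemma mat_one_mult: "M \<in> mats R n \<Longrightarrow> mat_mult R n (mat_one R n) M = M"
proof (rule mats_eqI[of _ R n _ R])
  fix k l assume "M \<in> mats R n" "k < n" "l < n"
  then show "mat_mult R n (mat_one R n) M k l = M k l"
    using finsum_delta[of k n "\<lambda>j. M j l"]
    by (auto simp: mat_mult_simps mat_one_def matsD cong: finsum_cong)
qed (auto simp: mat_mult_closed mat_one_closed)

lemma mat_mult_one: "M \<in> mats R n \<Longrightarrow> mat_mult R n M (mat_one R n) = M"
proof (rule mats_eqI[of _ R n _ R])
  fix k l assume "M \<in> mats R n" "k < n" "l < n"
  then show "mat_mult R n M (mat_one R n) k l = M k l"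
    using finsum_delta_r[of l n "\<lambda>j. M k j"]
    by (auto simp: mat_mult_simps mat_one_def matsD cong: finsum_cong)
qed (auto simp: mat_mult_closed mat_one_closed)

lemma mat_vec_one: "s \<in> {..<n} \<rightarrow>\<^sub>E carrier R \<Longrightarrow> mat_vec R n (mat_one R n) s = s"
proof (rule extensionalityI[of _ "{..<n}"])
  fix k assume "s \<in> {..<n} \<rightarrow>\<^sub>E carrier R" "k \<in> {..<n}"
  moreover from this have "mat_vec R n (mat_one R n) s k = (\<Oplus>j\<in>{..<n}. (if k = j then \<one> else \<zero>) \<otimes> s j)"
    unfolding mat_vec_def mat_one_def by (auto simp: PiE_iff intro!: finsum_cong')
  ultimately show "mat_vec R n (mat_one R n) s k = s k"
    using finsum_delta[of k n s] by (auto simp: PiE_iff)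
qed (auto simp: mat_vec_def PiE_iff)

lemma mat_mult_add_l:
  assumes "M \<in> mats R n" "N \<in> mats R n" "P \<in> mats R n"
  shows "mat_mult R n (mat_add R n M N) P = mat_add R n (mat_mult R n M P) (mat_mult R n N P)"
proof (rule mats_eqI[of _ R n _ R])
  fix k l assume "k < n" "l < n"
  then show "mat_mult R n (mat_add R n M N) P k l = mat_add R n (mat_mult R n M P) (mat_mult R n N P) k l"
    using assms by (simp add: mat_mult_simps mat_add_def matsD l_distr Pi_def cong: finsum_cong)
qed (use assms in \<open>auto simp: mat_mult_closed mat_add_closed\<close>)

lemma mat_mult_add_r:
  assumes "M \<in> mats R n" "N \<in> mats R n" "P \<in> mats R n"
  shows "mat_mult R n P (mat_add R n M N) = mat_add R n (mat_mult R n P M) (mat_mult R n P N)"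
proof (rule mats_eqI[of _ R n _ R])
  fix k l assume "k < n" "l < n"
  then show "mat_mult R n P (mat_add R n M N) k l = mat_add R n (mat_mult R n P M) (mat_mult R n P N) k l"
    using assms by (simp add: mat_mult_simps mat_add_def matsD r_distr Pi_def cong: finsum_cong)
qed (use assms in \<open>auto simp: mat_mult_closed mat_add_closed\<close>)

lemma finsum_neg: "f \<in> A \<rightarrow> carrier R \<Longrightarrow> \<ominus> (finsum R f A) = (\<Oplus>i\<in>A. \<ominus> f i)"
proof (induction A rule: infinite_finite_induct)
  case (insert x F)
  then show ?case by (subst (1 2) finsum_insert) (auto simp: minus_add Pi_def)
qed auto

lemma mat_mult_minus_l:
  assumes "M \<in> mats R n" "P \<in> mats R n"
  shows "mat_mult R n (mat_minus R n M) P = mat_minus R n (mat_mult R n M P)"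
proof (rule mats_eqI[of _ R n _ R])
  fix k l assume "k < n" "l < n"
  then show "mat_mult R n (mat_minus R n M) P k l = mat_minus R n (mat_mult R n M P) k l"
    using assms by (simp add: mat_mult_simps mat_minus_def matsD l_minus finsum_neg Pi_def cong: finsum_cong)
qed (use assms in \<open>auto simp: mat_mult_closed mat_minus_closed\<close>)

end

lemma mcol_mat_mult: "l < n \<Longrightarrow> mcol n (mat_mult R n M N) l = mat_vec R n M (\<lambda>k. N k l)"
  by (auto simp: mcol_def mat_vec_def mat_mult_simps)

context superalg
begin

lemma smat_mats: "M \<in> smat R p q a \<Longrightarrow> M \<in> mats R (p + q)"
  unfolding smat_def mats_def by (auto split: if_splits) (metis gr_closed)+

lemma smat_mult_closed:
  assumes "M \<in> smat R p q a" "N \<in> smat R p q b"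
  shows "mat_mult R (p + q) M N \<in> smat R p q (a \<noteq> b)"
  unfolding mat_mult_def
proof (intro mk_mat_in_smat gr_finsum gr_mult')
  fix k l j assume "k < p + q" "l < p + q" "j \<in> {..<p + q}"
  then show "M k j \<in> gr R (a \<noteq> ((p \<le> k) \<noteq> (p \<le> j)))" "N j l \<in> gr R (b \<noteq> ((p \<le> j) \<noteq> (p \<le> l)))"
    using smatD[OF assms(1)] smatD[OF assms(2)] by auto
qed auto

lemma smat_add_closed:
  "M \<in> smat R p q a \<Longrightarrow> N \<in> smat R p q a \<Longrightarrow> mat_add R (p + q) M N \<in> smat R p q a"
  unfolding mat_add_def by (intro mk_mat_in_smat gr_add smatD)

lemma smat_minus_closed:
  "M \<in> smat R p q a \<Longrightarrow> mat_minus R (p + q) M \<in> smat R p q a"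
  unfolding mat_minus_def map_mat_def by (intro mk_mat_in_smat gr_neg smatD)

lemma smat_one: "mat_one R (p + q) \<in> smat R p q False"
  unfolding mat_one_def by (intro mk_mat_in_smat) auto

lemma even_mat_simps [simp]: 
  "carrier (even_mat_monoid R p q) = smat R p q False"
  "monoid.mult (even_mat_monoid R p q) = mat_mult R (p + q)"
  "monoid.one (even_mat_monoid R p q) = mat_one R (p + q)"
  by (simp_all add: even_mat_monoid_def)

lemma even_mat_monoid: "monoid (even_mat_monoid R p q)"
proof (rule monoidI)
  fix M N assume "M \<in> carrier (even_mat_monoid R p q)" "N \<in> carrier (even_mat_monoid R p q)"
  then show "M \<otimes>\<^bsub>even_mat_monoid R p q\<^esub> N \<in> carrier (even_mat_monoid R p q)"
    using smat_mult_closed[of M p q False N False] by simp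
qed (auto simp: smat_one mat_mult_assoc smat_mats mat_one_mult mat_mult_one)

text \<open>The geometric series, written as a recursion: the solution of \<open>Y + N Y = M\<close> is \<open>M - Y'\<close>, where
  \<open>Y'\<close> is the solution for \<open>N M\<close>, whose entries lie one step lower in the filtration.\<close>

lemma right_inverse_one_plus_nilpotent_aux:
  assumes N: "N \<in> smat R p q False" and X: "finite X" "X \<subseteq> carrier R"
    and NX: "\<And>k l. k < p + q \<Longrightarrow> l < p + q \<Longrightarrow> N k l \<in> X"
    and M: "M \<in> smat R p q False" "\<And>k l. k < p + q \<Longrightarrow> l < p + q \<Longrightarrow> M k l \<in> ann X m"
  shows "\<exists>Y\<in>smat R p q False. mat_add R (p + q) Y (mat_mult R (p + q) N Y) = M"
  using M
proof (induction m arbitrary: M)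
  case 0
  have "M k l = \<zero>" if "k < p + q" "l < p + q" for k l using 0(2)[OF that] ann_0 by blast
  then have "mat_add R (p + q) M (mat_mult R (p + q) N M) = M"
  proof (intro mats_eqI[of _ R "p + q" _ R] mat_add_closed mat_mult_closed smat_mats[OF N] smat_mats[OF 0(1)])
    fix k l assume kl: "k < p + q" "l < p + q"
    have "(\<Oplus>j\<in>{..<p + q}. N k j \<otimes> M j l) = (\<Oplus>j\<in>{..<p + q}. \<zero>)"
      using \<open>\<And>k l. k < p + q \<Longrightarrow> l < p + q \<Longrightarrow> M k l = \<zero>\<close> kl matsD[OF smat_mats[OF N]]
      by (intro finsum_cong') auto
    then show "mat_add R (p + q) M (mat_mult R (p + q) N M) k l = M k l"
      using kl \<open>\<And>k l. k < p + q \<Longrightarrow> l < p + q \<Longrightarrow> M k l = \<zero>\<close>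
      by (simp add: mat_add_def mat_mult_simps)
  qed
  then show ?case using 0 by blast
next
  case (Suc m)
  let ?NM = "mat_mult R (p + q) N M"
  have NM: "?NM \<in> smat R p q False" using smat_mult_closed[OF N Suc.prems(1)] by simp
  have "?NM k l \<in> ann X m" if "k < p + q" "l < p + q" for k l
    unfolding mat_mult_simps[OF that] using that Suc.prems NX X by (intro ann_finsum ann_Suc) auto
  then obtain Y where Y: "Y \<in> smat R p q False" "mat_add R (p + q) Y (mat_mult R (p + q) N Y) = ?NM"
    using Suc.IH[OF NM] by blast
  let ?Y = "mat_add R (p + q) M (mat_minus R (p + q) Y)"
  have Y': "?Y \<in> smat R p q False" by (intro smat_add_closed smat_minus_closed Y Suc.prems)
  have "mat_add R (p + q) ?Y (mat_mult R (p + q) N ?Y) = M"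
  proof (intro mats_eqI[of _ R "p + q" _ R] mat_add_closed mat_mult_closed mat_minus_closed
      smat_mats[OF Y(1)] smat_mats[OF N] smat_mats[OF Suc.prems(1)])
    fix k l assume kl: "k < p + q" "l < p + q"
    note [simp] = matsD[OF smat_mats[OF N]] matsD[OF smat_mats[OF Suc.prems(1)]] matsD[OF smat_mats[OF Y(1)]]
    have c: "mat_mult R (p + q) N Y k l \<in> carrier R" "?NM k l \<in> carrier R"
      using kl by (auto intro!: matsD[of _ R "p + q"] mat_mult_closed smat_mats[OF N] smat_mats[OF Y(1)] smat_mats[OF Suc.prems(1)])
    have Yj: "?Y j l = M j l \<oplus> \<ominus> Y j l" if "j < p + q" for j
      using that kl by (simp add: mat_add_def mat_minus_def)
    have "mat_mult R (p + q) N ?Y k l = (\<Oplus>j\<in>{..<p+q}. N k j \<otimes> M j l \<oplus> \<ominus> (N k j \<otimes> Y j l))"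
      unfolding mat_mult_simps[OF kl] using kl
      by (intro finsum_cong') (auto simp: Yj r_distr r_minus)
    also have "\<dots> = ?NM k l \<oplus> \<ominus> mat_mult R (p + q) N Y k l"
      using kl by (simp add: mat_mult_simps finsum_addf finsum_neg Pi_def)
    also have "?NM k l = Y k l \<oplus> mat_mult R (p + q) N Y k l"
      using kl by (subst Y(2)[symmetric]) (simp add: mat_add_def)
    finally have "mat_mult R (p + q) N ?Y k l = Y k l"
      using c kl by (simp add: a_assoc r_neg)
    then show "mat_add R (p + q) ?Y (mat_mult R (p + q) N ?Y) k l = M k l"
      using kl by (simp add: mat_add_def mat_minus_def a_assoc l_neg)
  qed
  then show ?case using Y' by blast
qed

lemma right_inverse_one_plus_nilpotent:
  assumes N: "N \<in> smat R p q False" 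
    and nil: "\<And>k l. k < p + q \<Longrightarrow> l < p + q \<Longrightarrow> N k l \<in> nil"
    and M: "M \<in> smat R p q False"
  shows "\<exists>Y\<in>smat R p q False. mat_add R (p + q) Y (mat_mult R (p + q) N Y) = M"
proof -
  define X where "X = (\<lambda>(k, l). N k l) ` ({..<p + q} \<times> {..<p + q})"
  have X: "finite X" "\<forall>x\<in>X. x \<in> nil \<and> (\<exists>b. x \<in> gr R b)"
  proof -
    show "\<forall>x\<in>X. x \<in> nil \<and> (\<exists>b. x \<in> gr R b)"
    proof
      fix x assume "x \<in> X"
      then obtain k l where "x = N k l" "k < p + q" "l < p + q" by (auto simp: X_def)
      then show "x \<in> nil \<and> (\<exists>b. x \<in> gr R b)" using nil smatD[OF N] by blast
    qed
  qed (simp add: X_def)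
  then obtain L where "ann X L = carrier R" using ann_top by blast
  then show ?thesis
    using X matsD[OF smat_mats[OF M]] 
    by (intro right_inverse_one_plus_nilpotent_aux[of N p q X M L] N M) (auto simp: X_def nil_def)
qed

definition unipotents :: "nat \<Rightarrow> nat \<Rightarrow> 'a mat set" where
  "unipotents p q = {A \<in> smat R p q False. \<forall>k<p + q. \<forall>l<p + q.
       A k l \<ominus> mat_one R (p + q) k l \<in> nil}"

text \<open>With \<open>A = I + N\<close> the inverse satisfies \<open>Y - I = - N Y\<close> and is therefore congruent to the identity
  again.\<close>

lemma unipotent_right_inverse:
  assumes A: "A \<in> unipotents p q"
  shows "\<exists>Y\<in>unipotents p q. mat_mult R (p + q) A Y = mat_one R (p + q)"
proof -
  let ?n = "p + q" and ?I = "mat_one R (p + q)"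
  define N where "N = mat_add R ?n A (mat_minus R ?n ?I)"
  have A': "A \<in> smat R p q False" using A by (simp add: unipotents_def)
  have N: "N \<in> smat R p q False"
    unfolding N_def by (intro smat_add_closed smat_minus_closed smat_one A')
  have nil: "N k l \<in> nil" if "k < ?n" "l < ?n" for k l
    using A that by (simp add: N_def mat_add_def mat_minus_def unipotents_def minus_eq)
  obtain Y where Y: "Y \<in> smat R p q False" "mat_add R ?n Y (mat_mult R ?n N Y) = ?I"
    using right_inverse_one_plus_nilpotent[OF N nil smat_one] by auto
  have AN: "A = mat_add R ?n ?I N"
    using matsD[OF smat_mats[OF A']] matsD[OF mat_one_closed[of ?n]]
    by (intro mats_eqI[of A R ?n _ R] mat_add_closed smat_mats[OF A'] smat_mats[OF N] mat_one_closed)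
       (auto simp: N_def mat_add_def mat_minus_def a_lcomm r_neg)
  have AY: "mat_mult R ?n A Y = ?I"
    unfolding AN using Y N mat_one_closed by (simp add: mat_mult_add_l smat_mats mat_one_mult)
  have "Y k l \<ominus> ?I k l \<in> nil" if kl: "k < ?n" "l < ?n" for k l
  proof -
    have c: "Y k l \<in> carrier R" "mat_mult R ?n N Y k l \<in> carrier R"
      using kl by (auto intro!: matsD[of _ R "p + q"] mat_mult_closed smat_mats[OF N] smat_mats[OF Y(1)])
    have "?I k l = Y k l \<oplus> mat_mult R ?n N Y k l"
      using kl by (subst Y(2)[symmetric]) (simp add: mat_add_def)
    then have "Y k l \<ominus> ?I k l = \<ominus> mat_mult R ?n N Y k l"
      using c by (simp add: minus_eq minus_add a_assoc[symmetric] r_neg)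
    also have "\<dots> = (\<Oplus>j\<in>{..<?n}. N k j \<otimes> \<ominus> Y j l)"
      using kl matsD[OF smat_mats[OF N]] matsD[OF smat_mats[OF Y(1)]]
      by (simp add: mat_mult_simps finsum_neg Pi_def r_minus cong: finsum_cong)
    also have "\<dots> \<in> nil"
    proof (rule nil_finsum[of _ _ "(p \<le> k) \<noteq> (p \<le> l)"], rule IntI)
      fix j assume "j \<in> {..<?n}"
      then have N': "N k j \<in> nil" "N k j \<in> gr R ((p \<le> k) \<noteq> (p \<le> j))" 
        and Y': "\<ominus> Y j l \<in> gr R ((p \<le> j) \<noteq> (p \<le> l))"
        using kl nil smatD[OF N, of k j] smatD[OF Y(1), of j l] by auto
      show "N k j \<otimes> \<ominus> Y j l \<in> nil" by (rule nil_mult[OF N' Y'])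
      show "N k j \<otimes> \<ominus> Y j l \<in> gr R ((p \<le> k) \<noteq> (p \<le> l))" by (rule gr_mult'[OF N'(2) Y']) auto
    qed
    finally show ?thesis .
  qed
  then show ?thesis using Y AY by (auto simp: unipotents_def)
qed

lemma unipotents_mult:
  assumes A: "A \<in> unipotents p q" and B: "B \<in> unipotents p q"
  shows "mat_mult R (p + q) A B \<in> unipotents p q"
proof -
  let ?n = "p + q" and ?I = "mat_one R (p + q)"
  have AB: "A \<in> smat R p q False" "B \<in> smat R p q False" using A B by (auto simp: unipotents_def)
  have I: "?I \<in> smat R p q False" by (rule smat_one)
  have "mat_mult R ?n A B k l \<ominus> ?I k l \<in> nil" if kl: "k < ?n" "l < ?n" for k l
  proof -
    define N where "N = mat_add R ?n A (mat_minus R ?n ?I)"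
    have N: "N \<in> smat R p q False" unfolding N_def by (intro smat_add_closed smat_minus_closed AB I)
    have Nnil: "N k j \<in> nil" if "j < ?n" for j
      using A kl that by (simp add: N_def mat_add_def mat_minus_def unipotents_def minus_eq)
    note m = matsD[OF smat_mats[OF AB(1)]] matsD[OF smat_mats[OF AB(2)]] matsD[OF smat_mats[OF N]]
      matsD[OF mat_one_closed]
    have NB: "mat_mult R ?n N B \<in> smat R p q False" using smat_mult_closed[OF N AB(2)] by simp
    have "A = mat_add R ?n ?I N"
      using m by (intro mats_eqI[of A R ?n _ R] mat_add_closed smat_mats[OF AB(1)] smat_mats[OF N] mat_one_closed)
       (auto simp: N_def mat_add_def mat_minus_def a_lcomm r_neg)
    then have "mat_mult R ?n A B = mat_add R ?n B (mat_mult R ?n N B)"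
      using mat_mult_add_l[OF mat_one_closed smat_mats[OF N] smat_mats[OF AB(2)]] mat_one_mult[OF smat_mats[OF AB(2)]]
      by simp
    then have "mat_mult R ?n A B k l \<ominus> ?I k l = mat_mult R ?n N B k l \<oplus> (B k l \<ominus> ?I k l)"
      using kl m matsD[OF smat_mats[OF NB]] by (simp add: mat_add_def minus_eq a_ac)
    also have "\<dots> \<in> nil"
    proof (rule nil_add)
      show "B k l \<ominus> ?I k l \<in> nil" using B kl by (simp add: unipotents_def)
      show "B k l \<ominus> ?I k l \<in> gr R ((p \<le> k) \<noteq> (p \<le> l))"
        using smatD[OF AB(2) kl] smatD[OF I kl] by auto
      show "mat_mult R ?n N B k l \<in> gr R ((p \<le> k) \<noteq> (p \<le> l))" using smatD[OF NB kl] by auto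
      show "mat_mult R ?n N B k l \<in> nil" unfolding mat_mult_simps[OF kl]
      proof (rule nil_finsum[of _ _ "(p \<le> k) \<noteq> (p \<le> l)"], rule IntI)
        fix j assume "j \<in> {..<?n}"
        then have N': "N k j \<in> nil" "N k j \<in> gr R ((p \<le> k) \<noteq> (p \<le> j))" 
          and B': "B j l \<in> gr R ((p \<le> j) \<noteq> (p \<le> l))"
          using kl Nnil smatD[OF N, of k j] smatD[OF AB(2), of j l] by auto
        show "N k j \<otimes> B j l \<in> nil" by (rule nil_mult[OF N' B'])
        show "N k j \<otimes> B j l \<in> gr R ((p \<le> k) \<noteq> (p \<le> l))" by (rule gr_mult'[OF N'(2) B']) auto
      qed
    qed
    finally show ?thesis .
  qed
  then show ?thesis using smat_mult_closed[OF AB] by (simp add: unipotents_def)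
qed

lemma unipotents_one: "mat_one R (p + q) \<in> unipotents p q"
  using smat_one matsD[OF mat_one_closed] nil_zero by (simp add: unipotents_def minus_eq r_neg)

text \<open>A right inverse \<open>Y\<close> of \<open>A\<close> has itself a right inverse, which must be \<open>A\<close>.\<close>

lemma unipotent_inverse:
  assumes A: "A \<in> unipotents p q"
  shows "\<exists>Y\<in>unipotents p q. mat_mult R (p + q) A Y = mat_one R (p + q) \<and> mat_mult R (p + q) Y A = mat_one R (p + q)"
proof -
  obtain Y where Y: "Y \<in> unipotents p q" "mat_mult R (p + q) A Y = mat_one R (p + q)"
    using unipotent_right_inverse[OF A] by blast
  obtain B where B: "B \<in> unipotents p q" "mat_mult R (p + q) Y B = mat_one R (p + q)"
    using unipotent_right_inverse[OF Y(1)] by blast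
  have m: "A \<in> mats R (p + q)" "Y \<in> mats R (p + q)" "B \<in> mats R (p + q)"
    using A Y B smat_mats by (auto simp: unipotents_def)
  have "A = mat_mult R (p + q) A (mat_mult R (p + q) Y B)" using B m by (simp add: mat_mult_one)
  also have "\<dots> = B" using Y m by (simp add: mat_mult_assoc[symmetric] mat_one_mult)
  finally show ?thesis using Y B by auto
qed

end

section \<open>Homomorphisms of superalgebras\<close>

locale superalg_hom = C: superalg C + R: superalg R
  for C :: "('c, 's) sring_scheme" and R :: "('a, 'r) sring_scheme" +
  fixes h :: "'c \<Rightarrow> 'a"
  assumes hom: "h \<in> sring_hom C R"
begin

lemma h_closed [simp, intro]: "x \<in> carrier C \<Longrightarrow> h x \<in> carrier R"
  using hom by (auto simp: sring_hom_def ring_hom_def)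

lemma h_gr [simp, intro]: "x \<in> gr C b \<Longrightarrow> h x \<in> gr R b"
  using hom by (auto simp: sring_hom_def)

lemma h_add: "x \<in> carrier C \<Longrightarrow> y \<in> carrier C \<Longrightarrow> h (x \<oplus>\<^bsub>C\<^esub> y) = h x \<oplus>\<^bsub>R\<^esub> h y"
  using hom by (auto simp: sring_hom_def ring_hom_def)

lemma h_mult: "x \<in> carrier C \<Longrightarrow> y \<in> carrier C \<Longrightarrow> h (x \<otimes>\<^bsub>C\<^esub> y) = h x \<otimes>\<^bsub>R\<^esub> h y"
  using hom by (auto simp: sring_hom_def ring_hom_def)

lemma h_one [simp]: "h \<one>\<^bsub>C\<^esub> = \<one>\<^bsub>R\<^esub>"
  using hom by (auto simp: sring_hom_def ring_hom_def)

lemma h_zero [simp]: "h \<zero>\<^bsub>C\<^esub> = \<zero>\<^bsub>R\<^esub>"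
  using hom ring_hom_zero[OF _ C.ring_axioms R.ring_axioms] by (auto simp: sring_hom_def)

lemma h_neg: "x \<in> carrier C \<Longrightarrow> h (\<ominus>\<^bsub>C\<^esub> x) = \<ominus>\<^bsub>R\<^esub> h x"
  by (metis C.a_inv_closed C.l_neg R.minus_equality h_add h_closed h_zero)

lemma h_minus: "x \<in> carrier C \<Longrightarrow> y \<in> carrier C \<Longrightarrow> h (x \<ominus>\<^bsub>C\<^esub> y) = h x \<ominus>\<^bsub>R\<^esub> h y"
  by (simp add: C.minus_eq R.minus_eq h_add h_neg)

lemma h_sg: "x \<in> carrier C \<Longrightarrow> h (sg C e x) = sg R e (h x)"
  by (simp add: sg_def h_neg)

lemma h_finsum: "f \<in> A \<rightarrow> carrier C \<Longrightarrow> h (finsum C f A) = (\<Oplus>\<^bsub>R\<^esub>i\<in>A. h (f i))"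
proof (induction A rule: infinite_finite_induct)
  case (insert x F)
  then have c: "f x \<in> carrier C" "f \<in> F \<rightarrow> carrier C" "(\<lambda>i. h (f i)) \<in> F \<rightarrow> carrier R" by auto
  then have "h (finsum C f (insert x F)) = h (f x \<oplus>\<^bsub>C\<^esub> finsum C f F)"
    using insert.hyps by (simp add: C.finsum_insert)
  also have "\<dots> = h (f x) \<oplus>\<^bsub>R\<^esub> (\<Oplus>\<^bsub>R\<^esub>i\<in>F. h (f i))"
    using c insert.IH by (simp add: h_add C.finsum_closed)
  also have "\<dots> = (\<Oplus>\<^bsub>R\<^esub>i\<in>insert x F. h (f i))"
    using c insert.hyps by (intro R.finsum_insert[symmetric]) auto
  finally show ?case .
qed auto

lemma h_pow: "x \<in> carrier C \<Longrightarrow> h (x [^]\<^bsub>C\<^esub> (k::nat)) = h x [^]\<^bsub>R\<^esub> k"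
  by (induction k) (auto simp: h_mult)

lemma h_gi: "x \<in> carrier C \<Longrightarrow> h (C.gi x) = R.gi (h x)"
proof (induction x rule: C.homogeneous_cases)
  case (gr x b)
  then show ?case by (simp add: C.gi_homogeneous R.gi_homogeneous[OF h_gr[OF gr]] h_sg)
qed (simp add: C.gi_add R.gi_add h_add)

lemma map_mat_smat: "M \<in> smat C p q a \<Longrightarrow> map_mat (p + q) h M \<in> smat R p q a"
  unfolding map_mat_def by (intro mk_mat_in_smat h_gr smatD)

lemma map_mat_mats: "M \<in> mats C n \<Longrightarrow> map_mat n h M \<in> mats R n"
  unfolding map_mat_def by (intro mk_mat_in_mats h_closed matsD)

lemma map_mat_mult:
  assumes "M \<in> mats C n" "N \<in> mats C n"
  shows "map_mat n h (mat_mult C n M N) = mat_mult R n (map_mat n h M) (map_mat n h N)"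
proof (intro mats_eqI[of _ R n _ R] map_mat_mats C.mat_mult_closed R.mat_mult_closed assms)
  fix k l assume kl: "k < n" "l < n"
  then show "map_mat n h (mat_mult C n M N) k l = mat_mult R n (map_mat n h M) (map_mat n h N) k l"
    using matsD[OF assms(1)] matsD[OF assms(2)]
    by (auto simp: mat_mult_simps h_finsum Pi_def h_mult intro!: R.finsum_cong')
qed

lemma map_mat_one: "map_mat n h (mat_one C n) = mat_one R n"
  by (intro mats_eqI[of _ R n _ R] map_mat_mats C.mat_one_closed R.mat_one_closed)
    (auto simp: mat_one_def)

lemma h_nil: "x \<in> C.nil \<Longrightarrow> h x \<in> R.nil"
  unfolding C.nil_def R.nil_def by (auto simp: h_pow[symmetric]) (metis h_zero)

end

section \<open>Odd coordinates\<close>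

lemma ex1_eqI: "\<exists>!x. P x \<Longrightarrow> P a \<Longrightarrow> P b \<Longrightarrow> a = b"
  by blast

lemma (in abelian_group) add_cancel_middle:
  assumes "x \<in> carrier G" "y \<in> carrier G" "z \<in> carrier G"
  shows "(x \<oplus> y) \<oplus> (z \<oplus> \<ominus> y) = x \<oplus> z"
proof -
  have "(x \<oplus> y) \<oplus> (z \<oplus> \<ominus> y) = x \<oplus> (z \<oplus> (y \<oplus> \<ominus> y))" using assms by (simp add: a_ac)
  then show ?thesis using assms by (simp add: r_neg)
qed

text \<open>\<open>R\<close> is the exterior algebra over \<open>C\<close> on the elements \<open>t i\<close>. For a purely odd submersion, \<open>C\<close> and \<open>R\<close>
  are the functions on the target and on the source over an open set with odd coordinates.\<close>

locale odd_coords = superalg_hom C R h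
  for C :: "('c, 's) sring_scheme" and R :: "('a, 'r) sring_scheme" and h +
  fixes n :: nat and t :: "nat \<Rightarrow> 'a"
  assumes t_odd: "i < n \<Longrightarrow> t i \<in> gr R True"
    and expansion: "f \<in> carrier R \<Longrightarrow> \<exists>!c. c \<in> Pow {..<n} \<rightarrow>\<^sub>E carrier C \<and>
      f = (\<Oplus>\<^bsub>R\<^esub>J\<in>Pow {..<n}. h (c J) \<otimes>\<^bsub>R\<^esub> odd_monomial R t J)"
begin

definition tprod :: "nat list \<Rightarrow> 'a" where
  "tprod xs = foldr (\<lambda>i y. t i \<otimes>\<^bsub>R\<^esub> y) xs \<one>\<^bsub>R\<^esub>"

abbreviation mon :: "nat set \<Rightarrow> 'a" where
  "mon J \<equiv> odd_monomial R t J"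

lemma mon_tprod: "mon J = tprod (sorted_list_of_set J)"
  by (simp add: odd_monomial_def tprod_def)

lemma tprod_simps [simp]: "tprod [] = \<one>\<^bsub>R\<^esub>" "tprod (i # xs) = t i \<otimes>\<^bsub>R\<^esub> tprod xs"
  by (simp_all add: tprod_def)

lemma t_closed [simp]: "i < n \<Longrightarrow> t i \<in> carrier R"
  by (rule R.gr_closed[OF t_odd])

lemma tprod_closed: "set xs \<subseteq> {..<n} \<Longrightarrow> tprod xs \<in> carrier R"
  by (induction xs) auto

lemma tprod_gr: "set xs \<subseteq> {..<n} \<Longrightarrow> \<exists>b. tprod xs \<in> gr R b"
proof (induction xs)
  case (Cons x xs)
  then show ?case using R.gr_mult[OF t_odd[of x]] by auto
qed auto

lemma finite_sub: "J \<subseteq> {..<n} \<Longrightarrow> finite J"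
  using finite_subset by blast

lemma mon_closed [simp]: "J \<subseteq> {..<n} \<Longrightarrow> mon J \<in> carrier R"
  by (simp add: mon_tprod tprod_closed finite_sub)

lemma mon_gr: "J \<subseteq> {..<n} \<Longrightarrow> \<exists>b. mon J \<in> gr R b"
  by (simp add: mon_tprod tprod_gr finite_sub)

lemma mon_empty [simp]: "mon {} = \<one>\<^bsub>R\<^esub>"
  by (simp add: mon_tprod)

lemma tprod_extract:
  "set xs \<subseteq> {..<n} \<Longrightarrow> j \<in> set xs \<Longrightarrow> \<exists>e. tprod xs = sg R e (t j \<otimes>\<^bsub>R\<^esub> tprod (remove1 j xs))"
proof (induction xs)
  case (Cons x xs)
  show ?case
  proof (cases "x = j")
    case True
    then show ?thesis by (intro exI[of _ False]) auto
  next
    case False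
    then obtain e where e: "tprod xs = sg R e (t j \<otimes>\<^bsub>R\<^esub> tprod (remove1 j xs))" using Cons by auto
    have x: "t x \<in> gr R True" "t j \<in> gr R True" using Cons.prems t_odd by auto
    have c: "tprod (remove1 j xs) \<in> carrier R"
      using Cons.prems set_remove1_subset[of j xs] by (intro tprod_closed) auto
    have "tprod (x # xs) = sg R e ((t x \<otimes>\<^bsub>R\<^esub> t j) \<otimes>\<^bsub>R\<^esub> tprod (remove1 j xs))"
      using e x c by (simp add: R.sg_mult_r R.m_assoc)
    also have "t x \<otimes>\<^bsub>R\<^esub> t j = sg R True (t j \<otimes>\<^bsub>R\<^esub> t x)" using R.supercomm[OF x] by simp
    finally show ?thesis using False x c 
      by (intro exI[of _ "e \<noteq> True"]) (simp add: R.sg_mult_l R.m_assoc)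
  qed
qed auto

text \<open>Reordering the factors of a monomial changes it by a sign. The signs are left implicit, as the
  arguments below are about vanishing and membership.\<close>

lemma mon_extract:
  assumes "J \<subseteq> {..<n}" "j \<in> J"
  shows "\<exists>e. mon J = sg R e (t j \<otimes>\<^bsub>R\<^esub> mon (J - {j}))"
  using tprod_extract[of "sorted_list_of_set J" j] assms finite_sub[OF assms(1)]
  by (simp add: mon_tprod sorted_list_of_set_remove)

lemma t_mult_mon_new:
  assumes "J \<subseteq> {..<n}" "j < n" "j \<notin> J"
  shows "\<exists>e. t j \<otimes>\<^bsub>R\<^esub> mon J = sg R e (mon (insert j J))"
proof -
  obtain e where e: "mon (insert j J) = sg R e (t j \<otimes>\<^bsub>R\<^esub> mon (insert j J - {j}))"
    using mon_extract[of "insert j J" j] assms by auto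
  have "insert j J - {j} = J" using assms by auto
  then have "sg R e (mon (insert j J)) = t j \<otimes>\<^bsub>R\<^esub> mon J" using e assms by simp
  then show ?thesis by metis
qed

lemma t_mult_mon_old:
  assumes "J \<subseteq> {..<n}" "j \<in> J"
  shows "t j \<otimes>\<^bsub>R\<^esub> mon J = \<zero>\<^bsub>R\<^esub>"
proof -
  obtain e where e: "mon J = sg R e (t j \<otimes>\<^bsub>R\<^esub> mon (J - {j}))" using mon_extract assms by blast
  have c: "mon (J - {j}) \<in> carrier R" "t j \<in> gr R True" using assms by (auto intro!: mon_closed t_odd)
  have "t j \<otimes>\<^bsub>R\<^esub> mon J = sg R e ((t j \<otimes>\<^bsub>R\<^esub> t j) \<otimes>\<^bsub>R\<^esub> mon (J - {j}))"
    using e c by (simp add: R.sg_mult_r R.m_assoc)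
  then show ?thesis using R.odd_square[OF c(2)] c by simp
qed

subsection \<open>The subalgebra in a subset of the coordinates\<close>

text \<open>The functions of the coordinates with index in \<open>K\<close>. They are used to single out one coordinate:
  every function is uniquely of the form \<open>g + t\<^sub>i u\<close> with \<open>g\<close> and \<open>u\<close> free of \<open>t\<^sub>i\<close>.\<close>

definition sub :: "nat set \<Rightarrow> 'a set" where
  "sub K = {\<Oplus>\<^bsub>R\<^esub>J\<in>Pow K. h (c J) \<otimes>\<^bsub>R\<^esub> mon J | c. c \<in> Pow K \<rightarrow> carrier C}"

lemma sub_closed: "K \<subseteq> {..<n} \<Longrightarrow> f \<in> sub K \<Longrightarrow> f \<in> carrier R"
  unfolding sub_def by (auto intro!: R.finsum_closed R.m_closed mon_closed)

lemma sub_top: "f \<in> carrier R \<Longrightarrow> f \<in> sub {..<n}"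
  using ex1_implies_ex[OF expansion[of f]] unfolding sub_def by (auto simp: PiE_iff Pi_def)

lemma sub_term:
  assumes "K \<subseteq> {..<n}" "J \<subseteq> K" "a \<in> carrier C"
  shows "h a \<otimes>\<^bsub>R\<^esub> mon J \<in> sub K"
proof -
  have "(\<Oplus>\<^bsub>R\<^esub>J'\<in>Pow K. h (if J = J' then a else \<zero>\<^bsub>C\<^esub>) \<otimes>\<^bsub>R\<^esub> mon J')
      = (\<Oplus>\<^bsub>R\<^esub>J'\<in>Pow K. if J = J' then h a \<otimes>\<^bsub>R\<^esub> mon J' else \<zero>\<^bsub>R\<^esub>)"
    using assms by (intro R.finsum_cong') (auto intro!: mon_closed)
  also have "\<dots> = h a \<otimes>\<^bsub>R\<^esub> mon J"
    using assms finite_sub by (intro R.finsum_singleton) (auto intro!: mon_closed R.m_closed)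
  finally show ?thesis unfolding sub_def 
    using assms by (intro CollectI exI[of _ "\<lambda>J'. if J = J' then a else \<zero>\<^bsub>C\<^esub>"]) auto
qed

lemma sub_add:
  assumes "K \<subseteq> {..<n}" "f \<in> sub K" "g \<in> sub K"
  shows "f \<oplus>\<^bsub>R\<^esub> g \<in> sub K"
proof -
  obtain c d where cd: "c \<in> Pow K \<rightarrow> carrier C" "d \<in> Pow K \<rightarrow> carrier C"
    "f = (\<Oplus>\<^bsub>R\<^esub>J\<in>Pow K. h (c J) \<otimes>\<^bsub>R\<^esub> mon J)" "g = (\<Oplus>\<^bsub>R\<^esub>J\<in>Pow K. h (d J) \<otimes>\<^bsub>R\<^esub> mon J)"
    using assms unfolding sub_def by auto
  have m: "J \<subseteq> K \<Longrightarrow> c J \<in> carrier C \<and> d J \<in> carrier C \<and> mon J \<in> carrier R" for J using cd(1,2) assms by auto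
  have "f \<oplus>\<^bsub>R\<^esub> g = (\<Oplus>\<^bsub>R\<^esub>J\<in>Pow K. h (c J) \<otimes>\<^bsub>R\<^esub> mon J \<oplus>\<^bsub>R\<^esub> h (d J) \<otimes>\<^bsub>R\<^esub> mon J)"
    unfolding cd(3,4) using m by (intro R.finsum_addf[symmetric]) auto
  also have "\<dots> = (\<Oplus>\<^bsub>R\<^esub>J\<in>Pow K. h (c J \<oplus>\<^bsub>C\<^esub> d J) \<otimes>\<^bsub>R\<^esub> mon J)"
    using m by (intro R.finsum_cong') (auto simp: h_add R.l_distr)
  finally show ?thesis unfolding sub_def using m
    by (intro CollectI exI[of _ "\<lambda>J. c J \<oplus>\<^bsub>C\<^esub> d J"]) auto
qed

lemma sub_zero: "K \<subseteq> {..<n} \<Longrightarrow> \<zero>\<^bsub>R\<^esub> \<in> sub K"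
  using sub_term[of K "{}" "\<zero>\<^bsub>C\<^esub>"] by simp

lemma sub_const: "K \<subseteq> {..<n} \<Longrightarrow> a \<in> carrier C \<Longrightarrow> h a \<in> sub K"
  using sub_term[of K "{}" a] by simp

lemma sub_finsum: 
  "K \<subseteq> {..<n} \<Longrightarrow> (\<And>i. i \<in> A \<Longrightarrow> f i \<in> sub K) \<Longrightarrow> finsum R f A \<in> sub K"
proof (induction A rule: infinite_finite_induct)
  case (insert x F)
  then have "finsum R f (insert x F) = f x \<oplus>\<^bsub>R\<^esub> finsum R f F"
    using sub_closed by (intro R.finsum_insert) auto
  moreover have "finsum R f F \<in> sub K" "f x \<in> sub K" using insert by auto
  ultimately show ?case using sub_add insert.prems by auto
qed (auto simp: sub_zero)

lemma sub_induct [consumes 2, case_names zero add monomial]: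
  assumes K: "K \<subseteq> {..<n}" and f: "f \<in> sub K"
    and zero: "P \<zero>\<^bsub>R\<^esub>"
    and add: "\<And>f g. P f \<Longrightarrow> P g \<Longrightarrow> f \<in> sub K \<Longrightarrow> g \<in> sub K \<Longrightarrow> P (f \<oplus>\<^bsub>R\<^esub> g)"
    and monomial: "\<And>a J. a \<in> carrier C \<Longrightarrow> J \<subseteq> K \<Longrightarrow> P (h a \<otimes>\<^bsub>R\<^esub> mon J)"
  shows "P f"
proof -
  obtain c where c: "c \<in> Pow K \<rightarrow> carrier C" "f = (\<Oplus>\<^bsub>R\<^esub>J\<in>Pow K. h (c J) \<otimes>\<^bsub>R\<^esub> mon J)"
    using f unfolding sub_def by auto
  have "finite A \<Longrightarrow> A \<subseteq> Pow K \<Longrightarrow> P (\<Oplus>\<^bsub>R\<^esub>J\<in>A. h (c J) \<otimes>\<^bsub>R\<^esub> mon J)" for A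
  proof (induction A rule: finite_induct)
    case (insert J A)
    have t: "h (c J) \<otimes>\<^bsub>R\<^esub> mon J \<in> sub K" if "J \<in> Pow K" for J using that c K by (intro sub_term) auto
    have "(\<Oplus>\<^bsub>R\<^esub>J\<in>insert J A. h (c J) \<otimes>\<^bsub>R\<^esub> mon J) 
        = h (c J) \<otimes>\<^bsub>R\<^esub> mon J \<oplus>\<^bsub>R\<^esub> (\<Oplus>\<^bsub>R\<^esub>J\<in>A. h (c J) \<otimes>\<^bsub>R\<^esub> mon J)"
      using insert t sub_closed[OF K] by (intro R.finsum_insert) auto
    moreover have "(\<Oplus>\<^bsub>R\<^esub>J\<in>A. h (c J) \<otimes>\<^bsub>R\<^esub> mon J) \<in> sub K"
      using insert t K by (intro sub_finsum) auto
    moreover have "P (h (c J) \<otimes>\<^bsub>R\<^esub> mon J)" using insert c by (intro monomial) auto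
    ultimately show ?case using add insert t by auto
  qed (simp add: zero)
  from this[of "Pow K"] show ?thesis using c(2) finite_sub[OF K] by simp
qed

lemma sub_const_mult:
  assumes K: "K \<subseteq> {..<n}" and "a \<in> carrier C" "f \<in> sub K"
  shows "h a \<otimes>\<^bsub>R\<^esub> f \<in> sub K"
  using K assms(3)
proof (induction f rule: sub_induct)
  case (monomial b J)
  have "h a \<otimes>\<^bsub>R\<^esub> (h b \<otimes>\<^bsub>R\<^esub> mon J) = h (a \<otimes>\<^bsub>C\<^esub> b) \<otimes>\<^bsub>R\<^esub> mon J"
    using monomial assms K by (simp add: h_mult R.m_assoc)
  then show ?case using monomial assms sub_term by simp
qed (use assms K sub_closed[OF K] in \<open>auto simp: sub_zero R.r_distr intro: sub_add\<close>)

lemma t_mult_const: "j < n \<Longrightarrow> a \<in> carrier C \<Longrightarrow> t j \<otimes>\<^bsub>R\<^esub> h a = h (C.gi a) \<otimes>\<^bsub>R\<^esub> t j"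
  using R.odd_comm_gi[OF t_odd, of j "h (C.gi a)"] by (simp add: h_gi[symmetric])

lemma sg_const: "a \<in> carrier C \<Longrightarrow> x \<in> carrier R \<Longrightarrow> h a \<otimes>\<^bsub>R\<^esub> sg R e x = h (sg C e a) \<otimes>\<^bsub>R\<^esub> x"
  by (simp add: h_sg R.sg_mult_l R.sg_mult_r)

lemma sub_t_mult:
  assumes K: "K \<subseteq> {..<n}" and "j \<in> K" "f \<in> sub K"
  shows "t j \<otimes>\<^bsub>R\<^esub> f \<in> sub K"
proof -
  have tj: "t j \<in> carrier R" using assms by (auto intro!: t_closed)
  show ?thesis using K assms(3)
proof (induction f rule: sub_induct)
  case (monomial b J)
  have J: "J \<subseteq> {..<n}" "j < n" using monomial assms by auto
  have eq: "t j \<otimes>\<^bsub>R\<^esub> (h b \<otimes>\<^bsub>R\<^esub> mon J) = h (C.gi b) \<otimes>\<^bsub>R\<^esub> (t j \<otimes>\<^bsub>R\<^esub> mon J)"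
    using monomial J t_mult_const by (simp add: R.m_assoc[symmetric])
  show ?case
  proof (cases "j \<in> J")
    case True
    then show ?thesis using eq t_mult_mon_old[OF J(1)] K monomial by (simp add: sub_zero)
  next
    case False
    then obtain e where "t j \<otimes>\<^bsub>R\<^esub> mon J = sg R e (mon (insert j J))" using t_mult_mon_new J by blast
    then have "t j \<otimes>\<^bsub>R\<^esub> (h b \<otimes>\<^bsub>R\<^esub> mon J) = h (sg C e (C.gi b)) \<otimes>\<^bsub>R\<^esub> mon (insert j J)"
      using eq J monomial by (simp add: sg_const)
    then show ?thesis using monomial assms by (auto intro!: sub_term)
  qed
qed (use assms K tj sub_closed[OF K] in \<open>auto simp: sub_zero R.r_distr intro: sub_add\<close>)
qed

lemma sub_mult:
  assumes K: "K \<subseteq> {..<n}" and "f \<in> sub K" and g: "g \<in> sub K"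
  shows "f \<otimes>\<^bsub>R\<^esub> g \<in> sub K"
  using K assms(2)
proof (induction f rule: sub_induct)
  case (monomial b J)
  have "set xs \<subseteq> K \<Longrightarrow> tprod xs \<otimes>\<^bsub>R\<^esub> g \<in> sub K" for xs
  proof (induction xs)
    case (Cons x xs)
    have "tprod (x # xs) \<otimes>\<^bsub>R\<^esub> g = t x \<otimes>\<^bsub>R\<^esub> (tprod xs \<otimes>\<^bsub>R\<^esub> g)"
      using Cons.prems K sub_closed[OF K g] by (auto intro!: R.m_assoc tprod_closed)
    then show ?case using Cons sub_t_mult K by auto
  qed (use g sub_closed[OF K g] in simp)
  then have "mon J \<otimes>\<^bsub>R\<^esub> g \<in> sub K" using monomial finite_sub[of J] K by (simp add: mon_tprod)
  moreover have "h b \<otimes>\<^bsub>R\<^esub> mon J \<otimes>\<^bsub>R\<^esub> g = h b \<otimes>\<^bsub>R\<^esub> (mon J \<otimes>\<^bsub>R\<^esub> g)"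
    using monomial K sub_closed[OF K g] by (intro R.m_assoc) auto
  ultimately show ?case using sub_const_mult K monomial by simp
qed (use assms K sub_closed[OF K] in \<open>auto simp: sub_zero R.l_distr intro: sub_add\<close>)

lemma sub_gi:
  assumes K: "K \<subseteq> {..<n}" and "f \<in> sub K"
  shows "R.gi f \<in> sub K"
  using assms
proof (induction f rule: sub_induct)
  case (monomial b J)
  then have J: "mon J \<in> carrier R" "J \<subseteq> {..<n}" using K by auto
  obtain e where "mon J \<in> gr R e" using mon_gr J by blast
  then have "R.gi (h b \<otimes>\<^bsub>R\<^esub> mon J) = h (sg C e (C.gi b)) \<otimes>\<^bsub>R\<^esub> mon J"
    using monomial J by (simp add: R.gi_mult R.gi_homogeneous[of "mon J"] h_gi[symmetric] sg_const)
  then show ?case using monomial K by (simp add: sub_term)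
qed (use assms K sub_closed[OF K] in \<open>auto simp: sub_zero R.gi_add intro: sub_add\<close>)

lemma sub_sg: "K \<subseteq> {..<n} \<Longrightarrow> f \<in> sub K \<Longrightarrow> sg R e f \<in> sub K"
  using sub_const_mult[of K "sg C e \<one>\<^bsub>C\<^esub>" f] sub_closed[of K f] 
  by (auto simp: h_sg R.sg_mult_l)

subsection \<open>Splitting off one coordinate\<close>

abbreviation rest :: "nat \<Rightarrow> 'a set" where
  "rest i \<equiv> sub ({..<n} - {i})"

lemma rest_closed: "f \<in> rest i \<Longrightarrow> f \<in> carrier R"
  by (rule sub_closed[of "{..<n} - {i}"]) auto

lemma coefficients_unique:
  assumes "c \<in> Pow {..<n} \<rightarrow> carrier C" "d \<in> Pow {..<n} \<rightarrow> carrier C"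
    "(\<Oplus>\<^bsub>R\<^esub>J\<in>Pow {..<n}. h (c J) \<otimes>\<^bsub>R\<^esub> mon J) = (\<Oplus>\<^bsub>R\<^esub>J\<in>Pow {..<n}. h (d J) \<otimes>\<^bsub>R\<^esub> mon J)"
    "J \<subseteq> {..<n}"
  shows "c J = d J"
proof -
  define f where "f = (\<Oplus>\<^bsub>R\<^esub>J\<in>Pow {..<n}. h (c J) \<otimes>\<^bsub>R\<^esub> mon J)"
  have rs: "restrict e (Pow {..<n}) \<in> Pow {..<n} \<rightarrow>\<^sub>E carrier C \<and> 
      (\<Oplus>\<^bsub>R\<^esub>J\<in>Pow {..<n}. h (e J) \<otimes>\<^bsub>R\<^esub> mon J) = (\<Oplus>\<^bsub>R\<^esub>J\<in>Pow {..<n}. h (restrict e (Pow {..<n}) J) \<otimes>\<^bsub>R\<^esub> mon J)"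
    if "e \<in> Pow {..<n} \<rightarrow> carrier C" for e
  proof -
    have "e J \<in> carrier C" if "J \<subseteq> {..<n}" for J using \<open>e \<in> _\<close> that by blast
    then show ?thesis by (auto intro!: R.finsum_cong' R.m_closed mon_closed)
  qed
  have "f \<in> carrier R" unfolding f_def using assms(1) by (auto intro!: R.finsum_closed R.m_closed mon_closed)
  then have "restrict c (Pow {..<n}) = restrict d (Pow {..<n})"
  proof (rule ex1_eqI[OF expansion])
    show "restrict c (Pow {..<n}) \<in> Pow {..<n} \<rightarrow>\<^sub>E carrier C \<and>
        f = (\<Oplus>\<^bsub>R\<^esub>J\<in>Pow {..<n}. h (restrict c (Pow {..<n}) J) \<otimes>\<^bsub>R\<^esub> mon J)"
      using rs[OF assms(1)] unfolding f_def by blast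
    show "restrict d (Pow {..<n}) \<in> Pow {..<n} \<rightarrow>\<^sub>E carrier C \<and>
        f = (\<Oplus>\<^bsub>R\<^esub>J\<in>Pow {..<n}. h (restrict d (Pow {..<n}) J) \<otimes>\<^bsub>R\<^esub> mon J)"
      using rs[OF assms(2)] unfolding f_def assms(3) by blast
  qed
  then show ?thesis using assms(4) by (metis PowI restrict_apply')
qed

lemma split_exists:
  assumes "i < n" "f \<in> carrier R"
  shows "\<exists>g\<in>rest i. \<exists>u\<in>rest i. f = g \<oplus>\<^bsub>R\<^esub> t i \<otimes>\<^bsub>R\<^esub> u"
  using order.refl sub_top[OF assms(2)]
proof (induction f rule: sub_induct)
  case zero
  show ?case by (intro bexI[of _ "\<zero>\<^bsub>R\<^esub>"]) (use assms in \<open>auto intro: sub_zero\<close>)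
next
  case (add f1 f2)
  then obtain g1 u1 g2 u2 where gu: "g1 \<in> rest i" "u1 \<in> rest i" "g2 \<in> rest i" "u2 \<in> rest i"
    "f1 = g1 \<oplus>\<^bsub>R\<^esub> t i \<otimes>\<^bsub>R\<^esub> u1" "f2 = g2 \<oplus>\<^bsub>R\<^esub> t i \<otimes>\<^bsub>R\<^esub> u2" by blast
  show ?case
  proof (intro bexI)
    show "f1 \<oplus>\<^bsub>R\<^esub> f2 = (g1 \<oplus>\<^bsub>R\<^esub> g2) \<oplus>\<^bsub>R\<^esub> t i \<otimes>\<^bsub>R\<^esub> (u1 \<oplus>\<^bsub>R\<^esub> u2)"
      using gu(5,6) gu(1-4)[THEN rest_closed] assms by (simp add: R.r_distr R.a_ac)
  qed (use gu sub_add in auto)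
next
  case (monomial a J)
  show ?case
  proof (cases "i \<in> J")
    case False
    then show ?thesis using monomial assms
      by (intro bexI[of _ "h a \<otimes>\<^bsub>R\<^esub> mon J"] bexI[of _ "\<zero>\<^bsub>R\<^esub>"]) (auto intro!: sub_term sub_zero)
  next
    case True
    then obtain e where e: "mon J = sg R e (t i \<otimes>\<^bsub>R\<^esub> mon (J - {i}))" using mon_extract monomial by blast
    have m: "mon (J - {i}) \<in> carrier R" using monomial by (intro mon_closed) auto
    have "h a \<otimes>\<^bsub>R\<^esub> mon J = h (sg C e a) \<otimes>\<^bsub>R\<^esub> (t i \<otimes>\<^bsub>R\<^esub> mon (J - {i}))"
      using e m monomial assms sg_const by simp
    also have "\<dots> = (h (C.gi (C.gi (sg C e a))) \<otimes>\<^bsub>R\<^esub> t i) \<otimes>\<^bsub>R\<^esub> mon (J - {i})"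
      using m monomial assms by (simp add: R.m_assoc)
    also have "\<dots> = t i \<otimes>\<^bsub>R\<^esub> (h (C.gi (sg C e a)) \<otimes>\<^bsub>R\<^esub> mon (J - {i}))"
      using m monomial assms by (subst t_mult_const[symmetric]) (auto simp: R.m_assoc)
    finally show ?thesis using monomial assms m
      by (intro bexI[of _ "\<zero>\<^bsub>R\<^esub>"] bexI[of _ "h (C.gi (sg C e a)) \<otimes>\<^bsub>R\<^esub> mon (J - {i})"]) 
         (auto intro!: sub_term sub_zero)
  qed
qed

text \<open>Multiplication by \<open>t\<^sub>i\<close> maps the monomials free of \<open>t\<^sub>i\<close> to distinct monomials up to sign, and
  expansions are unique.\<close>

lemma t_mult_inj:
  assumes i: "i < n" and u: "u \<in> rest i" and z: "t i \<otimes>\<^bsub>R\<^esub> u = \<zero>\<^bsub>R\<^esub>"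
  shows "u = \<zero>\<^bsub>R\<^esub>"
proof -
  let ?K = "{..<n} - {i}"
  obtain d where d: "d \<in> Pow ?K \<rightarrow> carrier C" "u = (\<Oplus>\<^bsub>R\<^esub>J\<in>Pow ?K. h (d J) \<otimes>\<^bsub>R\<^esub> mon J)"
    using u unfolding sub_def by auto
  have "\<forall>J. \<exists>e. J \<subseteq> ?K \<longrightarrow> t i \<otimes>\<^bsub>R\<^esub> mon J = sg R e (mon (insert i J))"
    using t_mult_mon_new[OF _ i] by blast
  then obtain e where e: "\<And>J. J \<subseteq> ?K \<Longrightarrow> t i \<otimes>\<^bsub>R\<^esub> mon J = sg R (e J) (mon (insert i J))" by metis
  \<comment> \<open>the coefficients of the expansion of \<open>t\<^sub>i u\<close>; the involution arises from moving \<open>t\<^sub>i\<close> past \<open>d J\<close>\<close>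
  define c where "c J = (if i \<in> J then sg C (e (J - {i})) (C.gi (d (J - {i}))) else \<zero>\<^bsub>C\<^esub>)" for J
  have dC: "d J \<in> carrier C" if "J \<subseteq> ?K" for J using d(1) that by blast
  have c: "c \<in> Pow {..<n} \<rightarrow> carrier C"
  proof
    fix J assume "J \<in> Pow {..<n}"
    then have "d (J - {i}) \<in> carrier C" by (intro dC) auto
    then show "c J \<in> carrier C" by (simp add: c_def)
  qed
  have dc: "J \<subseteq> ?K \<Longrightarrow> d J \<in> carrier C \<and> mon J \<in> carrier R \<and> mon (insert i J) \<in> carrier R" for J
    using dC i by (auto intro!: mon_closed)
  have tm: "t i \<otimes>\<^bsub>R\<^esub> (h (d J) \<otimes>\<^bsub>R\<^esub> mon J) = h (c (insert i J)) \<otimes>\<^bsub>R\<^esub> mon (insert i J)" if J: "J \<subseteq> ?K" for J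
  proof -
    have "insert i J - {i} = J" using J by auto
    then have cJ: "c (insert i J) = sg C (e J) (C.gi (d J))" by (simp add: c_def)
    have "t i \<otimes>\<^bsub>R\<^esub> (h (d J) \<otimes>\<^bsub>R\<^esub> mon J) = h (C.gi (d J)) \<otimes>\<^bsub>R\<^esub> (t i \<otimes>\<^bsub>R\<^esub> mon J)"
      using dc[OF J] i by (simp add: R.m_assoc[symmetric] t_mult_const)
    then show ?thesis using e[OF J] dc[OF J] by (simp add: sg_const cJ)
  qed
  have inj: "inj_on (insert i) (Pow ?K)" by (auto simp: inj_on_def)
  have cc: "J \<subseteq> {..<n} \<Longrightarrow> h (c J) \<otimes>\<^bsub>R\<^esub> mon J \<in> carrier R" for J
    using c by (intro R.m_closed h_closed mon_closed) auto
  have cci: "h (c (insert i J)) \<otimes>\<^bsub>R\<^esub> mon (insert i J) \<in> carrier R" if "J \<subseteq> ?K" for J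
    using that i by (intro cc) auto
  have Pow_eq: "Pow {..<n} = Pow ?K \<union> insert i ` Pow ?K"
  proof -
    have "J \<in> insert i ` Pow ?K" if "J \<subseteq> {..<n}" "i \<in> J" for J
      by (rule image_eqI[of _ _ "J - {i}"]) (use that in auto)
    then show ?thesis using i by blast
  qed
  have "(\<Oplus>\<^bsub>R\<^esub>J\<in>Pow {..<n}. h (c J) \<otimes>\<^bsub>R\<^esub> mon J)
      = (\<Oplus>\<^bsub>R\<^esub>J\<in>Pow ?K. h (c J) \<otimes>\<^bsub>R\<^esub> mon J) \<oplus>\<^bsub>R\<^esub> (\<Oplus>\<^bsub>R\<^esub>J\<in>insert i ` Pow ?K. h (c J) \<otimes>\<^bsub>R\<^esub> mon J)"
    unfolding Pow_eq
  proof (rule R.finsum_Un_disjoint)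
    show "(\<lambda>J. h (c J) \<otimes>\<^bsub>R\<^esub> mon J) \<in> Pow ?K \<rightarrow> carrier R"
      using cc by auto
    show "(\<lambda>J. h (c J) \<otimes>\<^bsub>R\<^esub> mon J) \<in> insert i ` Pow ?K \<rightarrow> carrier R"
      using cci by blast
  qed auto
  also have "(\<Oplus>\<^bsub>R\<^esub>J\<in>Pow ?K. h (c J) \<otimes>\<^bsub>R\<^esub> mon J) = (\<Oplus>\<^bsub>R\<^esub>J\<in>Pow ?K. \<zero>\<^bsub>R\<^esub>)"
    using dc by (intro R.finsum_cong') (auto simp: c_def)
  also have "(\<Oplus>\<^bsub>R\<^esub>J\<in>insert i ` Pow ?K. h (c J) \<otimes>\<^bsub>R\<^esub> mon J) 
      = (\<Oplus>\<^bsub>R\<^esub>J\<in>Pow ?K. h (c (insert i J)) \<otimes>\<^bsub>R\<^esub> mon (insert i J))"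
    by (rule R.finsum_reindex[OF _ inj]) (use cci in blast)
  also have "\<dots> = (\<Oplus>\<^bsub>R\<^esub>J\<in>Pow ?K. t i \<otimes>\<^bsub>R\<^esub> (h (d J) \<otimes>\<^bsub>R\<^esub> mon J))"
    using dc i by (intro R.finsum_cong') (auto simp: tm)
  also have "\<dots> = t i \<otimes>\<^bsub>R\<^esub> u"
    unfolding d(2) using dc i by (intro R.finsum_rdistr[symmetric]) auto
  finally have "(\<Oplus>\<^bsub>R\<^esub>J\<in>Pow {..<n}. h (c J) \<otimes>\<^bsub>R\<^esub> mon J) 
      = (\<Oplus>\<^bsub>R\<^esub>J\<in>Pow {..<n}. h ((\<lambda>_. \<zero>\<^bsub>C\<^esub>) J) \<otimes>\<^bsub>R\<^esub> mon J)"
    using z by (simp cong: R.finsum_cong)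
  then have c0: "c J = \<zero>\<^bsub>C\<^esub>" if "J \<subseteq> {..<n}" for J
    using coefficients_unique[OF c _ _ that, of "\<lambda>_. \<zero>\<^bsub>C\<^esub>"] by auto
  have "d J = \<zero>\<^bsub>C\<^esub>" if "J \<subseteq> ?K" for J
  proof -
    have "insert i J - {i} = J" using that by auto
    then have "sg C (e J) (C.gi (d J)) = \<zero>\<^bsub>C\<^esub>" using c0[of "insert i J"] that i by (auto simp: c_def)
    then have "C.gi (d J) = \<zero>\<^bsub>C\<^esub>" using dc[OF that] by simp
    then have "C.gi (C.gi (d J)) = \<zero>\<^bsub>C\<^esub>" by simp
    then show ?thesis using dc[OF that] by simp
  qed
  then have "u = (\<Oplus>\<^bsub>R\<^esub>J\<in>Pow ?K. \<zero>\<^bsub>R\<^esub>)" unfolding d(2) using dc by (intro R.finsum_cong') auto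
  then show ?thesis by simp
qed

text \<open>Multiplication by \<open>t\<^sub>i\<close> kills the second summands and is injective on the first ones.\<close>

lemma split_unique:
  assumes i: "i < n" and "g \<in> rest i" "u \<in> rest i" "g' \<in> rest i" "u' \<in> rest i"
    and eq: "g \<oplus>\<^bsub>R\<^esub> t i \<otimes>\<^bsub>R\<^esub> u = g' \<oplus>\<^bsub>R\<^esub> t i \<otimes>\<^bsub>R\<^esub> u'"
  shows "g = g' \<and> u = u'"
proof -
  note c = assms(2-5)[THEN rest_closed] t_closed[OF i]
  have tt: "t i \<otimes>\<^bsub>R\<^esub> (t i \<otimes>\<^bsub>R\<^esub> x) = \<zero>\<^bsub>R\<^esub>" if "x \<in> carrier R" for x
    using R.odd_square[OF t_odd[OF i]] that c by (simp add: R.m_assoc[symmetric])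
  have neg: "\<ominus>\<^bsub>R\<^esub> x \<in> rest i" if "x \<in> rest i" for x
    using sub_sg[OF _ that, of True] by (simp add: sg_def)
  have "t i \<otimes>\<^bsub>R\<^esub> g = t i \<otimes>\<^bsub>R\<^esub> g'"
    using arg_cong[OF eq, of "\<lambda>x. t i \<otimes>\<^bsub>R\<^esub> x"] c tt by (simp add: R.r_distr)
  then have "t i \<otimes>\<^bsub>R\<^esub> (g \<oplus>\<^bsub>R\<^esub> \<ominus>\<^bsub>R\<^esub> g') = \<zero>\<^bsub>R\<^esub>" using c by (simp add: R.r_distr R.r_minus R.r_neg)
  then have "g \<oplus>\<^bsub>R\<^esub> \<ominus>\<^bsub>R\<^esub> g' = \<zero>\<^bsub>R\<^esub>"
    by (rule t_mult_inj[OF i sub_add[OF _ assms(2) neg[OF assms(4)]], rotated]) auto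
  then have g: "g = g'" using c by (metis R.minus_eq R.r_right_minus_eq)
  then have "t i \<otimes>\<^bsub>R\<^esub> u = t i \<otimes>\<^bsub>R\<^esub> u'" using eq c by (metis R.a_comm R.add.right_cancel R.m_closed)
  then have "t i \<otimes>\<^bsub>R\<^esub> (u \<oplus>\<^bsub>R\<^esub> \<ominus>\<^bsub>R\<^esub> u') = \<zero>\<^bsub>R\<^esub>" using c by (simp add: R.r_distr R.r_minus R.r_neg)
  then have "u \<oplus>\<^bsub>R\<^esub> \<ominus>\<^bsub>R\<^esub> u' = \<zero>\<^bsub>R\<^esub>"
    by (rule t_mult_inj[OF i sub_add[OF _ assms(3) neg[OF assms(5)]], rotated]) auto
  then have "u = u'" using c by (metis R.minus_eq R.r_right_minus_eq)
  then show ?thesis using g by blast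
qed

text \<open>The left derivative: \<open>t\<^sub>i\<close> is moved to the front before it is removed.\<close>

definition partial :: "nat \<Rightarrow> 'a \<Rightarrow> 'a" where
  "partial i f = (THE u. u \<in> rest i \<and> (\<exists>g\<in>rest i. f = g \<oplus>\<^bsub>R\<^esub> t i \<otimes>\<^bsub>R\<^esub> u))"

lemma partial_eq:
  assumes "i < n" "g \<in> rest i" "u \<in> rest i"
  shows "partial i (g \<oplus>\<^bsub>R\<^esub> t i \<otimes>\<^bsub>R\<^esub> u) = u"
  unfolding partial_def using split_unique assms by (intro the_equality) blast+

lemma partial_rest: "i < n \<Longrightarrow> f \<in> rest i \<Longrightarrow> partial i f = \<zero>\<^bsub>R\<^esub>"
  using partial_eq[of i f "\<zero>\<^bsub>R\<^esub>"] rest_closed[of f i] by (simp add: sub_zero)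

lemma partial_in_rest: "i < n \<Longrightarrow> f \<in> carrier R \<Longrightarrow> partial i f \<in> rest i"
  using split_exists[of i f] partial_eq by auto

lemma partial_closed [simp]: "i < n \<Longrightarrow> f \<in> carrier R \<Longrightarrow> partial i f \<in> carrier R"
  using partial_in_rest rest_closed by blast

lemma partial_const: "i < n \<Longrightarrow> a \<in> carrier C \<Longrightarrow> partial i (h a) = \<zero>\<^bsub>R\<^esub>"
  by (intro partial_rest sub_const) auto

lemma t_in_sub: "j \<in> K \<Longrightarrow> K \<subseteq> {..<n} \<Longrightarrow> t j \<in> sub K"
  using sub_t_mult[OF _ _ sub_const[of K "\<one>\<^bsub>C\<^esub>"], of j] by (auto simp: subset_iff)

lemma partial_t: "i < n \<Longrightarrow> j < n \<Longrightarrow> partial i (t j) = (if i = j then \<one>\<^bsub>R\<^esub> else \<zero>\<^bsub>R\<^esub>)"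
  using partial_eq[of i "\<zero>\<^bsub>R\<^esub>" "\<one>\<^bsub>R\<^esub>"] sub_zero[of "{..<n} - {i}"] sub_const[of "{..<n} - {i}" "\<one>\<^bsub>C\<^esub>"]
  by (auto intro!: partial_rest t_in_sub)

lemma partial_add:
  assumes "i < n" "f1 \<in> carrier R" "f2 \<in> carrier R"
  shows "partial i (f1 \<oplus>\<^bsub>R\<^esub> f2) = partial i f1 \<oplus>\<^bsub>R\<^esub> partial i f2"
proof -
  obtain g1 u1 g2 u2 where gu: "g1 \<in> rest i" "u1 \<in> rest i" "g2 \<in> rest i" "u2 \<in> rest i"
    "f1 = g1 \<oplus>\<^bsub>R\<^esub> t i \<otimes>\<^bsub>R\<^esub> u1" "f2 = g2 \<oplus>\<^bsub>R\<^esub> t i \<otimes>\<^bsub>R\<^esub> u2" 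
    using split_exists[OF assms(1)] assms(2,3) by metis
  have "f1 \<oplus>\<^bsub>R\<^esub> f2 = (g1 \<oplus>\<^bsub>R\<^esub> g2) \<oplus>\<^bsub>R\<^esub> t i \<otimes>\<^bsub>R\<^esub> (u1 \<oplus>\<^bsub>R\<^esub> u2)"
    using gu(5,6) gu(1-4)[THEN rest_closed] assms by (simp add: R.r_distr R.a_ac)
  then show ?thesis using gu assms by (simp add: partial_eq sub_add)
qed

text \<open>Both factors are split as \<open>g + t\<^sub>i u\<close>. In the product the terms with two factors \<open>t\<^sub>i\<close> vanish, and
  moving \<open>t\<^sub>i\<close> to the front past \<open>g\<close> turns \<open>g\<close> into its image under the grade involution.\<close>

lemma partial_mult_gi:
  assumes i: "i < n" and "f1 \<in> carrier R" "f2 \<in> carrier R"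
  shows "partial i (f1 \<otimes>\<^bsub>R\<^esub> f2) = partial i f1 \<otimes>\<^bsub>R\<^esub> f2 \<oplus>\<^bsub>R\<^esub> R.gi f1 \<otimes>\<^bsub>R\<^esub> partial i f2"
proof -
  obtain g1 u1 g2 u2 where gu: "g1 \<in> rest i" "u1 \<in> rest i" "g2 \<in> rest i" "u2 \<in> rest i"
    "f1 = g1 \<oplus>\<^bsub>R\<^esub> t i \<otimes>\<^bsub>R\<^esub> u1" "f2 = g2 \<oplus>\<^bsub>R\<^esub> t i \<otimes>\<^bsub>R\<^esub> u2" 
    using split_exists[OF assms(1)] assms(2,3) by metis
  note c = gu(1-4)[THEN rest_closed] t_closed[OF i]
  have comm: "x \<otimes>\<^bsub>R\<^esub> (t i \<otimes>\<^bsub>R\<^esub> y) = t i \<otimes>\<^bsub>R\<^esub> (R.gi x \<otimes>\<^bsub>R\<^esub> y)" if "x \<in> carrier R" "y \<in> carrier R" for x y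
    using R.odd_comm_gi[OF t_odd[OF i]] that c by (simp add: R.m_assoc[symmetric])
  have tt: "t i \<otimes>\<^bsub>R\<^esub> (t i \<otimes>\<^bsub>R\<^esub> x) = \<zero>\<^bsub>R\<^esub>" if "x \<in> carrier R" for x
    using R.odd_square[OF t_odd[OF i]] that c by (simp add: R.m_assoc[symmetric])
  have git: "R.gi (t i) = \<ominus>\<^bsub>R\<^esub> t i" using R.gi_homogeneous[OF t_odd[OF i]] by (simp add: sg_def)
  have rest: "g1 \<otimes>\<^bsub>R\<^esub> g2 \<in> rest i" "u1 \<otimes>\<^bsub>R\<^esub> g2 \<oplus>\<^bsub>R\<^esub> R.gi g1 \<otimes>\<^bsub>R\<^esub> u2 \<in> rest i"
    using gu by (auto intro!: sub_mult sub_add sub_gi)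
  have g1f: "g1 \<otimes>\<^bsub>R\<^esub> f2 = g1 \<otimes>\<^bsub>R\<^esub> g2 \<oplus>\<^bsub>R\<^esub> t i \<otimes>\<^bsub>R\<^esub> (R.gi g1 \<otimes>\<^bsub>R\<^esub> u2)"
    unfolding gu(6) using c by (simp add: R.r_distr comm)
  have u1f: "u1 \<otimes>\<^bsub>R\<^esub> f2 = u1 \<otimes>\<^bsub>R\<^esub> g2 \<oplus>\<^bsub>R\<^esub> t i \<otimes>\<^bsub>R\<^esub> (R.gi u1 \<otimes>\<^bsub>R\<^esub> u2)"
    unfolding gu(6) using c by (simp add: R.r_distr comm)
  have "f1 \<otimes>\<^bsub>R\<^esub> f2 = g1 \<otimes>\<^bsub>R\<^esub> f2 \<oplus>\<^bsub>R\<^esub> t i \<otimes>\<^bsub>R\<^esub> (u1 \<otimes>\<^bsub>R\<^esub> f2)"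
    unfolding gu(5) using c assms(3) by (simp add: R.l_distr R.m_assoc)
  also have "\<dots> = g1 \<otimes>\<^bsub>R\<^esub> g2 \<oplus>\<^bsub>R\<^esub> t i \<otimes>\<^bsub>R\<^esub> (u1 \<otimes>\<^bsub>R\<^esub> g2 \<oplus>\<^bsub>R\<^esub> R.gi g1 \<otimes>\<^bsub>R\<^esub> u2)"
    unfolding g1f u1f using c by (simp add: R.r_distr tt R.a_ac)
  finally have "partial i (f1 \<otimes>\<^bsub>R\<^esub> f2) = u1 \<otimes>\<^bsub>R\<^esub> g2 \<oplus>\<^bsub>R\<^esub> R.gi g1 \<otimes>\<^bsub>R\<^esub> u2"
    using partial_eq[OF i rest] by simp
  also have "\<dots> = (u1 \<otimes>\<^bsub>R\<^esub> g2 \<oplus>\<^bsub>R\<^esub> t i \<otimes>\<^bsub>R\<^esub> (R.gi u1 \<otimes>\<^bsub>R\<^esub> u2)) \<oplus>\<^bsub>R\<^esub>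
      (R.gi g1 \<otimes>\<^bsub>R\<^esub> u2 \<oplus>\<^bsub>R\<^esub> \<ominus>\<^bsub>R\<^esub> (t i \<otimes>\<^bsub>R\<^esub> (R.gi u1 \<otimes>\<^bsub>R\<^esub> u2)))"
    using c by (intro R.add_cancel_middle[symmetric]) auto
  also have "R.gi g1 \<otimes>\<^bsub>R\<^esub> u2 \<oplus>\<^bsub>R\<^esub> \<ominus>\<^bsub>R\<^esub> (t i \<otimes>\<^bsub>R\<^esub> (R.gi u1 \<otimes>\<^bsub>R\<^esub> u2)) = R.gi f1 \<otimes>\<^bsub>R\<^esub> u2"
    unfolding gu(5) using c by (simp add: R.gi_add R.gi_mult git R.l_distr R.l_minus R.m_assoc)
  finally have "partial i (f1 \<otimes>\<^bsub>R\<^esub> f2) = u1 \<otimes>\<^bsub>R\<^esub> f2 \<oplus>\<^bsub>R\<^esub> R.gi f1 \<otimes>\<^bsub>R\<^esub> u2"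
    unfolding u1f .
  then show ?thesis using gu i by (simp add: partial_eq)
qed

text \<open>By uniqueness of the splitting, the grade involution acts on the two parts of \<open>g + t\<^sub>i u\<close> separately,
  with an additional sign on \<open>u\<close>.\<close>

lemma partial_gr:
  assumes i: "i < n" and "f \<in> gr R b"
  shows "partial i f \<in> gr R (\<not> b)"
proof -
  obtain g u where gu: "g \<in> rest i" "u \<in> rest i" "f = g \<oplus>\<^bsub>R\<^esub> t i \<otimes>\<^bsub>R\<^esub> u"
    using split_exists[OF i] assms(2) R.gr_closed by metis
  note c = gu(1,2)[THEN rest_closed] t_closed[OF i]
  have git: "R.gi (t i) = \<ominus>\<^bsub>R\<^esub> t i" using R.gi_homogeneous[OF t_odd[OF i]] by (simp add: sg_def)
  have K: "{..<n} - {i} \<subseteq> {..<n}" by auto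
  have "R.gi g \<oplus>\<^bsub>R\<^esub> t i \<otimes>\<^bsub>R\<^esub> sg R True (R.gi u) = sg R b g \<oplus>\<^bsub>R\<^esub> t i \<otimes>\<^bsub>R\<^esub> sg R b u"
    using R.gi_homogeneous[OF assms(2)] c unfolding gu(3)
    by (simp add: R.gi_add R.gi_mult git R.sg_add R.sg_mult_r R.l_minus) (simp add: sg_def R.r_minus)
  then have "sg R True (R.gi u) = sg R b u"
    by (rule split_unique[OF i sub_gi[OF K gu(1)] sub_sg[OF K sub_gi[OF K gu(2)]]
        sub_sg[OF K gu(1)] sub_sg[OF K gu(2)], THEN conjunct2])
  then have "sg R True (sg R True (R.gi u)) = sg R True (sg R b u)" by simp
  then have "R.gi u = sg R (\<not> b) u" using c by simp
  then show ?thesis using R.gr_iff_gi c gu i by (simp add: partial_eq)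
qed

lemma partial_mult:
  assumes i: "i < n" and "f \<in> gr R b" "g \<in> carrier R"
  shows "partial i (f \<otimes>\<^bsub>R\<^esub> g) = partial i f \<otimes>\<^bsub>R\<^esub> g \<oplus>\<^bsub>R\<^esub> sg R b (f \<otimes>\<^bsub>R\<^esub> partial i g)"
  using assms by (simp add: partial_mult_gi R.gi_homogeneous R.sg_mult_l)

text \<open>A constant is the coefficient of the empty monomial.\<close>

lemma const_inj: "a \<in> carrier C \<Longrightarrow> b \<in> carrier C \<Longrightarrow> h a = h b \<Longrightarrow> a = b"
proof -
  assume ab: "a \<in> carrier C" "b \<in> carrier C" "h a = h b"
  have "(\<Oplus>\<^bsub>R\<^esub>J\<in>Pow {..<n}. h (if J = {} then x else \<zero>\<^bsub>C\<^esub>) \<otimes>\<^bsub>R\<^esub> mon J) = h x" if "x \<in> carrier C" for x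
  proof -
    have "(\<Oplus>\<^bsub>R\<^esub>J\<in>Pow {..<n}. h (if J = {} then x else \<zero>\<^bsub>C\<^esub>) \<otimes>\<^bsub>R\<^esub> mon J)
      = (\<Oplus>\<^bsub>R\<^esub>J\<in>Pow {..<n}. if {} = J then h x \<otimes>\<^bsub>R\<^esub> mon J else \<zero>\<^bsub>R\<^esub>)"
      using that by (intro R.finsum_cong') (auto intro!: mon_closed)
    also have "\<dots> = h x \<otimes>\<^bsub>R\<^esub> mon {}"
      using that by (intro R.finsum_singleton) (auto intro!: mon_closed R.m_closed)
    finally show ?thesis using that by simp
  qed
  then show "a = b" 
    using coefficients_unique[of "\<lambda>J. if J = {} then a else \<zero>\<^bsub>C\<^esub>" "\<lambda>J. if J = {} then b else \<zero>\<^bsub>C\<^esub>" "{}"] ab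
    by auto
qed

text \<open>If the derivative with respect to \<open>t\<^sub>i\<close> vanishes, \<open>f\<close> is free of \<open>t\<^sub>i\<close>, and by uniqueness of the
  expansion no monomial containing \<open>t\<^sub>i\<close> occurs in it. Only the empty monomial remains.\<close>

lemma constant_if_partials_vanish:
  assumes f: "f \<in> carrier R" and z: "\<And>i. i < n \<Longrightarrow> partial i f = \<zero>\<^bsub>R\<^esub>"
  shows "\<exists>a\<in>carrier C. f = h a"
proof -
  obtain c where c: "c \<in> Pow {..<n} \<rightarrow> carrier C" "f = (\<Oplus>\<^bsub>R\<^esub>J\<in>Pow {..<n}. h (c J) \<otimes>\<^bsub>R\<^esub> mon J)"
    using sub_top[OF f] unfolding sub_def by auto
  have cc: "c {} \<in> carrier C" using c(1) by blast
  have c0: "c J = \<zero>\<^bsub>C\<^esub>" if "i \<in> J" "J \<subseteq> {..<n}" for i J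
  proof -
    have i: "i < n" using that by auto
    let ?K = "{..<n} - {i}"
    obtain g u where gu: "g \<in> rest i" "u \<in> rest i" "f = g \<oplus>\<^bsub>R\<^esub> t i \<otimes>\<^bsub>R\<^esub> u"
      using split_exists[OF i f] by auto
    then have "u = \<zero>\<^bsub>R\<^esub>" using z[OF i] partial_eq[OF i gu(1,2)] by simp
    then have "f \<in> rest i" using gu i rest_closed[OF gu(1)] by simp
    then obtain d where d: "d \<in> Pow ?K \<rightarrow> carrier C" "f = (\<Oplus>\<^bsub>R\<^esub>J\<in>Pow ?K. h (d J) \<otimes>\<^bsub>R\<^esub> mon J)"
      unfolding sub_def by auto
    \<comment> \<open>the expansion of \<open>f\<close> in the other coordinates, as an expansion in all coordinates\<close>
    define d' where "d' J = (if i \<in> J then \<zero>\<^bsub>C\<^esub> else d J)" for J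
    have d': "d' \<in> Pow {..<n} \<rightarrow> carrier C" using d(1) by (auto simp: d'_def Pi_def)
    have sub: "Pow ?K \<subseteq> Pow {..<n}" by auto
    have "(\<Oplus>\<^bsub>R\<^esub>J\<in>Pow {..<n}. h (d' J) \<otimes>\<^bsub>R\<^esub> mon J) = (\<Oplus>\<^bsub>R\<^esub>J\<in>Pow ?K. h (d' J) \<otimes>\<^bsub>R\<^esub> mon J)"
    proof (rule R.add.finprod_mono_neutral_cong_right[OF _ sub])
      show "\<And>J. J \<in> Pow {..<n} - Pow ?K \<Longrightarrow> h (d' J) \<otimes>\<^bsub>R\<^esub> mon J = \<zero>\<^bsub>R\<^esub>"
        by (auto simp: d'_def subset_iff)
      show "(\<lambda>J. h (d' J) \<otimes>\<^bsub>R\<^esub> mon J) \<in> Pow {..<n} \<rightarrow> carrier R"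
        using d' by (auto intro!: R.m_closed mon_closed)
    qed auto
    also have "\<dots> = f" unfolding d(2) using d(1)
      by (intro R.finsum_cong') (auto simp: d'_def intro!: R.m_closed mon_closed)
    finally have "d' J = c J" using coefficients_unique[OF d' c(1) _ that(2)] c(2) by simp
    then show ?thesis using that by (simp add: d'_def)
  qed
  have "f = (\<Oplus>\<^bsub>R\<^esub>J\<in>Pow {..<n}. if {} = J then h (c {}) \<otimes>\<^bsub>R\<^esub> mon J else \<zero>\<^bsub>R\<^esub>)"
    unfolding c(2)
  proof (intro R.finsum_cong')
    fix J assume "J \<in> Pow {..<n}"
    then show "h (c J) \<otimes>\<^bsub>R\<^esub> mon J = (if {} = J then h (c {}) \<otimes>\<^bsub>R\<^esub> mon J else \<zero>\<^bsub>R\<^esub>)"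
      using c0[of _ J] by (cases "J = {}") auto
  qed (use cc in \<open>auto intro!: mon_closed R.m_closed\<close>)
  also have "\<dots> = h (c {}) \<otimes>\<^bsub>R\<^esub> mon {}"
    using cc by (intro R.finsum_singleton) (auto intro!: mon_closed R.m_closed)
  finally have "f = h (c {})" using cc by simp
  then show ?thesis using cc by blast
qed

text \<open>The constants and the coordinates generate the ring.\<close>

lemma derivation_vanishes:
  assumes closed: "\<And>f. f \<in> carrier R \<Longrightarrow> v f \<in> carrier R"
    and add: "\<And>f g. f \<in> carrier R \<Longrightarrow> g \<in> carrier R \<Longrightarrow> v (f \<oplus>\<^bsub>R\<^esub> g) = v f \<oplus>\<^bsub>R\<^esub> v g"
    and leibniz: "\<And>b f g. f \<in> gr R b \<Longrightarrow> g \<in> carrier R \<Longrightarrow> 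
      v (f \<otimes>\<^bsub>R\<^esub> g) = v f \<otimes>\<^bsub>R\<^esub> g \<oplus>\<^bsub>R\<^esub> sg R (a \<and> b) (f \<otimes>\<^bsub>R\<^esub> v g)"
    and const: "\<And>c. c \<in> carrier C \<Longrightarrow> v (h c) = \<zero>\<^bsub>R\<^esub>"
    and coords: "\<And>i. i < n \<Longrightarrow> v (t i) = \<zero>\<^bsub>R\<^esub>"
    and f: "f \<in> carrier R"
  shows "v f = \<zero>\<^bsub>R\<^esub>"
proof -
  have mult: "v (x \<otimes>\<^bsub>R\<^esub> y) = \<zero>\<^bsub>R\<^esub>" if "x \<in> gr R b" "y \<in> carrier R" "v x = \<zero>\<^bsub>R\<^esub>" "v y = \<zero>\<^bsub>R\<^esub>" for x y b
    using leibniz[OF that(1,2)] that by simp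
  have cmult: "v (h c \<otimes>\<^bsub>R\<^esub> y) = \<zero>\<^bsub>R\<^esub>" if "c \<in> carrier C" "y \<in> carrier R" "v y = \<zero>\<^bsub>R\<^esub>" for c y
    using that(1)
  proof (induction c rule: C.homogeneous_cases)
    case (add x1 x2)
    then show ?case using that assms(2) by (simp add: h_add R.l_distr)
  next
    case (gr x b)
    then show ?case using mult[OF h_gr[OF gr] that(2)] const that by simp
  qed
  have v1: "v \<one>\<^bsub>R\<^esub> = \<zero>\<^bsub>R\<^esub>" using const[of "\<one>\<^bsub>C\<^esub>"] by simp
  have mon: "set xs \<subseteq> {..<n} \<Longrightarrow> v (tprod xs) = \<zero>\<^bsub>R\<^esub>" for xs
  proof (induction xs)
    case (Cons x xs)
    then show ?case using mult[OF t_odd[of x] tprod_closed[of xs]] coords by auto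
  qed (simp add: v1)
  show ?thesis using order.refl sub_top[OF f]
  proof (induction f rule: sub_induct)
    case zero
    show ?case using const[of "\<zero>\<^bsub>C\<^esub>"] by simp
  next
    case (add f g)
    then show ?case using assms(2) sub_closed[OF order.refl] by simp
  next
    case (monomial c J)
    then show ?case using mon[of "sorted_list_of_set J"] finite_sub[of J] 
      by (intro cmult) (auto simp: mon_tprod[symmetric])
  qed
qed

end

text \<open>A homomorphism which respects constants and coordinates respects the splitting \<open>g + t\<^sub>i u\<close>. So the
  partial derivatives over different open sets form a vector field.\<close>

lemma partial_restrict:
  assumes "odd_coords C R h n t" "odd_coords C' R' h' n t'"
    and "superalg_hom C C' rC" "superalg_hom R R' r"
    and comm: "\<And>c. c \<in> carrier C \<Longrightarrow> r (h c) = h' (rC c)"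
    and coords: "\<And>i. i < n \<Longrightarrow> r (t i) = t' i"
    and i: "i < n" and f: "f \<in> carrier R"
  shows "r (odd_coords.partial C R h n t i f) = odd_coords.partial C' R' h' n t' i (r f)"
proof -
  interpret A: odd_coords C R h n t by fact
  interpret B: odd_coords C' R' h' n t' by fact
  interpret rC: superalg_hom C C' rC by fact
  interpret r: superalg_hom R R' r by fact
  have tp: "set xs \<subseteq> {..<n} \<Longrightarrow> r (A.tprod xs) = B.tprod xs" for xs
  proof (induction xs)
    case (Cons x xs)
    then show ?case using coords A.tprod_closed[of xs] by (auto simp: r.h_mult)
  qed auto
  have sub: "r g \<in> B.sub K" if K: "K \<subseteq> {..<n}" and "g \<in> A.sub K" for K g
    using that
  proof (induction g rule: A.sub_induct)
    case (monomial a J)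
    then have J: "J \<subseteq> {..<n}" using K by auto
    have "r (A.mon J) = B.mon J" using tp[of "sorted_list_of_set J"] A.finite_sub[OF J] J 
      by (simp add: A.mon_tprod B.mon_tprod)
    then have "r (h a \<otimes>\<^bsub>R\<^esub> A.mon J) = h' (rC a) \<otimes>\<^bsub>R'\<^esub> B.mon J"
      using monomial comm J by (simp add: r.h_mult)
    then show ?case using B.sub_term[OF K] monomial by simp
  qed (use K A.sub_closed[OF K] in \<open>auto simp: r.h_add B.sub_zero intro: B.sub_add\<close>)
  obtain g u where gu: "g \<in> A.rest i" "u \<in> A.rest i" "f = g \<oplus>\<^bsub>R\<^esub> t i \<otimes>\<^bsub>R\<^esub> u"
    using A.split_exists[OF i f] by auto
  then have "r f = r g \<oplus>\<^bsub>R'\<^esub> t' i \<otimes>\<^bsub>R'\<^esub> r u"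
    using A.rest_closed i coords by (simp add: r.h_add r.h_mult)
  then show ?thesis using gu i sub[of "{..<n} - {i}"] by (simp add: A.partial_eq B.partial_eq)
qed

section \<open>Non-abelian cohomology of a presheaf of groups\<close>

lemma (in group) conj_flip:
  assumes "c \<in> carrier G" "h \<in> carrier G" "g \<in> carrier G" "d \<in> carrier G" "c \<otimes> h = g \<otimes> d"
  shows "inv c \<otimes> g = h \<otimes> inv d"
proof -
  have "h = inv c \<otimes> (g \<otimes> d)" using assms by (metis inv_solve_left m_closed)
  then show ?thesis using assms by (simp add: m_assoc)
qed

locale group_presheaf =
  fixes T :: "'x topology" and G :: "'x set \<Rightarrow> 'g monoid" and r :: "'x set \<Rightarrow> 'x set \<Rightarrow> 'g \<Rightarrow> 'g"
  assumes grp: "openin T U \<Longrightarrow> group (G U)"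
    and r_hom: "openin T U \<Longrightarrow> openin T V \<Longrightarrow> V \<subseteq> U \<Longrightarrow> r U V \<in> hom (G U) (G V)"
    and r_r: "openin T U \<Longrightarrow> openin T V \<Longrightarrow> V \<subseteq> U \<Longrightarrow> openin T V' \<Longrightarrow> V' \<subseteq> V \<Longrightarrow>
      g \<in> carrier (G U) \<Longrightarrow> r V V' (r U V g) = r U V' g"
begin

lemma r_closed: "openin T U \<Longrightarrow> openin T V \<Longrightarrow> V \<subseteq> U \<Longrightarrow> g \<in> carrier (G U) \<Longrightarrow> r U V g \<in> carrier (G V)"
  using r_hom hom_in_carrier by metis

lemma r_mult: "openin T U \<Longrightarrow> openin T V \<Longrightarrow> V \<subseteq> U \<Longrightarrow> g \<in> carrier (G U) \<Longrightarrow> h \<in> carrier (G U) \<Longrightarrow>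
   r U V (g \<otimes>\<^bsub>G U\<^esub> h) = r U V g \<otimes>\<^bsub>G V\<^esub> r U V h"
  using r_hom hom_mult by metis

lemma r_one: "openin T U \<Longrightarrow> openin T V \<Longrightarrow> V \<subseteq> U \<Longrightarrow> r U V \<one>\<^bsub>G U\<^esub> = \<one>\<^bsub>G V\<^esub>"
  using r_hom grp hom_one by metis

lemma r_inv: "openin T U \<Longrightarrow> openin T V \<Longrightarrow> V \<subseteq> U \<Longrightarrow> g \<in> carrier (G U) \<Longrightarrow> 
   r U V (inv\<^bsub>G U\<^esub> g) = inv\<^bsub>G V\<^esub> r U V g"
  using group_hom.hom_inv[of "G U" "G V" "r U V" g] r_hom grp 
  by (simp add: group_hom_def group_hom_axioms_def)

lemma cocyclesD:
  assumes "(U, g) \<in> cocycles T G r" "x \<in> topspace T" "y \<in> topspace T"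
  shows "openin T (U x)" "x \<in> U x" "g x y \<in> carrier (G (U x \<inter> U y))"
  using assms by (auto simp: cocycles_def point_cover_def)

lemma cocycle_restrict:
  assumes c: "(U, g) \<in> cocycles T G r" "x \<in> topspace T" "y \<in> topspace T" "z \<in> topspace T"
    and K: "openin T K" "K \<subseteq> U x" "K \<subseteq> U y" "K \<subseteq> U z"
  shows "r (U x \<inter> U y) K (g x y) \<otimes>\<^bsub>G K\<^esub> r (U y \<inter> U z) K (g y z) = r (U x \<inter> U z) K (g x z)"
proof -
  let ?V = "U x \<inter> U y \<inter> U z"
  have o: "openin T (U x)" "openin T (U y)" "openin T (U z)" using cocyclesD c by blast+
  have g: "g x y \<in> carrier (G (U x \<inter> U y))" "g y z \<in> carrier (G (U y \<inter> U z))" "g x z \<in> carrier (G (U x \<inter> U z))"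
    using cocyclesD c by blast+
  have "r (U x \<inter> U y) ?V (g x y) \<otimes>\<^bsub>G ?V\<^esub> r (U y \<inter> U z) ?V (g y z) = r (U x \<inter> U z) ?V (g x z)"
    using c by (auto simp: cocycles_def Let_def)
  then have "r ?V K (r (U x \<inter> U y) ?V (g x y) \<otimes>\<^bsub>G ?V\<^esub> r (U y \<inter> U z) ?V (g y z)) 
      = r ?V K (r (U x \<inter> U z) ?V (g x z))" by simp
  moreover have "r ?V K (r (U x \<inter> U y) ?V (g x y) \<otimes>\<^bsub>G ?V\<^esub> r (U y \<inter> U z) ?V (g y z))
    = r ?V K (r (U x \<inter> U y) ?V (g x y)) \<otimes>\<^bsub>G K\<^esub> r ?V K (r (U y \<inter> U z) ?V (g y z))"
    using o K g by (intro r_mult r_closed) (auto intro!: openin_Int)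
  moreover have "r ?V K (r (U x \<inter> U y) ?V (g x y)) = r (U x \<inter> U y) K (g x y)"
    using o K g by (intro r_r) (auto intro!: openin_Int)
  moreover have "r ?V K (r (U y \<inter> U z) ?V (g y z)) = r (U y \<inter> U z) K (g y z)"
    using o K g by (intro r_r) (auto intro!: openin_Int)
  moreover have "r ?V K (r (U x \<inter> U z) ?V (g x z)) = r (U x \<inter> U z) K (g x z)"
    using o K g by (intro r_r) (auto intro!: openin_Int)
  ultimately show ?thesis by simp
qed

lemma cohomologousI:
  assumes "(U, g) \<in> cocycles T G r" "(V, h) \<in> cocycles T G r" "point_cover T N"
    and "\<And>x. x \<in> topspace T \<Longrightarrow> \<rho> x \<in> topspace T \<and> \<tau> x \<in> topspace T \<and>
         N x \<subseteq> U (\<rho> x) \<and> N x \<subseteq> V (\<tau> x) \<and> c x \<in> carrier (G (N x))"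
    and "\<And>x y K. x \<in> topspace T \<Longrightarrow> y \<in> topspace T \<Longrightarrow> K = N x \<inter> N y \<Longrightarrow> openin T K \<Longrightarrow>
         r (N x) K (c x) \<otimes>\<^bsub>G K\<^esub> r (V (\<tau> x) \<inter> V (\<tau> y)) K (h (\<tau> x) (\<tau> y)) =
         r (U (\<rho> x) \<inter> U (\<rho> y)) K (g (\<rho> x) (\<rho> y)) \<otimes>\<^bsub>G K\<^esub> r (N y) K (c y)"
  shows "((U, g), (V, h)) \<in> cohomologous T G r"
proof -
  have op: "openin T (N x \<inter> N y)" if "x \<in> topspace T" "y \<in> topspace T" for x y
    using assms(3) that by (auto simp: point_cover_def)
  have A: "\<forall>x\<in>topspace T. \<rho> x \<in> topspace T \<and> \<tau> x \<in> topspace T \<and>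
         N x \<subseteq> U (\<rho> x) \<and> N x \<subseteq> V (\<tau> x) \<and> c x \<in> carrier (G (N x))"
    using assms(4) by (rule ballI)
  have B: "\<forall>x\<in>topspace T. \<forall>y\<in>topspace T.
         r (N x) (N x \<inter> N y) (c x) \<otimes>\<^bsub>G (N x \<inter> N y)\<^esub> r (V (\<tau> x) \<inter> V (\<tau> y)) (N x \<inter> N y) (h (\<tau> x) (\<tau> y)) =
         r (U (\<rho> x) \<inter> U (\<rho> y)) (N x \<inter> N y) (g (\<rho> x) (\<rho> y)) \<otimes>\<^bsub>G (N x \<inter> N y)\<^esub> r (N y) (N x \<inter> N y) (c y)"
    using assms(5)[OF _ _ refl op] by (intro ballI)
  show ?thesis unfolding cohomologous_def Let_def mem_Collect_eq prod.case
    by (intro conjI assms(1,2), rule exI[of _ N], rule exI[of _ \<rho>], rule exI[of _ \<tau>], rule exI[of _ c])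
      (intro conjI assms(3) A B)
qed

lemma cohomologousE:
  assumes "((U, g), (V, h)) \<in> cohomologous T G r"
  obtains N \<rho> \<tau> c where "(U, g) \<in> cocycles T G r" "(V, h) \<in> cocycles T G r" "point_cover T N"
    and "\<And>x. x \<in> topspace T \<Longrightarrow> \<rho> x \<in> topspace T \<and> \<tau> x \<in> topspace T \<and>
         N x \<subseteq> U (\<rho> x) \<and> N x \<subseteq> V (\<tau> x) \<and> c x \<in> carrier (G (N x))"
    and "\<And>x y. x \<in> topspace T \<Longrightarrow> y \<in> topspace T \<Longrightarrow> 
         r (N x) (N x \<inter> N y) (c x) \<otimes>\<^bsub>G (N x \<inter> N y)\<^esub> r (V (\<tau> x) \<inter> V (\<tau> y)) (N x \<inter> N y) (h (\<tau> x) (\<tau> y)) =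
         r (U (\<rho> x) \<inter> U (\<rho> y)) (N x \<inter> N y) (g (\<rho> x) (\<rho> y)) \<otimes>\<^bsub>G (N x \<inter> N y)\<^esub> r (N y) (N x \<inter> N y) (c y)"
proof -
  from assms obtain N \<rho> \<tau> c where "(U, g) \<in> cocycles T G r" "(V, h) \<in> cocycles T G r" "point_cover T N"
    and "\<forall>x\<in>topspace T. \<rho> x \<in> topspace T \<and> \<tau> x \<in> topspace T \<and>
         N x \<subseteq> U (\<rho> x) \<and> N x \<subseteq> V (\<tau> x) \<and> c x \<in> carrier (G (N x))"
    and "\<forall>x\<in>topspace T. \<forall>y\<in>topspace T.
         r (N x) (N x \<inter> N y) (c x) \<otimes>\<^bsub>G (N x \<inter> N y)\<^esub> r (V (\<tau> x) \<inter> V (\<tau> y)) (N x \<inter> N y) (h (\<tau> x) (\<tau> y)) =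
         r (U (\<rho> x) \<inter> U (\<rho> y)) (N x \<inter> N y) (g (\<rho> x) (\<rho> y)) \<otimes>\<^bsub>G (N x \<inter> N y)\<^esub> r (N y) (N x \<inter> N y) (c y)"
    unfolding cohomologous_def Let_def by auto
  then show thesis by (intro that[of N \<rho> \<tau> c]) blast+
qed

lemma cohomologous_refl: 
  assumes "(U, g) \<in> cocycles T G r" shows "((U, g), (U, g)) \<in> cohomologous T G r"
proof (rule cohomologousI[OF assms assms, of U "\<lambda>x. x" "\<lambda>x. x" "\<lambda>x. \<one>\<^bsub>G (U x)\<^esub>"])
  show "point_cover T U" using assms by (auto simp: cocycles_def)
  fix x assume x: "x \<in> topspace T"
  show "x \<in> topspace T \<and> x \<in> topspace T \<and> U x \<subseteq> U x \<and> U x \<subseteq> U x \<and> \<one>\<^bsub>G (U x)\<^esub> \<in> carrier (G (U x))"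
    using x grp[OF cocyclesD(1)[OF assms x x]] by (auto simp: group.is_monoid monoid.one_closed)
next
  fix x y K assume xy: "x \<in> topspace T" "y \<in> topspace T" and K: "K = U x \<inter> U y" "openin T K"
  interpret K: group "G K" by (rule grp[OF K(2)])
  have o: "openin T (U x)" "openin T (U y)" using cocyclesD[OF assms] xy by blast+
  have "r (U x \<inter> U y) K (g x y) \<in> carrier (G K)"
    using K o xy by (intro r_closed cocyclesD[OF assms]) auto
  moreover have "r (U x) K \<one>\<^bsub>G (U x)\<^esub> = \<one>\<^bsub>G K\<^esub>" "r (U y) K \<one>\<^bsub>G (U y)\<^esub> = \<one>\<^bsub>G K\<^esub>"
    using K o by (auto intro!: r_one)
  ultimately show "r (U x) K \<one>\<^bsub>G (U x)\<^esub> \<otimes>\<^bsub>G K\<^esub> r (U x \<inter> U y) K (g x y) =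
      r (U x \<inter> U y) K (g x y) \<otimes>\<^bsub>G K\<^esub> r (U y) K \<one>\<^bsub>G (U y)\<^esub>"
    by simp
qed

lemma cohomologous_sym: 
  assumes "((U, g), (V, h)) \<in> cohomologous T G r" shows "((V, h), (U, g)) \<in> cohomologous T G r"
  using assms
proof (rule cohomologousE)
  fix N \<rho> \<tau> c
  assume c1: "(U, g) \<in> cocycles T G r" and c2: "(V, h) \<in> cocycles T G r" and N: "point_cover T N"
    and m: "\<And>x. x \<in> topspace T \<Longrightarrow> \<rho> x \<in> topspace T \<and> \<tau> x \<in> topspace T \<and>
         N x \<subseteq> U (\<rho> x) \<and> N x \<subseteq> V (\<tau> x) \<and> c x \<in> carrier (G (N x))"
    and eq: "\<And>x y. x \<in> topspace T \<Longrightarrow> y \<in> topspace T \<Longrightarrow> 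
         r (N x) (N x \<inter> N y) (c x) \<otimes>\<^bsub>G (N x \<inter> N y)\<^esub> r (V (\<tau> x) \<inter> V (\<tau> y)) (N x \<inter> N y) (h (\<tau> x) (\<tau> y)) =
         r (U (\<rho> x) \<inter> U (\<rho> y)) (N x \<inter> N y) (g (\<rho> x) (\<rho> y)) \<otimes>\<^bsub>G (N x \<inter> N y)\<^esub> r (N y) (N x \<inter> N y) (c y)"
  have oN: "openin T (N x)" if "x \<in> topspace T" for x using N that by (auto simp: point_cover_def)
  show "((V, h), (U, g)) \<in> cohomologous T G r"
  proof (rule cohomologousI[OF c2 c1 N, of \<tau> \<rho> "\<lambda>x. inv\<^bsub>G (N x)\<^esub> c x"])
    fix x assume x: "x \<in> topspace T"
    show "\<tau> x \<in> topspace T \<and> \<rho> x \<in> topspace T \<and> N x \<subseteq> V (\<tau> x) \<and> N x \<subseteq> U (\<rho> x) \<and> 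
        inv\<^bsub>G (N x)\<^esub> c x \<in> carrier (G (N x))"
      using m[OF x] group.inv_closed[OF grp[OF oN[OF x]]] by blast
  next
    fix x y K assume xy: "x \<in> topspace T" "y \<in> topspace T" and K: "K = N x \<inter> N y" "openin T K"
    interpret K: group "G K" by (rule grp[OF K(2)])
    note mx = m[OF xy(1)] and my = m[OF xy(2)]
    have o: "openin T (U (\<rho> x))" "openin T (U (\<rho> y))" "openin T (V (\<tau> x))" "openin T (V (\<tau> y))" 
      using cocyclesD[OF c1] cocyclesD[OF c2] mx my by blast+
    have "inv\<^bsub>G K\<^esub> r (N x) K (c x) \<otimes>\<^bsub>G K\<^esub> r (U (\<rho> x) \<inter> U (\<rho> y)) K (g (\<rho> x) (\<rho> y)) 
      = r (V (\<tau> x) \<inter> V (\<tau> y)) K (h (\<tau> x) (\<tau> y)) \<otimes>\<^bsub>G K\<^esub> inv\<^bsub>G K\<^esub> r (N y) K (c y)"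
    proof (rule K.conj_flip)
      show "r (N x) K (c x) \<in> carrier (G K)" "r (N y) K (c y) \<in> carrier (G K)"
        using K mx my oN xy by (auto intro!: r_closed)
      show "r (V (\<tau> x) \<inter> V (\<tau> y)) K (h (\<tau> x) (\<tau> y)) \<in> carrier (G K)"
        using K mx my o by (intro r_closed cocyclesD[OF c2]) auto
      show "r (U (\<rho> x) \<inter> U (\<rho> y)) K (g (\<rho> x) (\<rho> y)) \<in> carrier (G K)"
        using K mx my o by (intro r_closed cocyclesD[OF c1]) auto
    qed (use eq[OF xy] K in simp)
    then show "r (N x) K (inv\<^bsub>G (N x)\<^esub> c x) \<otimes>\<^bsub>G K\<^esub> r (U (\<rho> x) \<inter> U (\<rho> y)) K (g (\<rho> x) (\<rho> y)) =
      r (V (\<tau> x) \<inter> V (\<tau> y)) K (h (\<tau> x) (\<tau> y)) \<otimes>\<^bsub>G K\<^esub> r (N y) K (inv\<^bsub>G (N y)\<^esub> c y)"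
      using r_inv[OF oN[OF xy(1)] K(2), of "c x"] r_inv[OF oN[OF xy(2)] K(2), of "c y"] mx my K(1) by auto
  qed
qed

text \<open>Both refinements map into the middle cover, in general to different members, so that a value
  of the middle cocycle itself appears between the two cochains.\<close>

lemma cohomologous_trans: 
  assumes "((U, g), (V, h)) \<in> cohomologous T G r" and "((V, h), (W, k)) \<in> cohomologous T G r"
  shows "((U, g), (W, k)) \<in> cohomologous T G r"
proof -
  obtain N \<rho> \<tau> c where c1: "(U, g) \<in> cocycles T G r" and c2: "(V, h) \<in> cocycles T G r" and N: "point_cover T N"
    and m: "\<And>x. x \<in> topspace T \<Longrightarrow> \<rho> x \<in> topspace T \<and> \<tau> x \<in> topspace T \<and>
         N x \<subseteq> U (\<rho> x) \<and> N x \<subseteq> V (\<tau> x) \<and> c x \<in> carrier (G (N x))"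
    and eq: "\<And>x y. x \<in> topspace T \<Longrightarrow> y \<in> topspace T \<Longrightarrow> 
         r (N x) (N x \<inter> N y) (c x) \<otimes>\<^bsub>G (N x \<inter> N y)\<^esub> r (V (\<tau> x) \<inter> V (\<tau> y)) (N x \<inter> N y) (h (\<tau> x) (\<tau> y)) =
         r (U (\<rho> x) \<inter> U (\<rho> y)) (N x \<inter> N y) (g (\<rho> x) (\<rho> y)) \<otimes>\<^bsub>G (N x \<inter> N y)\<^esub> r (N y) (N x \<inter> N y) (c y)"
    using cohomologousE[OF assms(1)] by metis
  obtain N' \<rho>' \<tau>' d where c3: "(W, k) \<in> cocycles T G r" and N': "point_cover T N'"
    and m': "\<And>x. x \<in> topspace T \<Longrightarrow> \<rho>' x \<in> topspace T \<and> \<tau>' x \<in> topspace T \<and>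
         N' x \<subseteq> V (\<rho>' x) \<and> N' x \<subseteq> W (\<tau>' x) \<and> d x \<in> carrier (G (N' x))"
    and eq': "\<And>x y. x \<in> topspace T \<Longrightarrow> y \<in> topspace T \<Longrightarrow> 
         r (N' x) (N' x \<inter> N' y) (d x) \<otimes>\<^bsub>G (N' x \<inter> N' y)\<^esub> r (W (\<tau>' x) \<inter> W (\<tau>' y)) (N' x \<inter> N' y) (k (\<tau>' x) (\<tau>' y)) =
         r (V (\<rho>' x) \<inter> V (\<rho>' y)) (N' x \<inter> N' y) (h (\<rho>' x) (\<rho>' y)) \<otimes>\<^bsub>G (N' x \<inter> N' y)\<^esub> r (N' y) (N' x \<inter> N' y) (d y)"
    using cohomologousE[OF assms(2)] by metis
  define M where "M x = N x \<inter> N' x" for x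
  \<comment> \<open>\<open>c\<close> leads from \<open>g\<close> to \<open>h\<close> at \<open>\<tau> x\<close>, and \<open>d\<close> leads from \<open>h\<close> at \<open>\<rho>' x\<close> to \<open>k\<close>\<close>
  define e where "e x = (r (N x) (M x) (c x) \<otimes>\<^bsub>G (M x)\<^esub> r (V (\<tau> x) \<inter> V (\<rho>' x)) (M x) (h (\<tau> x) (\<rho>' x))) 
      \<otimes>\<^bsub>G (M x)\<^esub> r (N' x) (M x) (d x)" for x
  have oN: "openin T (N x)" "openin T (N' x)" "openin T (M x)" if "x \<in> topspace T" for x 
    using N N' that by (auto simp: point_cover_def M_def)
  have pc: "point_cover T M" using N N' by (auto simp: point_cover_def M_def)
  have oV: "openin T (U (\<rho> x))" "openin T (V (\<tau> x))" "openin T (V (\<rho>' x))" "openin T (W (\<tau>' x))"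
    if "x \<in> topspace T" for x 
    using cocyclesD(1)[OF c1] cocyclesD(1)[OF c2] cocyclesD(1)[OF c3] m[OF that] m'[OF that] by blast+
  have eres: "r (M x) K (e x) = (r (N x) K (c x) \<otimes>\<^bsub>G K\<^esub> r (V (\<tau> x) \<inter> V (\<rho>' x)) K (h (\<tau> x) (\<rho>' x))) 
      \<otimes>\<^bsub>G K\<^esub> r (N' x) K (d x)" 
    and ein: "e x \<in> carrier (G (M x))"
    and cl: "r (N x) K (c x) \<in> carrier (G K)" "r (N' x) K (d x) \<in> carrier (G K)"
      "r (V (\<tau> x) \<inter> V (\<rho>' x)) K (h (\<tau> x) (\<rho>' x)) \<in> carrier (G K)"
    if x: "x \<in> topspace T" and K: "openin T K" "K \<subseteq> M x" for x K
  proof -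
    interpret M: group "G (M x)" by (rule grp[OF oN(3)[OF x]])
    have h: "h (\<tau> x) (\<rho>' x) \<in> carrier (G (V (\<tau> x) \<inter> V (\<rho>' x)))"
      using m[OF x] m'[OF x] cocyclesD[OF c2] by blast
    have sub: "M x \<subseteq> N x" "M x \<subseteq> N' x" "M x \<subseteq> V (\<tau> x) \<inter> V (\<rho>' x)"
      using m[OF x] m'[OF x] by (auto simp: M_def)
    have oVV: "openin T (V (\<tau> x) \<inter> V (\<rho>' x))" using oV[OF x] by auto
    have cM: "r (N x) (M x) (c x) \<in> carrier (G (M x))" "r (N' x) (M x) (d x) \<in> carrier (G (M x))"
      "r (V (\<tau> x) \<inter> V (\<rho>' x)) (M x) (h (\<tau> x) (\<rho>' x)) \<in> carrier (G (M x))"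
      using m[OF x] m'[OF x] h sub oN[OF x] oVV by (auto intro!: r_closed)
    show "r (N x) K (c x) \<in> carrier (G K)" "r (N' x) K (d x) \<in> carrier (G K)"
      "r (V (\<tau> x) \<inter> V (\<rho>' x)) K (h (\<tau> x) (\<rho>' x)) \<in> carrier (G K)"
      using m[OF x] m'[OF x] h sub oN[OF x] oVV K by (auto intro!: r_closed)
    show "e x \<in> carrier (G (M x))" unfolding e_def using cM by simp
    show "r (M x) K (e x) = (r (N x) K (c x) \<otimes>\<^bsub>G K\<^esub> r (V (\<tau> x) \<inter> V (\<rho>' x)) K (h (\<tau> x) (\<rho>' x))) 
      \<otimes>\<^bsub>G K\<^esub> r (N' x) K (d x)"
      unfolding e_def using cM K m[OF x] m'[OF x] h
      by (simp add: r_mult[OF oN(3)[OF x]] r_r[OF oN(1)[OF x] oN(3)[OF x] sub(1)] 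
          r_r[OF oN(2)[OF x] oN(3)[OF x] sub(2)] r_r[OF oVV oN(3)[OF x] sub(3)])
  qed
  show ?thesis
  proof (rule cohomologousI[OF c1 c3 pc, of \<rho> \<tau>' e])
    fix x assume x: "x \<in> topspace T"
    then show "\<rho> x \<in> topspace T \<and> \<tau>' x \<in> topspace T \<and> M x \<subseteq> U (\<rho> x) \<and> M x \<subseteq> W (\<tau>' x) \<and> e x \<in> carrier (G (M x))"
      using m[OF x] m'[OF x] ein[OF x oN(3)[OF x]] by (auto simp: M_def)
  next
    fix x y K assume xy: "x \<in> topspace T" "y \<in> topspace T" and K: "K = M x \<inter> M y" "openin T K"
    interpret K: group "G K" by (rule grp[OF K(2)])
    note mx = m[OF xy(1)] and my = m[OF xy(2)] and mx' = m'[OF xy(1)] and my' = m'[OF xy(2)]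
    have Ks: "K \<subseteq> M x" "K \<subseteq> M y" "K \<subseteq> N x \<inter> N y" "K \<subseteq> N' x \<inter> N' y" using K by (auto simp: M_def)
    have KV: "K \<subseteq> V (\<tau> x)" "K \<subseteq> V (\<tau> y)" "K \<subseteq> V (\<rho>' x)" "K \<subseteq> V (\<rho>' y)" "K \<subseteq> U (\<rho> x)" "K \<subseteq> U (\<rho> y)"
      "K \<subseteq> W (\<tau>' x)" "K \<subseteq> W (\<tau>' y)"
      using Ks(3,4) mx my mx' my' by (metis Int_subset_iff order_trans)+
    note clx = cl[OF xy(1) K(2) Ks(1)] and cly = cl[OF xy(2) K(2) Ks(2)]
    have hcl: "r (V a \<inter> V b) K (h a b) \<in> carrier (G K)" 
      if "a \<in> topspace T" "b \<in> topspace T" "K \<subseteq> V a" "K \<subseteq> V b" for a b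
      using that K cocyclesD[OF c2] by (intro r_closed) auto
    have gcl: "r (U (\<rho> x) \<inter> U (\<rho> y)) K (g (\<rho> x) (\<rho> y)) \<in> carrier (G K)"
      using mx my KV K cocyclesD[OF c1] by (intro r_closed) auto
    have kcl: "r (W (\<tau>' x) \<inter> W (\<tau>' y)) K (k (\<tau>' x) (\<tau>' y)) \<in> carrier (G K)"
      using mx' my' KV K cocyclesD[OF c3] by (intro r_closed) auto
    note hc = cocycle_restrict[OF c2 _ _ _ K(2)]
    have E1: "r (N x) K (c x) \<otimes>\<^bsub>G K\<^esub> r (V (\<tau> x) \<inter> V (\<tau> y)) K (h (\<tau> x) (\<tau> y)) =
         r (U (\<rho> x) \<inter> U (\<rho> y)) K (g (\<rho> x) (\<rho> y)) \<otimes>\<^bsub>G K\<^esub> r (N y) K (c y)"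
    proof -
      let ?L = "N x \<inter> N y"
      have oL: "openin T ?L" using oN xy by auto
      have s: "?L \<subseteq> N x" "?L \<subseteq> N y" "?L \<subseteq> V (\<tau> x) \<inter> V (\<tau> y)" "?L \<subseteq> U (\<rho> x) \<inter> U (\<rho> y)" using mx my by auto
      have o: "openin T (V (\<tau> x) \<inter> V (\<tau> y))" "openin T (U (\<rho> x) \<inter> U (\<rho> y))" using oV xy by auto
      have i: "h (\<tau> x) (\<tau> y) \<in> carrier (G (V (\<tau> x) \<inter> V (\<tau> y)))" "g (\<rho> x) (\<rho> y) \<in> carrier (G (U (\<rho> x) \<inter> U (\<rho> y)))"
        using cocyclesD(3)[OF c1] cocyclesD(3)[OF c2] mx my by blast+
      show ?thesis
        using arg_cong[OF eq[OF xy], of "r ?L K"] mx my i s o oL K(2) Ks(3) oN[OF xy(1)] oN[OF xy(2)]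
        by (simp add: r_mult r_closed r_r)
    qed
    have E2: "r (N' x) K (d x) \<otimes>\<^bsub>G K\<^esub> r (W (\<tau>' x) \<inter> W (\<tau>' y)) K (k (\<tau>' x) (\<tau>' y)) =
         r (V (\<rho>' x) \<inter> V (\<rho>' y)) K (h (\<rho>' x) (\<rho>' y)) \<otimes>\<^bsub>G K\<^esub> r (N' y) K (d y)"
    proof -
      let ?L = "N' x \<inter> N' y"
      have oL: "openin T ?L" using oN xy by auto
      have s: "?L \<subseteq> N' x" "?L \<subseteq> N' y" "?L \<subseteq> W (\<tau>' x) \<inter> W (\<tau>' y)" "?L \<subseteq> V (\<rho>' x) \<inter> V (\<rho>' y)" using mx' my' by auto
      have o: "openin T (W (\<tau>' x) \<inter> W (\<tau>' y))" "openin T (V (\<rho>' x) \<inter> V (\<rho>' y))" using oV xy by auto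
      have i: "k (\<tau>' x) (\<tau>' y) \<in> carrier (G (W (\<tau>' x) \<inter> W (\<tau>' y)))" "h (\<rho>' x) (\<rho>' y) \<in> carrier (G (V (\<rho>' x) \<inter> V (\<rho>' y)))"
        using cocyclesD(3)[OF c2] cocyclesD(3)[OF c3] mx' my' by blast+
      show ?thesis
        using arg_cong[OF eq'[OF xy], of "r ?L K"] mx' my' i s o oL K(2) Ks(4) oN[OF xy(1)] oN[OF xy(2)]
        by (simp add: r_mult r_closed r_r)
    qed
    have t: "\<tau> x \<in> topspace T" "\<tau> y \<in> topspace T" "\<rho>' x \<in> topspace T" "\<rho>' y \<in> topspace T"
      using mx my mx' my' by auto
    let ?h = "\<lambda>a b. r (V a \<inter> V b) K (h a b)"
    let ?cx = "r (N x) K (c x)" and ?dx = "r (N' x) K (d x)" and ?cy = "r (N y) K (c y)" and ?dy = "r (N' y) K (d y)"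
    let ?k = "r (W (\<tau>' x) \<inter> W (\<tau>' y)) K (k (\<tau>' x) (\<tau>' y))" and ?g = "r (U (\<rho> x) \<inter> U (\<rho> y)) K (g (\<rho> x) (\<rho> y))"
    note H = hcl[OF t(1) t(2) KV(1) KV(2)] hcl[OF t(1) t(3) KV(1) KV(3)] hcl[OF t(1) t(4) KV(1) KV(4)]
      hcl[OF t(2) t(4) KV(2) KV(4)] hcl[OF t(3) t(4) KV(3) KV(4)]
    have "r (M x) K (e x) \<otimes>\<^bsub>G K\<^esub> ?k = (?cx \<otimes>\<^bsub>G K\<^esub> ?h (\<tau> x) (\<rho>' x)) \<otimes>\<^bsub>G K\<^esub> (?dx \<otimes>\<^bsub>G K\<^esub> ?k)"
      using eres[OF xy(1) K(2) Ks(1)] clx kcl by (simp add: K.m_assoc)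
    also have "\<dots> = ?cx \<otimes>\<^bsub>G K\<^esub> (?h (\<tau> x) (\<rho>' x) \<otimes>\<^bsub>G K\<^esub> ?h (\<rho>' x) (\<rho>' y)) \<otimes>\<^bsub>G K\<^esub> ?dy"
      unfolding E2 using clx cly H by (simp add: K.m_assoc)
    also have "?h (\<tau> x) (\<rho>' x) \<otimes>\<^bsub>G K\<^esub> ?h (\<rho>' x) (\<rho>' y) = ?h (\<tau> x) (\<tau> y) \<otimes>\<^bsub>G K\<^esub> ?h (\<tau> y) (\<rho>' y)"
      using hc[OF t(1) t(3) t(4)] hc[OF t(1) t(2) t(4)] KV by simp
    also have "?cx \<otimes>\<^bsub>G K\<^esub> (?h (\<tau> x) (\<tau> y) \<otimes>\<^bsub>G K\<^esub> ?h (\<tau> y) (\<rho>' y)) \<otimes>\<^bsub>G K\<^esub> ?dy 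
        = (?cx \<otimes>\<^bsub>G K\<^esub> ?h (\<tau> x) (\<tau> y)) \<otimes>\<^bsub>G K\<^esub> ?h (\<tau> y) (\<rho>' y) \<otimes>\<^bsub>G K\<^esub> ?dy"
      using clx cly H by (simp add: K.m_assoc)
    also have "\<dots> = ?g \<otimes>\<^bsub>G K\<^esub> r (M y) K (e y)"
      unfolding E1 using eres[OF xy(2) K(2) Ks(2)] gcl cly H by (simp add: K.m_assoc)
    finally show "r (M x) K (e x) \<otimes>\<^bsub>G K\<^esub> ?k = ?g \<otimes>\<^bsub>G K\<^esub> r (M y) K (e y)" .
  qed
qed

lemma cohomologous_equiv: "equiv (cocycles T G r) (cohomologous T G r)"
proof (rule equivI)
  show "refl_on (cocycles T G r) (cohomologous T G r)"
    using cohomologous_refl by (auto simp: refl_on_def)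
  show "sym (cohomologous T G r)"
    by (rule symI) (metis cohomologous_sym surj_pair)
  show "trans (cohomologous T G r)"
    by (rule transI) (metis cohomologous_trans surj_pair)
qed (auto simp: cohomologous_def)

text \<open>A construction that depends on choices defines a cohomology class if the cocycles obtained from any
  two choices are cohomologous and some choice exists.\<close>

lemma class_of_choices:
  assumes "s \<in> S" "S \<subseteq> cocycles T G r" "\<And>a b. a \<in> S \<Longrightarrow> b \<in> S \<Longrightarrow> (a, b) \<in> cohomologous T G r"
  shows "cohomologous T G r `` S = cohomologous T G r `` {s}" "cohomologous T G r `` S \<in> H1 T G r"
proof -
  show eq: "cohomologous T G r `` S = cohomologous T G r `` {s}"
  proof
    have "trans (cohomologous T G r)" using cohomologous_equiv by (auto elim: equivE)
    then have "(s, t) \<in> cohomologous T G r" if "(a, t) \<in> cohomologous T G r" "a \<in> S" for a t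
      using that assms(1,3) by (meson transD)
    then show "cohomologous T G r `` S \<subseteq> cohomologous T G r `` {s}" by blast
  qed (use assms(1) in blast)
  show "cohomologous T G r `` S \<in> H1 T G r" 
    unfolding eq H1_def using assms by (auto intro!: quotientI)
qed

end

section \<open>Superspaces\<close>

locale sspace =
  fixes \<Lambda> :: "'l base_alg" and X :: "('x, 'a, 'l) superspace"
  assumes base: "nilpotent_extension \<Lambda>" and space: "superspace \<Lambda> X"
begin

abbreviation op :: "'x set \<Rightarrow> bool" where "op U \<equiv> openin (tsp X) U"
abbreviation sc :: "'x set \<Rightarrow> 'a set" where "sc U \<equiv> carrier (sec X U)"

lemma sub_open_iff [simp]: "sub_open (tsp X) V U \<longleftrightarrow> op V \<and> V \<subseteq> U"
  by (simp add: sub_open_def)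

lemma sec_superring: "op U \<Longrightarrow> superring (sec X U)"
  using space by (simp add: superspace_def)

lemma res_sring_hom: "op U \<Longrightarrow> op V \<Longrightarrow> V \<subseteq> U \<Longrightarrow> res X U V \<in> sring_hom (sec X U) (sec X V)"
  using space by (simp add: superspace_def sub_open_def)

lemma base_half: "\<exists>h\<in>carrier \<Lambda>. h \<oplus>\<^bsub>\<Lambda>\<^esub> h = \<one>\<^bsub>\<Lambda>\<^esub>"
proof (rule bexI)
  have h: "cst \<Lambda> \<in> ring_hom complex_ring \<Lambda>" using base by (simp add: nilpotent_extension_def)
  show "cst \<Lambda> (1/2) \<oplus>\<^bsub>\<Lambda>\<^esub> cst \<Lambda> (1/2) = \<one>\<^bsub>\<Lambda>\<^esub>"
    using ring_hom_add[OF h, of "1/2" "1/2"] ring_hom_one[OF h] by (simp add: complex_ring_def)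
  show "cst \<Lambda> (1/2) \<in> carrier \<Lambda>"
    using ring_hom_closed[OF h, of "1/2"] by (simp add: complex_ring_def)
qed

lemma scal_ring_hom: 
  assumes "op U" shows "scal X U \<in> ring_hom \<Lambda> (sec X U)"
proof -
  have "smap X \<in> ring_hom \<Lambda> (sec X (topspace (tsp X)))" 
    using space by (simp add: superspace_def sring_hom_def)
  moreover have "res X (topspace (tsp X)) U \<in> ring_hom (sec X (topspace (tsp X))) (sec X U)"
    using res_sring_hom[of "topspace (tsp X)" U] assms openin_subset[OF assms] by (simp add: sring_hom_def)
  ultimately have "res X (topspace (tsp X)) U \<circ> smap X \<in> ring_hom \<Lambda> (sec X U)"
    by (rule ring_hom_trans)
  then show ?thesis by (simp add: comp_def scal_def[abs_def])
qed

lemma sec_superalg: "op U \<Longrightarrow> superalg (sec X U)"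
proof
  assume U: "op U"
  obtain h where h: "h \<in> carrier \<Lambda>" "h \<oplus>\<^bsub>\<Lambda>\<^esub> h = \<one>\<^bsub>\<Lambda>\<^esub>" using base_half by blast
  note s = scal_ring_hom[OF U]
  show "\<exists>h\<in>sc U. h \<oplus>\<^bsub>sec X U\<^esub> h = \<one>\<^bsub>sec X U\<^esub>"
    using ring_hom_closed[OF s h(1)] ring_hom_add[OF s h(1) h(1)] ring_hom_one[OF s] h(2) by auto
qed (rule sec_superring)

lemma res_hom: "op U \<Longrightarrow> op V \<Longrightarrow> V \<subseteq> U \<Longrightarrow> superalg_hom (sec X U) (sec X V) (res X U V)"
  unfolding superalg_hom_def superalg_hom_axioms_def
  using sec_superalg res_sring_hom by auto

lemma res_closed [simp]: "op U \<Longrightarrow> op V \<Longrightarrow> V \<subseteq> U \<Longrightarrow> f \<in> sc U \<Longrightarrow> res X U V f \<in> sc V"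
  using superalg_hom.h_closed[OF res_hom] by blast

lemma res_gr [simp]: "op U \<Longrightarrow> op V \<Longrightarrow> V \<subseteq> U \<Longrightarrow> f \<in> gr (sec X U) b \<Longrightarrow> res X U V f \<in> gr (sec X V) b"
  using superalg_hom.h_gr[OF res_hom] by blast

lemma res_id: "op U \<Longrightarrow> f \<in> sc U \<Longrightarrow> res X U U f = f"
  using space by (simp add: superspace_def)

lemma res_res: "op U \<Longrightarrow> op V \<Longrightarrow> V \<subseteq> U \<Longrightarrow> op V' \<Longrightarrow> V' \<subseteq> V \<Longrightarrow> f \<in> sc U \<Longrightarrow> 
  res X V V' (res X U V f) = res X U V' f"
  using space[unfolded superspace_def, THEN conjunct2, THEN conjunct2, THEN conjunct2, THEN conjunct1,
    rule_format, of U V V' f] by simp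

lemma glue:
  assumes "\<And>V. V \<in> \<U> \<Longrightarrow> op V" "\<And>V. V \<in> \<U> \<Longrightarrow> s V \<in> sc V"
    "\<And>V V'. V \<in> \<U> \<Longrightarrow> V' \<in> \<U> \<Longrightarrow> res X V (V \<inter> V') (s V) = res X V' (V \<inter> V') (s V')"
  shows "\<exists>!f. f \<in> sc (\<Union>\<U>) \<and> (\<forall>V\<in>\<U>. res X (\<Union>\<U>) V f = s V)"
  using assms
  by (intro space[unfolded superspace_def, THEN conjunct2, THEN conjunct2, THEN conjunct2, THEN conjunct2,
      THEN conjunct1, THEN spec, THEN spec, THEN mp]) blast

lemma separated:
  assumes U: "op U" and fg: "f \<in> sc U" "g \<in> sc U"
    and loc: "\<And>x. x \<in> U \<Longrightarrow> \<exists>V. op V \<and> x \<in> V \<and> V \<subseteq> U \<and> res X U V f = res X U V g"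
  shows "f = g"
proof -
  define \<U> where "\<U> = {V. op V \<and> V \<subseteq> U \<and> res X U V f = res X U V g}"
  have un: "\<Union>\<U> = U"
  proof
    show "U \<subseteq> \<Union>\<U>"
    proof
      fix x assume "x \<in> U"
      then obtain V where "op V \<and> x \<in> V \<and> V \<subseteq> U \<and> res X U V f = res X U V g" using loc by meson
      then show "x \<in> \<Union>\<U>" by (intro UnionI[of V]) (auto simp: \<U>_def)
    qed
  qed (auto simp: \<U>_def)
  have ex1: "\<exists>!h. h \<in> sc (\<Union>\<U>) \<and> (\<forall>V\<in>\<U>. res X (\<Union>\<U>) V h = res X U V f)"
    by (rule glue) (use U fg in \<open>auto simp: \<U>_def res_res openin_Int\<close>)
  show ?thesis by (rule ex1_eqI[OF ex1[unfolded un]]) (use fg in \<open>auto simp: \<U>_def\<close>)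
qed

text \<open>On overlaps, the sections with the property \<open>P\<close> agree by uniqueness. In the applications \<open>P\<close> says that
  a section is an entry of an inverse matrix or comes from the target of a submersion.\<close>

lemma glue_unique:
  assumes U: "op U"
    and loc: "\<And>x. x \<in> U \<Longrightarrow> \<exists>V. op V \<and> x \<in> V \<and> V \<subseteq> U \<and> (\<exists>f\<in>sc V. P V f)"
    and uniq: "\<And>V f g. op V \<Longrightarrow> V \<subseteq> U \<Longrightarrow> f \<in> sc V \<Longrightarrow> g \<in> sc V \<Longrightarrow> P V f \<Longrightarrow> P V g \<Longrightarrow> f = g"
    and restr: "\<And>V V' f. op V \<Longrightarrow> V \<subseteq> U \<Longrightarrow> op V' \<Longrightarrow> V' \<subseteq> V \<Longrightarrow> f \<in> sc V \<Longrightarrow> P V f \<Longrightarrow> P V' (res X V V' f)"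
  shows "\<exists>f\<in>sc U. \<forall>V. op V \<and> V \<subseteq> U \<and> (\<exists>g\<in>sc V. P V g) \<longrightarrow> P V (res X U V f)"
proof -
  define \<U> where "\<U> = {V. op V \<and> V \<subseteq> U \<and> (\<exists>g\<in>sc V. P V g)}"
  define s where "s V = (SOME g. g \<in> sc V \<and> P V g)" for V
  have s: "s V \<in> sc V \<and> P V (s V)" if "V \<in> \<U>" for V
    unfolding s_def using that someI_ex[of "\<lambda>g. g \<in> sc V \<and> P V g"] by (auto simp: \<U>_def)
  have o: "op V \<and> V \<subseteq> U" if "V \<in> \<U>" for V using that by (auto simp: \<U>_def)
  have un: "\<Union>\<U> = U"
  proof
    show "U \<subseteq> \<Union>\<U>"
    proof
      fix x assume "x \<in> U"
      then obtain V where "op V \<and> x \<in> V \<and> V \<subseteq> U \<and> (\<exists>f\<in>sc V. P V f)" using loc by meson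
      then show "x \<in> \<Union>\<U>" by (intro UnionI[of V]) (auto simp: \<U>_def)
    qed
  qed (auto simp: \<U>_def)
  have "\<exists>!f. f \<in> sc (\<Union>\<U>) \<and> (\<forall>V\<in>\<U>. res X (\<Union>\<U>) V f = s V)"
  proof (rule glue)
    fix V V' assume V: "V \<in> \<U>" "V' \<in> \<U>"
    have K: "op (V \<inter> V')" using V o by auto
    show "res X V (V \<inter> V') (s V) = res X V' (V \<inter> V') (s V')"
    proof (rule uniq[OF K])
      show "P (V \<inter> V') (res X V (V \<inter> V') (s V))" using V o s K by (intro restr) auto
      show "P (V \<inter> V') (res X V' (V \<inter> V') (s V'))" using V o s K by (intro restr) auto
    qed (use V o s K in auto)
  qed (use s o in auto)
  then obtain f where "f \<in> sc U" "\<forall>V\<in>\<U>. res X U V f = s V" unfolding un by blast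
  then show ?thesis using s by (intro bexI[of _ f]) (auto simp: \<U>_def)
qed

text \<open>Parity is an equation between two sections, by means of the grade involution.\<close>

lemma gr_local:
  assumes U: "op U" and f: "f \<in> sc U"
    and loc: "\<And>x. x \<in> U \<Longrightarrow> \<exists>V. op V \<and> x \<in> V \<and> V \<subseteq> U \<and> res X U V f \<in> gr (sec X V) b"
  shows "f \<in> gr (sec X U) b"
proof -
  interpret U: superalg "sec X U" by (rule sec_superalg[OF U])
  have "U.gi f = sg (sec X U) b f"
  proof (rule separated[OF U])
    fix x assume "x \<in> U"
    then obtain V where V: "op V" "x \<in> V" "V \<subseteq> U" "res X U V f \<in> gr (sec X V) b" using loc by blast
    interpret r: superalg_hom "sec X U" "sec X V" "res X U V" by (rule res_hom[OF U V(1,3)])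
    have "res X U V (U.gi f) = res X U V (sg (sec X U) b f)"
      using V f by (simp add: r.h_gi r.h_sg r.R.gi_homogeneous)
    then show "\<exists>V. op V \<and> x \<in> V \<and> V \<subseteq> U \<and> res X U V (U.gi f) = res X U V (sg (sec X U) b f)" using V by blast
  qed (use f in auto)
  then show ?thesis using U.gr_iff_gi f by simp
qed

lemma finite_common_nbhd:
  assumes "finite I" "op U" "x \<in> U"
    and "\<And>i. i \<in> I \<Longrightarrow> \<exists>V. op V \<and> x \<in> V \<and> V \<subseteq> U \<and> Q i V"
    and "\<And>i V V'. i \<in> I \<Longrightarrow> op V \<Longrightarrow> V \<subseteq> U \<Longrightarrow> op V' \<Longrightarrow> V' \<subseteq> V \<Longrightarrow> Q i V \<Longrightarrow> Q i V'"
  shows "\<exists>V. op V \<and> x \<in> V \<and> V \<subseteq> U \<and> (\<forall>i\<in>I. Q i V)"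
  using assms(1,4,5)
proof (induction I)
  case empty
  then show ?case using assms(2,3) by blast
next
  case (insert i I)
  have "\<exists>V. op V \<and> x \<in> V \<and> V \<subseteq> U \<and> (\<forall>i\<in>I. Q i V)"
    by (rule insert.IH) (use insert.prems in \<open>blast+\<close>)
  then obtain V where V: "op V" "x \<in> V" "V \<subseteq> U" "\<forall>i\<in>I. Q i V" by blast
  obtain V' where V': "op V'" "x \<in> V'" "V' \<subseteq> U" "Q i V'" using insert.prems(1)[of i] by auto
  have "op (V \<inter> V')" using V V' by auto
  then show ?case using V V' insert.prems(2)[of _ V "V \<inter> V'"] insert.prems(2)[of _ V' "V \<inter> V'"]
    by (intro exI[of _ "V \<inter> V'"]) auto
qed

subsection \<open>Matrices over a superspace\<close>

abbreviation EM :: "nat \<Rightarrow> nat \<Rightarrow> 'x set \<Rightarrow> 'a mat monoid" where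
  "EM p q U \<equiv> even_mat_monoid (sec X U) p q"

lemma EM_monoid: "op U \<Longrightarrow> monoid (EM p q U)"
  using superalg.even_mat_monoid[OF sec_superalg] .

lemma EM_simps:
  "carrier (EM p q U) = smat (sec X U) p q False"
  "monoid.mult (EM p q U) = mat_mult (sec X U) (p + q)"
  "monoid.one (EM p q U) = mat_one (sec X U) (p + q)"
  by (simp_all add: even_mat_monoid_def)

lemma smat_in_mats: "op U \<Longrightarrow> M \<in> smat (sec X U) p q a \<Longrightarrow> M \<in> mats (sec X U) (p + q)"
  using superalg.smat_mats[OF sec_superalg] .

lemma mat_res_simps: "k < n \<Longrightarrow> l < n \<Longrightarrow> mat_res X n U V A k l = res X U V (A k l)"
  by (simp add: mat_res_def)

lemma mat_res_mats: "op U \<Longrightarrow> op V \<Longrightarrow> V \<subseteq> U \<Longrightarrow> A \<in> mats (sec X U) n \<Longrightarrow> mat_res X n U V A \<in> mats (sec X V) n"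
  unfolding mat_res_def using superalg_hom.map_mat_mats[OF res_hom] .

lemma mat_res_smat: 
  "op U \<Longrightarrow> op V \<Longrightarrow> V \<subseteq> U \<Longrightarrow> A \<in> smat (sec X U) p q a \<Longrightarrow> mat_res X (p + q) U V A \<in> smat (sec X V) p q a"
  unfolding mat_res_def using superalg_hom.map_mat_smat[OF res_hom] .

lemma mat_res_mult: 
  "op U \<Longrightarrow> op V \<Longrightarrow> V \<subseteq> U \<Longrightarrow> A \<in> mats (sec X U) n \<Longrightarrow> B \<in> mats (sec X U) n \<Longrightarrow> 
   mat_res X n U V (mat_mult (sec X U) n A B) = mat_mult (sec X V) n (mat_res X n U V A) (mat_res X n U V B)"
  unfolding mat_res_def using superalg_hom.map_mat_mult[OF res_hom] .

lemma mat_res_one: "op U \<Longrightarrow> op V \<Longrightarrow> V \<subseteq> U \<Longrightarrow> mat_res X n U V (mat_one (sec X U) n) = mat_one (sec X V) n"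
  unfolding mat_res_def using superalg_hom.map_mat_one[OF res_hom] .

lemma mat_res_res:
  assumes "op U" "op V" "V \<subseteq> U" "op V'" "V' \<subseteq> V" "A \<in> mats (sec X U) n"
  shows "mat_res X n V V' (mat_res X n U V A) = mat_res X n U V' A"
  using assms
  by (intro mats_eqI[of _ "sec X V'" n _ "sec X V'"] mat_res_mats[of V V'] mat_res_mats[of U V] mat_res_mats[of U V'])
     (auto simp: mat_res_simps res_res matsD)

lemma mat_separated:
  assumes "op U" "A \<in> mats (sec X U) n" "B \<in> mats (sec X U) n"
    and "\<And>x. x \<in> U \<Longrightarrow> \<exists>V. op V \<and> x \<in> V \<and> V \<subseteq> U \<and> mat_res X n U V A = mat_res X n U V B"
  shows "A = B"
proof (rule mats_eqI[OF assms(2,3)])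
  fix k l assume kl: "k < n" "l < n"
  show "A k l = B k l"
  proof (rule separated[OF assms(1)])
    fix x assume "x \<in> U"
    then obtain V where V: "op V" "x \<in> V" "V \<subseteq> U" "mat_res X n U V A = mat_res X n U V B" using assms by blast
    then have "res X U V (A k l) = res X U V (B k l)" using kl by (metis mat_res_simps)
    then show "\<exists>V. op V \<and> x \<in> V \<and> V \<subseteq> U \<and> res X U V (A k l) = res X U V (B k l)" using V by blast
  qed (use kl matsD[OF assms(2)] matsD[OF assms(3)] in auto)
qed

lemma GL_carrier: "carrier (GL X p q U) = Units (EM p q U)"
  by (simp add: GL_def units_of_def)

lemma GL_mult: "monoid.mult (GL X p q U) = mat_mult (sec X U) (p + q)"
  by (simp add: GL_def units_of_def EM_simps)

lemma GL_one: "monoid.one (GL X p q U) = mat_one (sec X U) (p + q)"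
  by (simp add: GL_def units_of_def EM_simps)

lemma GL_group: "op U \<Longrightarrow> group (GL X p q U)"
  unfolding GL_def by (rule monoid.units_group[OF EM_monoid])

lemma GL_iff: "A \<in> carrier (GL X p q U) \<longleftrightarrow> A \<in> smat (sec X U) p q False \<and>
   (\<exists>B\<in>smat (sec X U) p q False. mat_mult (sec X U) (p + q) B A = mat_one (sec X U) (p + q) \<and>
      mat_mult (sec X U) (p + q) A B = mat_one (sec X U) (p + q))"
  by (auto simp: GL_carrier Units_def EM_simps)

lemma GL_smat: "A \<in> carrier (GL X p q U) \<Longrightarrow> A \<in> smat (sec X U) p q False"
  by (simp add: GL_iff)

lemma GL_mats: "op U \<Longrightarrow> A \<in> carrier (GL X p q U) \<Longrightarrow> A \<in> mats (sec X U) (p + q)"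
  using GL_smat smat_in_mats by blast

lemma GL_res: "op U \<Longrightarrow> op V \<Longrightarrow> V \<subseteq> U \<Longrightarrow> A \<in> carrier (GL X p q U) \<Longrightarrow> 
  mat_res X (p + q) U V A \<in> carrier (GL X p q V)"
proof -
  assume a: "op U" "op V" "V \<subseteq> U" "A \<in> carrier (GL X p q U)"
  then obtain B where B: "B \<in> smat (sec X U) p q False" "mat_mult (sec X U) (p + q) B A = mat_one (sec X U) (p + q)"
      "mat_mult (sec X U) (p + q) A B = mat_one (sec X U) (p + q)" by (auto simp: GL_iff)
  note m = smat_in_mats[OF a(1) B(1)] GL_mats[OF a(1,4)]
  show ?thesis unfolding GL_iff
    using mat_res_mult[OF a(1-3) m] mat_res_mult[OF a(1-3) m(2,1)] B mat_res_one[OF a(1-3)] mat_res_smat[OF a(1-3)]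
      GL_smat[OF a(4)] by (intro conjI bexI[of _ "mat_res X (p + q) U V B"]) auto
qed

lemma GL_presheaf: "group_presheaf (tsp X) (GL X p q) (mat_res X (p + q))"
proof (rule group_presheaf.intro)
  fix U V assume o: "op U" "op V" "V \<subseteq> U"
  show "mat_res X (p + q) U V \<in> hom (GL X p q U) (GL X p q V)"
    using o by (intro homI) (auto simp: GL_res GL_mult mat_res_mult GL_mats)
qed (auto simp: GL_group mat_res_res GL_mats)

subsection \<open>Matrices congruent to the identity modulo nilpotents\<close>

lemma nilpotents_iff:
  assumes "op U"
  shows "f \<in> nilpotents X U \<longleftrightarrow> f \<in> sc U \<and>
    (\<forall>x\<in>U. \<exists>V. op V \<and> x \<in> V \<and> V \<subseteq> U \<and> res X U V f \<in> superalg.nil (sec X V))"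
proof -
  have eq: "res X U V f \<in> superalg.nil (sec X V) \<longleftrightarrow> (\<exists>k::nat. res X U V f [^]\<^bsub>sec X V\<^esub> k = \<zero>\<^bsub>sec X V\<^esub>)"
    if "op V" "V \<subseteq> U" "f \<in> sc U" for V
    using assms that by (simp add: superalg.nil_def[OF sec_superalg])
  show ?thesis unfolding nilpotents_def mem_Collect_eq
    by (rule conj_cong[OF refl], rule ball_cong[OF refl], rule ex_cong1) (auto simp: eq)
qed

lemma GL1_iff: "A \<in> carrier (GL1 X p q U) \<longleftrightarrow> A \<in> smat (sec X U) p q False \<and> 
   (\<forall>k<p + q. \<forall>l<p + q. A k l \<ominus>\<^bsub>sec X U\<^esub> mat_one (sec X U) (p + q) k l \<in> nilpotents X U)"
  by (simp add: GL1_def)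

lemma GL1_mult: "monoid.mult (GL1 X p q U) = mat_mult (sec X U) (p + q)"
  by (simp add: GL1_def EM_simps)

lemma GL1_one: "monoid.one (GL1 X p q U) = mat_one (sec X U) (p + q)"
  by (simp add: GL1_def EM_simps)

lemma mat_res_one_entry: "op U \<Longrightarrow> op V \<Longrightarrow> V \<subseteq> U \<Longrightarrow> k < n \<Longrightarrow> l < n \<Longrightarrow>
   res X U V (mat_one (sec X U) n k l) = mat_one (sec X V) n k l"
  using mat_res_one mat_res_simps by metis

text \<open>Locally, the matrices congruent to the identity are the unipotent ones of the ring of sections;
  the entries are finitely many and so are nilpotent on a common neighborhood.\<close>

lemma GL1_local:
  assumes U: "op U" and A: "A \<in> smat (sec X U) p q False"
  shows "A \<in> carrier (GL1 X p q U) \<longleftrightarrow> 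
    (\<forall>x\<in>U. \<exists>V. op V \<and> x \<in> V \<and> V \<subseteq> U \<and> mat_res X (p + q) U V A \<in> superalg.unipotents (sec X V) p q)"
    (is "?L \<longleftrightarrow> ?R")
proof -
  let ?n = "p + q" and ?I = "mat_one (sec X U) (p + q)"
  define Q where "Q kl V \<longleftrightarrow> res X U V (A (fst kl) (snd kl) \<ominus>\<^bsub>sec X U\<^esub> ?I (fst kl) (snd kl)) \<in> superalg.nil (sec X V)" for kl V
  interpret U: superalg "sec X U" by (rule sec_superalg[OF U])
  have c: "A k l \<in> sc U" "?I k l \<in> sc U" if "k < ?n" "l < ?n" for k l
    using that matsD[OF U.smat_mats[OF A]] matsD[OF U.mat_one_closed] by auto
  have Q_uni: "(\<forall>k<?n. \<forall>l<?n. Q (k, l) V) \<longleftrightarrow> mat_res X ?n U V A \<in> superalg.unipotents (sec X V) p q"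
    if V: "op V" "V \<subseteq> U" for V
  proof -
    interpret r: superalg_hom "sec X U" "sec X V" "res X U V" by (rule res_hom[OF U V])
    have "res X U V (A k l \<ominus>\<^bsub>sec X U\<^esub> ?I k l) = mat_res X ?n U V A k l \<ominus>\<^bsub>sec X V\<^esub> mat_one (sec X V) ?n k l"
      if "k < ?n" "l < ?n" for k l
      using that c[OF that] mat_res_one_entry[OF U V that] by (simp add: r.h_minus mat_res_simps)
    then show ?thesis using mat_res_smat[OF U V A] by (auto simp: Q_def r.R.unipotents_def)
  qed
  show ?thesis
  proof
    assume ?L
    show ?R
    proof
      fix x assume x: "x \<in> U"
      have "\<exists>V. op V \<and> x \<in> V \<and> V \<subseteq> U \<and> (\<forall>kl\<in>{..<?n} \<times> {..<?n}. Q kl V)"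
      proof (rule finite_common_nbhd[OF _ U x])
        show "\<exists>V. op V \<and> x \<in> V \<and> V \<subseteq> U \<and> Q kl V" if "kl \<in> {..<?n} \<times> {..<?n}" for kl
          using \<open>?L\<close> that x U by (auto simp: GL1_iff nilpotents_iff Q_def)
        fix kl V V' assume a: "kl \<in> {..<?n} \<times> {..<?n}" "op V" "V \<subseteq> U" "op V'" "V' \<subseteq> V" "Q kl V"
        let ?f = "A (fst kl) (snd kl) \<ominus>\<^bsub>sec X U\<^esub> ?I (fst kl) (snd kl)"
        have "?f \<in> sc U" using a(1) c by auto
        then show "Q kl V'" using superalg_hom.h_nil[OF res_hom[OF a(2,4,5)], of "res X U V ?f"] a
          by (simp add: Q_def res_res[OF U a(2-5)])
      qed auto
      then show "\<exists>V. op V \<and> x \<in> V \<and> V \<subseteq> U \<and> mat_res X ?n U V A \<in> superalg.unipotents (sec X V) p q"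
        using Q_uni by (metis SigmaI lessThan_iff)
    qed
  next
    assume R: ?R
    show ?L unfolding GL1_iff nilpotents_iff[OF U]
    proof (intro conjI allI impI ballI A)
      fix k l x assume kl: "k < ?n" "l < ?n" and x: "x \<in> U"
      obtain V where V: "op V" "x \<in> V" "V \<subseteq> U" "mat_res X ?n U V A \<in> superalg.unipotents (sec X V) p q"
        using R x by blast
      then have "Q (k, l) V" using Q_uni kl by blast
      then show "\<exists>V. op V \<and> x \<in> V \<and> V \<subseteq> U \<and> res X U V (A k l \<ominus>\<^bsub>sec X U\<^esub> ?I k l) \<in> superalg.nil (sec X V)"
        using V by (auto simp: Q_def)
    qed (use c in auto)
  qed
qed

lemma GL1_closed:
  assumes U: "op U" and A: "A \<in> carrier (GL1 X p q U)" and B: "B \<in> carrier (GL1 X p q U)"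
  shows "mat_mult (sec X U) (p + q) A B \<in> carrier (GL1 X p q U)"
proof -
  interpret U: superalg "sec X U" by (rule sec_superalg[OF U])
  have s: "A \<in> smat (sec X U) p q False" "B \<in> smat (sec X U) p q False" using A B by (auto simp: GL1_iff)
  have "mat_mult (sec X U) (p + q) A B \<in> smat (sec X U) p q False"
    using U.smat_mult_closed[OF s] by simp
  moreover have "\<exists>V. op V \<and> x \<in> V \<and> V \<subseteq> U \<and> mat_res X (p + q) U V (mat_mult (sec X U) (p + q) A B) 
      \<in> superalg.unipotents (sec X V) p q" if x: "x \<in> U" for x
  proof -
    obtain V where V: "op V" "x \<in> V" "V \<subseteq> U" "mat_res X (p + q) U V A \<in> superalg.unipotents (sec X V) p q"
      using GL1_local[OF U s(1)] A x by blast
    obtain V' where V': "op V'" "x \<in> V'" "V' \<subseteq> U" "mat_res X (p + q) U V' B \<in> superalg.unipotents (sec X V') p q"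
      using GL1_local[OF U s(2)] B x by blast
    let ?K = "V \<inter> V'"
    have K: "op ?K" using V V' by auto
    have uni: "mat_res X (p + q) U ?K M \<in> superalg.unipotents (sec X ?K) p q" 
      if "mat_res X (p + q) U V'' M \<in> superalg.unipotents (sec X V'') p q" "op V''" "V'' \<subseteq> U" "?K \<subseteq> V''"
        "M \<in> smat (sec X U) p q False" for M V''
    proof -
      note M' = that
      interpret r: superalg_hom "sec X V''" "sec X ?K" "res X V'' ?K" by (rule res_hom[OF that(2) K that(4)])
      have M: "mat_res X (p + q) U V'' M \<in> smat (sec X V'') p q False" 
        using mat_res_smat[OF U that(2,3,5)] .
      have eq: "mat_res X (p + q) U ?K M = mat_res X (p + q) V'' ?K (mat_res X (p + q) U V'' M)"
        using mat_res_res[OF U that(2,3) K that(4) U.smat_mats[OF that(5)]] by simp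
      have "mat_res X (p + q) V'' ?K (mat_res X (p + q) U V'' M) k l \<ominus>\<^bsub>sec X ?K\<^esub> mat_one (sec X ?K) (p + q) k l
          \<in> r.R.nil" if kl: "k < p + q" "l < p + q" for k l
      proof -
        have "mat_res X (p + q) U V'' M k l \<ominus>\<^bsub>sec X V''\<^esub> mat_one (sec X V'') (p + q) k l \<in> r.C.nil"
          using M' kl \<open>mat_res X (p + q) U V'' M \<in> r.C.unipotents p q\<close> by (auto simp: r.C.unipotents_def)
        from r.h_nil[OF this] show ?thesis
          using kl matsD[OF r.C.smat_mats[OF M] kl] matsD[OF r.C.mat_one_closed kl] 
            mat_res_one_entry[OF M'(2) K M'(4) kl] 
          by (simp add: r.h_minus mat_res_simps)
      qed
      then show ?thesis unfolding eq r.R.unipotents_def using mat_res_smat[OF that(2) K that(4) M] by auto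
    qed
    interpret K: superalg "sec X ?K" by (rule sec_superalg[OF K])
    have KU: "?K \<subseteq> U" using V by auto
    have "mat_res X (p + q) U ?K (mat_mult (sec X U) (p + q) A B) \<in> K.unipotents p q"
      unfolding mat_res_mult[OF U K KU U.smat_mats[OF s(1)] U.smat_mats[OF s(2)]]
      by (rule K.unipotents_mult[OF uni[OF V(4) V(1,3) Int_lower1 s(1)] uni[OF V'(4) V'(1,3) Int_lower2 s(2)]])
    then show ?thesis using K V V' by blast
  qed
  ultimately show ?thesis using GL1_local[OF U] by blast
qed

lemma GL1_one_closed: 
  assumes "op U" shows "mat_one (sec X U) (p + q) \<in> carrier (GL1 X p q U)"
proof -
  interpret U: superalg "sec X U" by (rule sec_superalg[OF assms])
  show ?thesis using GL1_local[OF assms U.smat_one] mat_res_one[OF assms assms order.refl] 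
      U.unipotents_one assms by auto
qed

lemma GL1_res:
  assumes o: "op U" "op V" "V \<subseteq> U" and A: "A \<in> carrier (GL1 X p q U)"
  shows "mat_res X (p + q) U V A \<in> carrier (GL1 X p q V)"
proof -
  interpret r: superalg_hom "sec X U" "sec X V" "res X U V" by (rule res_hom[OF o])
  have s: "A \<in> smat (sec X U) p q False" using A by (simp add: GL1_iff)
  have "res X U V f \<in> nilpotents X V" if f: "f \<in> nilpotents X U" for f
    unfolding nilpotents_iff[OF o(2)]
  proof (intro conjI ballI)
    have fc: "f \<in> sc U" using f o by (simp add: nilpotents_iff)
    then show "res X U V f \<in> sc V" using o by simp
    fix x assume x: "x \<in> V"
    then obtain N where N: "op N" "x \<in> N" "N \<subseteq> U" "res X U N f \<in> superalg.nil (sec X N)" 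
      using f[unfolded nilpotents_iff[OF o(1)]] o(3) by blast
    have K: "op (N \<inter> V)" using N o by auto
    have "res X N (N \<inter> V) (res X U N f) \<in> superalg.nil (sec X (N \<inter> V))"
      by (rule superalg_hom.h_nil[OF res_hom[OF N(1) K Int_lower1] N(4)])
    then have "res X V (N \<inter> V) (res X U V f) \<in> superalg.nil (sec X (N \<inter> V))"
      using N K o fc by (simp add: res_res)
    then show "\<exists>N. op N \<and> x \<in> N \<and> N \<subseteq> V \<and> res X V N (res X U V f) \<in> superalg.nil (sec X N)"
      using K N x by blast
  qed
  then have "mat_res X (p + q) U V A k l \<ominus>\<^bsub>sec X V\<^esub> mat_one (sec X V) (p + q) k l \<in> nilpotents X V"
    if "k < p + q" "l < p + q" for k l
  proof -
    have "res X U V (A k l \<ominus>\<^bsub>sec X U\<^esub> mat_one (sec X U) (p + q) k l) \<in> nilpotents X V"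
      using that A \<open>\<And>f. f \<in> nilpotents X U \<Longrightarrow> res X U V f \<in> nilpotents X V\<close> by (simp add: GL1_iff)
    then show ?thesis
      using that r.h_minus[OF matsD[OF r.C.smat_mats[OF s] that] matsD[OF r.C.mat_one_closed that]] 
        mat_res_one_entry[OF o that] by (simp add: mat_res_simps)
  qed
  then show ?thesis using mat_res_smat[OF o s] by (auto simp: GL1_iff)
qed

text \<open>The inverses that exist locally are unique, so their entries glue.\<close>

lemma GL1_inverse:
  assumes U: "op U" and A: "A \<in> carrier (GL1 X p q U)"
  shows "\<exists>B\<in>carrier (GL1 X p q U). mat_mult (sec X U) (p + q) A B = mat_one (sec X U) (p + q) \<and>
    mat_mult (sec X U) (p + q) B A = mat_one (sec X U) (p + q)"
proof -
  let ?n = "p + q"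
  interpret U: superalg "sec X U" by (rule sec_superalg[OF U])
  have s: "A \<in> smat (sec X U) p q False" using A by (simp add: GL1_iff)
  define I where "I V Y \<longleftrightarrow> Y \<in> smat (sec X V) p q False \<and> 
    mat_mult (sec X V) ?n (mat_res X ?n U V A) Y = mat_one (sec X V) ?n \<and>
    mat_mult (sec X V) ?n Y (mat_res X ?n U V A) = mat_one (sec X V) ?n" for V Y
  have I_unique: "Y = Y'" if V: "op V" "V \<subseteq> U" and "I V Y" "I V Y'" for V Y Y'
  proof -
    interpret V: superalg "sec X V" by (rule sec_superalg[OF V(1)])
    have m: "Y \<in> mats (sec X V) ?n" "Y' \<in> mats (sec X V) ?n" "mat_res X ?n U V A \<in> mats (sec X V) ?n"
      using that mat_res_smat[OF U V s] V.smat_mats by (auto simp: I_def)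
    have "Y = mat_mult (sec X V) ?n Y (mat_mult (sec X V) ?n (mat_res X ?n U V A) Y')"
      using that m by (simp add: I_def V.mat_mult_one)
    also have "\<dots> = Y'"
      using that(3) unfolding V.mat_mult_assoc[OF m(1,3,2), symmetric] I_def by (simp add: V.mat_one_mult[OF m(2)])
    finally show ?thesis .
  qed
  have I_res: "I V' (mat_res X ?n V V' Y)" if V: "op V" "V \<subseteq> U" and V': "op V'" "V' \<subseteq> V" and "I V Y" for V V' Y
  proof -
    have m: "Y \<in> mats (sec X V) ?n" "mat_res X ?n U V A \<in> mats (sec X V) ?n"
      using that mat_res_smat[OF U V s] superalg.smat_mats[OF sec_superalg[OF V(1)]] by (auto simp: I_def)
    show ?thesis
      using mat_res_mult[OF V(1) V' m] mat_res_mult[OF V(1) V' m(2,1)] mat_res_one[OF V(1) V', of ?n] that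
        mat_res_res[OF U V V' U.smat_mats[OF s]] mat_res_smat[OF V(1) V', of Y p q False]
      by (auto simp: I_def)
  qed
  have I_local: "\<exists>V. op V \<and> x \<in> V \<and> V \<subseteq> U \<and> (\<exists>Y\<in>superalg.unipotents (sec X V) p q. I V Y)" if x: "x \<in> U" for x
  proof -
    obtain V where V: "op V" "x \<in> V" "V \<subseteq> U" "mat_res X ?n U V A \<in> superalg.unipotents (sec X V) p q"
      using GL1_local[OF U s] A x by blast
    interpret V: superalg "sec X V" by (rule sec_superalg[OF V(1)])
    obtain Y where "Y \<in> V.unipotents p q" "I V Y"
      using V.unipotent_inverse[OF V(4)] by (auto simp: I_def V.unipotents_def)
    then show ?thesis using V by blast
  qed
  have "\<exists>y\<in>sc U. \<forall>V. op V \<and> V \<subseteq> U \<and> (\<exists>g\<in>sc V. \<exists>Y. I V Y \<and> Y k l = g) \<longrightarrow> (\<exists>Y. I V Y \<and> Y k l = res X U V y)"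
    if kl: "k < ?n" "l < ?n" for k l
  proof (rule glue_unique[OF U])
    fix x assume "x \<in> U"
    then obtain V Y where V: "op V" "x \<in> V" "V \<subseteq> U" "I V Y" using I_local by blast
    then have "Y k l \<in> sc V" using kl matsD[OF smat_in_mats] by (auto simp: I_def)
    then show "\<exists>V. op V \<and> x \<in> V \<and> V \<subseteq> U \<and> (\<exists>f\<in>sc V. \<exists>Y. I V Y \<and> Y k l = f)" using V by blast
  next
    fix V f g assume "op V" "V \<subseteq> U" "\<exists>Y. I V Y \<and> Y k l = f" "\<exists>Y. I V Y \<and> Y k l = g"
    then show "f = g" using I_unique by blast
  next
    fix V V' f assume "op V" "V \<subseteq> U" "op V'" "V' \<subseteq> V" "\<exists>Y. I V Y \<and> Y k l = f"
    then show "\<exists>Y. I V' Y \<and> Y k l = res X V V' f" using I_res kl mat_res_simps by metis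
  qed
  then obtain y where y: "\<And>k l. k < ?n \<Longrightarrow> l < ?n \<Longrightarrow> y k l \<in> sc U \<and>
      (\<forall>V. op V \<and> V \<subseteq> U \<and> (\<exists>g\<in>sc V. \<exists>Y. I V Y \<and> Y k l = g) \<longrightarrow> (\<exists>Y. I V Y \<and> Y k l = res X U V (y k l)))"
    by metis
  define B where "B = mk_mat ?n y"
  have BY: "mat_res X ?n U V B = Y" if V: "op V" "V \<subseteq> U" and Y: "I V Y" for V Y
  proof (rule mats_eqI[of _ "sec X V" ?n _ "sec X V"])
    show "mat_res X ?n U V B \<in> mats (sec X V) ?n"
      using y by (intro mat_res_mats U V) (auto simp: B_def intro!: mk_mat_in_mats)
    show "Y \<in> mats (sec X V) ?n" using Y V smat_in_mats by (auto simp: I_def)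
    fix k l assume kl: "k < ?n" "l < ?n"
    have "Y k l \<in> sc V" using kl Y V matsD[OF smat_in_mats] by (auto simp: I_def)
    then obtain Y' where "I V Y'" "Y' k l = res X U V (y k l)" using y[OF kl] V Y by blast
    then show "mat_res X ?n U V B k l = Y k l" using I_unique[OF V Y] kl by (simp add: B_def mat_res_simps)
  qed
  have Bs: "B \<in> smat (sec X U) p q False" unfolding B_def
  proof (rule mk_mat_in_smat, rule gr_local[OF U])
    fix k l x assume kl: "k < ?n" "l < ?n" and "x \<in> U"
    then obtain V Y where V: "op V" "x \<in> V" "V \<subseteq> U" "I V Y" using I_local by blast
    then have "res X U V (y k l) = Y k l" using BY[OF V(1,3,4)] kl by (auto simp: B_def mat_res_simps)
    then show "\<exists>V. op V \<and> x \<in> V \<and> V \<subseteq> U \<and> res X U V (y k l) \<in> gr (sec X V) (False \<noteq> ((p \<le> k) \<noteq> (p \<le> l)))"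
      using V kl smatD[of Y "sec X V" p q False k l] by (auto simp: I_def)
  qed (use y in auto)
  have B1: "B \<in> carrier (GL1 X p q U)"
    unfolding GL1_local[OF U Bs] using I_local BY by metis
  note m = U.smat_mats[OF s] U.smat_mats[OF Bs]
  have "mat_mult (sec X U) ?n A B = mat_one (sec X U) ?n"
  proof (rule mat_separated[OF U])
    fix x assume "x \<in> U"
    then obtain V Y where V: "op V" "x \<in> V" "V \<subseteq> U" "I V Y" using I_local by blast
    then show "\<exists>V. op V \<and> x \<in> V \<and> V \<subseteq> U \<and> mat_res X ?n U V (mat_mult (sec X U) ?n A B) = 
       mat_res X ?n U V (mat_one (sec X U) ?n)"
      using BY[OF V(1,3,4)] mat_res_mult[OF U V(1,3) m] mat_res_one[OF U V(1,3)] by (auto simp: I_def)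
  qed (use m U.mat_mult_closed U.mat_one_closed in auto)
  moreover have "mat_mult (sec X U) ?n B A = mat_one (sec X U) ?n"
  proof (rule mat_separated[OF U])
    fix x assume "x \<in> U"
    then obtain V Y where V: "op V" "x \<in> V" "V \<subseteq> U" "I V Y" using I_local by blast
    then show "\<exists>V. op V \<and> x \<in> V \<and> V \<subseteq> U \<and> mat_res X ?n U V (mat_mult (sec X U) ?n B A) = 
       mat_res X ?n U V (mat_one (sec X U) ?n)"
      using BY[OF V(1,3,4)] mat_res_mult[OF U V(1,3) m(2,1)] mat_res_one[OF U V(1,3)] by (auto simp: I_def)
  qed (use m U.mat_mult_closed U.mat_one_closed in auto)
  ultimately show ?thesis using B1 by blast
qed

lemma GL1_in_GL: "op U \<Longrightarrow> A \<in> carrier (GL1 X p q U) \<Longrightarrow> A \<in> carrier (GL X p q U)"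
proof -
  assume a: "op U" "A \<in> carrier (GL1 X p q U)"
  from GL1_inverse[OF a] obtain B where "B \<in> carrier (GL1 X p q U)" 
    "mat_mult (sec X U) (p + q) A B = mat_one (sec X U) (p + q)"
    "mat_mult (sec X U) (p + q) B A = mat_one (sec X U) (p + q)" by blast
  then show ?thesis using a(2) by (auto simp: GL_iff GL1_iff)
qed

lemma GL1_group: 
  assumes U: "op U" shows "group (GL1 X p q U)"
proof -
  interpret U: superalg "sec X U" by (rule sec_superalg[OF U])
  have m: "A \<in> mats (sec X U) (p + q)" if "A \<in> carrier (GL1 X p q U)" for A
    using that U.smat_mats by (auto simp: GL1_iff)
  show ?thesis
  proof (rule groupI)
    fix A B assume "A \<in> carrier (GL1 X p q U)" "B \<in> carrier (GL1 X p q U)"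
    then show "A \<otimes>\<^bsub>GL1 X p q U\<^esub> B \<in> carrier (GL1 X p q U)" using GL1_closed[OF U] by (simp add: GL1_mult)
  next
    fix A assume "A \<in> carrier (GL1 X p q U)"
    then show "\<exists>B\<in>carrier (GL1 X p q U). B \<otimes>\<^bsub>GL1 X p q U\<^esub> A = \<one>\<^bsub>GL1 X p q U\<^esub>"
      using GL1_inverse[OF U, of A] by (auto simp: GL1_mult GL1_one)
  qed (auto simp: GL1_mult GL1_one GL1_one_closed U U.mat_mult_assoc m U.mat_one_mult)
qed

lemma GL1_presheaf: "group_presheaf (tsp X) (GL1 X p q) (mat_res X (p + q))"
proof (rule group_presheaf.intro)
  fix U V assume o: "op U" "op V" "V \<subseteq> U"
  show "mat_res X (p + q) U V \<in> hom (GL1 X p q U) (GL1 X p q V)"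
    using o by (intro homI) (auto simp: GL1_res GL1_mult mat_res_mult GL_mats GL1_in_GL)
qed (auto simp: GL1_group mat_res_res GL_mats GL1_in_GL)

lemma cocycles_GL1_GL:
  "cocycles (tsp X) (GL1 X p q) (mat_res X (p + q)) \<subseteq> cocycles (tsp X) (GL X p q) (mat_res X (p + q))"
  by (auto simp: cocycles_def Let_def GL1_mult GL_mult point_cover_def intro!: GL1_in_GL)

lemma cohomologous_GL1_GL:
  "cohomologous (tsp X) (GL1 X p q) (mat_res X (p + q)) \<subseteq> cohomologous (tsp X) (GL X p q) (mat_res X (p + q))"
proof (rule subrelI)
  interpret G1: group_presheaf "tsp X" "GL1 X p q" "mat_res X (p + q)" by (rule GL1_presheaf)
  interpret G: group_presheaf "tsp X" "GL X p q" "mat_res X (p + q)" by (rule GL_presheaf)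
  fix a b assume ab: "(a, b) \<in> cohomologous (tsp X) (GL1 X p q) (mat_res X (p + q))"
  obtain U g V h where [simp]: "a = (U, g)" "b = (V, h)" by (cases a, cases b)
  from ab show "(a, b) \<in> cohomologous (tsp X) (GL X p q) (mat_res X (p + q))"
    unfolding \<open>a = _\<close> \<open>b = _\<close>
  proof (rule G1.cohomologousE, goal_cases)
    case (1 N \<rho> \<tau> c)
    show ?case
      by (rule G.cohomologousI[OF subsetD[OF cocycles_GL1_GL 1(1)] subsetD[OF cocycles_GL1_GL 1(2)] 1(3), of \<rho> \<tau> c])
        (use 1(3-5) in \<open>auto simp: GL1_mult GL_mult point_cover_def intro!: GL1_in_GL\<close>)
  qed
qed

end

section \<open>Vector fields\<close>

text \<open>In the commutator of two derivations of a product, \<open>y\<close> and \<open>z\<close> are the mixed terms, in which each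
  derivation acts on a different factor.\<close>

lemma (in abelian_group) commutator_rearrange:
  assumes "x \<in> carrier G" "y \<in> carrier G" "z \<in> carrier G" "w \<in> carrier G" "x' \<in> carrier G" "w' \<in> carrier G"
  shows "((x \<oplus> y) \<oplus> (z \<oplus> w)) \<oplus> \<ominus> ((x' \<oplus> z) \<oplus> (y \<oplus> w')) = (x \<oplus> \<ominus> x') \<oplus> (w \<oplus> \<ominus> w')"
proof -
  have "((x \<oplus> y) \<oplus> (z \<oplus> w)) \<oplus> \<ominus> ((x' \<oplus> z) \<oplus> (y \<oplus> w')) 
      = ((x \<oplus> \<ominus> x') \<oplus> (w \<oplus> \<ominus> w')) \<oplus> ((y \<oplus> \<ominus> y) \<oplus> (z \<oplus> \<ominus> z))"
    using assms by (simp add: minus_add a_ac)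
  then show ?thesis using assms by (simp add: r_neg)
qed

context sspace
begin

lemma vfD:
  assumes "v \<in> vfields \<Lambda> X U a" "op U'" "U' \<subseteq> U"
  shows "f \<in> sc U' \<Longrightarrow> v U' f \<in> sc U'"
    and "f \<in> sc U' \<Longrightarrow> g \<in> sc U' \<Longrightarrow> v U' (f \<oplus>\<^bsub>sec X U'\<^esub> g) = v U' f \<oplus>\<^bsub>sec X U'\<^esub> v U' g"
    and "f \<in> gr (sec X U') b \<Longrightarrow> v U' f \<in> gr (sec X U') (a \<noteq> b)"
    and "f \<in> gr (sec X U') b \<Longrightarrow> g \<in> sc U' \<Longrightarrow> v U' (f \<otimes>\<^bsub>sec X U'\<^esub> g) =
      (v U' f \<otimes>\<^bsub>sec X U'\<^esub> g) \<oplus>\<^bsub>sec X U'\<^esub> sg (sec X U') (a \<and> b) (f \<otimes>\<^bsub>sec X U'\<^esub> v U' g)"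
    and "l \<in> carrier \<Lambda> \<Longrightarrow> v U' (scal X U' l) = \<zero>\<^bsub>sec X U'\<^esub>"
    and "op U'' \<Longrightarrow> U'' \<subseteq> U' \<Longrightarrow> f \<in> sc U' \<Longrightarrow> res X U' U'' (v U' f) = v U'' (res X U' U'' f)"
proof -
  have *: "v U' \<in> carrier (sec X U') \<rightarrow>\<^sub>E carrier (sec X U') \<and>
      (\<forall>f\<in>carrier (sec X U'). \<forall>g\<in>carrier (sec X U').
         v U' (f \<oplus>\<^bsub>sec X U'\<^esub> g) = v U' f \<oplus>\<^bsub>sec X U'\<^esub> v U' g) \<and>
      (\<forall>b. \<forall>f\<in>gr (sec X U') b. v U' f \<in> gr (sec X U') (a \<noteq> b)) \<and>
      (\<forall>b. \<forall>f\<in>gr (sec X U') b. \<forall>g\<in>carrier (sec X U').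
         v U' (f \<otimes>\<^bsub>sec X U'\<^esub> g) =
           (v U' f \<otimes>\<^bsub>sec X U'\<^esub> g) \<oplus>\<^bsub>sec X U'\<^esub> sg (sec X U') (a \<and> b) (f \<otimes>\<^bsub>sec X U'\<^esub> v U' g)) \<and>
      (\<forall>l\<in>carrier \<Lambda>. v U' (scal X U' l) = \<zero>\<^bsub>sec X U'\<^esub>) \<and>
      (\<forall>U''. sub_open (tsp X) U'' U' \<longrightarrow> (\<forall>f\<in>carrier (sec X U').
         res X U' U'' (v U' f) = v U'' (res X U' U'' f)))"
    using assms(1)[unfolded vfields_def mem_Collect_eq, THEN conjunct2, THEN spec, THEN mp, of U'] assms(2,3)
    by (simp add: sub_open_def)
  show "f \<in> sc U' \<Longrightarrow> v U' f \<in> sc U'" using *[THEN conjunct1] by blast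
  show "f \<in> sc U' \<Longrightarrow> g \<in> sc U' \<Longrightarrow> v U' (f \<oplus>\<^bsub>sec X U'\<^esub> g) = v U' f \<oplus>\<^bsub>sec X U'\<^esub> v U' g"
    using *[THEN conjunct2, THEN conjunct1] by blast
  show "f \<in> gr (sec X U') b \<Longrightarrow> v U' f \<in> gr (sec X U') (a \<noteq> b)"
    using *[THEN conjunct2, THEN conjunct2, THEN conjunct1] by blast
  show "f \<in> gr (sec X U') b \<Longrightarrow> g \<in> sc U' \<Longrightarrow> v U' (f \<otimes>\<^bsub>sec X U'\<^esub> g) =
      (v U' f \<otimes>\<^bsub>sec X U'\<^esub> g) \<oplus>\<^bsub>sec X U'\<^esub> sg (sec X U') (a \<and> b) (f \<otimes>\<^bsub>sec X U'\<^esub> v U' g)"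
    using *[THEN conjunct2, THEN conjunct2, THEN conjunct2, THEN conjunct1] by blast
  show "l \<in> carrier \<Lambda> \<Longrightarrow> v U' (scal X U' l) = \<zero>\<^bsub>sec X U'\<^esub>"
    using *[THEN conjunct2, THEN conjunct2, THEN conjunct2, THEN conjunct2, THEN conjunct1] by blast
  show "op U'' \<Longrightarrow> U'' \<subseteq> U' \<Longrightarrow> f \<in> sc U' \<Longrightarrow> res X U' U'' (v U' f) = v U'' (res X U' U'' f)"
    using *[THEN conjunct2, THEN conjunct2, THEN conjunct2, THEN conjunct2, THEN conjunct2] by simp
qed

lemma vf_outside:
  assumes "v \<in> vfields \<Lambda> X U a" 
  shows "\<not> (op U' \<and> U' \<subseteq> U) \<Longrightarrow> v U' = (\<lambda>_. undefined)" and "f \<notin> sc U' \<Longrightarrow> v U' f = undefined"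
proof -
  show 1: "v U' = (\<lambda>_. undefined)" if "\<not> (op U' \<and> U' \<subseteq> U)" for U'
    using assms(1)[unfolded vfields_def mem_Collect_eq, THEN conjunct1] that by (simp add: sub_open_def)
  show "v U' f = undefined" if "f \<notin> sc U'"
  proof (cases "op U' \<and> U' \<subseteq> U")
    case True
    then have "v U' \<in> sc U' \<rightarrow>\<^sub>E sc U'"
      using assms(1)[unfolded vfields_def mem_Collect_eq, THEN conjunct2, THEN spec, THEN mp, of U'] 
      by (simp add: sub_open_def)
    then show ?thesis using that by (auto simp: PiE_iff extensional_def)
  next
    case False
    then show ?thesis using 1 by simp
  qed
qed

lemma vf_eqI:
  assumes "v \<in> vfields \<Lambda> X U a" "w \<in> vfields \<Lambda> X U b"
    and "\<And>U' f. op U' \<Longrightarrow> U' \<subseteq> U \<Longrightarrow> f \<in> sc U' \<Longrightarrow> v U' f = w U' f"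
  shows "v = w"
proof (intro ext)
  fix U' f
  show "v U' f = w U' f"
    using assms(3) vf_outside[OF assms(1)] vf_outside[OF assms(2)] by (cases "op U' \<and> U' \<subseteq> U \<and> f \<in> sc U'") metis+
qed

lemma vf_mkI:
  assumes "\<And>U' f. op U' \<Longrightarrow> U' \<subseteq> U \<Longrightarrow> f \<in> sc U' \<Longrightarrow> h U' f \<in> sc U'"
    and "\<And>U' f g. op U' \<Longrightarrow> U' \<subseteq> U \<Longrightarrow> f \<in> sc U' \<Longrightarrow> g \<in> sc U' \<Longrightarrow> 
      h U' (f \<oplus>\<^bsub>sec X U'\<^esub> g) = h U' f \<oplus>\<^bsub>sec X U'\<^esub> h U' g"
    and "\<And>U' f b. op U' \<Longrightarrow> U' \<subseteq> U \<Longrightarrow> f \<in> gr (sec X U') b \<Longrightarrow> h U' f \<in> gr (sec X U') (a \<noteq> b)"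
    and "\<And>U' f g b. op U' \<Longrightarrow> U' \<subseteq> U \<Longrightarrow> f \<in> gr (sec X U') b \<Longrightarrow> g \<in> sc U' \<Longrightarrow> h U' (f \<otimes>\<^bsub>sec X U'\<^esub> g) =
      (h U' f \<otimes>\<^bsub>sec X U'\<^esub> g) \<oplus>\<^bsub>sec X U'\<^esub> sg (sec X U') (a \<and> b) (f \<otimes>\<^bsub>sec X U'\<^esub> h U' g)"
    and "\<And>U' l. op U' \<Longrightarrow> U' \<subseteq> U \<Longrightarrow> l \<in> carrier \<Lambda> \<Longrightarrow> h U' (scal X U' l) = \<zero>\<^bsub>sec X U'\<^esub>"
    and "\<And>U' U'' f. op U' \<Longrightarrow> U' \<subseteq> U \<Longrightarrow> op U'' \<Longrightarrow> U'' \<subseteq> U' \<Longrightarrow> f \<in> sc U' \<Longrightarrow> 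
      res X U' U'' (h U' f) = h U'' (res X U' U'' f)"
  shows "vf_mk X U h \<in> vfields \<Lambda> X U a"
  unfolding vfields_def
proof (intro CollectI conjI allI impI)
  fix U' assume U': "sub_open (tsp X) U' U"
  then have o: "op U'" "U' \<subseteq> U" by auto
  interpret R: superalg "sec X U'" by (rule sec_superalg[OF o(1)])
  have eq: "f \<in> sc U' \<Longrightarrow> vf_mk X U h U' f = h U' f" for f using o by (simp add: vf_mk_def)
  show "vf_mk X U h U' \<in> sc U' \<rightarrow>\<^sub>E sc U'" using o assms(1) by (auto simp: vf_mk_def)
  show "\<forall>f\<in>sc U'. \<forall>g\<in>sc U'. vf_mk X U h U' (f \<oplus>\<^bsub>sec X U'\<^esub> g) = vf_mk X U h U' f \<oplus>\<^bsub>sec X U'\<^esub> vf_mk X U h U' g"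
    using assms(2)[OF o] by (simp add: eq)
  show "\<forall>f\<in>gr (sec X U') b. vf_mk X U h U' f \<in> gr (sec X U') (a \<noteq> b)" for b
    using assms(3)[OF o] R.gr_closed eq by metis
  show "\<forall>f\<in>gr (sec X U') b. \<forall>g\<in>sc U'. vf_mk X U h U' (f \<otimes>\<^bsub>sec X U'\<^esub> g) =
           (vf_mk X U h U' f \<otimes>\<^bsub>sec X U'\<^esub> g) \<oplus>\<^bsub>sec X U'\<^esub> sg (sec X U') (a \<and> b) (f \<otimes>\<^bsub>sec X U'\<^esub> vf_mk X U h U' g)" for b
    using assms(4)[OF o] by (simp add: eq)
  have "scal X U' l \<in> sc U'" if "l \<in> carrier \<Lambda>" for l
    using ring_hom_closed[OF scal_ring_hom[OF o(1)] that] .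
  then show "\<forall>l\<in>carrier \<Lambda>. vf_mk X U h U' (scal X U' l) = \<zero>\<^bsub>sec X U'\<^esub>"
    using assms(5)[OF o] by (simp add: eq)
  fix U'' assume U'': "sub_open (tsp X) U'' U'"
  then have o': "op U''" "U'' \<subseteq> U'" by auto
  show "\<forall>f\<in>sc U'. res X U' U'' (vf_mk X U h U' f) = vf_mk X U h U'' (res X U' U'' f)"
    using assms(6)[OF o o'] o o' eq by (auto simp: vf_mk_def)
qed (auto simp: vf_mk_def)

lemma vf_mk_apply: "op U' \<Longrightarrow> U' \<subseteq> U \<Longrightarrow> f \<in> sc U' \<Longrightarrow> vf_mk X U h U' f = h U' f"
  by (simp add: vf_mk_def)

lemma vf_zero:
  assumes "v \<in> vfields \<Lambda> X U a" "op U'" "U' \<subseteq> U"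
  shows "v U' \<zero>\<^bsub>sec X U'\<^esub> = \<zero>\<^bsub>sec X U'\<^esub>"
proof -
  interpret R: superalg "sec X U'" by (rule sec_superalg[OF assms(2)])
  note [simp] = vfD(1)[OF assms]
  have "v U' \<zero>\<^bsub>sec X U'\<^esub> \<oplus>\<^bsub>sec X U'\<^esub> v U' \<zero>\<^bsub>sec X U'\<^esub> = v U' \<zero>\<^bsub>sec X U'\<^esub>"
    using vfD(2)[OF assms R.zero_closed R.zero_closed] by simp
  then show ?thesis by (metis R.add.r_cancel_one R.zero_closed vfD(1)[OF assms])
qed

lemma vf_neg:
  assumes "v \<in> vfields \<Lambda> X U a" "op U'" "U' \<subseteq> U" "f \<in> sc U'"
  shows "v U' (\<ominus>\<^bsub>sec X U'\<^esub> f) = \<ominus>\<^bsub>sec X U'\<^esub> v U' f"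
proof -
  interpret R: superalg "sec X U'" by (rule sec_superalg[OF assms(2)])
  have "v U' (\<ominus>\<^bsub>sec X U'\<^esub> f) \<oplus>\<^bsub>sec X U'\<^esub> v U' f = \<zero>\<^bsub>sec X U'\<^esub>"
    using vfD(2)[OF assms(1-3), of "\<ominus>\<^bsub>sec X U'\<^esub> f" f] assms(4) vf_zero[OF assms(1-3)] by (simp add: R.l_neg)
  then show ?thesis using vfD(1)[OF assms(1-3)] assms(4) R.minus_equality by (metis R.a_inv_closed)
qed

lemma vf_sg:
  assumes "v \<in> vfields \<Lambda> X U a" "op U'" "U' \<subseteq> U" "f \<in> sc U'"
  shows "v U' (sg (sec X U') e f) = sg (sec X U') e (v U' f)"
  using vf_neg[OF assms] by (simp add: sg_def)

lemma vf_finsum: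
  assumes "v \<in> vfields \<Lambda> X U a" "op U'" "U' \<subseteq> U" "f \<in> A \<rightarrow> sc U'"
  shows "v U' (finsum (sec X U') f A) = (\<Oplus>\<^bsub>sec X U'\<^esub>i\<in>A. v U' (f i))"
proof -
  interpret R: superalg "sec X U'" by (rule sec_superalg[OF assms(2)])
  show ?thesis using assms(4)
  proof (induction A rule: infinite_finite_induct)
    case (insert x F)
    then have c: "f x \<in> sc U'" "f \<in> F \<rightarrow> sc U'" "(\<lambda>i. v U' (f i)) \<in> F \<rightarrow> sc U'" "v U' (f x) \<in> sc U'" 
      using vfD(1)[OF assms(1-3)] by auto
    have "v U' (finsum (sec X U') f (insert x F)) = v U' (f x) \<oplus>\<^bsub>sec X U'\<^esub> v U' (finsum (sec X U') f F)"
      using c insert.hyps vfD(2)[OF assms(1-3)] by (simp add: R.finsum_insert R.finsum_closed)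
    also have "\<dots> = (\<Oplus>\<^bsub>sec X U'\<^esub>i\<in>insert x F. v U' (f i))"
      using c insert by (simp add: R.finsum_insert)
    finally show ?case .
  qed (use vf_zero[OF assms(1-3)] in auto)
qed

lemma vf_add_in:
  assumes v: "v \<in> vfields \<Lambda> X U a" and w: "w \<in> vfields \<Lambda> X U a"
  shows "vf_add X U v w \<in> vfields \<Lambda> X U a"
  unfolding vf_add_def
proof (rule vf_mkI, goal_cases)
  case (2 U' f g)
  interpret R: superalg "sec X U'" by (rule sec_superalg[OF 2(1)])
  show ?case using 2 vfD(1,2)[OF v 2(1,2)] vfD(1,2)[OF w 2(1,2)] by (simp add: R.a_ac)
next
  case (3 U' f b)
  interpret R: superalg "sec X U'" by (rule sec_superalg[OF 3(1)])
  show ?case using 3 vfD(3)[OF v 3(1,2)] vfD(3)[OF w 3(1,2)] by blast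
next
  case (4 U' f g b)
  interpret R: superalg "sec X U'" by (rule sec_superalg[OF 4(1)])
  have "f \<in> sc U'" using 4 by simp
  then show ?case using 4 vfD(1,4)[OF v 4(1,2)] vfD(1,4)[OF w 4(1,2)] 
    by (simp add: R.a_ac R.sg_add R.l_distr R.r_distr)
next
  case (5 U' l)
  interpret R: superalg "sec X U'" by (rule sec_superalg[OF 5(1)])
  show ?case using 5 vfD(5)[OF v 5(1,2)] vfD(5)[OF w 5(1,2)] by simp
next
  case (6 U' U'' f)
  then show ?case using vfD(1,6)[OF v 6(1,2)] vfD(1,6)[OF w 6(1,2)]
    by (simp add: superalg_hom.h_add[OF res_hom])
next
  case (1 U' f)
  interpret R: superalg "sec X U'" by (rule sec_superalg[OF 1(1)])
  show ?case using 1 vfD(1)[OF v 1(1,2)] vfD(1)[OF w 1(1,2)] by simp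
qed

lemma vf_smult_in:
  assumes U: "op U" and r: "r \<in> gr (sec X U) c" and v: "v \<in> vfields \<Lambda> X U a" 
  shows "vf_smult X U r v \<in> vfields \<Lambda> X U (c \<noteq> a)"
  unfolding vf_smult_def
proof (rule vf_mkI, goal_cases)
  case (2 U' f g)
  interpret R: superalg "sec X U'" by (rule sec_superalg[OF 2(1)])
  have "res X U U' r \<in> sc U'" using 2 U r by (meson R.gr_closed res_gr)
  then show ?case using 2 vfD(1,2)[OF v 2(1,2)] by (simp add: R.r_distr)
next
  case (3 U' f b)
  interpret R: superalg "sec X U'" by (rule sec_superalg[OF 3(1)])
  have "res X U U' r \<in> gr (sec X U') c" using 3 U r by simp
  then show ?case by (rule R.gr_mult'[OF _ vfD(3)[OF v 3]]) auto
next
  case (4 U' f g b)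
  interpret R: superalg "sec X U'" by (rule sec_superalg[OF 4(1)])
  let ?r = "res X U U' r"
  have r': "?r \<in> gr (sec X U') c" using 4 U r by simp
  have f: "f \<in> sc U'" "?r \<in> sc U'" "v U' f \<in> sc U'" "v U' g \<in> sc U'" using 4 r' vfD(1)[OF v 4(1,2)] by auto
  have "?r \<otimes>\<^bsub>sec X U'\<^esub> (f \<otimes>\<^bsub>sec X U'\<^esub> v U' g) = (?r \<otimes>\<^bsub>sec X U'\<^esub> f) \<otimes>\<^bsub>sec X U'\<^esub> v U' g"
    using f by (simp add: R.m_assoc)
  also have "?r \<otimes>\<^bsub>sec X U'\<^esub> f = sg (sec X U') (c \<and> b) (f \<otimes>\<^bsub>sec X U'\<^esub> ?r)"
    by (rule R.supercomm[OF r' 4(3)])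
  finally have "?r \<otimes>\<^bsub>sec X U'\<^esub> (f \<otimes>\<^bsub>sec X U'\<^esub> v U' g) 
      = sg (sec X U') (c \<and> b) (f \<otimes>\<^bsub>sec X U'\<^esub> (?r \<otimes>\<^bsub>sec X U'\<^esub> v U' g))"
    using f by (simp add: R.sg_mult_l R.m_assoc)
  moreover have "(a \<and> b) \<noteq> (c \<and> b) \<longleftrightarrow> (c \<noteq> a) \<and> b" by auto
  ultimately show ?case using 4 f vfD(4)[OF v 4(1-4)] 
    by (simp add: R.r_distr R.sg_mult_r R.m_assoc)
next
  case (5 U' l)
  interpret R: superalg "sec X U'" by (rule sec_superalg[OF 5(1)])
  have "res X U U' r \<in> sc U'" using 5 U r by (meson R.gr_closed res_gr)
  then show ?case using 5 vfD(5)[OF v 5(1,2)] by simp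
next
  case (6 U' U'' f)
  interpret R: superalg "sec X U" by (rule sec_superalg[OF U])
  have "r \<in> sc U" using r by simp
  then show ?case using 6 U vfD(1,6)[OF v 6(1,2)]
    by (simp add: superalg_hom.h_mult[OF res_hom] res_res)
next
  case (1 U' f)
  interpret R: superalg "sec X U'" by (rule sec_superalg[OF 1(1)])
  have "res X U U' r \<in> sc U'" using 1 U r by (meson R.gr_closed res_gr)
  then show ?case using 1 vfD(1)[OF v 1(1,2)] by simp
qed

text \<open>The Leibniz rule holds because the mixed terms, in which the two fields act on different factors,
  occur with the same sign in both terms of the supercommutator.\<close>

lemma vf_bracket_in:
  assumes v: "v \<in> vfields \<Lambda> X U a" and w: "w \<in> vfields \<Lambda> X U b"
  shows "vf_bracket X U a v b w \<in> vfields \<Lambda> X U (a \<noteq> b)"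
  unfolding vf_bracket_def
proof (rule vf_mkI, goal_cases)
  case (1 U' f)
  interpret R: superalg "sec X U'" by (rule sec_superalg[OF 1(1)])
  show ?case using 1 vfD(1)[OF v 1(1,2)] vfD(1)[OF w 1(1,2)] by simp
next
  case (2 U' f g)
  interpret R: superalg "sec X U'" by (rule sec_superalg[OF 2(1)])
  show ?case using 2 vfD(1,2)[OF v 2(1,2)] vfD(1,2)[OF w 2(1,2)] 
    by (simp add: R.minus_eq R.sg_add R.minus_add R.a_ac)
next
  case (3 U' f c)
  interpret R: superalg "sec X U'" by (rule sec_superalg[OF 3(1)])
  have "v U' (w U' f) \<in> gr (sec X U') (a \<noteq> (b \<noteq> c))" "w U' (v U' f) \<in> gr (sec X U') (b \<noteq> (a \<noteq> c))"
    using 3 vfD(3)[OF v 3(1,2)] vfD(3)[OF w 3(1,2)] by blast+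
  moreover have "(a \<noteq> (b \<noteq> c)) = ((a \<noteq> b) \<noteq> c)" "(b \<noteq> (a \<noteq> c)) = ((a \<noteq> b) \<noteq> c)" by auto
  ultimately show ?case by (intro R.gr_minus R.sg_gr) simp_all
next
  case (4 U' f g c)
  interpret R: superalg "sec X U'" by (rule sec_superalg[OF 4(1)])
  let ?m = "\<lambda>x y. x \<otimes>\<^bsub>sec X U'\<^esub> y" and ?s = "sg (sec X U')" and ?v = "v U'" and ?w = "w U'"
  have f: "f \<in> sc U'" using 4 by simp
  note g = 4(4)
  have cl: "?v x \<in> sc U'" "?w x \<in> sc U'" if "x \<in> sc U'" for x
    using that vfD(1)[OF v 4(1,2)] vfD(1)[OF w 4(1,2)] by auto
  have wf: "?w f \<in> gr (sec X U') (b \<noteq> c)" and vf: "?v f \<in> gr (sec X U') (a \<noteq> c)"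
    using vfD(3)[OF v 4(1,2)] vfD(3)[OF w 4(1,2)] 4 by blast+
  have A: "?v (?w (?m f g)) = (?m (?v (?w f)) g \<oplus>\<^bsub>sec X U'\<^esub> ?s (a \<and> (b \<noteq> c)) (?m (?w f) (?v g)))
      \<oplus>\<^bsub>sec X U'\<^esub> (?s (b \<and> c) (?m (?v f) (?w g)) \<oplus>\<^bsub>sec X U'\<^esub> ?s ((b \<and> c) \<noteq> (a \<and> c)) (?m f (?v (?w g))))"
    unfolding vfD(4)[OF w 4(1-4)] using f g cl
    by (simp add: vfD(2)[OF v 4(1,2)] vf_sg[OF v 4(1,2)] vfD(4)[OF v 4(1,2) wf] vfD(4)[OF v 4(1-3)] R.sg_add)
  have B: "?w (?v (?m f g)) = (?m (?w (?v f)) g \<oplus>\<^bsub>sec X U'\<^esub> ?s (b \<and> (a \<noteq> c)) (?m (?v f) (?w g)))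
      \<oplus>\<^bsub>sec X U'\<^esub> (?s (a \<and> c) (?m (?w f) (?v g)) \<oplus>\<^bsub>sec X U'\<^esub> ?s ((a \<and> c) \<noteq> (b \<and> c)) (?m f (?w (?v g))))"
    unfolding vfD(4)[OF v 4(1-4)] using f g cl
    by (simp add: vfD(2)[OF w 4(1,2)] vf_sg[OF w 4(1,2)] vfD(4)[OF w 4(1,2) vf] vfD(4)[OF w 4(1-3)] R.sg_add)
  have C: "?s (a \<and> b) (?w (?v (?m f g))) = (?s (a \<and> b) (?m (?w (?v f)) g) \<oplus>\<^bsub>sec X U'\<^esub> ?s (b \<and> c) (?m (?v f) (?w g)))
      \<oplus>\<^bsub>sec X U'\<^esub> (?s (a \<and> (b \<noteq> c)) (?m (?w f) (?v g)) \<oplus>\<^bsub>sec X U'\<^esub> 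
        ?s ((a \<and> b) \<noteq> ((a \<and> c) \<noteq> (b \<and> c))) (?m f (?w (?v g))))"
    unfolding B using f g cl by (cases a; cases b; cases c) (simp_all add: R.sg_add)
  have "?v (?w (?m f g)) \<ominus>\<^bsub>sec X U'\<^esub> ?s (a \<and> b) (?w (?v (?m f g))) 
    = (?m (?v (?w f)) g \<oplus>\<^bsub>sec X U'\<^esub> \<ominus>\<^bsub>sec X U'\<^esub> ?s (a \<and> b) (?m (?w (?v f)) g)) \<oplus>\<^bsub>sec X U'\<^esub> 
      (?s ((b \<and> c) \<noteq> (a \<and> c)) (?m f (?v (?w g))) \<oplus>\<^bsub>sec X U'\<^esub> 
       \<ominus>\<^bsub>sec X U'\<^esub> ?s ((a \<and> b) \<noteq> ((a \<and> c) \<noteq> (b \<and> c))) (?m f (?w (?v g))))"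
    unfolding R.minus_eq A C using f g cl by (intro R.commutator_rearrange) auto
  also have "\<dots> = ?m (?v (?w f) \<ominus>\<^bsub>sec X U'\<^esub> ?s (a \<and> b) (?w (?v f))) g \<oplus>\<^bsub>sec X U'\<^esub>
     ?s ((a \<noteq> b) \<and> c) (?m f (?v (?w g) \<ominus>\<^bsub>sec X U'\<^esub> ?s (a \<and> b) (?w (?v g))))"
    using f g cl by (cases a; cases b; cases c)
      (simp_all add: R.minus_eq R.l_distr R.r_distr R.sg_add R.sg_mult_l R.sg_mult_r R.l_minus R.r_minus R.sg_neg)
  finally show ?case .
next
  case (5 U' l)
  interpret R: superalg "sec X U'" by (rule sec_superalg[OF 5(1)])
  show ?case using 5 vfD(5)[OF v 5(1,2)] vfD(5)[OF w 5(1,2)] vf_zero[OF v 5(1,2)] vf_zero[OF w 5(1,2)] 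
    by (simp add: R.minus_eq)
next
  case (6 U' U'' f)
  interpret r: superalg_hom "sec X U'" "sec X U''" "res X U' U''" by (rule res_hom) (use 6 in auto)
  show ?case using 6 vfD(1,6)[OF v 6(1,2)] vfD(1,6)[OF w 6(1,2)] by (simp add: r.h_minus r.h_sg)
qed

lemma vf_res_in:
  assumes v: "v \<in> vfields \<Lambda> X U a" and V: "op V" "V \<subseteq> U"
  shows "vf_res V v \<in> vfields \<Lambda> X V a"
proof -
  have "vf_res V v = vf_mk X V v"
    unfolding vf_res_def vf_mk_def using vf_outside[OF v] by (intro ext) (auto simp: restrict_def)
  moreover have "vf_mk X V v \<in> vfields \<Lambda> X V a"
  proof (rule vf_mkI)
    fix U' assume "op U'" "U' \<subseteq> V"
    then have o: "op U'" "U' \<subseteq> U" using V by auto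
    note d = vfD[OF v o]
    show "f \<in> sc U' \<Longrightarrow> v U' f \<in> sc U'" for f by (rule d(1))
    show "f \<in> sc U' \<Longrightarrow> g \<in> sc U' \<Longrightarrow> v U' (f \<oplus>\<^bsub>sec X U'\<^esub> g) = v U' f \<oplus>\<^bsub>sec X U'\<^esub> v U' g" for f g
      by (rule d(2))
    show "f \<in> gr (sec X U') b \<Longrightarrow> v U' f \<in> gr (sec X U') (a \<noteq> b)" for f b by (rule d(3))
    show "f \<in> gr (sec X U') b \<Longrightarrow> g \<in> sc U' \<Longrightarrow> v U' (f \<otimes>\<^bsub>sec X U'\<^esub> g) =
      (v U' f \<otimes>\<^bsub>sec X U'\<^esub> g) \<oplus>\<^bsub>sec X U'\<^esub> sg (sec X U') (a \<and> b) (f \<otimes>\<^bsub>sec X U'\<^esub> v U' g)" for f g b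
      by (rule d(4))
    show "l \<in> carrier \<Lambda> \<Longrightarrow> v U' (scal X U' l) = \<zero>\<^bsub>sec X U'\<^esub>" for l by (rule d(5))
    show "op U'' \<Longrightarrow> U'' \<subseteq> U' \<Longrightarrow> f \<in> sc U' \<Longrightarrow> res X U' U'' (v U' f) = v U'' (res X U' U'' f)" for U'' f
      by (rule d(6))
  qed
  ultimately show ?thesis by simp
qed

lemma vf_res_apply: "U' \<subseteq> V \<Longrightarrow> vf_res V v U' = v U'"
  by (simp add: vf_res_def)

end

section \<open>Flat connections on the free module\<close>

text \<open>In the anticommutator of two covariant derivatives, \<open>p\<close> and \<open>q\<close> are the terms in which one field
  differentiates the section and the other one enters through the connection form.\<close>

lemma (in abelian_group) curvature_rearrange:
  assumes "x \<in> carrier G" "e \<in> carrier G" "p \<in> carrier G" "q \<in> carrier G" "g \<in> carrier G"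
    "x' \<in> carrier G" "e' \<in> carrier G" "g' \<in> carrier G"
  shows "(x \<oplus> ((e \<oplus> \<ominus> p) \<oplus> (q \<oplus> g))) \<oplus> (x' \<oplus> ((e' \<oplus> \<ominus> q) \<oplus> (p \<oplus> g'))) 
    = (x \<oplus> x') \<oplus> ((e \<oplus> e') \<oplus> (g \<oplus> g'))"
proof -
  have "(x \<oplus> ((e \<oplus> \<ominus> p) \<oplus> (q \<oplus> g))) \<oplus> (x' \<oplus> ((e' \<oplus> \<ominus> q) \<oplus> (p \<oplus> g'))) 
    = ((x \<oplus> x') \<oplus> ((e \<oplus> e') \<oplus> (g \<oplus> g'))) \<oplus> ((p \<oplus> \<ominus> p) \<oplus> (q \<oplus> \<ominus> q))"
    using assms by (simp add: a_ac)
  then show ?thesis using assms by (simp add: r_neg)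
qed

text \<open>The covariant derivative for \<open>d + \<omega>\<close>. The sign is that of moving the vector field past the \<open>k\<close>-th
  basis vector.\<close>

definition cov :: "('x, 'a, 'l) superspace \<Rightarrow> nat \<Rightarrow> nat \<Rightarrow> ('x, 'a) mform \<Rightarrow> 'x set \<Rightarrow> bool \<Rightarrow> 
    ('x, 'a) vfield \<Rightarrow> (nat \<Rightarrow> 'a) \<Rightarrow> nat \<Rightarrow> 'a" where
  "cov X p q \<omega> U a v s = (\<lambda>k\<in>{..<p + q}. sg (sec X U) (a \<and> p \<le> k) (v U (s k)) \<oplus>\<^bsub>sec X U\<^esub>
       (\<Oplus>\<^bsub>sec X U\<^esub>l\<in>{..<p + q}. \<omega> U a v k l \<otimes>\<^bsub>sec X U\<^esub> s l))"

text \<open>The left multiplication of a column by an odd function \<open>t\<close>, which also has to move past the basis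
  vectors.\<close>

definition theta_mult :: "('a, 'r) ring_scheme \<Rightarrow> nat \<Rightarrow> nat \<Rightarrow> 'a \<Rightarrow> (nat \<Rightarrow> 'a) \<Rightarrow> nat \<Rightarrow> 'a" where
  "theta_mult R p q t s = (\<lambda>k\<in>{..<p + q}. sg R (p \<le> k) (t \<otimes>\<^bsub>R\<^esub> s k))"

locale flat_conn = sspace \<Lambda> X for \<Lambda> :: "'l base_alg" and X :: "('x, 'a, 'l) superspace" +
  fixes p q :: nat and \<omega> :: "('x, 'a) mform"
  assumes flat: "\<omega> \<in> flat_forms X (vfields \<Lambda> X) p q (topspace (tsp X))"
begin

abbreviation n :: nat where "n \<equiv> p + q"
abbreviation D :: "'x set \<Rightarrow> bool \<Rightarrow> ('x, 'a) vfield \<Rightarrow> (nat \<Rightarrow> 'a) \<Rightarrow> nat \<Rightarrow> 'a" where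
  "D \<equiv> cov X p q \<omega>"
abbreviation cols :: "'x set \<Rightarrow> (nat \<Rightarrow> 'a) set" where
  "cols U \<equiv> {..<p + q} \<rightarrow>\<^sub>E sc U"
abbreviation rcol :: "'x set \<Rightarrow> 'x set \<Rightarrow> (nat \<Rightarrow> 'a) \<Rightarrow> nat \<Rightarrow> 'a" where
  "rcol U V s \<equiv> (\<lambda>k\<in>{..<p + q}. res X U V (s k))"

lemma op_top: "op U \<Longrightarrow> U \<subseteq> topspace (tsp X)"
  by (rule openin_subset)

lemma formD:
  assumes "op U" "v \<in> vfields \<Lambda> X U a"
  shows "\<omega> U a v \<in> smat (sec X U) p q a"
    and "w \<in> vfields \<Lambda> X U a \<Longrightarrow> \<omega> U a (vf_add X U v w) = mat_add (sec X U) (p + q) (\<omega> U a v) (\<omega> U a w)"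
    and "f \<in> gr (sec X U) b \<Longrightarrow> \<omega> U (b \<noteq> a) (vf_smult X U f v) = mat_smult (sec X U) p q b f (\<omega> U a v)"
    and "op V \<Longrightarrow> V \<subseteq> U \<Longrightarrow> \<omega> V a (vf_res V v) = mat_res X (p + q) U V (\<omega> U a v)"
proof -
  have "\<omega> \<in> one_forms X (vfields \<Lambda> X) p q (topspace (tsp X))" using flat by (simp add: flat_forms_def)
  then have *: "\<omega> U a v \<in> smat (sec X U) p q a \<and>
      (\<forall>w\<in>vfields \<Lambda> X U a. \<omega> U a (vf_add X U v w) = mat_add (sec X U) (p + q) (\<omega> U a v) (\<omega> U a w)) \<and>
      (\<forall>b. \<forall>f\<in>gr (sec X U) b.
         \<omega> U (b \<noteq> a) (vf_smult X U f v) = mat_smult (sec X U) p q b f (\<omega> U a v)) \<and>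
      (\<forall>U''. sub_open (tsp X) U'' U \<longrightarrow>
         \<omega> U'' a (vf_res U'' v) = mat_res X (p + q) U U'' (\<omega> U a v))"
    using assms op_top[OF assms(1)] unfolding one_forms_def by (simp add: sub_open_def)
  show "\<omega> U a v \<in> smat (sec X U) p q a" using * by blast
  show "w \<in> vfields \<Lambda> X U a \<Longrightarrow> \<omega> U a (vf_add X U v w) = mat_add (sec X U) (p + q) (\<omega> U a v) (\<omega> U a w)"
    using * by blast
  show "f \<in> gr (sec X U) b \<Longrightarrow> \<omega> U (b \<noteq> a) (vf_smult X U f v) = mat_smult (sec X U) p q b f (\<omega> U a v)"
    using * by blast
  show "op V \<Longrightarrow> V \<subseteq> U \<Longrightarrow> \<omega> V a (vf_res V v) = mat_res X (p + q) U V (\<omega> U a v)"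
    using * by (simp add: sub_open_def)
qed

lemma form_entry:
  assumes "op U" "v \<in> vfields \<Lambda> X U a" "k < p + q" "l < p + q"
  shows "\<omega> U a v k l \<in> gr (sec X U) (a \<noteq> ((p \<le> k) \<noteq> (p \<le> l)))" "\<omega> U a v k l \<in> sc U"
proof -
  show "\<omega> U a v k l \<in> gr (sec X U) (a \<noteq> ((p \<le> k) \<noteq> (p \<le> l)))"
    by (rule smatD[OF formD(1)[OF assms(1,2)] assms(3,4)])
  then show "\<omega> U a v k l \<in> sc U" by (rule superalg.gr_closed[OF sec_superalg[OF assms(1)]])
qed

lemma flatD:
  assumes "op U" "v \<in> vfields \<Lambda> X U a" "w \<in> vfields \<Lambda> X U b"
  shows "mat_add (sec X U) (p + q) (d_form X p q \<omega> U a v b w) (wedge_form X p q \<omega> U a v b w)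
         = mat_zero (sec X U) (p + q)"
  using flat assms op_top[OF assms(1)] unfolding flat_forms_def by (simp add: sub_open_def)

text \<open>A form is additive, and \<open>z + z = z\<close>.\<close>

lemma form_of_zero_field:
  assumes U: "op U" and z: "z \<in> vfields \<Lambda> X U a" 
    and zero: "\<And>U' f. op U' \<Longrightarrow> U' \<subseteq> U \<Longrightarrow> f \<in> sc U' \<Longrightarrow> z U' f = \<zero>\<^bsub>sec X U'\<^esub>"
    and kl: "k < p + q" "l < p + q"
  shows "\<omega> U a z k l = \<zero>\<^bsub>sec X U\<^esub>"
proof -
  interpret R: superalg "sec X U" by (rule sec_superalg[OF U])
  have "vf_add X U z z = z"
  proof (rule vf_eqI[OF vf_add_in[OF z z] z])
    fix U' f assume a: "op U'" "U' \<subseteq> U" "f \<in> sc U'"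
    interpret R': superalg "sec X U'" by (rule sec_superalg[OF a(1)])
    show "vf_add X U z z U' f = z U' f" using a zero by (simp add: vf_add_def vf_mk_apply)
  qed
  then have "\<omega> U a z k l = \<omega> U a z k l \<oplus>\<^bsub>sec X U\<^esub> \<omega> U a z k l"
    using formD(2)[OF U z z] kl by (metis (mono_tags, lifting) mat_add_def mk_mat_simps)
  then show ?thesis using form_entry(2)[OF U z kl] by simp
qed

lemma D_entry: "k < p + q \<Longrightarrow> D U a v s k = sg (sec X U) (a \<and> p \<le> k) (v U (s k)) \<oplus>\<^bsub>sec X U\<^esub>
       (\<Oplus>\<^bsub>sec X U\<^esub>l\<in>{..<p + q}. \<omega> U a v k l \<otimes>\<^bsub>sec X U\<^esub> s l)"
  by (simp add: cov_def)

lemma D_closed: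
  assumes U: "op U" and v: "v \<in> vfields \<Lambda> X U a" and s: "s \<in> cols U"
  shows "D U a v s \<in> cols U"
proof -
  interpret R: superalg "sec X U" by (rule sec_superalg[OF U])
  have "s k \<in> sc U" if "k < p + q" for k using s that by auto
  then show ?thesis unfolding cov_def using form_entry(2)[OF U v] vfD(1)[OF v U order.refl]
    by (auto intro!: R.a_closed R.finsum_closed)
qed

lemma D_gr:
  assumes U: "op U" and v: "v \<in> vfields \<Lambda> X U a" 
    and s: "\<And>k. k < p + q \<Longrightarrow> s k \<in> gr (sec X U) (b \<noteq> (p \<le> k))" and k: "k < p + q"
  shows "D U a v s k \<in> gr (sec X U) ((a \<noteq> b) \<noteq> (p \<le> k))"
proof -
  interpret R: superalg "sec X U" by (rule sec_superalg[OF U])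
  have "v U (s k) \<in> gr (sec X U) ((a \<noteq> b) \<noteq> (p \<le> k))"
    using vfD(3)[OF v U order.refl s[OF k]] by (cases a; cases b) auto
  moreover have "(\<Oplus>\<^bsub>sec X U\<^esub>l\<in>{..<p + q}. \<omega> U a v k l \<otimes>\<^bsub>sec X U\<^esub> s l) \<in> gr (sec X U) ((a \<noteq> b) \<noteq> (p \<le> k))"
  proof (rule R.gr_finsum)
    fix l assume "l \<in> {..<p + q}"
    then have l: "l < p + q" by simp
    show "\<omega> U a v k l \<otimes>\<^bsub>sec X U\<^esub> s l \<in> gr (sec X U) ((a \<noteq> b) \<noteq> (p \<le> k))"
      by (rule R.gr_mult'[OF form_entry(1)[OF U v k l] s[OF l]]) auto
  qed
  ultimately show ?thesis unfolding D_entry[OF k] by (intro R.gr_add R.sg_gr)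
qed

lemma D_add:
  assumes U: "op U" and v: "v \<in> vfields \<Lambda> X U a" and s: "s \<in> cols U" "s' \<in> cols U" and k: "k < p + q"
  shows "D U a v (\<lambda>k\<in>{..<p + q}. s k \<oplus>\<^bsub>sec X U\<^esub> s' k) k = D U a v s k \<oplus>\<^bsub>sec X U\<^esub> D U a v s' k"
proof -
  interpret R: superalg "sec X U" by (rule sec_superalg[OF U])
  have c: "s k \<in> sc U" "s' k \<in> sc U" if "k < p + q" for k using s that by auto
  note w = form_entry(2)[OF U v k]
  have "(\<Oplus>\<^bsub>sec X U\<^esub>l\<in>{..<p + q}. \<omega> U a v k l \<otimes>\<^bsub>sec X U\<^esub> (\<lambda>k\<in>{..<p + q}. s k \<oplus>\<^bsub>sec X U\<^esub> s' k) l)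
    = (\<Oplus>\<^bsub>sec X U\<^esub>l\<in>{..<p + q}. \<omega> U a v k l \<otimes>\<^bsub>sec X U\<^esub> s l \<oplus>\<^bsub>sec X U\<^esub> \<omega> U a v k l \<otimes>\<^bsub>sec X U\<^esub> s' l)"
    using c w by (intro R.finsum_cong') (auto simp: R.r_distr)
  also have "\<dots> = (\<Oplus>\<^bsub>sec X U\<^esub>l\<in>{..<p + q}. \<omega> U a v k l \<otimes>\<^bsub>sec X U\<^esub> s l) \<oplus>\<^bsub>sec X U\<^esub> 
      (\<Oplus>\<^bsub>sec X U\<^esub>l\<in>{..<p + q}. \<omega> U a v k l \<otimes>\<^bsub>sec X U\<^esub> s' l)"
    using c w by (intro R.finsum_addf) auto
  finally show ?thesis
    using c[OF k] vfD(1,2)[OF v U order.refl] k w c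
    by (simp add: D_entry R.sg_add R.a_ac R.finsum_closed Pi_def)
qed

lemma D_zero:
  assumes U: "op U" and v: "v \<in> vfields \<Lambda> X U a" and k: "k < p + q"
  shows "D U a v (\<lambda>k\<in>{..<p + q}. \<zero>\<^bsub>sec X U\<^esub>) k = \<zero>\<^bsub>sec X U\<^esub>"
proof -
  interpret R: superalg "sec X U" by (rule sec_superalg[OF U])
  have "(\<Oplus>\<^bsub>sec X U\<^esub>l\<in>{..<p + q}. \<omega> U a v k l \<otimes>\<^bsub>sec X U\<^esub> (\<lambda>k\<in>{..<p + q}. \<zero>\<^bsub>sec X U\<^esub>) l)
      = (\<Oplus>\<^bsub>sec X U\<^esub>l\<in>{..<p + q}. \<zero>\<^bsub>sec X U\<^esub>)"
    using form_entry(2)[OF U v k] by (intro R.finsum_cong') auto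
  then show ?thesis using k vf_zero[OF v U order.refl] by (simp add: D_entry)
qed

lemma D_res:
  assumes U: "op U" and V: "op V" "V \<subseteq> U" and v: "v \<in> vfields \<Lambda> X U a" and s: "s \<in> cols U"
  shows "D V a (vf_res V v) (rcol U V s) = rcol U V (D U a v s)"
proof -
  interpret r: superalg_hom "sec X U" "sec X V" "res X U V" by (rule res_hom[OF U V])
  have c: "s k \<in> sc U" if "k < p + q" for k using s that by auto
  have "D V a (vf_res V v) (rcol U V s) k = rcol U V (D U a v s) k" if k: "k < p + q" for k
  proof -
    note w = form_entry(2)[OF U v k]
    have "(\<Oplus>\<^bsub>sec X V\<^esub>l\<in>{..<p + q}. \<omega> V a (vf_res V v) k l \<otimes>\<^bsub>sec X V\<^esub> rcol U V s l)
        = res X U V (\<Oplus>\<^bsub>sec X U\<^esub>l\<in>{..<p + q}. \<omega> U a v k l \<otimes>\<^bsub>sec X U\<^esub> s l)"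
      unfolding formD(4)[OF U v V] using c w k
      by (subst r.h_finsum) (auto simp: r.h_mult mat_res_simps intro!: r.R.finsum_cong')
    then show ?thesis using k c[OF k] c w vfD(1)[OF v U order.refl] 
      by (simp add: D_entry r.h_add r.h_sg vfD(6)[OF v U order.refl V] vf_res_apply r.C.finsum_closed Pi_def)
  qed
  then show ?thesis by (intro ext) (auto simp: cov_def)
qed

lemma D_vf_add:
  assumes U: "op U" and v: "v \<in> vfields \<Lambda> X U a" and w: "w \<in> vfields \<Lambda> X U a" and s: "s \<in> cols U" and k: "k < p + q"
  shows "D U a (vf_add X U v w) s k = D U a v s k \<oplus>\<^bsub>sec X U\<^esub> D U a w s k"
proof -
  interpret R: superalg "sec X U" by (rule sec_superalg[OF U])
  have c: "s k \<in> sc U" if "k < p + q" for k using s that by auto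
  note e = form_entry(2)[OF U v k] form_entry(2)[OF U w k]
  have "(\<Oplus>\<^bsub>sec X U\<^esub>l\<in>{..<p + q}. \<omega> U a (vf_add X U v w) k l \<otimes>\<^bsub>sec X U\<^esub> s l)
    = (\<Oplus>\<^bsub>sec X U\<^esub>l\<in>{..<p + q}. \<omega> U a v k l \<otimes>\<^bsub>sec X U\<^esub> s l \<oplus>\<^bsub>sec X U\<^esub> \<omega> U a w k l \<otimes>\<^bsub>sec X U\<^esub> s l)"
    unfolding formD(2)[OF U v w] using c e k by (intro R.finsum_cong') (auto simp: R.l_distr mat_add_def)
  also have "\<dots> = (\<Oplus>\<^bsub>sec X U\<^esub>l\<in>{..<p + q}. \<omega> U a v k l \<otimes>\<^bsub>sec X U\<^esub> s l) \<oplus>\<^bsub>sec X U\<^esub> 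
      (\<Oplus>\<^bsub>sec X U\<^esub>l\<in>{..<p + q}. \<omega> U a w k l \<otimes>\<^bsub>sec X U\<^esub> s l)"
    using c e by (intro R.finsum_addf) auto
  finally show ?thesis
    using c[OF k] vfD(1)[OF v U order.refl] vfD(1)[OF w U order.refl] k e c U
    by (simp add: D_entry vf_add_def vf_mk_apply R.sg_add R.a_ac R.finsum_closed Pi_def)
qed

lemma D_vf_smult:
  assumes U: "op U" and v: "v \<in> vfields \<Lambda> X U a" and f: "f \<in> gr (sec X U) b" and s: "s \<in> cols U" and k: "k < p + q"
  shows "D U (b \<noteq> a) (vf_smult X U f v) s k = sg (sec X U) (b \<and> p \<le> k) (f \<otimes>\<^bsub>sec X U\<^esub> D U a v s k)"
proof -
  interpret R: superalg "sec X U" by (rule sec_superalg[OF U])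
  have c: "s k \<in> sc U" if "k < p + q" for k using s that by auto
  have f': "f \<in> sc U" using f by simp
  note e = form_entry(2)[OF U v k]
  let ?S = "(\<Oplus>\<^bsub>sec X U\<^esub>l\<in>{..<p + q}. \<omega> U a v k l \<otimes>\<^bsub>sec X U\<^esub> s l)"
  have S: "?S \<in> sc U" using c e by (auto intro!: R.finsum_closed)
  have "(\<Oplus>\<^bsub>sec X U\<^esub>l\<in>{..<p + q}. \<omega> U (b \<noteq> a) (vf_smult X U f v) k l \<otimes>\<^bsub>sec X U\<^esub> s l)
    = (\<Oplus>\<^bsub>sec X U\<^esub>l\<in>{..<p + q}. sg (sec X U) (b \<and> p \<le> k) f \<otimes>\<^bsub>sec X U\<^esub> (\<omega> U a v k l \<otimes>\<^bsub>sec X U\<^esub> s l))"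
    unfolding formD(3)[OF U v f] using c e k f' 
    by (intro R.finsum_cong') (auto simp: R.m_assoc R.sg_mult_l mat_smult_def)
  also have "\<dots> = sg (sec X U) (b \<and> p \<le> k) f \<otimes>\<^bsub>sec X U\<^esub> ?S"
    using c e f' by (intro R.finsum_rdistr[symmetric]) auto
  finally have 1: "(\<Oplus>\<^bsub>sec X U\<^esub>l\<in>{..<p + q}. \<omega> U (b \<noteq> a) (vf_smult X U f v) k l \<otimes>\<^bsub>sec X U\<^esub> s l)
     = sg (sec X U) (b \<and> p \<le> k) (f \<otimes>\<^bsub>sec X U\<^esub> ?S)" using f' S by (simp add: R.sg_mult_l)
  have 2: "vf_smult X U f v U (s k) = f \<otimes>\<^bsub>sec X U\<^esub> v U (s k)"
    using U c[OF k] f' by (simp add: vf_smult_def vf_mk_apply res_id)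
  have 3: "((b \<noteq> a) \<and> p \<le> k) = ((b \<and> p \<le> k) \<noteq> (a \<and> p \<le> k))" by auto
  have vc: "v U (s k) \<in> sc U" using vfD(1)[OF v U order.refl] c[OF k] by simp
  show ?thesis unfolding D_entry[OF k] 1 2 3 using f' S vc
    by (simp add: R.r_distr R.sg_add R.sg_mult_r)
qed

text \<open>The rule \<open>D\<^sub>v t + t D\<^sub>v = v(t)\<close> for left multiplication by \<open>t\<close>: the connection form is odd as an
  endomorphism and anticommutes with \<open>t\<close>.\<close>

lemma D_theta_mult:
  assumes U: "op U" and v: "v \<in> vfields \<Lambda> X U True" and t: "t \<in> gr (sec X U) True" and s: "s \<in> cols U" and k: "k < p + q"
  shows "D U True v (theta_mult (sec X U) p q t s) k = 
    v U t \<otimes>\<^bsub>sec X U\<^esub> s k \<ominus>\<^bsub>sec X U\<^esub> theta_mult (sec X U) p q t (D U True v s) k"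
proof -
  interpret R: superalg "sec X U" by (rule sec_superalg[OF U])
  have c: "s k \<in> sc U" if "k < p + q" for k using s that by auto
  have t': "t \<in> sc U" using t by simp
  note e = form_entry(2)[OF U v k]
  let ?S = "(\<Oplus>\<^bsub>sec X U\<^esub>l\<in>{..<p + q}. \<omega> U True v k l \<otimes>\<^bsub>sec X U\<^esub> s l)"
  have S: "?S \<in> sc U" using c e by (auto intro!: R.finsum_closed)
  have tm: "\<omega> U True v k l \<otimes>\<^bsub>sec X U\<^esub> theta_mult (sec X U) p q t s l 
      = sg (sec X U) (\<not> p \<le> k) t \<otimes>\<^bsub>sec X U\<^esub> (\<omega> U True v k l \<otimes>\<^bsub>sec X U\<^esub> s l)" if l: "l < p + q" for l
  proof -
    have "\<omega> U True v k l \<otimes>\<^bsub>sec X U\<^esub> t = sg (sec X U) ((True \<noteq> ((p \<le> k) \<noteq> (p \<le> l))) \<and> True) (t \<otimes>\<^bsub>sec X U\<^esub> \<omega> U True v k l)"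
      by (rule R.supercomm[OF form_entry(1)[OF U v k l] t])
    then have *: "(\<omega> U True v k l \<otimes>\<^bsub>sec X U\<^esub> t) \<otimes>\<^bsub>sec X U\<^esub> s l = 
        sg (sec X U) (True \<noteq> ((p \<le> k) \<noteq> (p \<le> l))) (t \<otimes>\<^bsub>sec X U\<^esub> (\<omega> U True v k l \<otimes>\<^bsub>sec X U\<^esub> s l))"
      using t' c[OF l] e[OF l] by (simp add: R.sg_mult_l R.m_assoc)
    have "\<omega> U True v k l \<otimes>\<^bsub>sec X U\<^esub> theta_mult (sec X U) p q t s l
       = sg (sec X U) (p \<le> l) ((\<omega> U True v k l \<otimes>\<^bsub>sec X U\<^esub> t) \<otimes>\<^bsub>sec X U\<^esub> s l)"
      using t' c[OF l] e[OF l] l by (simp add: theta_mult_def R.sg_mult_r R.m_assoc)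
    also have "\<dots> = sg (sec X U) ((p \<le> l) \<noteq> (True \<noteq> ((p \<le> k) \<noteq> (p \<le> l)))) (t \<otimes>\<^bsub>sec X U\<^esub> (\<omega> U True v k l \<otimes>\<^bsub>sec X U\<^esub> s l))"
      unfolding * using t' c[OF l] e[OF l] by simp
    also have "((p \<le> l) \<noteq> (True \<noteq> ((p \<le> k) \<noteq> (p \<le> l)))) = (\<not> p \<le> k)" by auto
    finally show ?thesis using t' c[OF l] e[OF l] by (simp add: R.sg_mult_l)
  qed
  have "(\<Oplus>\<^bsub>sec X U\<^esub>l\<in>{..<p + q}. \<omega> U True v k l \<otimes>\<^bsub>sec X U\<^esub> theta_mult (sec X U) p q t s l)
    = (\<Oplus>\<^bsub>sec X U\<^esub>l\<in>{..<p + q}. sg (sec X U) (\<not> p \<le> k) t \<otimes>\<^bsub>sec X U\<^esub> (\<omega> U True v k l \<otimes>\<^bsub>sec X U\<^esub> s l))"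
    using c e t' by (intro R.finsum_cong') (auto simp: tm)
  also have "\<dots> = sg (sec X U) (\<not> p \<le> k) t \<otimes>\<^bsub>sec X U\<^esub> ?S"
    using c e t' by (intro R.finsum_rdistr[symmetric]) auto
  finally have 1: "(\<Oplus>\<^bsub>sec X U\<^esub>l\<in>{..<p + q}. \<omega> U True v k l \<otimes>\<^bsub>sec X U\<^esub> theta_mult (sec X U) p q t s l)
     = sg (sec X U) (\<not> p \<le> k) (t \<otimes>\<^bsub>sec X U\<^esub> ?S)" using t' S by (simp add: R.sg_mult_l)
  have vc: "v U (s k) \<in> sc U" "v U t \<in> sc U" using vfD(1)[OF v U order.refl] c[OF k] t' by auto
  have 2: "sg (sec X U) (True \<and> p \<le> k) (v U (theta_mult (sec X U) p q t s k)) 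
      = v U t \<otimes>\<^bsub>sec X U\<^esub> s k \<oplus>\<^bsub>sec X U\<^esub> \<ominus>\<^bsub>sec X U\<^esub> (t \<otimes>\<^bsub>sec X U\<^esub> v U (s k))"
    using t' c[OF k] k vc vfD(4)[OF v U order.refl t c[OF k]]
    by (simp add: theta_mult_def vf_sg[OF v U order.refl]) (simp add: sg_def)
  have 3: "theta_mult (sec X U) p q t (D U True v s) k = 
      t \<otimes>\<^bsub>sec X U\<^esub> v U (s k) \<oplus>\<^bsub>sec X U\<^esub> sg (sec X U) (p \<le> k) (t \<otimes>\<^bsub>sec X U\<^esub> ?S)"
    using k t' S vc by (simp add: theta_mult_def D_entry R.r_distr R.sg_add R.sg_mult_r)
  show ?thesis unfolding D_entry[OF k] 1 2 3 using t' S vc c[OF k]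
    by (simp add: R.minus_eq R.minus_add R.a_ac) (simp add: sg_def R.a_ac)
qed

text \<open>The two sums in which a field differentiates \<open>s\<close> are interchanged, with opposite signs, when \<open>v\<close>
  and \<open>w\<close> are exchanged. They cancel in the anticommutator.\<close>

lemma D_D_entry:
  assumes U: "op U" and v: "v \<in> vfields \<Lambda> X U True" and w: "w \<in> vfields \<Lambda> X U True" 
    and s: "s \<in> cols U" and k: "k < p + q"
  shows "D U True v (D U True w s) k = v U (w U (s k)) \<oplus>\<^bsub>sec X U\<^esub> 
    (((\<Oplus>\<^bsub>sec X U\<^esub>l\<in>{..<p + q}. sg (sec X U) (p \<le> k) (v U (\<omega> U True w k l)) \<otimes>\<^bsub>sec X U\<^esub> s l) \<oplus>\<^bsub>sec X U\<^esub>
     \<ominus>\<^bsub>sec X U\<^esub> (\<Oplus>\<^bsub>sec X U\<^esub>l\<in>{..<p + q}. sg (sec X U) (p \<le> l) (\<omega> U True w k l \<otimes>\<^bsub>sec X U\<^esub> v U (s l)))) \<oplus>\<^bsub>sec X U\<^esub>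
     ((\<Oplus>\<^bsub>sec X U\<^esub>l\<in>{..<p + q}. sg (sec X U) (p \<le> l) (\<omega> U True v k l \<otimes>\<^bsub>sec X U\<^esub> w U (s l))) \<oplus>\<^bsub>sec X U\<^esub>
     (\<Oplus>\<^bsub>sec X U\<^esub>l\<in>{..<p + q}. mat_mult (sec X U) (p + q) (\<omega> U True v) (\<omega> U True w) k l \<otimes>\<^bsub>sec X U\<^esub> s l)))"
proof -
  interpret R: superalg "sec X U" by (rule sec_superalg[OF U])
  have c: "s k \<in> sc U" if "k < p + q" for k using s that by auto
  note V = form_entry(2)[OF U v] and W = form_entry(2)[OF U w]
  note vd = vfD[OF v U order.refl] and wd = vfD[OF w U order.refl]
  note cl = c V W vd(1) wd(1)
  let ?S = "\<lambda>f. finsum (sec X U) f {..<p + q}"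
  let ?m = "\<lambda>x y. x \<otimes>\<^bsub>sec X U\<^esub> y" and ?s = "sg (sec X U)"
  have tm: "?s (p \<le> k) (v U (?m (\<omega> U True w k l) (s l))) = 
      ?m (?s (p \<le> k) (v U (\<omega> U True w k l))) (s l) \<oplus>\<^bsub>sec X U\<^esub> \<ominus>\<^bsub>sec X U\<^esub> ?s (p \<le> l) (?m (\<omega> U True w k l) (v U (s l)))"
    if l: "l < p + q" for l
  proof -
    have "?s (p \<le> k) (v U (?m (\<omega> U True w k l) (s l))) = ?m (?s (p \<le> k) (v U (\<omega> U True w k l))) (s l) \<oplus>\<^bsub>sec X U\<^esub> 
        ?s ((p \<le> k) \<noteq> (True \<and> (True \<noteq> ((p \<le> k) \<noteq> (p \<le> l))))) (?m (\<omega> U True w k l) (v U (s l)))"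
      unfolding vd(4)[OF form_entry(1)[OF U w k l] c[OF l]] using cl k l 
      by (simp add: R.sg_add R.sg_mult_l)
    also have "((p \<le> k) \<noteq> (True \<and> (True \<noteq> ((p \<le> k) \<noteq> (p \<le> l))))) = (\<not> p \<le> l)" by auto
    also have "?s (\<not> p \<le> l) (?m (\<omega> U True w k l) (v U (s l))) = \<ominus>\<^bsub>sec X U\<^esub> ?s (p \<le> l) (?m (\<omega> U True w k l) (v U (s l)))"
      using cl k l by (auto simp: sg_def)
    finally show ?thesis .
  qed
  have ws: "w U (s k) \<in> sc U" "?S (\<lambda>l. ?m (\<omega> U True w k l) (s l)) \<in> sc U" if "k < p + q" for k
    using cl that by (auto intro!: R.finsum_closed)
  have 1: "?s (p \<le> k) (v U (D U True w s k)) = v U (w U (s k)) \<oplus>\<^bsub>sec X U\<^esub> 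
      (?S (\<lambda>l. ?m (?s (p \<le> k) (v U (\<omega> U True w k l))) (s l)) \<oplus>\<^bsub>sec X U\<^esub> 
       \<ominus>\<^bsub>sec X U\<^esub> ?S (\<lambda>l. ?s (p \<le> l) (?m (\<omega> U True w k l) (v U (s l)))))"
  proof -
    have "?s (p \<le> k) (v U (D U True w s k)) = ?s (p \<le> k) (v U (?s (p \<le> k) (w U (s k)))) \<oplus>\<^bsub>sec X U\<^esub> 
        ?s (p \<le> k) (v U (?S (\<lambda>l. ?m (\<omega> U True w k l) (s l))))"
      unfolding D_entry[OF k] using ws[OF k] cl by (simp add: vd(2) R.sg_add)
    also have "?s (p \<le> k) (v U (?s (p \<le> k) (w U (s k)))) = v U (w U (s k))"
      using ws[OF k] cl by (simp add: vf_sg[OF v U order.refl])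
    also have "?s (p \<le> k) (v U (?S (\<lambda>l. ?m (\<omega> U True w k l) (s l)))) 
        = ?S (\<lambda>l. ?s (p \<le> k) (v U (?m (\<omega> U True w k l) (s l))))"
      using cl k by (subst vf_finsum[OF v U order.refl]) (auto intro!: R.sg_finsum)
    also have "\<dots> = ?S (\<lambda>l. ?m (?s (p \<le> k) (v U (\<omega> U True w k l))) (s l) \<oplus>\<^bsub>sec X U\<^esub> 
        \<ominus>\<^bsub>sec X U\<^esub> ?s (p \<le> l) (?m (\<omega> U True w k l) (v U (s l))))"
      using cl k by (intro R.finsum_cong') (auto simp: tm)
    also have "\<dots> = ?S (\<lambda>l. ?m (?s (p \<le> k) (v U (\<omega> U True w k l))) (s l)) \<oplus>\<^bsub>sec X U\<^esub> 
        ?S (\<lambda>l. \<ominus>\<^bsub>sec X U\<^esub> ?s (p \<le> l) (?m (\<omega> U True w k l) (v U (s l))))"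
      using cl k by (intro R.finsum_addf) auto
    also have "?S (\<lambda>l. \<ominus>\<^bsub>sec X U\<^esub> ?s (p \<le> l) (?m (\<omega> U True w k l) (v U (s l)))) = 
        \<ominus>\<^bsub>sec X U\<^esub> ?S (\<lambda>l. ?s (p \<le> l) (?m (\<omega> U True w k l) (v U (s l))))"
      using cl k by (intro R.finsum_neg[symmetric]) auto
    finally show ?thesis .
  qed
  have 2: "?S (\<lambda>l. ?m (\<omega> U True v k l) (D U True w s l)) = 
      ?S (\<lambda>l. ?s (p \<le> l) (?m (\<omega> U True v k l) (w U (s l)))) \<oplus>\<^bsub>sec X U\<^esub>
      ?S (\<lambda>l. ?m (mat_mult (sec X U) (p + q) (\<omega> U True v) (\<omega> U True w) k l) (s l))"
  proof -
    have "?S (\<lambda>l. ?m (\<omega> U True v k l) (D U True w s l)) = 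
      ?S (\<lambda>l. ?s (p \<le> l) (?m (\<omega> U True v k l) (w U (s l))) \<oplus>\<^bsub>sec X U\<^esub> 
         ?m (\<omega> U True v k l) (?S (\<lambda>j. ?m (\<omega> U True w l j) (s j))))"
      using cl k ws by (intro R.finsum_cong') (auto simp: D_entry R.r_distr R.sg_mult_r)
    also have "\<dots> = ?S (\<lambda>l. ?s (p \<le> l) (?m (\<omega> U True v k l) (w U (s l)))) \<oplus>\<^bsub>sec X U\<^esub>
        ?S (\<lambda>l. ?m (\<omega> U True v k l) (?S (\<lambda>j. ?m (\<omega> U True w l j) (s j))))"
      using cl k ws by (intro R.finsum_addf) auto
    also have "?S (\<lambda>l. ?m (\<omega> U True v k l) (?S (\<lambda>j. ?m (\<omega> U True w l j) (s j)))) = 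
       ?S (\<lambda>l. ?m (mat_mult (sec X U) (p + q) (\<omega> U True v) (\<omega> U True w) k l) (s l))"
      using R.mat_vec_assoc_entry[OF R.smat_mats[OF formD(1)[OF U v]] R.smat_mats[OF formD(1)[OF U w]] c k] by simp
    finally show ?thesis .
  qed
  have "?S (\<lambda>l. ?m (?s (p \<le> k) (v U (\<omega> U True w k l))) (s l)) \<in> sc U"
    "?S (\<lambda>l. ?s (p \<le> l) (?m (\<omega> U True w k l) (v U (s l)))) \<in> sc U"
    "?S (\<lambda>l. ?s (p \<le> l) (?m (\<omega> U True v k l) (w U (s l)))) \<in> sc U"
    using cl k by (auto intro!: R.finsum_closed)
  moreover have "?S (\<lambda>l. ?m (mat_mult (sec X U) (p + q) (\<omega> U True v) (\<omega> U True w) k l) (s l)) \<in> sc U"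
    using c k matsD[OF R.mat_mult_closed[OF R.smat_mats[OF formD(1)[OF U v]] R.smat_mats[OF formD(1)[OF U w]]]]
    by (auto intro!: R.finsum_closed)
  ultimately show ?thesis using D_entry[OF k, of U True v "D U True w s"] 1 2 cl k
    by (simp add: R.a_assoc)
qed

text \<open>The anticommutator of two covariant derivatives is the covariant derivative along the bracket plus the
  curvature. The form vanishes on the bracket, and the curvature vanishes by flatness.\<close>

lemma D_anticommute:
  assumes U: "op U" and v: "v \<in> vfields \<Lambda> X U True" and w: "w \<in> vfields \<Lambda> X U True" 
    and bracket: "\<And>U' f. op U' \<Longrightarrow> U' \<subseteq> U \<Longrightarrow> f \<in> sc U' \<Longrightarrow> v U' (w U' f) \<oplus>\<^bsub>sec X U'\<^esub> w U' (v U' f) = \<zero>\<^bsub>sec X U'\<^esub>"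
    and s: "s \<in> cols U" and k: "k < p + q"
  shows "D U True v (D U True w s) k \<oplus>\<^bsub>sec X U\<^esub> D U True w (D U True v s) k = \<zero>\<^bsub>sec X U\<^esub>"
proof -
  interpret R: superalg "sec X U" by (rule sec_superalg[OF U])
  have c: "s k \<in> sc U" if "k < p + q" for k using s that by auto
  note V = form_entry(2)[OF U v] and W = form_entry(2)[OF U w]
  note vd = vfD[OF v U order.refl] and wd = vfD[OF w U order.refl]
  note mV = R.smat_mats[OF formD(1)[OF U v]] and mW = R.smat_mats[OF formD(1)[OF U w]]
  note VW = matsD[OF R.mat_mult_closed[OF mV mW]] and WV = matsD[OF R.mat_mult_closed[OF mW mV]]
  note cl = c V W vd(1) wd(1) VW WV
  let ?S = "\<lambda>f. finsum (sec X U) f {..<p + q}"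
  let ?m = "\<lambda>x y. x \<otimes>\<^bsub>sec X U\<^esub> y" and ?s = "sg (sec X U)"
  let ?b = "vf_bracket X U True v True w"
  have b: "?b \<in> vfields \<Lambda> X U False" using vf_bracket_in[OF v w] by simp
  have b0: "\<omega> U False ?b k l = \<zero>\<^bsub>sec X U\<^esub>" if "l < p + q" for l
  proof (rule form_of_zero_field[OF U b _ k that])
    fix U' f assume a: "op U'" "U' \<subseteq> U" "f \<in> sc U'"
    interpret R': superalg "sec X U'" by (rule sec_superalg[OF a(1)])
    show "?b U' f = \<zero>\<^bsub>sec X U'\<^esub>"
      using bracket[OF a] a vfD(1)[OF v a(1,2)] vfD(1)[OF w a(1,2)] 
      by (simp add: vf_bracket_def vf_mk_apply R'.minus_eq) (simp add: sg_def)
  qed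
  have F: "(?s (p \<le> k) (v U (\<omega> U True w k l)) \<oplus>\<^bsub>sec X U\<^esub> ?s (p \<le> k) (w U (\<omega> U True v k l))) \<oplus>\<^bsub>sec X U\<^esub>
     (mat_mult (sec X U) (p + q) (\<omega> U True v) (\<omega> U True w) k l \<oplus>\<^bsub>sec X U\<^esub>
      mat_mult (sec X U) (p + q) (\<omega> U True w) (\<omega> U True v) k l) = \<zero>\<^bsub>sec X U\<^esub>" if l: "l < p + q" for l
  proof -
    have "mat_add (sec X U) (p + q) (d_form X p q \<omega> U True v True w) (wedge_form X p q \<omega> U True v True w) k l = \<zero>\<^bsub>sec X U\<^esub>"
      using flatD[OF U v w] k l by (simp add: mat_zero_def)
    then show ?thesis using k l cl b0[OF l]
      by (cases "p \<le> k")
        (simp_all add: mat_add_def d_form_def wedge_form_def Let_def mat_minus_def mat_deriv_def mat_sg_def sg_def)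
  qed
  let ?E = "?S (\<lambda>l. ?m (?s (p \<le> k) (v U (\<omega> U True w k l))) (s l))"
  let ?E' = "?S (\<lambda>l. ?m (?s (p \<le> k) (w U (\<omega> U True v k l))) (s l))"
  let ?G = "?S (\<lambda>l. ?m (mat_mult (sec X U) (p + q) (\<omega> U True v) (\<omega> U True w) k l) (s l))"
  let ?G' = "?S (\<lambda>l. ?m (mat_mult (sec X U) (p + q) (\<omega> U True w) (\<omega> U True v) k l) (s l))"
  have "(?E \<oplus>\<^bsub>sec X U\<^esub> ?E') \<oplus>\<^bsub>sec X U\<^esub> (?G \<oplus>\<^bsub>sec X U\<^esub> ?G') = ?S (\<lambda>l. ?m (
     (?s (p \<le> k) (v U (\<omega> U True w k l)) \<oplus>\<^bsub>sec X U\<^esub> ?s (p \<le> k) (w U (\<omega> U True v k l))) \<oplus>\<^bsub>sec X U\<^esub>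
     (mat_mult (sec X U) (p + q) (\<omega> U True v) (\<omega> U True w) k l \<oplus>\<^bsub>sec X U\<^esub>
      mat_mult (sec X U) (p + q) (\<omega> U True w) (\<omega> U True v) k l)) (s l))"
    using cl k by (simp add: R.l_distr Pi_def cong: R.finsum_cong)
  also have "\<dots> = ?S (\<lambda>l. \<zero>\<^bsub>sec X U\<^esub>)" using c by (intro R.finsum_cong') (auto simp: F)
  finally have EG: "(?E \<oplus>\<^bsub>sec X U\<^esub> ?E') \<oplus>\<^bsub>sec X U\<^esub> (?G \<oplus>\<^bsub>sec X U\<^esub> ?G') = \<zero>\<^bsub>sec X U\<^esub>" by simp
  have "D U True v (D U True w s) k \<oplus>\<^bsub>sec X U\<^esub> D U True w (D U True v s) k = 
      (v U (w U (s k)) \<oplus>\<^bsub>sec X U\<^esub> w U (v U (s k))) \<oplus>\<^bsub>sec X U\<^esub> ((?E \<oplus>\<^bsub>sec X U\<^esub> ?E') \<oplus>\<^bsub>sec X U\<^esub> (?G \<oplus>\<^bsub>sec X U\<^esub> ?G'))"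
    unfolding D_D_entry[OF U v w s k] D_D_entry[OF U w v s k]
    by (rule R.curvature_rearrange) (use cl k in \<open>auto intro!: R.finsum_closed\<close>)
  also have "\<dots> = \<zero>\<^bsub>sec X U\<^esub>" unfolding EG using bracket[OF U order.refl c[OF k]] by simp
  finally show ?thesis .
qed

text \<open>By the Leibniz rule, the covariant derivative of a combination of sections that it kills acts on the
  coefficients only. The sign on the right is that of moving the field past the \<open>l\<close>-th section.\<close>

lemma D_mat_vec:
  assumes U: "op U" and v: "v \<in> vfields \<Lambda> X U a" and A: "A \<in> smat (sec X U) p q False"
    and killed: "\<And>l k. l < p + q \<Longrightarrow> k < p + q \<Longrightarrow> D U a v (mcol (p + q) A l) k = \<zero>\<^bsub>sec X U\<^esub>"
    and c: "\<And>l. l < p + q \<Longrightarrow> c l \<in> sc U" and k: "k < p + q"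
  shows "D U a v (mat_vec (sec X U) (p + q) A c) k = 
    (\<Oplus>\<^bsub>sec X U\<^esub>l\<in>{..<p + q}. A k l \<otimes>\<^bsub>sec X U\<^esub> sg (sec X U) (a \<and> p \<le> l) (v U (c l)))"
proof -
  interpret R: superalg "sec X U" by (rule sec_superalg[OF U])
  note vd = vfD[OF v U order.refl]
  note mA = matsD[OF R.smat_mats[OF A]] and mW = form_entry(2)[OF U v]
  note cl = c vd(1) mA mW
  let ?S = "\<lambda>f. finsum (sec X U) f {..<p + q}"
  let ?m = "\<lambda>x y. x \<otimes>\<^bsub>sec X U\<^esub> y" and ?s = "sg (sec X U)"
  have tm: "?s (a \<and> p \<le> k) (v U (?m (A k l) (c l))) = ?m (?s (a \<and> p \<le> k) (v U (A k l))) (c l) \<oplus>\<^bsub>sec X U\<^esub> 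
     ?m (A k l) (?s (a \<and> p \<le> l) (v U (c l)))" if l: "l < p + q" for l
  proof -
    have 1: "(a \<and> p \<le> l) = ((a \<and> p \<le> k) \<noteq> (a \<and> (False \<noteq> ((p \<le> k) \<noteq> (p \<le> l)))))" by auto
    show ?thesis unfolding vd(4)[OF smatD[OF A k l] c[OF l]] 1 using cl k l 
      by (simp add: R.sg_add R.sg_mult_l R.sg_mult_r)
  qed
  have "?s (a \<and> p \<le> k) (v U (mat_vec (sec X U) (p + q) A c k)) 
      = ?S (\<lambda>l. ?s (a \<and> p \<le> k) (v U (?m (A k l) (c l))))"
    unfolding mat_vec_simps[OF k] using cl k by (subst vf_finsum[OF v U order.refl]) (auto intro!: R.sg_finsum)
  also have "\<dots> = ?S (\<lambda>l. ?m (?s (a \<and> p \<le> k) (v U (A k l))) (c l) \<oplus>\<^bsub>sec X U\<^esub> ?m (A k l) (?s (a \<and> p \<le> l) (v U (c l))))"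
    using cl k by (intro R.finsum_cong') (auto simp: tm)
  also have "\<dots> = ?S (\<lambda>l. ?m (?s (a \<and> p \<le> k) (v U (A k l))) (c l)) \<oplus>\<^bsub>sec X U\<^esub> 
      ?S (\<lambda>l. ?m (A k l) (?s (a \<and> p \<le> l) (v U (c l))))"
    using cl k by (intro R.finsum_addf) auto
  finally have 1: "?s (a \<and> p \<le> k) (v U (mat_vec (sec X U) (p + q) A c k)) = 
     ?S (\<lambda>l. ?m (?s (a \<and> p \<le> k) (v U (A k l))) (c l)) \<oplus>\<^bsub>sec X U\<^esub> ?S (\<lambda>l. ?m (A k l) (?s (a \<and> p \<le> l) (v U (c l))))" .
  have 2: "?S (\<lambda>l. ?m (\<omega> U a v k l) (mat_vec (sec X U) (p + q) A c l)) = 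
      ?S (\<lambda>l. ?m (mat_mult (sec X U) (p + q) (\<omega> U a v) A k l) (c l))"
    using R.mat_vec_assoc_entry[OF R.smat_mats[OF formD(1)[OF U v]] R.smat_mats[OF A] c k] cl k
    by (auto simp: mat_vec_simps intro!: R.finsum_cong' R.finsum_closed)
  have M: "mat_mult (sec X U) (p + q) (\<omega> U a v) A k l \<in> sc U" if "l < p + q" for l
    by (rule matsD[OF R.mat_mult_closed[OF R.smat_mats[OF formD(1)[OF U v]] R.smat_mats[OF A]] k that])
  have "?s (a \<and> p \<le> k) (v U (A k l)) \<oplus>\<^bsub>sec X U\<^esub> mat_mult (sec X U) (p + q) (\<omega> U a v) A k l = \<zero>\<^bsub>sec X U\<^esub>" 
    if l: "l < p + q" for l
  proof -
    have "mat_mult (sec X U) (p + q) (\<omega> U a v) A k l = ?S (\<lambda>j. ?m (\<omega> U a v k j) (mcol (p + q) A l j))"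
      using cl k l by (auto simp: mat_mult_simps intro!: R.finsum_cong')
    then show ?thesis using killed[OF l k] k by (simp add: D_entry)
  qed
  then have "?S (\<lambda>l. ?m (?s (a \<and> p \<le> k) (v U (A k l)) \<oplus>\<^bsub>sec X U\<^esub> mat_mult (sec X U) (p + q) (\<omega> U a v) A k l) (c l)) 
      = ?S (\<lambda>l. \<zero>\<^bsub>sec X U\<^esub>)"
    using c by (intro R.finsum_cong') auto
  moreover have "?S (\<lambda>l. ?m (?s (a \<and> p \<le> k) (v U (A k l)) \<oplus>\<^bsub>sec X U\<^esub> mat_mult (sec X U) (p + q) (\<omega> U a v) A k l) (c l))
      = ?S (\<lambda>l. ?m (?s (a \<and> p \<le> k) (v U (A k l))) (c l)) \<oplus>\<^bsub>sec X U\<^esub> 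
        ?S (\<lambda>l. ?m (mat_mult (sec X U) (p + q) (\<omega> U a v) A k l) (c l))"
    using cl k M by (simp add: R.l_distr Pi_def cong: R.finsum_cong)
  ultimately have 3: "?S (\<lambda>l. ?m (?s (a \<and> p \<le> k) (v U (A k l))) (c l)) \<oplus>\<^bsub>sec X U\<^esub> 
        ?S (\<lambda>l. ?m (mat_mult (sec X U) (p + q) (\<omega> U a v) A k l) (c l)) = \<zero>\<^bsub>sec X U\<^esub>" by simp
  let ?P = "?S (\<lambda>l. ?m (?s (a \<and> p \<le> k) (v U (A k l))) (c l))"
  let ?Q = "?S (\<lambda>l. ?m (A k l) (?s (a \<and> p \<le> l) (v U (c l))))"
  let ?T = "?S (\<lambda>l. ?m (mat_mult (sec X U) (p + q) (\<omega> U a v) A k l) (c l))"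
  have cl': "?P \<in> sc U" "?Q \<in> sc U" "?T \<in> sc U" using cl k M by (auto intro!: R.finsum_closed)
  have "D U a v (mat_vec (sec X U) (p + q) A c) k = (?P \<oplus>\<^bsub>sec X U\<^esub> ?Q) \<oplus>\<^bsub>sec X U\<^esub> ?T"
    using D_entry[OF k] 1 2 by simp
  also have "\<dots> = (?P \<oplus>\<^bsub>sec X U\<^esub> ?T) \<oplus>\<^bsub>sec X U\<^esub> ?Q" using cl' by (simp add: R.a_ac)
  also have "\<dots> = ?Q" using 3 cl' by simp
  finally show ?thesis .
qed

end

section \<open>Purely odd submersions\<close>

locale submersion = sspace \<Lambda> Z + W: sspace \<Lambda> W
  for \<Lambda> :: "'l base_alg" and Z :: "('x, 'a, 'l) superspace" and W :: "('x, 'b, 'l) superspace" +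
  fixes \<sigma> :: "'x set \<Rightarrow> 'b \<Rightarrow> 'a"
  assumes sub: "purely_odd_submersion \<Lambda> Z W \<sigma>"
begin

lemma tsp_W [simp]: "tsp W = tsp Z"
  using sub by (simp add: purely_odd_submersion_def)

lemma \<sigma>_hom: "op U \<Longrightarrow> superalg_hom (sec W U) (sec Z U) (\<sigma> U)"
  unfolding superalg_hom_def superalg_hom_axioms_def
  using sec_superalg W.sec_superalg sub by (simp add: purely_odd_submersion_def)

lemma \<sigma>_res: "op U \<Longrightarrow> op V \<Longrightarrow> V \<subseteq> U \<Longrightarrow> f \<in> W.sc U \<Longrightarrow> \<sigma> V (res W U V f) = res Z U V (\<sigma> U f)"
  using sub by (simp add: purely_odd_submersion_def sub_open_def)

lemma \<sigma>_closed: "op U \<Longrightarrow> f \<in> W.sc U \<Longrightarrow> \<sigma> U f \<in> sc U"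
  using superalg_hom.h_closed[OF \<sigma>_hom] by blast

lemma \<sigma>_scal: 
  assumes "op U" "l \<in> carrier \<Lambda>" shows "\<sigma> U (scal W U l) = scal Z U l"
proof -
  let ?t = "topspace (tsp Z)"
  have "smap W l \<in> W.sc ?t"
    using ring_hom_closed[of "smap W" \<Lambda> "sec W ?t" l] W.space assms(2) 
    by (simp add: superspace_def sring_hom_def)
  moreover have "\<sigma> ?t (smap W l) = smap Z l" using sub assms(2) by (simp add: purely_odd_submersion_def)
  ultimately show ?thesis unfolding scal_def using \<sigma>_res[of ?t U] assms(1) openin_subset[OF assms(1)] by simp
qed

text \<open>The expansion in monomials is required over all open subsets of \<open>V\<close>, so that the partial derivatives
  commute with restriction.\<close>

definition chart :: "'x set \<Rightarrow> nat \<Rightarrow> (nat \<Rightarrow> 'a) \<Rightarrow> bool" where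
  "chart V n t \<longleftrightarrow> op V \<and> (\<forall>i<n. t i \<in> gr (sec Z V) True) \<and>
    (\<forall>U. op U \<and> U \<subseteq> V \<longrightarrow> odd_coords (sec W U) (sec Z U) (\<sigma> U) n (\<lambda>i. res Z V U (t i)))"

lemma res_odd_monomial:
  assumes U: "op V" "op U" "U \<subseteq> V" and t: "\<And>i. i < n \<Longrightarrow> t i \<in> sc V" and J: "J \<subseteq> {..<n}"
  shows "res Z V U (odd_monomial (sec Z V) t J) = odd_monomial (sec Z U) (\<lambda>i. res Z V U (t i)) J"
proof -
  interpret r: superalg_hom "sec Z V" "sec Z U" "res Z V U" by (rule res_hom[OF U])
  have "set xs \<subseteq> {..<n} \<Longrightarrow> foldr (\<lambda>i y. t i \<otimes>\<^bsub>sec Z V\<^esub> y) xs \<one>\<^bsub>sec Z V\<^esub> \<in> sc V \<and>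
     res Z V U (foldr (\<lambda>i y. t i \<otimes>\<^bsub>sec Z V\<^esub> y) xs \<one>\<^bsub>sec Z V\<^esub>) = 
     foldr (\<lambda>i y. res Z V U (t i) \<otimes>\<^bsub>sec Z U\<^esub> y) xs \<one>\<^bsub>sec Z U\<^esub>" for xs
    by (induction xs) (auto simp: r.h_mult t)
  from this[of "sorted_list_of_set J"] show ?thesis
    using J finite_subset[OF J] by (simp add: odd_monomial_def)
qed

lemma charts_exist: "\<exists>n. \<forall>x\<in>topspace (tsp Z). \<exists>V t. chart V n t \<and> x \<in> V"
proof -
  obtain n where n: "\<forall>x\<in>topspace (tsp Z). \<exists>V \<theta>. openin (tsp Z) V \<and> x \<in> V \<and>
      (\<forall>i<n. \<theta> i \<in> gr (sec Z V) True) \<and>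
      (\<forall>U. sub_open (tsp Z) U V \<longrightarrow> (\<forall>f\<in>carrier (sec Z U).
        \<exists>!c. c \<in> Pow {..<n} \<rightarrow>\<^sub>E carrier (sec W U) \<and>
          f = (\<Oplus>\<^bsub>sec Z U\<^esub>J\<in>Pow {..<n}. \<sigma> U (c J) \<otimes>\<^bsub>sec Z U\<^esub>
                res Z V U (odd_monomial (sec Z V) \<theta> J))))"
    using sub[unfolded purely_odd_submersion_def, THEN conjunct2, THEN conjunct2, THEN conjunct2, THEN conjunct2] 
    by (rule exE)
  show ?thesis
  proof (intro exI[of _ n] ballI)
    fix x assume x: "x \<in> topspace (tsp Z)"
    obtain V t where V: "op V" "x \<in> V" "\<forall>i<n. t i \<in> gr (sec Z V) True"
      and ex: "\<forall>U. sub_open (tsp Z) U V \<longrightarrow> (\<forall>f\<in>carrier (sec Z U).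
        \<exists>!c. c \<in> Pow {..<n} \<rightarrow>\<^sub>E carrier (sec W U) \<and>
          f = (\<Oplus>\<^bsub>sec Z U\<^esub>J\<in>Pow {..<n}. \<sigma> U (c J) \<otimes>\<^bsub>sec Z U\<^esub>
                res Z V U (odd_monomial (sec Z V) t J)))"
      using bspec[OF n x] by (elim exE conjE) (rule that)
    interpret V: superalg "sec Z V" by (rule sec_superalg[OF V(1)])
    have "odd_coords (sec W U) (sec Z U) (\<sigma> U) n (\<lambda>i. res Z V U (t i))" if U: "op U" "U \<subseteq> V" for U
    proof -
      interpret h: superalg_hom "sec W U" "sec Z U" "\<sigma> U" by (rule \<sigma>_hom[OF U(1)])
      show ?thesis
      proof unfold_locales
        show "i < n \<Longrightarrow> res Z V U (t i) \<in> gr (sec Z U) True" for i using V U by simp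
        fix f assume f: "f \<in> sc U"
        have mon: "res Z V U (odd_monomial (sec Z V) t J) = odd_monomial (sec Z U) (\<lambda>i. res Z V U (t i)) J"
          if "J \<in> Pow {..<n}" for J
          using that V by (intro res_odd_monomial V(1) U) auto
        have mc: "odd_monomial (sec Z V) t J \<in> sc V" if "J \<in> Pow {..<n}" for J
        proof -
          have "set xs \<subseteq> {..<n} \<Longrightarrow> foldr (\<lambda>i y. t i \<otimes>\<^bsub>sec Z V\<^esub> y) xs \<one>\<^bsub>sec Z V\<^esub> \<in> sc V" for xs
            using V(3) by (induction xs) auto
          then show ?thesis using that finite_subset[of J "{..<n}"] by (simp add: odd_monomial_def)
        qed
        have sums: "(\<Oplus>\<^bsub>sec Z U\<^esub>J\<in>Pow {..<n}. \<sigma> U (c J) \<otimes>\<^bsub>sec Z U\<^esub> odd_monomial (sec Z U) (\<lambda>i. res Z V U (t i)) J)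
            = (\<Oplus>\<^bsub>sec Z U\<^esub>J\<in>Pow {..<n}. \<sigma> U (c J) \<otimes>\<^bsub>sec Z U\<^esub> res Z V U (odd_monomial (sec Z V) t J))"
          if "c \<in> Pow {..<n} \<rightarrow>\<^sub>E carrier (sec W U)" for c
        proof (intro h.R.finsum_cong')
          show "(\<lambda>J. \<sigma> U (c J) \<otimes>\<^bsub>sec Z U\<^esub> res Z V U (odd_monomial (sec Z V) t J)) \<in> Pow {..<n} \<rightarrow> sc U"
          proof
            fix J assume J: "J \<in> Pow {..<n}"
            then have "c J \<in> W.sc U" using that by blast
            then show "\<sigma> U (c J) \<otimes>\<^bsub>sec Z U\<^esub> res Z V U (odd_monomial (sec Z V) t J) \<in> sc U"
              using mc[OF J] U V(1) by simp
          qed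
        qed (auto simp: mon)
        have e: "\<exists>!c. c \<in> Pow {..<n} \<rightarrow>\<^sub>E carrier (sec W U) \<and>
          f = (\<Oplus>\<^bsub>sec Z U\<^esub>J\<in>Pow {..<n}. \<sigma> U (c J) \<otimes>\<^bsub>sec Z U\<^esub> res Z V U (odd_monomial (sec Z V) t J))"
          using ex U f by (simp add: sub_open_def)
        show "\<exists>!c. c \<in> Pow {..<n} \<rightarrow>\<^sub>E carrier (sec W U) \<and>
          f = (\<Oplus>\<^bsub>sec Z U\<^esub>J\<in>Pow {..<n}. \<sigma> U (c J) \<otimes>\<^bsub>sec Z U\<^esub> odd_monomial (sec Z U) (\<lambda>i. res Z V U (t i)) J)"
          by (rule iffD1[OF arg_cong[of _ _ Ex1] e], rule ext, rule conj_cong[OF refl]) (simp add: sums)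
      qed
    qed
    then show "\<exists>V t. chart V n t \<and> x \<in> V" using V unfolding chart_def by blast
  qed
qed

lemma chartD: "chart V n t \<Longrightarrow> op U \<Longrightarrow> U \<subseteq> V \<Longrightarrow> 
    odd_coords (sec W U) (sec Z U) (\<sigma> U) n (\<lambda>i. res Z V U (t i))"
  by (simp add: chart_def)

lemma \<sigma>_inj:
  assumes U: "op U" and c: "c \<in> W.sc U" "c' \<in> W.sc U" and eq: "\<sigma> U c = \<sigma> U c'"
  shows "c = c'"
proof (rule W.separated)
  fix x assume x: "x \<in> U"
  obtain n V t where V: "chart V n t" "x \<in> V"
    using charts_exist x openin_subset[OF U] by (meson subsetD)
  have K: "op (U \<inter> V)" using U V by (auto simp: chart_def)
  interpret o: odd_coords "sec W (U \<inter> V)" "sec Z (U \<inter> V)" "\<sigma> (U \<inter> V)" n "\<lambda>i. res Z V (U \<inter> V) (t i)"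
    by (rule chartD[OF V(1) K]) auto
  have "\<sigma> (U \<inter> V) (res W U (U \<inter> V) c) = \<sigma> (U \<inter> V) (res W U (U \<inter> V) c')"
    using U K c eq by (simp add: \<sigma>_res)
  then have "res W U (U \<inter> V) c = res W U (U \<inter> V) c'" using U K c by (intro o.const_inj) auto
  then show "\<exists>V. W.op V \<and> x \<in> V \<and> V \<subseteq> U \<and> res W U V c = res W U V c'"
    using K x V by (intro exI[of _ "U \<inter> V"]) auto
qed (use U c in auto)

subsection \<open>Relative vector fields\<close>

abbreviation T :: "'x set \<Rightarrow> bool \<Rightarrow> ('x, 'a) vfield set" where
  "T \<equiv> rel_vfields \<Lambda> Z W \<sigma>"

lemma relD: 
  "v \<in> T U a \<Longrightarrow> v \<in> vfields \<Lambda> Z U a"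
  "v \<in> T U a \<Longrightarrow> op U' \<Longrightarrow> U' \<subseteq> U \<Longrightarrow> g \<in> W.sc U' \<Longrightarrow> v U' (\<sigma> U' g) = \<zero>\<^bsub>sec Z U'\<^esub>"
  unfolding rel_vfields_def by (auto simp: sub_open_def)

lemma relI:
  "v \<in> vfields \<Lambda> Z U a \<Longrightarrow> 
   (\<And>U' g. op U' \<Longrightarrow> U' \<subseteq> U \<Longrightarrow> g \<in> W.sc U' \<Longrightarrow> v U' (\<sigma> U' g) = \<zero>\<^bsub>sec Z U'\<^esub>) \<Longrightarrow> v \<in> T U a"
  unfolding rel_vfields_def by (auto simp: sub_open_def)

lemma rel_add: 
  assumes "v \<in> T U a" "w \<in> T U a" shows "vf_add Z U v w \<in> T U a"
proof (rule relI[OF vf_add_in[OF relD(1)[OF assms(1)] relD(1)[OF assms(2)]]])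
  fix U' g assume a: "op U'" "U' \<subseteq> U" "g \<in> W.sc U'"
  interpret R: superalg "sec Z U'" by (rule sec_superalg[OF a(1)])
  show "vf_add Z U v w U' (\<sigma> U' g) = \<zero>\<^bsub>sec Z U'\<^esub>"
    using a assms by (simp add: vf_add_def vf_mk_apply \<sigma>_closed relD(2))
qed

lemma rel_smult: 
  assumes "op U" "f \<in> gr (sec Z U) b" "v \<in> T U a" shows "vf_smult Z U f v \<in> T U (b \<noteq> a)"
proof (rule relI[OF vf_smult_in[OF assms(1,2) relD(1)[OF assms(3)]]])
  fix U' g assume a: "op U'" "U' \<subseteq> U" "g \<in> W.sc U'"
  interpret R: superalg "sec Z U'" by (rule sec_superalg[OF a(1)])
  have "res Z U U' f \<in> gr (sec Z U') b" using assms(1,2) a by simp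
  then have "res Z U U' f \<in> sc U'" by simp
  then show "vf_smult Z U f v U' (\<sigma> U' g) = \<zero>\<^bsub>sec Z U'\<^esub>"
    using a assms by (simp add: vf_smult_def vf_mk_apply \<sigma>_closed relD(2))
qed

lemma rel_bracket: 
  assumes "v \<in> T U a" "w \<in> T U b" shows "vf_bracket Z U a v b w \<in> T U (a \<noteq> b)"
proof (rule relI[OF vf_bracket_in[OF relD(1)[OF assms(1)] relD(1)[OF assms(2)]]])
  fix U' g assume a: "op U'" "U' \<subseteq> U" "g \<in> W.sc U'"
  interpret R: superalg "sec Z U'" by (rule sec_superalg[OF a(1)])
  show "vf_bracket Z U a v b w U' (\<sigma> U' g) = \<zero>\<^bsub>sec Z U'\<^esub>"
    using a assms vf_zero[OF relD(1)[OF assms(1)] a(1,2)] vf_zero[OF relD(1)[OF assms(2)] a(1,2)]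
    by (simp add: vf_bracket_def vf_mk_apply \<sigma>_closed relD(2) R.minus_eq)
qed

lemma rel_res: 
  assumes "v \<in> T U a" "op V" "V \<subseteq> U" shows "vf_res V v \<in> T V a"
  using assms vf_res_in[OF relD(1)[OF assms(1)] assms(2,3)]
  by (intro relI) (auto simp: vf_res_apply intro!: relD(2)[OF assms(1)])

text \<open>All operations on vector fields in the definition of a flat form, the bracket included, preserve
  relative vector fields. So the restricted form satisfies the same equations.\<close>

lemma restricted_form_flat:
  assumes "\<omega> \<in> flat_forms Z (vfields \<Lambda> Z) p q (topspace (tsp Z))"
  shows "form_restrict Z T (topspace (tsp Z)) \<omega> \<in> flat_forms Z T p q (topspace (tsp Z))"
proof -
  interpret flat_conn \<Lambda> Z p q \<omega> using assms by unfold_locales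
  let ?\<omega> = "form_restrict Z T (topspace (tsp Z)) \<omega>"
  have eq: "?\<omega> U a v = \<omega> U a v" if "op U" "v \<in> T U a" for U a v
    using that op_top by (simp add: form_restrict_def)
  have "?\<omega> \<in> one_forms Z T p q (topspace (tsp Z))"
    unfolding one_forms_def
  proof (intro CollectI conjI allI impI ballI)
    fix U a v assume "\<not> (sub_open (tsp Z) U (topspace (tsp Z)) \<and> v \<in> T U a)"
    then show "?\<omega> U a v = undefined" unfolding form_restrict_def by (simp only: if_False)
  next
    fix U a v assume v: "v \<in> T U a" and "sub_open (tsp Z) U (topspace (tsp Z))"
    then have U: "op U" by simp
    note fd = formD[OF U relD(1)[OF v]]
    show "?\<omega> U a v \<in> smat (sec Z U) p q a" using fd(1) eq[OF U v] by simp
    show "?\<omega> U a (vf_add Z U v w) = mat_add (sec Z U) (p + q) (?\<omega> U a v) (?\<omega> U a w)" if "w \<in> T U a" for w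
      using fd(2)[OF relD(1)[OF that]] eq[OF U v] eq[OF U that] eq[OF U rel_add[OF v that]] by simp
    show "?\<omega> U (b \<noteq> a) (vf_smult Z U f v) = mat_smult (sec Z U) p q b f (?\<omega> U a v)" if "f \<in> gr (sec Z U) b" for b f
      using fd(3)[OF that] eq[OF U v] eq[OF U rel_smult[OF U that v]] by simp
    show "?\<omega> V a (vf_res V v) = mat_res Z (p + q) U V (?\<omega> U a v)" if "sub_open (tsp Z) V U" for V
      using fd(4) eq[OF U v] eq[OF _ rel_res[OF v]] that by simp
  qed
  moreover have "mat_add (sec Z U) (p + q) (d_form Z p q ?\<omega> U a v b w) (wedge_form Z p q ?\<omega> U a v b w)
         = mat_zero (sec Z U) (p + q)" if "op U" "v \<in> T U a" "w \<in> T U b" for U a b v w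
    using flatD[OF that(1) relD(1)[OF that(2)] relD(1)[OF that(3)]] eq[OF that(1,2)] eq[OF that(1,3)]
      eq[OF that(1) rel_bracket[OF that(2,3)]]
    unfolding d_form_def wedge_form_def by simp
  ultimately show ?thesis unfolding flat_forms_def by simp
qed

subsection \<open>Coordinate vector fields\<close>

definition coord_vf :: "'x set \<Rightarrow> nat \<Rightarrow> (nat \<Rightarrow> 'a) \<Rightarrow> nat \<Rightarrow> ('x, 'a) vfield" where
  "coord_vf V n t i = vf_mk Z V (\<lambda>U f. odd_coords.partial (sec W U) (sec Z U) (\<sigma> U) n (\<lambda>j. res Z V U (t j)) i f)"

lemma coord_vf_apply: "op U \<Longrightarrow> U \<subseteq> V \<Longrightarrow> f \<in> sc U \<Longrightarrow> 
    coord_vf V n t i U f = odd_coords.partial (sec W U) (sec Z U) (\<sigma> U) n (\<lambda>j. res Z V U (t j)) i f"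
  by (simp add: coord_vf_def vf_mk_apply)

lemma coord_vf_in:
  assumes ch: "chart V n t" and i: "i < n" shows "coord_vf V n t i \<in> T V True"
proof (rule relI)
  have V: "op V" using ch by (simp add: chart_def)
  show "coord_vf V n t i \<in> vfields \<Lambda> Z V True" unfolding coord_vf_def
  proof (rule vf_mkI, goal_cases)
    case (1 U f)
    interpret o: odd_coords "sec W U" "sec Z U" "\<sigma> U" n "\<lambda>j. res Z V U (t j)" by (rule chartD[OF ch 1(1,2)])
    show ?case using 1 i by simp
  next
    case (2 U f g)
    interpret o: odd_coords "sec W U" "sec Z U" "\<sigma> U" n "\<lambda>j. res Z V U (t j)" by (rule chartD[OF ch 2(1,2)])
    show ?case using 2 i o.partial_add by simp
  next
    case (3 U f b)
    interpret o: odd_coords "sec W U" "sec Z U" "\<sigma> U" n "\<lambda>j. res Z V U (t j)" by (rule chartD[OF ch 3(1,2)])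
    show ?case using 3 i o.partial_gr by simp
  next
    case (4 U f g b)
    interpret o: odd_coords "sec W U" "sec Z U" "\<sigma> U" n "\<lambda>j. res Z V U (t j)" by (rule chartD[OF ch 4(1,2)])
    show ?case using o.partial_mult[OF i 4(3,4)] by simp
  next
    case (5 U l)
    interpret o: odd_coords "sec W U" "sec Z U" "\<sigma> U" n "\<lambda>j. res Z V U (t j)" by (rule chartD[OF ch 5(1,2)])
    have "scal W U l \<in> W.sc U" using ring_hom_closed[OF W.scal_ring_hom, of U l] 5 by simp
    then show ?case using o.partial_const[OF i] \<sigma>_scal[OF 5(1,3)] by metis
  next
    case (6 U U' f)
    have s: "U' \<subseteq> V" using 6 by auto
    show ?case
    proof (rule partial_restrict[OF chartD[OF ch 6(1,2)] chartD[OF ch 6(3) s], of "res W U U'"])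
      show "superalg_hom (sec W U) (sec W U') (res W U U')" using 6 by (intro W.res_hom) auto
      show "superalg_hom (sec Z U) (sec Z U') (res Z U U')" using 6 by (intro res_hom) auto
      show "c \<in> W.sc U \<Longrightarrow> res Z U U' (\<sigma> U c) = \<sigma> U' (res W U U' c)" for c using 6 by (simp add: \<sigma>_res)
      interpret V: superalg "sec Z V" by (rule sec_superalg[OF V])
      show "j < n \<Longrightarrow> res Z U U' (res Z V U (t j)) = res Z V U' (t j)" for j
        using 6 V ch by (intro res_res) (auto simp: chart_def)
    qed (use i 6 in auto)
  qed
next
  fix U g assume U: "op U" "U \<subseteq> V" and g: "g \<in> W.sc U"
  interpret o: odd_coords "sec W U" "sec Z U" "\<sigma> U" n "\<lambda>j. res Z V U (t j)" by (rule chartD[OF ch U])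
  show "coord_vf V n t i U (\<sigma> U g) = \<zero>\<^bsub>sec Z U\<^esub>" using U g i o.partial_const \<sigma>_closed by (simp add: coord_vf_apply)
qed

lemma coord_vf_coord:
  assumes ch: "chart V n t" and i: "i < n" "j < n" and U: "op U" "U \<subseteq> V"
  shows "coord_vf V n t i U (res Z V U (t j)) = (if i = j then \<one>\<^bsub>sec Z U\<^esub> else \<zero>\<^bsub>sec Z U\<^esub>)"
proof -
  interpret o: odd_coords "sec W U" "sec Z U" "\<sigma> U" n "\<lambda>j. res Z V U (t j)" by (rule chartD[OF ch U])
  show ?thesis using o.partial_t[OF i] o.t_closed[OF i(2)] U by (simp add: coord_vf_apply)
qed

text \<open>A relative vector field kills the functions from the target, which together with the odd coordinates
  generate all functions over any smaller open set.\<close>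

lemma rel_field_vanishes:
  assumes ch: "chart V n t" and U: "op U" "U \<subseteq> V" and z: "z \<in> T U a"
    and coords: "\<And>i. i < n \<Longrightarrow> z U (res Z V U (t i)) = \<zero>\<^bsub>sec Z U\<^esub>"
    and U': "op U'" "U' \<subseteq> U" and f: "f \<in> sc U'"
  shows "z U' f = \<zero>\<^bsub>sec Z U'\<^esub>"
proof -
  have s: "U' \<subseteq> V" using U U' by auto
  have V: "op V" and t: "\<And>i. i < n \<Longrightarrow> t i \<in> sc V"
    using ch superalg.gr_closed[OF sec_superalg, of V] by (auto simp: chart_def)
  interpret o: odd_coords "sec W U'" "sec Z U'" "\<sigma> U'" n "\<lambda>j. res Z V U' (t j)" by (rule chartD[OF ch U'(1) s])
  note d = vfD[OF relD(1)[OF z] U']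
  show ?thesis
  proof (rule o.derivation_vanishes[OF d(1) d(2) d(4) relD(2)[OF z U'] _ f])
    fix i assume i: "i < n"
    have "z U' (res Z U U' (res Z V U (t i))) = res Z U U' (z U (res Z V U (t i)))"
      using vfD(6)[OF relD(1)[OF z] U(1) order.refl U', of "res Z V U (t i)"] t[OF i] U V by simp
    also have "\<dots> = \<zero>\<^bsub>sec Z U'\<^esub>" using coords[OF i] superalg_hom.h_zero[OF res_hom[OF U(1) U']] by simp
    finally show "z U' (res Z V U' (t i)) = \<zero>\<^bsub>sec Z U'\<^esub>" using res_res[OF V U U' t[OF i]] by simp
  qed
qed

text \<open>The bracket is a relative vector field, and it kills the coordinates because their derivatives are
  constant.\<close>

lemma coord_vf_anticommute:
  assumes ch: "chart V n t" and ij: "i < n" "j < n" and U: "op U" "U \<subseteq> V" and f: "f \<in> sc U"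
  shows "coord_vf V n t i U (coord_vf V n t j U f) \<oplus>\<^bsub>sec Z U\<^esub> coord_vf V n t j U (coord_vf V n t i U f) = \<zero>\<^bsub>sec Z U\<^esub>"
proof -
  let ?v = "coord_vf V n t i" and ?w = "coord_vf V n t j"
  let ?b = "vf_bracket Z V True ?v True ?w"
  have V: "op V" and t: "\<And>i. i < n \<Longrightarrow> t i \<in> sc V"
    using ch superalg.gr_closed[OF sec_superalg, of V] by (auto simp: chart_def)
  note v = coord_vf_in[OF ch ij(1)] and w = coord_vf_in[OF ch ij(2)]
  have b: "?b \<in> T V False" using rel_bracket[OF v w] by simp
  have eq: "?b U f = ?v U (?w U f) \<oplus>\<^bsub>sec Z U\<^esub> ?w U (?v U f)" if U: "op U" "U \<subseteq> V" and f: "f \<in> sc U" for U f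
  proof -
    interpret R: superalg "sec Z U" by (rule sec_superalg[OF U(1)])
    show ?thesis using f U vfD(1)[OF relD(1)[OF v] U] vfD(1)[OF relD(1)[OF w] U]
      by (simp add: vf_bracket_def vf_mk_apply R.minus_eq) (simp add: sg_def)
  qed
  interpret RV: superalg "sec Z V" by (rule sec_superalg[OF V])
  interpret oV: odd_coords "sec W V" "sec Z V" "\<sigma> V" n "\<lambda>j. res Z V V (t j)" by (rule chartD[OF ch V order.refl])
  have const: "coord_vf V n t k V (if e then \<one>\<^bsub>sec Z V\<^esub> else \<zero>\<^bsub>sec Z V\<^esub>) = \<zero>\<^bsub>sec Z V\<^esub>" if "k < n" for k e
    using oV.partial_const[OF that oV.C.one_closed] oV.partial_const[OF that oV.C.zero_closed] V
    by (simp add: coord_vf_apply)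
  have "?b V (res Z V V (t k)) = \<zero>\<^bsub>sec Z V\<^esub>" if k: "k < n" for k
    using eq[OF V order.refl oV.t_closed[OF k]] coord_vf_coord[OF ch ij(1) k V order.refl] coord_vf_coord[OF ch ij(2) k V order.refl]
      const[OF ij(1), of "j = k"] const[OF ij(2), of "i = k"] by simp
  then have "?b U f = \<zero>\<^bsub>sec Z U\<^esub>" using rel_field_vanishes[OF ch V order.refl b _ U f] by blast
  then show ?thesis using eq[OF U f] by simp
qed

text \<open>In a chart all partial derivatives of \<open>f\<close> vanish, which leaves only the constant term. The functions
  on the target found in this way over charts are unique and therefore glue.\<close>

lemma constant_along_fibers:
  assumes U: "op U" and f: "f \<in> sc U"
    and killed: "\<And>U' a v. op U' \<Longrightarrow> U' \<subseteq> U \<Longrightarrow> v \<in> T U' a \<Longrightarrow> v U' (res Z U U' f) = \<zero>\<^bsub>sec Z U'\<^esub>"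
  shows "\<exists>c\<in>W.sc U. \<sigma> U c = f"
proof -
  have loc: "\<exists>V. op V \<and> x \<in> V \<and> V \<subseteq> U \<and> (\<exists>c\<in>W.sc V. \<sigma> V c = res Z U V f)" if x: "x \<in> U" for x
  proof -
    obtain n V t where V: "chart V n t" "x \<in> V"
      using charts_exist x openin_subset[OF U] by (meson subsetD)
    let ?K = "U \<inter> V"
    have oV: "op V" using V by (simp add: chart_def)
    then have K: "op ?K" using U by auto
    interpret o: odd_coords "sec W ?K" "sec Z ?K" "\<sigma> ?K" n "\<lambda>i. res Z V ?K (t i)"
      by (rule chartD[OF V(1) K]) auto
    have fK: "res Z U ?K f \<in> sc ?K" using U K f by simp
    have "o.partial i (res Z U ?K f) = \<zero>\<^bsub>sec Z ?K\<^esub>" if i: "i < n" for i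
    proof -
      have "vf_res ?K (coord_vf V n t i) \<in> T ?K True" by (rule rel_res[OF coord_vf_in[OF V(1) i] K]) auto
      from killed[OF K _ this] have "coord_vf V n t i ?K (res Z U ?K f) = \<zero>\<^bsub>sec Z ?K\<^esub>" by (simp add: vf_res_apply)
      then show ?thesis using K fK by (simp add: coord_vf_apply)
    qed
    then obtain c where "c \<in> W.sc ?K" "res Z U ?K f = \<sigma> ?K c"
      using o.constant_if_partials_vanish[OF fK] by blast
    then show ?thesis using K x V by (intro exI[of _ ?K]) auto
  qed
  have "\<exists>c\<in>W.sc U. \<forall>V. W.op V \<and> V \<subseteq> U \<and> (\<exists>g\<in>W.sc V. \<sigma> V g = res Z U V f) \<longrightarrow> \<sigma> V (res W U V c) = res Z U V f"
  proof (rule W.glue_unique)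
    fix V V' c assume a: "W.op V" "V \<subseteq> U" "W.op V'" "V' \<subseteq> V" "c \<in> W.sc V" "\<sigma> V c = res Z U V f"
    then show "\<sigma> V' (res W V V' c) = res Z U V' f" using U f by (simp add: \<sigma>_res res_res)
  qed (use U loc \<sigma>_inj in auto)
  then obtain c where c: "c \<in> W.sc U" 
    "\<And>V. op V \<Longrightarrow> V \<subseteq> U \<Longrightarrow> \<exists>g\<in>W.sc V. \<sigma> V g = res Z U V f \<Longrightarrow> \<sigma> V (res W U V c) = res Z U V f" by auto
  have "\<sigma> U c = f"
  proof (rule separated[OF U \<sigma>_closed[OF U c(1)] f])
    fix x assume x: "x \<in> U"
    obtain V where "op V" "x \<in> V" "V \<subseteq> U" "\<exists>g\<in>W.sc V. \<sigma> V g = res Z U V f"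
      using loc[OF x] by (elim exE conjE) (rule that)
    then show "\<exists>V. op V \<and> x \<in> V \<and> V \<subseteq> U \<and> res Z U V (\<sigma> U c) = res Z U V f"
      using c U by (metis \<sigma>_res)
  qed
  then show ?thesis using c by blast
qed

end

section \<open>Local solutions\<close>

locale relative_connection = submersion \<Lambda> Z W \<sigma> + flat_conn \<Lambda> Z p q \<omega>
  for \<Lambda> :: "'l base_alg" and Z :: "('x, 'a, 'l) superspace" and W :: "('x, 'b, 'l) superspace"
    and \<sigma> :: "'x set \<Rightarrow> 'b \<Rightarrow> 'a" and p q :: nat and \<omega> :: "('x, 'a) mform"
begin

text \<open>The sections of the direct image.\<close>

definition flat_cols :: "'x set \<Rightarrow> (nat \<Rightarrow> 'a) set" where
  "flat_cols U = {s \<in> cols U. \<forall>U' a. \<forall>v\<in>T U' a. op U' \<and> U' \<subseteq> U \<longrightarrow> 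
     D U' a v (rcol U U' s) = (\<lambda>k\<in>{..<p + q}. \<zero>\<^bsub>sec Z U'\<^esub>)}"

text \<open>In a chart, the operators \<open>D\<^sub>i\<close> anticommute with each other, and \<open>D\<^sub>i \<theta>\<^sub>j + \<theta>\<^sub>j D\<^sub>i\<close> is the
  Kronecker symbol. Hence \<open>1 - \<theta>\<^sub>i D\<^sub>i = D\<^sub>i \<theta>\<^sub>i\<close> maps to the kernel of \<open>D\<^sub>i\<close>
  and preserves the kernels of the other operators; it changes a column by nilpotents only.\<close>

lemma killed_by_coordinate_fields:
  assumes ch: "chart V m t" and l: "l < p + q" and j: "j \<le> m"
  shows "\<exists>s\<in>cols V. (\<forall>i<j. \<forall>k<p + q. D V True (coord_vf V m t i) s k = \<zero>\<^bsub>sec Z V\<^esub>) \<and>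
    (\<forall>k<p + q. s k \<in> gr (sec Z V) ((p \<le> l) \<noteq> (p \<le> k)) \<and> 
       s k \<ominus>\<^bsub>sec Z V\<^esub> mat_one (sec Z V) (p + q) k l \<in> superalg.nil (sec Z V))"
  using j
proof (induction j)
  case 0
  have V: "op V" using ch by (simp add: chart_def)
  interpret R: superalg "sec Z V" by (rule sec_superalg[OF V])
  have "mcol (p + q) (mat_one (sec Z V) (p + q)) l \<in> cols V"
    using l matsD[OF R.mat_one_closed] by (auto simp: mcol_def)
  moreover have "mat_one (sec Z V) (p + q) k l \<in> gr (sec Z V) ((p \<le> l) \<noteq> (p \<le> k))" if "k < p + q" for k
    using smatD[OF R.smat_one that l] by (cases "p \<le> k"; cases "p \<le> l") auto
  moreover have "mat_one (sec Z V) (p + q) k l \<ominus>\<^bsub>sec Z V\<^esub> mat_one (sec Z V) (p + q) k l \<in> R.nil" if "k < p + q" for k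
    using matsD[OF R.mat_one_closed that l] R.nil_zero by (simp add: R.minus_eq R.r_neg)
  ultimately show ?case by (intro bexI[of _ "mcol (p + q) (mat_one (sec Z V) (p + q)) l"]) auto
next
  case (Suc j)
  have V: "op V" and todd: "\<And>i. i < m \<Longrightarrow> t i \<in> gr (sec Z V) True" using ch by (auto simp: chart_def)
  interpret R: superalg "sec Z V" by (rule sec_superalg[OF V])
  obtain s where s: "s \<in> cols V" and sD: "\<And>i k. i < j \<Longrightarrow> k < p + q \<Longrightarrow> D V True (coord_vf V m t i) s k = \<zero>\<^bsub>sec Z V\<^esub>"
    and sg: "\<And>k. k < p + q \<Longrightarrow> s k \<in> gr (sec Z V) ((p \<le> l) \<noteq> (p \<le> k))"
    and sn: "\<And>k. k < p + q \<Longrightarrow> s k \<ominus>\<^bsub>sec Z V\<^esub> mat_one (sec Z V) (p + q) k l \<in> R.nil"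
    using Suc by auto
  have jm: "j < m" using Suc.prems by simp
  let ?d = "\<lambda>i. coord_vf V m t i"
  have d: "?d i \<in> vfields \<Lambda> Z V True" if "i < m" for i using relD(1)[OF coord_vf_in[OF ch that]] .
  define w where "w = D V True (?d j) s"
  have w: "w \<in> cols V" unfolding w_def by (rule D_closed[OF V d[OF jm] s])
  have wc: "w k \<in> sc V" "s k \<in> sc V" if "k < p + q" for k using w s that by auto
  \<comment> \<open>With this sign, \<open>s'\<close> below is \<open>s - \<theta>\<^sub>j D\<^sub>j s\<close>.\<close>
  define t' where "t' = \<ominus>\<^bsub>sec Z V\<^esub> t j"
  have t': "t' \<in> gr (sec Z V) True" using todd[OF jm] by (simp add: t'_def)
  define u where "u = theta_mult (sec Z V) p q t' w"
  define s' where "s' = (\<lambda>k\<in>{..<p + q}. s k \<oplus>\<^bsub>sec Z V\<^esub> u k)"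
  have u: "u \<in> cols V" using wc t' by (auto simp: u_def theta_mult_def)
  have s': "s' \<in> cols V" using s u by (auto simp: s'_def)
  have anti: "D V True (?d i) w k \<oplus>\<^bsub>sec Z V\<^esub> D V True (?d j) (D V True (?d i) s) k = \<zero>\<^bsub>sec Z V\<^esub>" 
    if "i < m" "k < p + q" for i k
    unfolding w_def by (rule D_anticommute[OF V d[OF that(1)] d[OF jm] coord_vf_anticommute[OF ch that(1) jm] s that(2)])
  \<comment> \<open>for \<open>i = j\<close> the anticommutator is \<open>2 D\<^sub>j D\<^sub>j s\<close>, for \<open>i < j\<close> it reduces to \<open>D\<^sub>i D\<^sub>j s\<close>\<close>
  have Dw: "D V True (?d i) w k = \<zero>\<^bsub>sec Z V\<^esub>" if i: "i \<le> j" and k: "k < p + q" for i k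
  proof (cases "i = j")
    case True
    have "D V True (?d j) w k \<in> sc V" using D_closed[OF V d[OF jm] w] k by auto
    then show ?thesis using anti[OF jm k] True R.two_zero unfolding w_def by blast
  next
    case False
    then have ij: "i < j" "i < m" using i jm by auto
    have "D V True (?d i) s = (\<lambda>k\<in>{..<p + q}. \<zero>\<^bsub>sec Z V\<^esub>)"
      using sD[OF ij(1)] by (intro ext) (auto simp: cov_def)
    then have "D V True (?d j) (D V True (?d i) s) k = \<zero>\<^bsub>sec Z V\<^esub>" using D_zero[OF V d[OF jm] k] by simp
    moreover have "D V True (?d i) w k \<in> sc V" using D_closed[OF V d[OF ij(2)] w] k by auto
    ultimately show ?thesis using anti[OF ij(2) k] by simp
  qed
  have dt: "?d i V t' = (if i = j then \<ominus>\<^bsub>sec Z V\<^esub> \<one>\<^bsub>sec Z V\<^esub> else \<zero>\<^bsub>sec Z V\<^esub>)" if "i < m" for i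
    using coord_vf_coord[OF ch that jm V order.refl] vf_neg[OF d[OF that] V order.refl, of "t j"] todd[OF jm] res_id[OF V, of "t j"]
    by (auto simp: t'_def)
  have "D V True (?d i) s' k = \<zero>\<^bsub>sec Z V\<^esub>" if i: "i < Suc j" and k: "k < p + q" for i k
  proof -
    have im: "i < m" "i \<le> j" using i jm by auto
    have "D V True (?d i) u k = ?d i V t' \<otimes>\<^bsub>sec Z V\<^esub> w k \<ominus>\<^bsub>sec Z V\<^esub> theta_mult (sec Z V) p q t' (D V True (?d i) w) k"
      unfolding u_def by (rule D_theta_mult[OF V d[OF im(1)] t' w k])
    also have "theta_mult (sec Z V) p q t' (D V True (?d i) w) k = \<zero>\<^bsub>sec Z V\<^esub>"
      using Dw[OF im(2) k] k t' by (simp add: theta_mult_def)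
    finally have Du: "D V True (?d i) u k = (if i = j then \<ominus>\<^bsub>sec Z V\<^esub> w k else \<zero>\<^bsub>sec Z V\<^esub>)"
      using dt[OF im(1)] wc[OF k] by (simp add: R.minus_eq R.l_minus)
    have "D V True (?d i) s' k = D V True (?d i) s k \<oplus>\<^bsub>sec Z V\<^esub> D V True (?d i) u k"
      unfolding s'_def by (rule D_add[OF V d[OF im(1)] s u k])
    then show ?thesis using Du wc[OF k] sD[OF _ k, of i] im by (cases "i = j") (auto simp: w_def R.r_neg)
  qed
  moreover have uk: "u k \<in> gr (sec Z V) ((p \<le> l) \<noteq> (p \<le> k)) \<and> u k \<in> R.nil" if k: "k < p + q" for k
  proof -
    have "w k \<in> gr (sec Z V) ((True \<noteq> (p \<le> l)) \<noteq> (p \<le> k))"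
      unfolding w_def by (rule D_gr[OF V d[OF jm] sg k])
    then have "t' \<otimes>\<^bsub>sec Z V\<^esub> sg (sec Z V) (p \<le> k) (w k) \<in> gr (sec Z V) ((p \<le> l) \<noteq> (p \<le> k))"
      "t' \<otimes>\<^bsub>sec Z V\<^esub> sg (sec Z V) (p \<le> k) (w k) \<in> R.nil"
      using R.nil_mult[OF R.nil_odd[OF t'] t'] by (auto intro!: R.gr_mult'[OF t'] R.sg_gr)
    then show ?thesis using k wc[OF k] t' by (simp add: u_def theta_mult_def R.sg_mult_r)
  qed
  moreover have "s' k \<in> gr (sec Z V) ((p \<le> l) \<noteq> (p \<le> k))" if k: "k < p + q" for k
    using sg[OF k] uk[OF k] k by (simp add: s'_def)
  moreover have "s' k \<ominus>\<^bsub>sec Z V\<^esub> mat_one (sec Z V) (p + q) k l \<in> R.nil" if k: "k < p + q" for k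
  proof -
    have I: "mat_one (sec Z V) (p + q) k l \<in> gr (sec Z V) ((p \<le> l) \<noteq> (p \<le> k))"
      using smatD[OF R.smat_one k l] by (cases "p \<le> k"; cases "p \<le> l") auto
    have "s' k \<ominus>\<^bsub>sec Z V\<^esub> mat_one (sec Z V) (p + q) k l = 
        (s k \<ominus>\<^bsub>sec Z V\<^esub> mat_one (sec Z V) (p + q) k l) \<oplus>\<^bsub>sec Z V\<^esub> u k"
      using k wc[OF k] R.gr_closed[OF I] R.gr_closed[OF conjunct1[OF uk[OF k]]]
      by (simp add: s'_def R.minus_eq R.a_ac)
    also have "\<dots> \<in> R.nil" using sn[OF k] uk[OF k] sg[OF k] I by (intro R.nil_add R.gr_minus) auto
    finally show ?thesis .
  qed
  ultimately show ?case using s' by (intro bexI[of _ s']) auto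
qed

text \<open>A relative vector field is a combination of the coordinate fields. The proof subtracts its components
  one at a time: \<open>v\<close> is assumed to kill the coordinates from \<open>j\<close> on, and for \<open>j = 0\<close> it is zero.\<close>

lemma flat_if_killed_by_coordinate_fields:
  assumes ch: "chart V m t" and s: "s \<in> cols V"
    and killed: "\<And>i k. i < m \<Longrightarrow> k < p + q \<Longrightarrow> D V True (coord_vf V m t i) s k = \<zero>\<^bsub>sec Z V\<^esub>"
  shows "s \<in> flat_cols V"
proof -
  have V: "op V" and todd: "\<And>i. i < m \<Longrightarrow> t i \<in> gr (sec Z V) True" using ch by (auto simp: chart_def)
  have main: "D U a v (rcol V U s) k = \<zero>\<^bsub>sec Z U\<^esub>" if "j \<le> m" "v \<in> T U a" "\<And>i. j \<le> i \<Longrightarrow> i < m \<Longrightarrow> v U (res Z V U (t i)) = \<zero>\<^bsub>sec Z U\<^esub>"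
    and U: "op U" "U \<subseteq> V" and k: "k < p + q" for U a j k v
    using that(1-3)
  proof (induction j arbitrary: v)
    case 0
    interpret R: superalg "sec Z U" by (rule sec_superalg[OF U(1)])
    have z: "v U' f = \<zero>\<^bsub>sec Z U'\<^esub>" if "op U'" "U' \<subseteq> U" "f \<in> sc U'" for U' f
      using rel_field_vanishes[OF ch U 0(2) _ that] 0(3) by blast
    have sU: "res Z V U (s k) \<in> sc U" if "k < p + q" for k
    proof -
      have "s k \<in> sc V" using s that by auto
      then show ?thesis using U V by simp
    qed
    have "(\<Oplus>\<^bsub>sec Z U\<^esub>l\<in>{..<p + q}. \<omega> U a v k l \<otimes>\<^bsub>sec Z U\<^esub> rcol V U s l) = (\<Oplus>\<^bsub>sec Z U\<^esub>l\<in>{..<p + q}. \<zero>\<^bsub>sec Z U\<^esub>)"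
      using form_of_zero_field[OF U(1) relD(1)[OF 0(2)] z k] sU by (intro R.finsum_cong') auto
    then show ?case using k z[OF U(1) order.refl sU[OF k]] by (simp add: D_entry)
  next
    case (Suc j)
    interpret R: superalg "sec Z U" by (rule sec_superalg[OF U(1)])
    have jm: "j < m" using Suc.prems by simp
    let ?t = "\<lambda>i. res Z V U (t i)"
    have t: "?t i \<in> gr (sec Z U) True" if "i < m" for i using todd[OF that] U V by simp
    \<comment> \<open>minus the coefficient of the \<open>j\<close>-th coordinate field in \<open>v\<close>\<close>
    define f where "f = \<ominus>\<^bsub>sec Z U\<^esub> v U (?t j)"
    have f: "f \<in> gr (sec Z U) (a \<noteq> True)"
      using vfD(3)[OF relD(1)[OF Suc.prems(2)] U(1) order.refl t[OF jm]] by (simp add: f_def)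
    let ?d = "vf_res U (coord_vf V m t j)"
    have d: "?d \<in> T U True" by (rule rel_res[OF coord_vf_in[OF ch jm] U])
    have sm: "vf_smult Z U f ?d \<in> T U a" using rel_smult[OF U(1) f d] by simp
    define v' where "v' = vf_add Z U v (vf_smult Z U f ?d)"
    have v': "v' \<in> T U a" unfolding v'_def by (rule rel_add[OF Suc.prems(2) sm])
    have sU: "rcol V U s \<in> cols U"
    proof -
      have "s k \<in> sc V" if "k < p + q" for k using s that by auto
      then show ?thesis using U V by simp
    qed
    have vz: "v' U (?t i) = \<zero>\<^bsub>sec Z U\<^esub>" if i: "j \<le> i" "i < m" for i
    proof -
      have "v' U (?t i) = v U (?t i) \<oplus>\<^bsub>sec Z U\<^esub> f \<otimes>\<^bsub>sec Z U\<^esub> coord_vf V m t j U (?t i)"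
        using U R.gr_closed[OF t[OF i(2)]] R.gr_closed[OF f] 
        by (simp add: v'_def vf_add_def vf_smult_def vf_mk_apply vf_res_apply res_id)
      then show ?thesis using coord_vf_coord[OF ch jm i(2) U] Suc.prems(3)[of i] i R.gr_closed[OF f]
          vfD(1)[OF relD(1)[OF Suc.prems(2)] U(1) order.refl R.gr_closed[OF t[OF jm]]]
        by (cases "i = j") (auto simp: f_def R.r_neg)
    qed
    then have E1: "D U a v' (rcol V U s) k = \<zero>\<^bsub>sec Z U\<^esub>" by (rule Suc.IH[OF less_imp_le[OF jm] v'])
    have E2: "D U a v' (rcol V U s) k = D U a v (rcol V U s) k \<oplus>\<^bsub>sec Z U\<^esub> D U a (vf_smult Z U f ?d) (rcol V U s) k"
      unfolding v'_def by (rule D_vf_add[OF U(1) relD(1)[OF Suc.prems(2)] relD(1)[OF sm] sU k])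
    have E3: "D U a (vf_smult Z U f ?d) (rcol V U s) k = \<zero>\<^bsub>sec Z U\<^esub>"
    proof -
      have "D U True ?d (rcol V U s) k = rcol V U (D V True (coord_vf V m t j) s) k"
        using D_res[OF V U relD(1)[OF coord_vf_in[OF ch jm]] s] by simp
      also have "\<dots> = \<zero>\<^bsub>sec Z U\<^esub>" using killed[OF jm k] k superalg_hom.h_zero[OF res_hom[OF V U]] by simp
      finally show ?thesis 
        using D_vf_smult[OF U(1) relD(1)[OF d] f sU k] R.gr_closed[OF f] by simp
    qed
    have E4: "D U a v (rcol V U s) k \<in> sc U"
      using D_closed[OF U(1) relD(1)[OF Suc.prems(2)] sU] k by auto
    show ?case using E1 unfolding E2 E3 R.r_zero[OF E4] .
  qed
  have "D U a v (rcol V U s) = (\<lambda>k\<in>{..<p + q}. \<zero>\<^bsub>sec Z U\<^esub>)" if "v \<in> T U a" "op U" "U \<subseteq> V" for U a v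
  proof (rule extensionalityI[of _ "{..<p + q}"])
    show "D U a v (rcol V U s) k = (\<lambda>k\<in>{..<p + q}. \<zero>\<^bsub>sec Z U\<^esub>) k" if "k \<in> {..<p + q}" for k
      using main[OF order.refl \<open>v \<in> T U a\<close> _ \<open>op U\<close> \<open>U \<subseteq> V\<close>, of k] that by simp
  qed (auto simp: cov_def)
  then show ?thesis using s by (auto simp: flat_cols_def)
qed

definition flat_mats :: "'x set \<Rightarrow> 'a mat set" where
  "flat_mats U = {A \<in> smat (sec Z U) p q False. \<forall>l<p + q. mcol (p + q) A l \<in> flat_cols U}"

text \<open>Over a chart, the columns that the projections make out of the basis vectors form a matrix congruent to
  the identity.\<close>

lemma local_solution:
  assumes "x \<in> topspace (tsp Z)"
  shows "\<exists>U A. op U \<and> x \<in> U \<and> A \<in> carrier (GL1 Z p q U) \<and> A \<in> flat_mats U"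
proof -
  obtain m V t where ch: "chart V m t" and x: "x \<in> V" using charts_exist assms by blast
  have V: "op V" using ch by (simp add: chart_def)
  interpret R: superalg "sec Z V" by (rule sec_superalg[OF V])
  obtain s where s: "\<And>l. l < p + q \<Longrightarrow> s l \<in> cols V \<and> (\<forall>i<m. \<forall>k<p + q. D V True (coord_vf V m t i) (s l) k = \<zero>\<^bsub>sec Z V\<^esub>) \<and>
    (\<forall>k<p + q. s l k \<in> gr (sec Z V) ((p \<le> l) \<noteq> (p \<le> k)) \<and> 
       s l k \<ominus>\<^bsub>sec Z V\<^esub> mat_one (sec Z V) (p + q) k l \<in> R.nil)"
    using killed_by_coordinate_fields[OF ch _ order.refl] by metis
  define A where "A = mk_mat (p + q) (\<lambda>k l. s l k)"
  have A: "A \<in> smat (sec Z V) p q False" unfolding A_def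
  proof (rule mk_mat_in_smat)
    fix k l assume "k < p + q" "l < p + q"
    then have "s l k \<in> gr (sec Z V) ((p \<le> l) \<noteq> (p \<le> k))" using s by blast
    moreover have "((p \<le> l) \<noteq> (p \<le> k)) = (False \<noteq> ((p \<le> k) \<noteq> (p \<le> l)))" by auto
    ultimately show "s l k \<in> gr (sec Z V) (False \<noteq> ((p \<le> k) \<noteq> (p \<le> l)))" by simp
  qed
  have "mcol (p + q) A l \<in> flat_cols V" if l: "l < p + q" for l
  proof -
    have "mcol (p + q) A l = s l" using s[OF l] l by (intro ext) (auto simp: mcol_def A_def PiE_iff extensional_def)
    then show ?thesis using flat_if_killed_by_coordinate_fields[OF ch, of "s l"] s[OF l] by simp
  qed
  then have "A \<in> flat_mats V" using A by (simp add: flat_mats_def)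
  moreover have "A \<in> carrier (GL1 Z p q V)" unfolding GL1_iff nilpotents_iff[OF V]
  proof (intro conjI allI impI ballI A)
    fix k l assume kl: "k < p + q" "l < p + q"
    have e: "A k l \<ominus>\<^bsub>sec Z V\<^esub> mat_one (sec Z V) (p + q) k l \<in> R.nil" using s[OF kl(2)] kl by (simp add: A_def)
    then show c: "A k l \<ominus>\<^bsub>sec Z V\<^esub> mat_one (sec Z V) (p + q) k l \<in> sc V" by (simp add: R.nil_def)
    fix y assume "y \<in> V"
    then show "\<exists>U. op U \<and> y \<in> U \<and> U \<subseteq> V \<and> res Z V U (A k l \<ominus>\<^bsub>sec Z V\<^esub> mat_one (sec Z V) (p + q) k l) \<in> superalg.nil (sec Z U)"
      using V e res_id[OF V c] by (intro exI[of _ V]) auto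
  qed
  ultimately show ?thesis using V x by blast
qed

lemma flat_cols_res:
  assumes U: "op U" and V: "op V" "V \<subseteq> U" and s: "s \<in> flat_cols U"
  shows "rcol U V s \<in> flat_cols V"
proof -
  have sc': "s \<in> cols U" using s by (simp add: flat_cols_def)
  have rr: "rcol V U' (rcol U V s) = rcol U U' s" if "op U'" "U' \<subseteq> V" for U'
  proof -
    have "s k \<in> sc U" if "k < p + q" for k using sc' that by auto
    then show ?thesis using U V that by (auto simp: res_res intro!: restrict_ext)
  qed
  show ?thesis unfolding flat_cols_def
  proof (intro CollectI conjI allI ballI impI)
    have "s k \<in> sc U" if "k < p + q" for k using sc' that by auto
    then show "rcol U V s \<in> cols V" using U V by simp
    fix U' a v assume v: "v \<in> T U' a" and U': "op U' \<and> U' \<subseteq> V"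
    then have "D U' a v (rcol U U' s) = (\<lambda>k\<in>{..<p + q}. \<zero>\<^bsub>sec Z U'\<^esub>)"
      using s V unfolding flat_cols_def by blast
    then show "D U' a v (rcol V U' (rcol U V s)) = (\<lambda>k\<in>{..<p + q}. \<zero>\<^bsub>sec Z U'\<^esub>)"
      using rr U' by simp
  qed
qed

lemma flat_mats_res:
  assumes U: "op U" and V: "op V" "V \<subseteq> U" and A: "A \<in> flat_mats U"
  shows "mat_res Z (p + q) U V A \<in> flat_mats V"
proof -
  have "mcol (p + q) (mat_res Z (p + q) U V A) l = rcol U V (mcol (p + q) A l)" if "l < p + q" for l
    using that by (auto simp: mcol_def mat_res_simps)
  then show ?thesis using A flat_cols_res[OF U V] mat_res_smat[OF U V] by (simp add: flat_mats_def)
qed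

lemma flat_matsD:
  assumes A: "A \<in> flat_mats U" and U: "op U" and v: "v \<in> T U a" and kl: "k < p + q" "l < p + q"
  shows "D U a v (mcol (p + q) A l) k = \<zero>\<^bsub>sec Z U\<^esub>"
proof -
  have s: "mcol (p + q) A l \<in> flat_cols U" using A kl by (simp add: flat_mats_def)
  then have "rcol U U (mcol (p + q) A l) = mcol (p + q) A l"
    using U by (intro ext) (auto simp: flat_cols_def PiE_iff extensional_def res_id)
  moreover have "D U a v (rcol U U (mcol (p + q) A l)) = (\<lambda>k\<in>{..<p + q}. \<zero>\<^bsub>sec Z U\<^esub>)"
    using s U v unfolding flat_cols_def by blast
  ultimately show ?thesis using kl by simp
qed

text \<open>Multiplied by \<open>A\<close>, the equation becomes \<open>dA + \<omega> A = 0\<close>. The \<open>l\<close>-th column of the left-hand side is the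
  covariant derivative of the \<open>l\<close>-th column of \<open>A\<close>.\<close>

lemma neg_dlog_iff:
  assumes U: "op U" and A: "A \<in> carrier (GL Z p q U)"
  shows "neg_dlog Z T p q U A = form_restrict Z T U (form_restrict Z T (topspace (tsp Z)) \<omega>) \<longleftrightarrow> A \<in> flat_mats U"
proof -
  let ?n = "p + q"
  have pointwise: "mat_minus (sec Z U') ?n (mat_mult (sec Z U') ?n (mat_deriv (sec Z U') p q a (v U') (mat_res Z ?n U U' A))
       (inv\<^bsub>GL Z p q U'\<^esub> (mat_res Z ?n U U' A))) = \<omega> U' a v \<longleftrightarrow> 
     (\<forall>l<?n. D U' a v (rcol U U' (mcol ?n A l)) = (\<lambda>k\<in>{..<?n}. \<zero>\<^bsub>sec Z U'\<^esub>))" (is "?L \<longleftrightarrow> ?R")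
    if U': "op U'" "U' \<subseteq> U" and v: "v \<in> T U' a" for U' a v
  proof -
    interpret R: superalg "sec Z U'" by (rule sec_superalg[OF U'(1)])
    interpret G: group "GL Z p q U'" by (rule GL_group[OF U'(1)])
    define B where "B = mat_res Z ?n U U' A"
    define C where "C = inv\<^bsub>GL Z p q U'\<^esub> B"
    define dB where "dB = mat_deriv (sec Z U') p q a (v U') B"
    let ?w = "\<omega> U' a v"
    have B: "B \<in> carrier (GL Z p q U')" unfolding B_def by (rule GL_res[OF U U' A])
    have C: "C \<in> carrier (GL Z p q U')" unfolding C_def using B by simp
    have BC: "mat_mult (sec Z U') ?n B C = mat_one (sec Z U') ?n" "mat_mult (sec Z U') ?n C B = mat_one (sec Z U') ?n"
      using G.r_inv[OF B] G.l_inv[OF B] by (simp_all add: C_def GL_mult GL_one)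
    have m: "B \<in> mats (sec Z U') ?n" "C \<in> mats (sec Z U') ?n" "?w \<in> mats (sec Z U') ?n"
      using GL_mats[OF U'(1) B] GL_mats[OF U'(1) C] R.smat_mats[OF formD(1)[OF U'(1) relD(1)[OF v]]] by auto
    have dB: "dB \<in> mats (sec Z U') ?n" unfolding dB_def mat_deriv_def
      using matsD[OF m(1)] vfD(1)[OF relD(1)[OF v] U'(1) order.refl] by (intro mk_mat_in_mats) auto
    have entry: "D U' a v (rcol U U' (mcol ?n A l)) k = dB k l \<oplus>\<^bsub>sec Z U'\<^esub> mat_mult (sec Z U') ?n ?w B k l"
      if kl: "k < ?n" "l < ?n" for k l
    proof -
      have "(\<Oplus>\<^bsub>sec Z U'\<^esub>j\<in>{..<?n}. ?w k j \<otimes>\<^bsub>sec Z U'\<^esub> rcol U U' (mcol ?n A l) j) = mat_mult (sec Z U') ?n ?w B k l"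
        using kl matsD[OF m(1)] matsD[OF m(3)]
        by (auto simp: mat_mult_simps B_def mat_res_simps intro!: R.finsum_cong')
      then show ?thesis using kl by (simp add: D_entry dB_def mat_deriv_def B_def mat_res_simps)
    qed
    have wB: "mat_mult (sec Z U') ?n ?w B \<in> mats (sec Z U') ?n" by (rule R.mat_mult_closed[OF m(3,1)])
    have R_iff: "?R \<longleftrightarrow> dB = mat_minus (sec Z U') ?n (mat_mult (sec Z U') ?n ?w B)"
    proof
      assume R: ?R
      show "dB = mat_minus (sec Z U') ?n (mat_mult (sec Z U') ?n ?w B)"
      proof (rule mats_eqI[OF dB R.mat_minus_closed[OF wB]])
        fix k l assume kl: "k < ?n" "l < ?n"
        have "dB k l \<oplus>\<^bsub>sec Z U'\<^esub> mat_mult (sec Z U') ?n ?w B k l = \<zero>\<^bsub>sec Z U'\<^esub>"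
          using entry[OF kl] R kl by simp
        then show "dB k l = mat_minus (sec Z U') ?n (mat_mult (sec Z U') ?n ?w B) k l"
          using kl matsD[OF dB kl] matsD[OF wB kl] R.minus_equality by (simp add: mat_minus_def)
      qed
    next
      assume eq: "dB = mat_minus (sec Z U') ?n (mat_mult (sec Z U') ?n ?w B)"
      show ?R
      proof (intro allI impI, rule extensionalityI[of _ "{..<?n}"])
        fix l k assume kl: "l < ?n" "k \<in> {..<?n}"
        have "dB k l = \<ominus>\<^bsub>sec Z U'\<^esub> mat_mult (sec Z U') ?n ?w B k l" using eq kl by (simp add: mat_minus_def)
        then show "D U' a v (rcol U U' (mcol ?n A l)) k = (\<lambda>k\<in>{..<?n}. \<zero>\<^bsub>sec Z U'\<^esub>) k"
          using entry kl matsD[OF wB] by (simp add: R.l_neg)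
      qed (auto simp: cov_def)
    qed
    have minus2: "mat_minus (sec Z U') ?n (mat_minus (sec Z U') ?n M) = M" if "M \<in> mats (sec Z U') ?n" for M
      using matsD[OF that] 
      by (intro mats_eqI[OF R.mat_minus_closed[OF R.mat_minus_closed[OF that]] that]) (simp add: mat_minus_def)
    have dBC: "mat_mult (sec Z U') ?n dB C \<in> mats (sec Z U') ?n" by (rule R.mat_mult_closed[OF dB m(2)])
    have "?L \<longleftrightarrow> mat_minus (sec Z U') ?n (mat_mult (sec Z U') ?n dB C) = ?w"
      by (simp add: B_def C_def dB_def)
    also have "\<dots> \<longleftrightarrow> dB = mat_minus (sec Z U') ?n (mat_mult (sec Z U') ?n ?w B)"
    proof
      assume L: "mat_minus (sec Z U') ?n (mat_mult (sec Z U') ?n dB C) = ?w"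
      have "mat_mult (sec Z U') ?n ?w B = mat_minus (sec Z U') ?n (mat_mult (sec Z U') ?n (mat_mult (sec Z U') ?n dB C) B)"
        unfolding L[symmetric] by (rule R.mat_mult_minus_l[OF dBC m(1)])
      also have "\<dots> = mat_minus (sec Z U') ?n dB"
        unfolding R.mat_mult_assoc[OF dB m(2,1)] BC R.mat_mult_one[OF dB] ..
      finally show "dB = mat_minus (sec Z U') ?n (mat_mult (sec Z U') ?n ?w B)" using minus2[OF dB] by simp
    next
      assume L: "dB = mat_minus (sec Z U') ?n (mat_mult (sec Z U') ?n ?w B)"
      have "mat_mult (sec Z U') ?n dB C = mat_minus (sec Z U') ?n (mat_mult (sec Z U') ?n (mat_mult (sec Z U') ?n ?w B) C)"
        unfolding L by (rule R.mat_mult_minus_l[OF wB m(2)])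
      also have "\<dots> = mat_minus (sec Z U') ?n ?w"
        unfolding R.mat_mult_assoc[OF m(3,1,2)] BC R.mat_mult_one[OF m(3)] ..
      finally show "mat_minus (sec Z U') ?n (mat_mult (sec Z U') ?n dB C) = ?w" using minus2[OF m(3)] by simp
    qed
    finally show ?thesis using R_iff by simp
  qed
  have fr: "form_restrict Z T U (form_restrict Z T (topspace (tsp Z)) \<omega>) U' a v = 
      (if op U' \<and> U' \<subseteq> U \<and> v \<in> T U' a then \<omega> U' a v else undefined)" for U' a v
    using op_top[OF U] by (auto simp: form_restrict_def)
  have "neg_dlog Z T p q U A = form_restrict Z T U (form_restrict Z T (topspace (tsp Z)) \<omega>) \<longleftrightarrow>
    (\<forall>U' a v. op U' \<and> U' \<subseteq> U \<and> v \<in> T U' a \<longrightarrow> 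
      mat_minus (sec Z U') ?n (mat_mult (sec Z U') ?n (mat_deriv (sec Z U') p q a (v U') (mat_res Z ?n U U' A))
       (inv\<^bsub>GL Z p q U'\<^esub> (mat_res Z ?n U U' A))) = \<omega> U' a v)"
  proof -
    have nd: "neg_dlog Z T p q U A U' a v = (if op U' \<and> U' \<subseteq> U \<and> v \<in> T U' a then
        mat_minus (sec Z U') ?n (mat_mult (sec Z U') ?n (mat_deriv (sec Z U') p q a (v U') (mat_res Z ?n U U' A))
       (inv\<^bsub>GL Z p q U'\<^esub> (mat_res Z ?n U U' A))) else undefined)" for U' a v
      by (simp add: neg_dlog_def form_restrict_def Let_def)
    have "f = g \<longleftrightarrow> (\<forall>U' a v. f U' a v = g U' a v)" for f g :: "('x, 'a) mform" by (auto simp: fun_eq_iff)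
    from this[of "neg_dlog Z T p q U A"] show ?thesis unfolding nd fr by auto
  qed
  also have "\<dots> \<longleftrightarrow> (\<forall>U' a v. op U' \<and> U' \<subseteq> U \<and> v \<in> T U' a \<longrightarrow> 
      (\<forall>l<?n. D U' a v (rcol U U' (mcol ?n A l)) = (\<lambda>k\<in>{..<?n}. \<zero>\<^bsub>sec Z U'\<^esub>)))"
    by (intro iff_allI imp_cong refl pointwise) blast+
  also have "\<dots> \<longleftrightarrow> A \<in> flat_mats U"
  proof -
    have "mcol ?n A l \<in> cols U" if "l < ?n" for l
      using matsD[OF GL_mats[OF U A]] that by (auto simp: mcol_def)
    then have "mcol ?n A l \<in> flat_cols U \<longleftrightarrow> (\<forall>U' a v. op U' \<and> U' \<subseteq> U \<and> v \<in> T U' a \<longrightarrow>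
        D U' a v (rcol U U' (mcol ?n A l)) = (\<lambda>k\<in>{..<?n}. \<zero>\<^bsub>sec Z U'\<^esub>))" if "l < ?n" for l
      unfolding flat_cols_def mem_Collect_eq Ball_def using that by meson
    then show ?thesis using GL_smat[OF A] unfolding flat_mats_def by auto
  qed
  finally show ?thesis .
qed

end

section \<open>Flat frames and their transition functions\<close>

context submersion
begin

text \<open>Parity is an equation, and \<open>\<sigma>\<close> is injective.\<close>

lemma \<sigma>_reflects_gr:
  assumes U: "op U" and c: "c \<in> W.sc U" and g: "\<sigma> U c \<in> gr (sec Z U) b"
  shows "c \<in> gr (sec W U) b"
proof -
  interpret h: superalg_hom "sec W U" "sec Z U" "\<sigma> U" by (rule \<sigma>_hom[OF U])
  have "\<sigma> U (h.C.gi c) = \<sigma> U (sg (sec W U) b c)"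
    using c h.R.gi_homogeneous[OF g] by (simp add: h.h_gi h.h_sg)
  then have "h.C.gi c = sg (sec W U) b c" using c by (intro \<sigma>_inj[OF U]) auto
  then show ?thesis using h.C.gr_iff_gi[OF c] by simp
qed

lemma \<sigma>_reflects_nilpotents:
  assumes U: "op U" and c: "c \<in> W.sc U" and g: "\<sigma> U c \<in> nilpotents Z U"
  shows "c \<in> nilpotents W U"
proof -
  have oW: "W.op U" using U by simp
  show ?thesis unfolding W.nilpotents_iff[OF oW]
  proof (intro conjI ballI c)
    fix x assume "x \<in> U"
    then obtain V where V: "op V" "x \<in> V" "V \<subseteq> U" "res Z U V (\<sigma> U c) \<in> superalg.nil (sec Z V)"
      using g[unfolded nilpotents_iff[OF U]] by blast
    interpret h: superalg_hom "sec W V" "sec Z V" "\<sigma> V" by (rule \<sigma>_hom[OF V(1)])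
    have r: "res W U V c \<in> W.sc V" using U V c by simp
    have "\<sigma> V (res W U V c) \<in> h.R.nil" using V U c \<sigma>_res by simp
    then obtain k :: nat where "\<sigma> V (res W U V c [^]\<^bsub>sec W V\<^esub> k) = \<sigma> V \<zero>\<^bsub>sec W V\<^esub>"
      using r by (auto simp: h.R.nil_def h.h_pow)
    then have "res W U V c [^]\<^bsub>sec W V\<^esub> k = \<zero>\<^bsub>sec W V\<^esub>" using r by (intro \<sigma>_inj[OF V(1)]) auto
    then have "res W U V c \<in> h.C.nil" using r by (auto simp: h.C.nil_def)
    then show "\<exists>V. W.op V \<and> x \<in> V \<and> V \<subseteq> U \<and> res W U V c \<in> superalg.nil (sec W V)" using V by auto
  qed
qed

abbreviation \<sigma>m :: "nat \<Rightarrow> 'x set \<Rightarrow> 'b mat \<Rightarrow> 'a mat" where "\<sigma>m n U \<equiv> map_mat n (\<sigma> U)"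

lemma \<sigma>m_mats: "op U \<Longrightarrow> M \<in> mats (sec W U) n \<Longrightarrow> \<sigma>m n U M \<in> mats (sec Z U) n"
  using superalg_hom.map_mat_mats[OF \<sigma>_hom] .

lemma \<sigma>m_smat: "op U \<Longrightarrow> M \<in> smat (sec W U) p q a \<Longrightarrow> \<sigma>m (p + q) U M \<in> smat (sec Z U) p q a"
  using superalg_hom.map_mat_smat[OF \<sigma>_hom] .

lemma \<sigma>m_mult: "op U \<Longrightarrow> M \<in> mats (sec W U) n \<Longrightarrow> N \<in> mats (sec W U) n \<Longrightarrow> 
    \<sigma>m n U (mat_mult (sec W U) n M N) = mat_mult (sec Z U) n (\<sigma>m n U M) (\<sigma>m n U N)"
  using superalg_hom.map_mat_mult[OF \<sigma>_hom] .

lemma \<sigma>m_one: "op U \<Longrightarrow> \<sigma>m n U (mat_one (sec W U) n) = mat_one (sec Z U) n"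
  using superalg_hom.map_mat_one[OF \<sigma>_hom] .

lemma \<sigma>m_res:
  assumes "op U" "op V" "V \<subseteq> U" "M \<in> mats (sec W U) n"
  shows "\<sigma>m n V (mat_res W n U V M) = mat_res Z n U V (\<sigma>m n U M)"
  using assms matsD[OF assms(4)]
  by (intro mats_eqI[OF \<sigma>m_mats mat_res_mats] W.mat_res_mats \<sigma>m_mats)
    (auto simp: mat_res_simps W.mat_res_simps \<sigma>_res)

lemma \<sigma>m_reflects_GL1:
  assumes U: "op U" and M: "M \<in> mats (sec W U) (p + q)" and g: "\<sigma>m (p + q) U M \<in> carrier (GL1 Z p q U)"
  shows "M \<in> carrier (GL1 W p q U)"
proof -
  interpret h: superalg_hom "sec W U" "sec Z U" "\<sigma> U" by (rule \<sigma>_hom[OF U])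
  have s: "\<sigma>m (p + q) U M \<in> smat (sec Z U) p q False" using g by (simp add: GL1_iff)
  have "M \<in> smat (sec W U) p q False"
  proof -
    have "M = mk_mat (p + q) M" using M by (intro mats_eqI[OF M mk_mat_in_mats[OF matsD[OF M]]]) auto
    moreover have "mk_mat (p + q) M \<in> smat (sec W U) p q False"
    proof (rule mk_mat_in_smat, rule \<sigma>_reflects_gr[OF U])
      fix k l assume kl: "k < p + q" "l < p + q"
      show "M k l \<in> W.sc U" by (rule matsD[OF M kl])
      show "\<sigma> U (M k l) \<in> gr (sec Z U) (False \<noteq> ((p \<le> k) \<noteq> (p \<le> l)))" using smatD[OF s kl] kl by simp
    qed
    ultimately show ?thesis by simp
  qed
  moreover have "M k l \<ominus>\<^bsub>sec W U\<^esub> mat_one (sec W U) (p + q) k l \<in> nilpotents W U" if kl: "k < p + q" "l < p + q" for k l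
  proof (rule \<sigma>_reflects_nilpotents[OF U])
    note c = matsD[OF M kl] matsD[OF h.C.mat_one_closed kl]
    show "M k l \<ominus>\<^bsub>sec W U\<^esub> mat_one (sec W U) (p + q) k l \<in> W.sc U" using c by simp
    have "\<sigma> U (mat_one (sec W U) (p + q) k l) = mat_one (sec Z U) (p + q) k l"
      using \<sigma>m_one[OF U, of "p + q"] kl by (metis map_mat_simps)
    then have "\<sigma> U (M k l \<ominus>\<^bsub>sec W U\<^esub> mat_one (sec W U) (p + q) k l) = 
        \<sigma>m (p + q) U M k l \<ominus>\<^bsub>sec Z U\<^esub> mat_one (sec Z U) (p + q) k l"
      using c kl by (simp add: h.h_minus)
    then show "\<sigma> U (M k l \<ominus>\<^bsub>sec W U\<^esub> mat_one (sec W U) (p + q) k l) \<in> nilpotents Z U"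
      using g kl by (simp add: GL1_iff)
  qed
  ultimately show ?thesis by (simp add: W.GL1_iff)
qed

end

context relative_connection
begin

text \<open>For \<open>s = A d\<close> the covariant derivative is \<open>A\<close> applied to the derivatives of \<open>d\<close>, up to signs. As \<open>A\<close> is
  invertible, these vanish, so that the entries of \<open>d\<close> come from the target.\<close>

lemma flat_coordinates:
  assumes U: "op U" and A: "A \<in> carrier (GL Z p q U)" "A \<in> flat_mats U" and s: "s \<in> flat_cols U"
  shows "\<exists>c\<in>{..<p + q} \<rightarrow>\<^sub>E W.sc U. s = mat_vec (sec Z U) (p + q) A (\<lambda>k. \<sigma> U (c k))"
proof -
  let ?n = "p + q"
  interpret R: superalg "sec Z U" by (rule sec_superalg[OF U])
  interpret G: group "GL Z p q U" by (rule GL_group[OF U])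
  define B where "B = inv\<^bsub>GL Z p q U\<^esub> A"
  have B: "B \<in> carrier (GL Z p q U)" using A by (simp add: B_def)
  have AB: "mat_mult (sec Z U) ?n A B = mat_one (sec Z U) ?n"
    using G.r_inv[OF A(1)] by (simp add: B_def GL_mult GL_one)
  have s': "s \<in> cols U" using s by (simp add: flat_cols_def)
  note m = GL_mats[OF U A(1)] GL_mats[OF U B]
  define d where "d = mat_vec (sec Z U) ?n B s"
  have d: "d \<in> cols U" unfolding d_def by (rule R.mat_vec_closed[OF m(2) s'])
  have sd: "s = mat_vec (sec Z U) ?n A d"
    unfolding d_def R.mat_vec_assoc[OF m s', symmetric] AB R.mat_vec_one[OF s'] ..
  have dc: "d k \<in> sc U" if "k < ?n" for k using d that by auto
  have "\<exists>c\<in>W.sc U. \<sigma> U c = d k" if k: "k < ?n" for k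
  proof (rule constant_along_fibers[OF U dc[OF k]])
    fix U' a v assume U': "op U'" "U' \<subseteq> U" and v: "v \<in> T U' a"
    interpret r: superalg_hom "sec Z U" "sec Z U'" "res Z U U'" by (rule res_hom[OF U U'])
    interpret G': group "GL Z p q U'" by (rule GL_group[OF U'(1)])
    let ?A = "mat_res Z ?n U U' A"
    let ?d = "rcol U U' d"
    have A': "?A \<in> flat_mats U'" "?A \<in> carrier (GL Z p q U')" 
      using flat_mats_res[OF U U' A(2)] GL_res[OF U U' A(1)] by auto
    define B' where "B' = inv\<^bsub>GL Z p q U'\<^esub> ?A"
    have B': "B' \<in> carrier (GL Z p q U')" using A' by (simp add: B'_def)
    have BA: "mat_mult (sec Z U') ?n B' ?A = mat_one (sec Z U') ?n"
      using G'.l_inv[OF A'(2)] by (simp add: B'_def GL_mult GL_one)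
    note m' = GL_mats[OF U'(1) A'(2)] GL_mats[OF U'(1) B']
    have d': "?d k \<in> sc U'" if "k < ?n" for k using dc[OF that] that U U' by simp
    have rs: "rcol U U' s = mat_vec (sec Z U') ?n ?A ?d"
    proof (rule extensionalityI[of _ "{..<?n}"])
      fix j assume "j \<in> {..<?n}"
      then show "rcol U U' s j = mat_vec (sec Z U') ?n ?A ?d j"
        unfolding sd using dc matsD[OF m(1)]
        by (auto simp: mat_vec_simps r.h_finsum Pi_def r.h_mult mat_res_simps intro!: r.R.finsum_cong')
    qed (auto simp: mat_vec_def)
    define e where "e = (\<lambda>l\<in>{..<?n}. sg (sec Z U') (a \<and> p \<le> l) (v U' (?d l)))"
    have ve: "v U' (?d l) \<in> sc U'" if "l < ?n" for l
      using vfD(1)[OF relD(1)[OF v] U'(1) order.refl d'[OF that]] .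
    have e: "e \<in> cols U'" using ve by (auto simp: e_def)
    have "D U' a v (rcol U U' s) = (\<lambda>k\<in>{..<?n}. \<zero>\<^bsub>sec Z U'\<^esub>)"
      using s U' v unfolding flat_cols_def by blast
    moreover have "D U' a v (mat_vec (sec Z U') ?n ?A ?d) j = mat_vec (sec Z U') ?n ?A e j" if j: "j < ?n" for j
    proof -
      have "D U' a v (mat_vec (sec Z U') ?n ?A ?d) j = 
        (\<Oplus>\<^bsub>sec Z U'\<^esub>l\<in>{..<?n}. ?A j l \<otimes>\<^bsub>sec Z U'\<^esub> sg (sec Z U') (a \<and> p \<le> l) (v U' (?d l)))"
        by (rule D_mat_vec[OF U'(1) relD(1)[OF v] GL_smat[OF A'(2)] flat_matsD[OF A'(1) U'(1) v] d' j])
      also have "\<dots> = mat_vec (sec Z U') ?n ?A e j"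
        unfolding mat_vec_simps[OF j] using ve matsD[OF m'(1)] j by (intro r.R.finsum_cong') (auto simp: e_def)
      finally show ?thesis .
    qed
    ultimately have "mat_vec (sec Z U') ?n ?A e = (\<lambda>k\<in>{..<?n}. \<zero>\<^bsub>sec Z U'\<^esub>)"
      unfolding rs by (intro extensionalityI[of _ "{..<?n}"]) (auto simp: mat_vec_def)
    then have "e = mat_vec (sec Z U') ?n B' (\<lambda>k\<in>{..<?n}. \<zero>\<^bsub>sec Z U'\<^esub>)"
      using r.R.mat_vec_assoc[OF m'(2,1) e] BA r.R.mat_vec_one[OF e] by simp
    then have "e k = mat_vec (sec Z U') ?n B' (\<lambda>k\<in>{..<?n}. \<zero>\<^bsub>sec Z U'\<^esub>) k" by simp
    also have "\<dots> = (\<Oplus>\<^bsub>sec Z U'\<^esub>l\<in>{..<?n}. \<zero>\<^bsub>sec Z U'\<^esub>)"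
      unfolding mat_vec_simps[OF k] using matsD[OF m'(2)] k by (intro r.R.finsum_cong') auto
    finally have "sg (sec Z U') (a \<and> p \<le> k) (v U' (?d k)) = \<zero>\<^bsub>sec Z U'\<^esub>" using k by (simp add: e_def)
    then show "v U' (res Z U U' (d k)) = \<zero>\<^bsub>sec Z U'\<^esub>" using ve[OF k] k by simp
  qed
  then obtain c where c: "\<And>k. k < ?n \<Longrightarrow> c k \<in> W.sc U \<and> \<sigma> U (c k) = d k" by metis
  have "s = mat_vec (sec Z U) ?n A (\<lambda>k. \<sigma> U (restrict c {..<?n} k))"
    unfolding sd mat_vec_def using c dc matsD[OF m(1)] by (intro restrict_ext R.finsum_cong') auto
  then show ?thesis using c by (intro bexI[of _ "restrict c {..<?n}"]) auto
qed

text \<open>The columns of \<open>B\<close> form a frame of the direct image; their homogeneity is the evenness of \<open>B\<close>.\<close>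

definition frame_mat :: "'x set \<Rightarrow> 'a mat \<Rightarrow> bool" where
  "frame_mat U B \<longleftrightarrow> B \<in> flat_mats U \<and> (\<forall>U'. op U' \<and> U' \<subseteq> U \<longrightarrow> (\<forall>s\<in>flat_cols U'. 
     \<exists>!c. c \<in> {..<p + q} \<rightarrow>\<^sub>E W.sc U' \<and> 
       s = mat_vec (sec Z U') (p + q) (mat_res Z (p + q) U U' B) (\<lambda>k. \<sigma> U' (c k))))"

lemma frame_mat_mats: "op U \<Longrightarrow> frame_mat U B \<Longrightarrow> B \<in> mats (sec Z U) (p + q)"
  using smat_in_mats by (auto simp: frame_mat_def flat_mats_def)

text \<open>The coordinates of a flat column \<open>s\<close> exist as functions on the target by \<open>flat_coordinates\<close>, and are
  recovered from \<open>s\<close> by \<open>A\<^sup>-\<^sup>1 s\<close>.\<close>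

lemma solution_is_frame:
  assumes U: "op U" and A: "A \<in> carrier (GL1 Z p q U)" "A \<in> flat_mats U"
  shows "frame_mat U A"
  unfolding frame_mat_def
proof (intro conjI allI impI ballI A(2))
  fix U' s assume U': "op U' \<and> U' \<subseteq> U" and s: "s \<in> flat_cols U'"
  let ?n = "p + q"
  let ?A = "mat_res Z ?n U U' A"
  have o: "op U'" "U' \<subseteq> U" using U' by auto
  interpret R: superalg "sec Z U'" by (rule sec_superalg[OF o(1)])
  interpret G: group "GL Z p q U'" by (rule GL_group[OF o(1)])
  have GA: "?A \<in> carrier (GL Z p q U')" by (rule GL_res[OF U o GL1_in_GL[OF U A(1)]])
  define B where "B = inv\<^bsub>GL Z p q U'\<^esub> ?A"
  have B: "B \<in> carrier (GL Z p q U')" using GA by (simp add: B_def)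
  have BA: "mat_mult (sec Z U') ?n B ?A = mat_one (sec Z U') ?n"
    using G.l_inv[OF GA] by (simp add: B_def GL_mult GL_one)
  note m = GL_mats[OF o(1) GA] GL_mats[OF o(1) B]
  obtain c where c: "c \<in> {..<?n} \<rightarrow>\<^sub>E W.sc U'" "s = mat_vec (sec Z U') ?n ?A (\<lambda>k. \<sigma> U' (c k))"
    using flat_coordinates[OF o(1) GA flat_mats_res[OF U o A(2)] s] by blast
  have recover: "\<sigma> U' (c k) = mat_vec (sec Z U') ?n B s k"
    if "c \<in> {..<?n} \<rightarrow>\<^sub>E W.sc U'" "s = mat_vec (sec Z U') ?n ?A (\<lambda>k. \<sigma> U' (c k))" "k < ?n" for c k
  proof -
    let ?c = "\<lambda>k\<in>{..<?n}. \<sigma> U' (c k)"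
    have c: "?c \<in> cols U'" using that(1) \<sigma>_closed[OF o(1)] by auto
    have "s = mat_vec (sec Z U') ?n ?A ?c"
      unfolding that(2) mat_vec_def using matsD[OF m(1)] that(1) \<sigma>_closed[OF o(1)]
      by (intro restrict_ext R.finsum_cong') (auto simp: PiE_iff)
    then have "mat_vec (sec Z U') ?n B s = ?c"
      using R.mat_vec_assoc[OF m(2,1) c] BA R.mat_vec_one[OF c] by simp
    then show ?thesis using that(3) by simp
  qed
  show "\<exists>!c. c \<in> {..<p + q} \<rightarrow>\<^sub>E W.sc U' \<and> s = mat_vec (sec Z U') ?n ?A (\<lambda>k. \<sigma> U' (c k))"
  proof (rule ex1I[of _ c])
    fix c' assume c': "c' \<in> {..<p + q} \<rightarrow>\<^sub>E W.sc U' \<and> s = mat_vec (sec Z U') ?n ?A (\<lambda>k. \<sigma> U' (c' k))"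
    show "c' = c"
    proof (rule PiE_ext[of _ "{..<?n}" "\<lambda>_. W.sc U'"])
      fix k assume "k \<in> {..<?n}"
      then show "c' k = c k" using recover[of c' k] recover[of c k] c' c 
        by (intro \<sigma>_inj[OF o(1)]) auto
    qed (use c c' in auto)
  qed (use c in auto)
qed

lemma frame_mat_res:
  assumes U: "op U" and V: "op V" "V \<subseteq> U" and B: "frame_mat U B"
  shows "frame_mat V (mat_res Z (p + q) U V B)"
  unfolding frame_mat_def
proof (intro conjI allI impI ballI)
  show "mat_res Z (p + q) U V B \<in> flat_mats V" using B flat_mats_res[OF U V] by (simp add: frame_mat_def)
  fix U' s assume a: "op U' \<and> U' \<subseteq> V" "s \<in> flat_cols U'"
  have eq: "mat_res Z (p + q) V U' (mat_res Z (p + q) U V B) = mat_res Z (p + q) U U' B"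
    using a V by (intro mat_res_res U frame_mat_mats B) auto
  show "\<exists>!c. c \<in> {..<p + q} \<rightarrow>\<^sub>E W.sc U' \<and> 
      s = mat_vec (sec Z U') (p + q) (mat_res Z (p + q) V U' (mat_res Z (p + q) U V B)) (\<lambda>k. \<sigma> U' (c k))"
    unfolding eq
    by (rule B[unfolded frame_mat_def, THEN conjunct2, THEN spec, THEN mp, THEN bspec]) (use a V in auto)
qed

lemma frame_expand:
  assumes U: "op U" and B: "frame_mat U B" and s: "s \<in> flat_cols U"
  shows "\<exists>!c. c \<in> {..<p + q} \<rightarrow>\<^sub>E W.sc U \<and> s = mat_vec (sec Z U) (p + q) B (\<lambda>k. \<sigma> U (c k))"
proof -
  have eq: "mat_res Z (p + q) U U B = B"
    using U frame_mat_mats[OF U B] 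
    by (intro mats_eqI[OF mat_res_mats frame_mat_mats[OF U B]]) (auto simp: mat_res_simps res_id matsD)
  have "\<exists>!c. c \<in> {..<p + q} \<rightarrow>\<^sub>E W.sc U \<and> 
       s = mat_vec (sec Z U) (p + q) (mat_res Z (p + q) U U B) (\<lambda>k. \<sigma> U (c k))"
    by (rule B[unfolded frame_mat_def, THEN conjunct2, THEN spec, THEN mp, THEN bspec]) (use U s in auto)
  then show ?thesis unfolding eq .
qed

lemma mcol_flat:
  assumes "B \<in> flat_mats U" "l < p + q" shows "mcol (p + q) B l \<in> flat_cols U"
  using assms by (simp add: flat_mats_def)

text \<open>Functions from the target are constants for relative vector fields.\<close>

lemma flat_cols_right_mult:
  assumes U: "op U" and s: "s \<in> flat_cols U" and c: "c \<in> W.sc U"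
  shows "(\<lambda>k\<in>{..<p + q}. s k \<otimes>\<^bsub>sec Z U\<^esub> \<sigma> U c) \<in> flat_cols U"
  unfolding flat_cols_def
proof (intro CollectI conjI allI ballI impI)
  have s': "s k \<in> sc U" if "k < p + q" for k using s that by (auto simp: flat_cols_def)
  have sc': "\<sigma> U c \<in> sc U" by (rule \<sigma>_closed[OF U c])
  interpret RU: superalg "sec Z U" by (rule sec_superalg[OF U])
  show "(\<lambda>k\<in>{..<p + q}. s k \<otimes>\<^bsub>sec Z U\<^esub> \<sigma> U c) \<in> cols U" using s' sc' by simp
  fix U' a v assume v: "v \<in> T U' a" and "op U' \<and> U' \<subseteq> U"
  then have U': "op U'" "U' \<subseteq> U" by auto
  interpret r: superalg_hom "sec Z U" "sec Z U'" "res Z U U'" by (rule res_hom[OF U U'])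
  define e where "e = \<sigma> U' (res W U U' c)"
  have cU: "res W U U' c \<in> W.sc U'" using U U' c by simp
  have e: "e \<in> sc U'" unfolding e_def by (rule \<sigma>_closed[OF U'(1) cU])
  have ve: "v U' e = \<zero>\<^bsub>sec Z U'\<^esub>" unfolding e_def by (rule relD(2)[OF v U'(1) order.refl cU])
  note vd = vfD[OF relD(1)[OF v] U'(1) order.refl]
  have vmult: "v U' (f \<otimes>\<^bsub>sec Z U'\<^esub> e) = v U' f \<otimes>\<^bsub>sec Z U'\<^esub> e" if "f \<in> sc U'" for f
    using that
  proof (induction f rule: r.R.homogeneous_cases)
    case (add x y)
    then show ?case using e vd(1) by (simp add: r.R.l_distr vd(2))
  next
    case (gr x b)
    then show ?case using e ve vd(1) vd(4)[OF gr e] by simp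
  qed
  let ?s = "rcol U U' s"
  have s2: "?s k \<in> sc U'" if "k < p + q" for k using s'[OF that] that U U' by simp
  have eq: "rcol U U' (\<lambda>k\<in>{..<p + q}. s k \<otimes>\<^bsub>sec Z U\<^esub> \<sigma> U c) = (\<lambda>k\<in>{..<p + q}. ?s k \<otimes>\<^bsub>sec Z U'\<^esub> e)"
    using s' sc' U U' c by (intro restrict_ext) (auto simp: r.h_mult e_def \<sigma>_res)
  have De: "D U' a v (\<lambda>k\<in>{..<p + q}. ?s k \<otimes>\<^bsub>sec Z U'\<^esub> e) k = D U' a v ?s k \<otimes>\<^bsub>sec Z U'\<^esub> e" if k: "k < p + q" for k
  proof -
    note w = form_entry(2)[OF U'(1) relD(1)[OF v] k]
    have "(\<Oplus>\<^bsub>sec Z U'\<^esub>l\<in>{..<p + q}. \<omega> U' a v k l \<otimes>\<^bsub>sec Z U'\<^esub> (\<lambda>k\<in>{..<p + q}. ?s k \<otimes>\<^bsub>sec Z U'\<^esub> e) l)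
      = (\<Oplus>\<^bsub>sec Z U'\<^esub>l\<in>{..<p + q}. (\<omega> U' a v k l \<otimes>\<^bsub>sec Z U'\<^esub> ?s l) \<otimes>\<^bsub>sec Z U'\<^esub> e)"
      using s2 e w by (intro r.R.finsum_cong') (auto simp: r.R.m_assoc)
    also have "\<dots> = (\<Oplus>\<^bsub>sec Z U'\<^esub>l\<in>{..<p + q}. \<omega> U' a v k l \<otimes>\<^bsub>sec Z U'\<^esub> ?s l) \<otimes>\<^bsub>sec Z U'\<^esub> e"
      using s2 e w by (intro r.R.finsum_ldistr[symmetric]) auto
    finally have sum: "(\<Oplus>\<^bsub>sec Z U'\<^esub>l\<in>{..<p + q}. \<omega> U' a v k l \<otimes>\<^bsub>sec Z U'\<^esub> (\<lambda>k\<in>{..<p + q}. ?s k \<otimes>\<^bsub>sec Z U'\<^esub> e) l)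
      = (\<Oplus>\<^bsub>sec Z U'\<^esub>l\<in>{..<p + q}. \<omega> U' a v k l \<otimes>\<^bsub>sec Z U'\<^esub> ?s l) \<otimes>\<^bsub>sec Z U'\<^esub> e" .
    have S: "(\<Oplus>\<^bsub>sec Z U'\<^esub>l\<in>{..<p + q}. \<omega> U' a v k l \<otimes>\<^bsub>sec Z U'\<^esub> ?s l) \<in> sc U'"
      using s2 w by (intro r.R.finsum_closed) auto
    show ?thesis unfolding D_entry[OF k] sum using S s2[OF k] e vd(1)[OF s2[OF k]] vmult[OF s2[OF k]] k
      by (simp add: r.R.l_distr r.R.sg_mult_l)
  qed
  have Ds: "D U' a v ?s = (\<lambda>k\<in>{..<p + q}. \<zero>\<^bsub>sec Z U'\<^esub>)"
    using s U' v unfolding flat_cols_def by blast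
  show "D U' a v (rcol U U' (\<lambda>k\<in>{..<p + q}. s k \<otimes>\<^bsub>sec Z U\<^esub> \<sigma> U c)) = (\<lambda>k\<in>{..<p + q}. \<zero>\<^bsub>sec Z U'\<^esub>)"
    unfolding eq
  proof (rule extensionalityI[of _ "{..<p + q}"])
    fix k assume "k \<in> {..<p + q}"
    then show "D U' a v (\<lambda>k\<in>{..<p + q}. ?s k \<otimes>\<^bsub>sec Z U'\<^esub> e) k = (\<lambda>k\<in>{..<p + q}. \<zero>\<^bsub>sec Z U'\<^esub>) k"
      using De[of k] e unfolding Ds by simp
  qed (simp_all add: cov_def)
qed

text \<open>The definition of a frame does not say that \<open>B\<close> is invertible over the source. Uniqueness of
  coordinates allows cancelling \<open>B\<close> in products that have flat columns and whose second factor comes from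
  the target.\<close>

lemma frame_cancel:
  assumes U: "op U" and B: "frame_mat U B" and M: "M \<in> mats (sec W U) (p + q)" "N \<in> mats (sec W U) (p + q)"
    and eq: "mat_mult (sec Z U) (p + q) B (\<sigma>m (p + q) U M) = mat_mult (sec Z U) (p + q) B (\<sigma>m (p + q) U N)"
    and flat_eq: "\<And>l. l < p + q \<Longrightarrow> mcol (p + q) (mat_mult (sec Z U) (p + q) B (\<sigma>m (p + q) U M)) l \<in> flat_cols U"
  shows "M = N"
proof (rule mats_eqI[OF M])
  interpret R: superalg "sec Z U" by (rule sec_superalg[OF U])
  let ?n = "p + q"
  fix k l assume kl: "k < ?n" "l < ?n"
  have col: "mcol ?n (mat_mult (sec Z U) ?n B (\<sigma>m ?n U L)) l = 
      mat_vec (sec Z U) ?n B (\<lambda>k. \<sigma> U (restrict (\<lambda>k. L k l) {..<?n} k))" if "L \<in> mats (sec W U) ?n" for L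
    unfolding mcol_mat_mult[OF kl(2)] mat_vec_def
    using kl matsD[OF that] matsD[OF frame_mat_mats[OF U B]] \<sigma>_closed[OF U]
    by (intro restrict_ext R.finsum_cong') auto
  have "restrict (\<lambda>k. M k l) {..<?n} = restrict (\<lambda>k. N k l) {..<?n}"
    by (rule ex1_eqI[OF frame_expand[OF U B flat_eq[OF kl(2)]]])
      (use col[OF M(1)] col[OF M(2)] eq kl matsD[OF M(1)] matsD[OF M(2)] in auto)
  then show "M k l = N k l" using kl by (metis lessThan_iff restrict_apply')
qed

lemma zero_flat: 
  assumes U: "op U" shows "(\<lambda>k\<in>{..<p + q}. \<zero>\<^bsub>sec Z U\<^esub>) \<in> flat_cols U"
  unfolding flat_cols_def
proof (intro CollectI conjI allI ballI impI)
  interpret R: superalg "sec Z U" by (rule sec_superalg[OF U])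
  show "(\<lambda>k\<in>{..<p + q}. \<zero>\<^bsub>sec Z U\<^esub>) \<in> cols U" by auto
  fix U' a v assume v: "v \<in> T U' a" and "op U' \<and> U' \<subseteq> U"
  then have U': "op U'" "U' \<subseteq> U" by auto
  have "rcol U U' (\<lambda>k\<in>{..<p + q}. \<zero>\<^bsub>sec Z U\<^esub>) = (\<lambda>k\<in>{..<p + q}. \<zero>\<^bsub>sec Z U'\<^esub>)"
    using superalg_hom.h_zero[OF res_hom[OF U U']] by (intro restrict_ext) auto
  then have eq: "rcol U U' (\<lambda>k\<in>{..<p + q}. \<zero>\<^bsub>sec Z U\<^esub>) = (\<lambda>k\<in>{..<p + q}. \<zero>\<^bsub>sec Z U'\<^esub>)" .
  show "D U' a v (rcol U U' (\<lambda>k\<in>{..<p + q}. \<zero>\<^bsub>sec Z U\<^esub>)) = (\<lambda>k\<in>{..<p + q}. \<zero>\<^bsub>sec Z U'\<^esub>)"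
    unfolding eq
  proof (rule extensionalityI[of _ "{..<p + q}"])
    fix k assume "k \<in> {..<p + q}"
    then show "D U' a v (\<lambda>k\<in>{..<p + q}. \<zero>\<^bsub>sec Z U'\<^esub>) k = (\<lambda>k\<in>{..<p + q}. \<zero>\<^bsub>sec Z U'\<^esub>) k"
      using D_zero[OF U'(1) relD(1)[OF v], of k] by (simp only: restrict_apply' lessThan_iff)
  qed (simp_all add: cov_def)
qed

lemma frame_coordinates:
  assumes U: "op U" and B: "frame_mat U B" and B': "B' \<in> flat_mats U"
  shows "\<exists>c\<in>mats (sec W U) (p + q). B' = mat_mult (sec Z U) (p + q) B (\<sigma>m (p + q) U c)"
proof -
  let ?n = "p + q"
  interpret R: superalg "sec Z U" by (rule sec_superalg[OF U])
  obtain C where C: "\<And>l. l < ?n \<Longrightarrow> C l \<in> {..<?n} \<rightarrow>\<^sub>E W.sc U \<and> 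
      mcol ?n B' l = mat_vec (sec Z U) ?n B (\<lambda>k. \<sigma> U (C l k))"
    using ex1_implies_ex[OF frame_expand[OF U B mcol_flat[OF B']]] by metis
  define c where "c = mk_mat ?n (\<lambda>k l. C l k)"
  have Cc: "C l k \<in> W.sc U" if "k < ?n" "l < ?n" for k l using C[OF that(2)] that(1) by auto
  have c: "c \<in> mats (sec W U) ?n" unfolding c_def using Cc by (intro mk_mat_in_mats) auto
  note mB = frame_mat_mats[OF U B]
  have mB': "B' \<in> mats (sec Z U) ?n" using B' smat_in_mats[OF U] by (auto simp: flat_mats_def)
  have "B' = mat_mult (sec Z U) ?n B (\<sigma>m ?n U c)"
  proof (rule mats_eqI[OF mB' R.mat_mult_closed[OF mB \<sigma>m_mats[OF U c]]])
    fix k l assume kl: "k < ?n" "l < ?n"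
    have "B' k l = mat_vec (sec Z U) ?n B (\<lambda>k. \<sigma> U (C l k)) k" using C[OF kl(2)] kl by (metis mcol_simps)
    also have "\<dots> = mat_mult (sec Z U) ?n B (\<sigma>m ?n U c) k l"
      unfolding mat_vec_simps[OF kl(1)] mat_mult_simps[OF kl] using kl Cc \<sigma>_closed[OF U] matsD[OF mB]
      by (intro R.finsum_cong') (auto simp: c_def)
    finally show "B' k l = mat_mult (sec Z U) ?n B (\<sigma>m ?n U c) k l" .
  qed
  then show ?thesis using c by blast
qed

lemma map_mat_add:
  assumes "op U" "M \<in> mats (sec W U) n" "N \<in> mats (sec W U) n"
  shows "\<sigma>m n U (mat_add (sec W U) n M N) = mat_add (sec Z U) n (\<sigma>m n U M) (\<sigma>m n U N)"
proof -
  interpret h: superalg_hom "sec W U" "sec Z U" "\<sigma> U" by (rule \<sigma>_hom[OF assms(1)])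
  show ?thesis
    by (rule mats_eqI[OF \<sigma>m_mats[OF assms(1) h.C.mat_add_closed[OF assms(2,3)]] 
          h.R.mat_add_closed[OF \<sigma>m_mats[OF assms(1,2)] \<sigma>m_mats[OF assms(1,3)]]])
      (use matsD[OF assms(2)] matsD[OF assms(3)] in \<open>simp add: mat_add_def h.h_add\<close>)
qed

text \<open>As \<open>B\<close> and \<open>B'\<close> are even, the product of \<open>B\<close> with the odd part of \<open>c\<close> is the odd part of \<open>B'\<close>, which
  is zero. The odd part of \<open>c\<close> is then zero by cancellation.\<close>

lemma frame_coordinates_even:
  assumes U: "op U" and B: "frame_mat U B" and B': "B' \<in> flat_mats U" and c: "c \<in> mats (sec W U) (p + q)"
    and eq: "B' = mat_mult (sec Z U) (p + q) B (\<sigma>m (p + q) U c)"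
  shows "c \<in> smat (sec W U) p q False"
proof -
  let ?n = "p + q" and ?Z = "sec Z U" and ?W = "sec W U"
  interpret h: superalg_hom ?W ?Z "\<sigma> U" by (rule \<sigma>_hom[OF U])
  define C where "C b = mk_mat ?n (\<lambda>k l. h.C.hpart (b \<noteq> ((p \<le> k) \<noteq> (p \<le> l))) (c k l))" for b
  have C: "C b \<in> smat ?W p q b" for b
    unfolding C_def using matsD[OF c] by (intro mk_mat_in_smat h.C.hpart_gr) auto
  have mC: "C b \<in> mats ?W ?n" for b by (rule h.C.smat_mats[OF C])
  have cC: "c = mat_add ?W ?n (C False) (C True)"
  proof (rule mats_eqI[OF c h.C.mat_add_closed[OF mC mC]])
    fix k l assume kl: "k < ?n" "l < ?n"
    then show "c k l = mat_add ?W ?n (C False) (C True) k l"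
      using h.C.hpart_sum[OF matsD[OF c kl], of "(p \<le> k) \<noteq> (p \<le> l)"] by (simp add: mat_add_def C_def)
  qed
  have Bs: "B \<in> smat ?Z p q False" "B' \<in> smat ?Z p q False" using B B' by (auto simp: frame_mat_def flat_mats_def)
  note mB = h.R.smat_mats[OF Bs(1)]
  let ?P = "\<lambda>b. mat_mult ?Z ?n B (\<sigma>m ?n U (C b))"
  have P: "?P b \<in> smat ?Z p q b" for b
    using h.R.smat_mult_closed[OF Bs(1) \<sigma>m_smat[OF U C, of b]] by simp
  have sum: "B' = mat_add ?Z ?n (?P False) (?P True)"
    unfolding eq by (subst cC) (simp add: map_mat_add[OF U mC mC] h.R.mat_mult_add_r[OF \<sigma>m_mats[OF U mC] \<sigma>m_mats[OF U mC] mB])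
  have zero: "?P True k l = \<zero>\<^bsub>?Z\<^esub>" if kl: "k < ?n" "l < ?n" for k l
  proof -
    let ?g = "(p \<le> k) \<noteq> (p \<le> l)"
    have g: "?P False k l \<in> gr ?Z ?g" "?P True k l \<in> gr ?Z (\<not> ?g)" "B' k l \<in> gr ?Z ?g"
      using smatD[OF P[of False] kl] smatD[OF P[of True] kl] smatD[OF Bs(2) kl] by simp_all
    have "B' k l = ?P True k l \<oplus>\<^bsub>?Z\<^esub> ?P False k l"
      using g by (subst sum) (simp add: mat_add_def kl h.R.a_comm)
    then have "h.R.hpart (\<not> ?g) (B' k l) = ?P True k l" using h.R.hpart_unique[OF g(2), of "?P False k l"] g by simp
    then show ?thesis using h.R.hpart_other[of "B' k l" "\<not> ?g"] g by simp
  qed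
  have Z0: "mat_zero ?W ?n \<in> mats ?W ?n" unfolding mat_zero_def by (intro mk_mat_in_mats) auto
  have "C True = mat_zero ?W ?n"
  proof (rule frame_cancel[OF U B mC Z0])
    show "?P True = mat_mult ?Z ?n B (\<sigma>m ?n U (mat_zero ?W ?n))"
    proof (rule mats_eqI[OF h.R.smat_mats[OF P] h.R.mat_mult_closed[OF mB \<sigma>m_mats[OF U Z0]]])
      fix k l assume kl: "k < ?n" "l < ?n"
      have "mat_mult ?Z ?n B (\<sigma>m ?n U (mat_zero ?W ?n)) k l = (\<Oplus>\<^bsub>?Z\<^esub>j\<in>{..<?n}. \<zero>\<^bsub>?Z\<^esub>)"
        unfolding mat_mult_simps[OF kl] using matsD[OF mB] kl by (intro h.R.finsum_cong') (auto simp: mat_zero_def)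
      then show "?P True k l = mat_mult ?Z ?n B (\<sigma>m ?n U (mat_zero ?W ?n)) k l" using zero[OF kl] by simp
    qed
    fix l assume l: "l < ?n"
    have "mcol ?n (?P True) l = (\<lambda>k\<in>{..<p + q}. \<zero>\<^bsub>sec Z U\<^esub>)"
      unfolding mcol_def using zero l by (intro restrict_ext) auto
    then show "mcol ?n (?P True) l \<in> flat_cols U" using zero_flat[OF U] by simp
  qed
  then have "c k l = C False k l" if "k < ?n" "l < ?n" for k l
    using that matsD[OF mC[of False] that] by (subst cC) (simp add: mat_add_def mat_zero_def)
  then have "c = C False" by (rule mats_eqI[OF c mC])
  then show ?thesis using C[of False] by simp
qed

lemma flat_mats_mats: "op U \<Longrightarrow> B \<in> flat_mats U \<Longrightarrow> B \<in> mats (sec Z U) (p + q)"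
  using smat_in_mats by (auto simp: flat_mats_def)

text \<open>The coordinate matrices of two frames with respect to each other are inverse to each other, by
  cancellation.\<close>

lemma frame_transition:
  assumes U: "op U" and B: "frame_mat U B" and B': "frame_mat U B'"
  shows "\<exists>c\<in>carrier (GL W p q U). B' = mat_mult (sec Z U) (p + q) B (\<sigma>m (p + q) U c)"
proof -
  let ?n = "p + q" and ?Z = "sec Z U" and ?W = "sec W U"
  interpret h: superalg_hom ?W ?Z "\<sigma> U" by (rule \<sigma>_hom[OF U])
  have *: "\<exists>c\<in>smat ?W p q False. B' = mat_mult ?Z ?n B (\<sigma>m ?n U c)" if "frame_mat U B" "frame_mat U B'" for B B'
  proof -
    have f: "B' \<in> flat_mats U" using that(2) by (simp add: frame_mat_def)
    note B = that(1)
    obtain c where "c \<in> mats ?W ?n" "B' = mat_mult ?Z ?n B (\<sigma>m ?n U c)"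
      using frame_coordinates[OF U B f] by blast
    with frame_coordinates_even[OF U B f this] show ?thesis by blast
  qed
  obtain c where c: "c \<in> smat ?W p q False" "B' = mat_mult ?Z ?n B (\<sigma>m ?n U c)" using *[OF B B'] by blast
  obtain d where d: "d \<in> smat ?W p q False" "B = mat_mult ?Z ?n B' (\<sigma>m ?n U d)" using *[OF B' B] by blast
  have inv: "mat_mult ?W ?n c d = mat_one ?W ?n" if B: "frame_mat U B" and c: "c \<in> smat ?W p q False" 
    and d: "d \<in> smat ?W p q False" and e: "B' = mat_mult ?Z ?n B (\<sigma>m ?n U c)" "B = mat_mult ?Z ?n B' (\<sigma>m ?n U d)" for B B' c d
  proof (rule frame_cancel[OF U B])
    note m = h.C.smat_mats[OF c] h.C.smat_mats[OF d] frame_mat_mats[OF U B]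
    show "mat_mult ?W ?n c d \<in> mats ?W ?n" "mat_one ?W ?n \<in> mats ?W ?n"
      using m h.C.mat_mult_closed h.C.mat_one_closed by auto
    have "mat_mult ?Z ?n B (\<sigma>m ?n U (mat_mult ?W ?n c d)) = B"
      using e m by (simp add: \<sigma>m_mult[OF U] h.R.mat_mult_assoc[symmetric] \<sigma>m_mats[OF U])
    then show "mat_mult ?Z ?n B (\<sigma>m ?n U (mat_mult ?W ?n c d)) = mat_mult ?Z ?n B (\<sigma>m ?n U (mat_one ?W ?n))"
      "l < ?n \<Longrightarrow> mcol ?n (mat_mult ?Z ?n B (\<sigma>m ?n U (mat_mult ?W ?n c d))) l \<in> flat_cols U" for l
      using B m by (simp_all add: \<sigma>m_one[OF U] h.R.mat_mult_one frame_mat_def flat_mats_def)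
  qed
  have "c \<in> carrier (GL W p q U)" unfolding W.GL_iff
    using c d inv[OF B c(1) d(1) c(2) d(2)] inv[OF B' d(1) c(1) d(2) c(2)] by blast
  then show ?thesis using c by blast
qed

text \<open>The image of \<open>c\<close> on the source is \<open>A\<^sup>-\<^sup>1 A'\<close>, which is congruent to the identity, and \<open>\<sigma>\<close> reflects
  nilpotency and parity.\<close>

lemma solution_transition:
  assumes U: "op U" and A: "A \<in> carrier (GL1 Z p q U)" "A \<in> flat_mats U"
    and A': "A' \<in> carrier (GL1 Z p q U)" "A' \<in> flat_mats U"
  shows "\<exists>c\<in>carrier (GL1 W p q U). A' = mat_mult (sec Z U) (p + q) A (\<sigma>m (p + q) U c)"
proof -
  let ?n = "p + q" and ?Z = "sec Z U" and ?W = "sec W U"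
  interpret h: superalg_hom ?W ?Z "\<sigma> U" by (rule \<sigma>_hom[OF U])
  obtain c where c: "c \<in> mats ?W ?n" "A' = mat_mult ?Z ?n A (\<sigma>m ?n U c)"
    using frame_coordinates[OF U solution_is_frame[OF U A] A'(2)] by blast
  obtain B where B: "B \<in> carrier (GL1 Z p q U)" "mat_mult ?Z ?n B A = mat_one ?Z ?n"
    using GL1_inverse[OF U A(1)] by blast
  have m: "A \<in> mats ?Z ?n" "B \<in> mats ?Z ?n" using A(1) B(1) U GL1_in_GL GL_mats by blast+
  have "mat_mult ?Z ?n B A' = \<sigma>m ?n U c"
    unfolding c(2) h.R.mat_mult_assoc[OF m(2,1) \<sigma>m_mats[OF U c(1)], symmetric] B(2) 
    by (rule h.R.mat_one_mult[OF \<sigma>m_mats[OF U c(1)]])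
  then have "\<sigma>m ?n U c \<in> carrier (GL1 Z p q U)" using GL1_closed[OF U B(1) A'(1)] by simp
  then show ?thesis using \<sigma>m_reflects_GL1[OF U c(1)] c(2) by blast
qed

text \<open>Both sides are the coordinates of \<open>By\<close> with respect to \<open>B\<close>. If \<open>B\<close> and \<open>B'\<close> belong to one system of
  frames, with transition matrix \<open>g\<close>, and \<open>Bx\<close> and \<open>By\<close> belong to another one, with transition matrix
  \<open>h\<close>, then this is the condition for \<open>g\<close> and \<open>h\<close> to be cohomologous by the matrices \<open>cx\<close>, \<open>cy\<close> that
  compare the systems. With \<open>cy\<close> the identity it is the cocycle condition.\<close>

lemma transition_compatible:
  assumes K: "op K" and B: "frame_mat K B" and By: "By \<in> flat_mats K"
    and m: "cx \<in> mats (sec W K) (p + q)" "cy \<in> mats (sec W K) (p + q)" "g \<in> mats (sec W K) (p + q)" "h \<in> mats (sec W K) (p + q)"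
    and eq: "Bx = mat_mult (sec Z K) (p + q) B (\<sigma>m (p + q) K cx)" "By = mat_mult (sec Z K) (p + q) Bx (\<sigma>m (p + q) K h)"
      "B' = mat_mult (sec Z K) (p + q) B (\<sigma>m (p + q) K g)" "By = mat_mult (sec Z K) (p + q) B' (\<sigma>m (p + q) K cy)"
  shows "mat_mult (sec W K) (p + q) cx h = mat_mult (sec W K) (p + q) g cy"
proof (rule frame_cancel[OF K B])
  let ?n = "p + q"
  interpret h: superalg_hom "sec W K" "sec Z K" "\<sigma> K" by (rule \<sigma>_hom[OF K])
  note mB = frame_mat_mats[OF K B]
  show "mat_mult (sec W K) ?n cx h \<in> mats (sec W K) ?n" "mat_mult (sec W K) ?n g cy \<in> mats (sec W K) ?n"
    using m h.C.mat_mult_closed by auto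
  have 1: "mat_mult (sec Z K) ?n B (\<sigma>m ?n K (mat_mult (sec W K) ?n cx h)) = By"
    unfolding eq(2) eq(1) using m mB by (simp add: \<sigma>m_mult[OF K] h.R.mat_mult_assoc \<sigma>m_mats[OF K])
  have 2: "mat_mult (sec Z K) ?n B (\<sigma>m ?n K (mat_mult (sec W K) ?n g cy)) = By"
    unfolding eq(4) eq(3) using m mB by (simp add: \<sigma>m_mult[OF K] h.R.mat_mult_assoc \<sigma>m_mats[OF K])
  show "mat_mult (sec Z K) ?n B (\<sigma>m ?n K (mat_mult (sec W K) ?n cx h)) = 
     mat_mult (sec Z K) ?n B (\<sigma>m ?n K (mat_mult (sec W K) ?n g cy))" using 1 2 by simp
  show "l < ?n \<Longrightarrow> mcol ?n (mat_mult (sec Z K) ?n B (\<sigma>m ?n K (mat_mult (sec W K) ?n cx h))) l \<in> flat_cols K" for l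
    unfolding 1 by (rule mcol_flat[OF By])
qed

end

section \<open>The direct image and its class\<close>

context relative_connection
begin

abbreviation \<M> :: "('x, 'b, nat \<Rightarrow> 'a) module_sheaf" where
  "\<M> \<equiv> odd_pushforward \<Lambda> Z W \<sigma> (free_conn_module Z p q \<omega>)"

lemma \<M>_simps:
  "carrier (msec \<M> U) = flat_cols U"
  "zero (msec \<M> U) = (\<lambda>k\<in>{..<p + q}. \<zero>\<^bsub>sec Z U\<^esub>)"
  "add (msec \<M> U) = (\<lambda>s t. \<lambda>k\<in>{..<p + q}. s k \<oplus>\<^bsub>sec Z U\<^esub> t k)"
  "ract (msec \<M> U) s c = (\<lambda>k\<in>{..<p + q}. s k \<otimes>\<^bsub>sec Z U\<^esub> \<sigma> U c)"
  "mgr (msec \<M> U) b = {s \<in> cols U. \<forall>k<p + q. s k \<in> gr (sec Z U) (b \<noteq> (p \<le> k))} \<inter> flat_cols U"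
  "mres \<M> U V s = rcol U V s"
  by (auto simp: odd_pushforward_def free_conn_module_def free_rmodule_def Let_def flat_cols_def cov_def)

lemma flat_cols_add:
  assumes U: "op U" and s: "s \<in> flat_cols U" "t \<in> flat_cols U"
  shows "(\<lambda>k\<in>{..<p + q}. s k \<oplus>\<^bsub>sec Z U\<^esub> t k) \<in> flat_cols U"
  unfolding flat_cols_def
proof (intro CollectI conjI allI ballI impI)
  have c: "s k \<in> sc U" "t k \<in> sc U" if "k < p + q" for k using s that by (auto simp: flat_cols_def)
  interpret RU: superalg "sec Z U" by (rule sec_superalg[OF U])
  show "(\<lambda>k\<in>{..<p + q}. s k \<oplus>\<^bsub>sec Z U\<^esub> t k) \<in> cols U" using c by simp
  fix U' a v assume v: "v \<in> T U' a" and "op U' \<and> U' \<subseteq> U"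
  then have U': "op U'" "U' \<subseteq> U" by auto
  interpret r: superalg_hom "sec Z U" "sec Z U'" "res Z U U'" by (rule res_hom[OF U U'])
  have eq: "rcol U U' (\<lambda>k\<in>{..<p + q}. s k \<oplus>\<^bsub>sec Z U\<^esub> t k) = 
      (\<lambda>k\<in>{..<p + q}. rcol U U' s k \<oplus>\<^bsub>sec Z U'\<^esub> rcol U U' t k)"
    using c by (intro restrict_ext) (auto simp: r.h_add)
  have rc: "rcol U U' s \<in> cols U'" "rcol U U' t \<in> cols U'" using c by auto
  have D0: "D U' a v (rcol U U' s) = (\<lambda>k\<in>{..<p + q}. \<zero>\<^bsub>sec Z U'\<^esub>)" 
    "D U' a v (rcol U U' t) = (\<lambda>k\<in>{..<p + q}. \<zero>\<^bsub>sec Z U'\<^esub>)"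
    using s[unfolded flat_cols_def, THEN CollectD, THEN conjunct2, THEN spec, THEN spec, THEN bspec, OF v] U'
    by simp_all
  show "D U' a v (rcol U U' (\<lambda>k\<in>{..<p + q}. s k \<oplus>\<^bsub>sec Z U\<^esub> t k)) = (\<lambda>k\<in>{..<p + q}. \<zero>\<^bsub>sec Z U'\<^esub>)"
    unfolding eq
  proof (rule extensionalityI[of _ "{..<p + q}"])
    fix k assume "k \<in> {..<p + q}"
    then have k: "k < p + q" by simp
    show "D U' a v (\<lambda>k\<in>{..<p + q}. rcol U U' s k \<oplus>\<^bsub>sec Z U'\<^esub> rcol U U' t k) k = (\<lambda>k\<in>{..<p + q}. \<zero>\<^bsub>sec Z U'\<^esub>) k"
      unfolding D_add[OF U'(1) relD(1)[OF v] rc k] D0 using k by simp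
  qed (simp_all add: cov_def)
qed

lemma \<M>_monoid:
  assumes U: "op U" shows "abelian_monoid (msec \<M> U)"
proof (rule abelian_monoidI)
  interpret R: superalg "sec Z U" by (rule sec_superalg[OF U])
  have c: "s k \<in> sc U" if "s \<in> flat_cols U" "k < p + q" for s k using that by (auto simp: flat_cols_def)
  have e: "s \<in> extensional {..<p + q}" if "s \<in> flat_cols U" for s using that by (auto simp: flat_cols_def PiE_iff)
  fix s t u assume s: "s \<in> carrier (msec \<M> U)" and t: "t \<in> carrier (msec \<M> U)"
  show "s \<oplus>\<^bsub>msec \<M> U\<^esub> t \<in> carrier (msec \<M> U)" using s t flat_cols_add[OF U] by (simp add: \<M>_simps)
  show "s \<oplus>\<^bsub>msec \<M> U\<^esub> t = t \<oplus>\<^bsub>msec \<M> U\<^esub> s" using s t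
    by (auto simp: \<M>_simps R.a_comm c intro!: restrict_ext)
  show "\<zero>\<^bsub>msec \<M> U\<^esub> \<oplus>\<^bsub>msec \<M> U\<^esub> s = s" using s e[of s]
    by (intro extensionalityI[of _ "{..<p + q}"]) (auto simp: \<M>_simps c)
  assume u: "u \<in> carrier (msec \<M> U)"
  show "(s \<oplus>\<^bsub>msec \<M> U\<^esub> t) \<oplus>\<^bsub>msec \<M> U\<^esub> u = s \<oplus>\<^bsub>msec \<M> U\<^esub> (t \<oplus>\<^bsub>msec \<M> U\<^esub> u)" using s t u
    by (auto simp: \<M>_simps R.a_assoc c intro!: restrict_ext)
next
  show "\<zero>\<^bsub>msec \<M> U\<^esub> \<in> carrier (msec \<M> U)" using zero_flat[OF U] by (simp add: \<M>_simps)
qed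

lemma \<M>_finsum:
  assumes U: "op U" and "finite I" and F: "\<And>i. i \<in> I \<Longrightarrow> F i \<in> flat_cols U"
  shows "finsum (msec \<M> U) F I = (\<lambda>k\<in>{..<p + q}. \<Oplus>\<^bsub>sec Z U\<^esub>i\<in>I. F i k)"
proof -
  interpret M: abelian_monoid "msec \<M> U" by (rule \<M>_monoid[OF U])
  interpret R: superalg "sec Z U" by (rule sec_superalg[OF U])
  have c: "s k \<in> sc U" if "s \<in> flat_cols U" "k < p + q" for s k using that by (auto simp: flat_cols_def)
  show ?thesis using assms(2,3)
  proof (induction I)
    case empty
    then show ?case by (simp add: \<M>_simps)
  next
    case (insert i I)
    have "finsum (msec \<M> U) F (insert i I) = F i \<oplus>\<^bsub>msec \<M> U\<^esub> finsum (msec \<M> U) F I"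
      using insert by (intro M.finsum_insert) (auto simp: \<M>_simps)
    also have "\<dots> = (\<lambda>k\<in>{..<p + q}. F i k \<oplus>\<^bsub>sec Z U\<^esub> (\<Oplus>\<^bsub>sec Z U\<^esub>i\<in>I. F i k))"
      using insert by (auto simp: \<M>_simps intro!: restrict_ext)
    also have "\<dots> = (\<lambda>k\<in>{..<p + q}. \<Oplus>\<^bsub>sec Z U\<^esub>i\<in>insert i I. F i k)"
      using insert c by (intro restrict_ext R.finsum_insert[symmetric]) auto
    finally show ?case .
  qed
qed

lemma \<M>_combination:
  assumes U: "op U" and V: "op V" "V \<subseteq> U" and A: "A \<in> flat_mats U" 
    and f: "\<And>k. k < p + q \<Longrightarrow> f k = mcol (p + q) A k" and c: "\<And>k. k < p + q \<Longrightarrow> c k \<in> W.sc V"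
  shows "(\<Oplus>\<^bsub>msec \<M> V\<^esub>k\<in>{..<p + q}. ract (msec \<M> V) (mres \<M> U V (f k)) (c k)) = 
    mat_vec (sec Z V) (p + q) (mat_res Z (p + q) U V A) (\<lambda>k. \<sigma> V (c k))"
proof -
  interpret R: superalg "sec Z V" by (rule sec_superalg[OF V(1)])
  have fl: "rcol U V (f k) \<in> flat_cols V" if "k < p + q" for k
    using flat_cols_res[OF U V mcol_flat[OF A that]] f[OF that] by simp
  have "(\<Oplus>\<^bsub>msec \<M> V\<^esub>k\<in>{..<p + q}. ract (msec \<M> V) (mres \<M> U V (f k)) (c k))
    = (\<lambda>j\<in>{..<p + q}. \<Oplus>\<^bsub>sec Z V\<^esub>k\<in>{..<p + q}. (\<lambda>j\<in>{..<p + q}. rcol U V (f k) j \<otimes>\<^bsub>sec Z V\<^esub> \<sigma> V (c k)) j)"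
    unfolding \<M>_simps by (rule \<M>_finsum[OF V(1)], simp, rule flat_cols_right_mult[OF V(1) fl c]) simp_all
  also have "\<dots> = mat_vec (sec Z V) (p + q) (mat_res Z (p + q) U V A) (\<lambda>k. \<sigma> V (c k))"
    unfolding mat_vec_def
    using f c \<sigma>_closed[OF V(1)] matsD[OF mat_res_mats[OF U V flat_mats_mats[OF U A]]]
    by (intro restrict_ext R.finsum_cong') (auto simp: mat_res_simps)
  finally show ?thesis .
qed

lemma frame_iff:
  assumes U: "op U" and A: "A \<in> mats (sec Z U) (p + q)" and f: "\<And>k. k < p + q \<Longrightarrow> f k = mcol (p + q) A k"
  shows "frame W \<M> p q U f \<longleftrightarrow> frame_mat U A"
proof -
  have 1: "(\<forall>k<p + q. f k \<in> mgr (msec \<M> U) (p \<le> k)) \<longleftrightarrow> A \<in> flat_mats U"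
  proof
    assume L: "\<forall>k<p + q. f k \<in> mgr (msec \<M> U) (p \<le> k)"
    have e: "A j k \<in> gr (sec Z U) (False \<noteq> ((p \<le> j) \<noteq> (p \<le> k)))" if "j < p + q" "k < p + q" for j k
    proof -
      have "f k j \<in> gr (sec Z U) ((p \<le> k) \<noteq> (p \<le> j))" using L that by (simp add: \<M>_simps)
      moreover have "((p \<le> k) \<noteq> (p \<le> j)) = (False \<noteq> ((p \<le> j) \<noteq> (p \<le> k)))" by auto
      ultimately show ?thesis using f[OF that(2)] that by simp
    qed
    have "A = mk_mat (p + q) A" by (rule mats_eqI[OF A mk_mat_in_mats[OF matsD[OF A]]]) auto
    moreover have "mk_mat (p + q) A \<in> smat (sec Z U) p q False" by (rule mk_mat_in_smat[OF e])
    ultimately have "A \<in> smat (sec Z U) p q False" by simp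
    then show "A \<in> flat_mats U" using L f by (simp add: flat_mats_def \<M>_simps)
  next
    assume R: "A \<in> flat_mats U"
    show "\<forall>k<p + q. f k \<in> mgr (msec \<M> U) (p \<le> k)"
    proof (intro allI impI)
      fix k assume k: "k < p + q"
      have s: "A \<in> smat (sec Z U) p q False" using R by (simp add: flat_mats_def)
      have "A j k \<in> gr (sec Z U) ((p \<le> k) \<noteq> (p \<le> j))" if j: "j < p + q" for j
      proof -
        have "(False \<noteq> ((p \<le> j) \<noteq> (p \<le> k))) = ((p \<le> k) \<noteq> (p \<le> j))" by auto
        then show ?thesis using smatD[OF s j k] by simp
      qed
      then show "f k \<in> mgr (msec \<M> U) (p \<le> k)"
        using f[OF k] mcol_flat[OF R k] by (simp add: \<M>_simps flat_cols_def)
    qed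
  qed
  have 2: "(\<forall>U'. sub_open (tsp W) U' U \<longrightarrow> (\<forall>s\<in>carrier (msec \<M> U').
      \<exists>!c. c \<in> {..<p + q} \<rightarrow>\<^sub>E carrier (sec W U') \<and>
        s = (\<Oplus>\<^bsub>msec \<M> U'\<^esub>k\<in>{..<p + q}. ract (msec \<M> U') (mres \<M> U U' (f k)) (c k)))) \<longleftrightarrow> 
    (\<forall>U'. op U' \<and> U' \<subseteq> U \<longrightarrow> (\<forall>s\<in>flat_cols U'. 
     \<exists>!c. c \<in> {..<p + q} \<rightarrow>\<^sub>E W.sc U' \<and> 
       s = mat_vec (sec Z U') (p + q) (mat_res Z (p + q) U U' A) (\<lambda>k. \<sigma> U' (c k))))" if "A \<in> flat_mats U"
  proof -
    have eq: "(\<Oplus>\<^bsub>msec \<M> U'\<^esub>k\<in>{..<p + q}. ract (msec \<M> U') (mres \<M> U U' (f k)) (c k)) = 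
       mat_vec (sec Z U') (p + q) (mat_res Z (p + q) U U' A) (\<lambda>k. \<sigma> U' (c k))"
      if "op U' \<and> U' \<subseteq> U" "c \<in> {..<p + q} \<rightarrow>\<^sub>E W.sc U'" for U' c
      using that by (intro \<M>_combination U \<open>A \<in> flat_mats U\<close> f) auto
    show ?thesis unfolding tsp_W sub_open_iff \<M>_simps(1)
      by (intro iff_allI imp_cong refl ball_cong arg_cong[where f = Ex1] ext conj_cong) (simp_all add: eq)
  qed
  show ?thesis unfolding frame_def frame_mat_def by (rule conj_cong[OF 1 2])
qed

subsection \<open>Systems of frames\<close>

abbreviation X :: "'x set" where "X \<equiv> topspace (tsp Z)"

text \<open>For the columns of the matrices this is the relation \<open>f\<^sub>j = f\<^sub>i g\<^sub>i\<^sub>j\<close> of frames; if the matrices are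
  invertible it is \<open>g\<^sub>i\<^sub>j = B\<^sub>i\<^sup>-\<^sup>1 B\<^sub>j\<close>.\<close>

definition transitions :: "('x \<Rightarrow> 'x set) \<Rightarrow> ('x \<Rightarrow> 'x \<Rightarrow> 'b mat) \<Rightarrow> ('x \<Rightarrow> 'a mat) \<Rightarrow> bool" where
  "transitions U g B \<longleftrightarrow> (\<forall>x\<in>X. \<forall>y\<in>X. mat_res Z (p + q) (U y) (U x \<inter> U y) (B y) = 
     mat_mult (sec Z (U x \<inter> U y)) (p + q) (mat_res Z (p + q) (U x) (U x \<inter> U y) (B x)) (\<sigma>m (p + q) (U x \<inter> U y) (g x y)))"

definition solution_cocycles :: "('x, 'b mat) cochain set" where
  "solution_cocycles = {(U, g). (U, g) \<in> cocycles (tsp Z) (GL1 W p q) (mat_res W (p + q)) \<and>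
    (\<exists>A. (\<forall>x\<in>X. A x \<in> carrier (GL1 Z p q (U x)) \<and> A x \<in> flat_mats (U x)) \<and> transitions U g A)}"

definition frame_cocycles :: "('x, 'b mat) cochain set" where
  "frame_cocycles = {(U, g). (U, g) \<in> cocycles (tsp Z) (GL W p q) (mat_res W (p + q)) \<and>
    (\<exists>B. (\<forall>x\<in>X. frame_mat (U x) (B x)) \<and> transitions U g B)}"

lemma product_restrict:
  assumes o: "op U" "op V" "V \<subseteq> U" and m: "A \<in> mats (sec Z U) n" "c \<in> mats (sec W U) n"
  shows "mat_res Z n U V (mat_mult (sec Z U) n A (\<sigma>m n U c)) = 
    mat_mult (sec Z V) n (mat_res Z n U V A) (\<sigma>m n V (mat_res W n U V c))"
  using mat_res_mult[OF o m(1) \<sigma>m_mats[OF o(1) m(2)]] \<sigma>m_res[OF o m(2)] by simp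

text \<open>Over \<open>U x \<inter> V x\<close> the two frames at \<open>x\<close> differ by a matrix \<open>c x\<close>, and these matrices are the required
  cochain. The presheaf \<open>G\<close> stands for all invertible matrices or for those congruent to the identity.\<close>

lemma cohomologous_choices:
  assumes G: "group_presheaf (tsp Z) G (mat_res W (p + q))"
    and Gm: "\<And>U. monoid.mult (G U) = mat_mult (sec W U) (p + q)"
    and Gc: "\<And>U. op U \<Longrightarrow> carrier (G U) \<subseteq> mats (sec W U) (p + q)"
    and c1: "(U, g) \<in> cocycles (tsp Z) G (mat_res W (p + q))" and c2: "(V, h) \<in> cocycles (tsp Z) G (mat_res W (p + q))"
    and B: "\<And>x. x \<in> X \<Longrightarrow> frame_mat (U x) (B x)" "transitions U g B"
    and B': "\<And>x. x \<in> X \<Longrightarrow> frame_mat (V x) (B' x)" "transitions V h B'"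
    and ex: "\<And>x. x \<in> X \<Longrightarrow> \<exists>c\<in>carrier (G (U x \<inter> V x)). mat_res Z (p + q) (V x) (U x \<inter> V x) (B' x) = 
        mat_mult (sec Z (U x \<inter> V x)) (p + q) (mat_res Z (p + q) (U x) (U x \<inter> V x) (B x)) (\<sigma>m (p + q) (U x \<inter> V x) c)"
  shows "((U, g), (V, h)) \<in> cohomologous (tsp Z) G (mat_res W (p + q))"
proof -
  let ?n = "p + q"
  interpret G: group_presheaf "tsp Z" G "mat_res W ?n" by (rule G)
  obtain c where c: "\<And>x. x \<in> X \<Longrightarrow> c x \<in> carrier (G (U x \<inter> V x)) \<and> mat_res Z ?n (V x) (U x \<inter> V x) (B' x) = 
      mat_mult (sec Z (U x \<inter> V x)) ?n (mat_res Z ?n (U x) (U x \<inter> V x) (B x)) (\<sigma>m ?n (U x \<inter> V x) (c x))"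
    using ex by metis
  have oU: "op (U x)" "x \<in> U x" and oV: "op (V x)" "x \<in> V x" if "x \<in> X" for x 
    using G.cocyclesD[OF c1 that that] G.cocyclesD[OF c2 that that] by auto
  show ?thesis
  proof (rule G.cohomologousI[OF c1 c2, of "\<lambda>x. U x \<inter> V x" "\<lambda>x. x" "\<lambda>x. x" c])
    show "point_cover (tsp Z) (\<lambda>x. U x \<inter> V x)" using oU oV by (auto simp: point_cover_def)
    fix x y K assume xy: "x \<in> X" "y \<in> X" and K: "K = U x \<inter> V x \<inter> (U y \<inter> V y)" "op K"
    note o = oU(1)[OF xy(1)] oU(1)[OF xy(2)] oV(1)[OF xy(1)] oV(1)[OF xy(2)]
    have oN: "op (U x \<inter> V x)" "op (U y \<inter> V y)" "op (U x \<inter> U y)" "op (V x \<inter> V y)" using o by auto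
    have Ks: "K \<subseteq> U x" "K \<subseteq> U y" "K \<subseteq> V x" "K \<subseteq> V y" "K \<subseteq> U x \<inter> V x" "K \<subseteq> U y \<inter> V y" 
      "K \<subseteq> U x \<inter> U y" "K \<subseteq> V x \<inter> V y" using K by auto
    have mB: "B x \<in> mats (sec Z (U x)) ?n" "B y \<in> mats (sec Z (U y)) ?n" 
      "B' x \<in> mats (sec Z (V x)) ?n" "B' y \<in> mats (sec Z (V y)) ?n"
      using B(1) B'(1) xy o frame_mat_mats by auto
    have mc: "c x \<in> mats (sec W (U x \<inter> V x)) ?n" "c y \<in> mats (sec W (U y \<inter> V y)) ?n"
      "g x y \<in> mats (sec W (U x \<inter> U y)) ?n" "h x y \<in> mats (sec W (V x \<inter> V y)) ?n"
      using c xy Gc[OF oN(1)] Gc[OF oN(2)] Gc[OF oN(3)] Gc[OF oN(4)] G.cocyclesD(3)[OF c1 xy] G.cocyclesD(3)[OF c2 xy] by auto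
    have restr: "mat_res Z ?n U2 K B2 = mat_mult (sec Z K) ?n (mat_res Z ?n U1 K B1) (\<sigma>m ?n K (mat_res W ?n N K d))"
      if "mat_res Z ?n U2 N B2 = mat_mult (sec Z N) ?n (mat_res Z ?n U1 N B1) (\<sigma>m ?n N d)" "op U1" "op U2" "op N" 
        "N \<subseteq> U1" "N \<subseteq> U2" "K \<subseteq> N" "B1 \<in> mats (sec Z U1) ?n" "B2 \<in> mats (sec Z U2) ?n" "d \<in> mats (sec W N) ?n"
      for U1 U2 N B1 B2 d
      using arg_cong[OF that(1), of "mat_res Z ?n N K"]
      unfolding product_restrict[OF that(4) K(2) that(7) mat_res_mats[OF that(2,4,5,8)] that(10)]
        mat_res_res[OF that(3,4,6) K(2) that(7,9)] mat_res_res[OF that(2,4,5) K(2) that(7,8)] .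
    have "mat_mult (sec W K) ?n (mat_res W ?n (U x \<inter> V x) K (c x)) (mat_res W ?n (V x \<inter> V y) K (h x y)) = 
      mat_mult (sec W K) ?n (mat_res W ?n (U x \<inter> U y) K (g x y)) (mat_res W ?n (U y \<inter> V y) K (c y))"
    proof (rule transition_compatible[OF K(2) frame_mat_res[OF o(1) K(2) Ks(1) B(1)[OF xy(1)]], 
          of "mat_res Z ?n (V y) K (B' y)" _ _ _ _ "mat_res Z ?n (V x) K (B' x)" "mat_res Z ?n (U y) K (B y)"])
      show "mat_res Z ?n (V y) K (B' y) \<in> flat_mats K"
        using flat_mats_res[OF o(4) K(2) Ks(4)] B'(1)[OF xy(2)] by (simp add: frame_mat_def)
      show "mat_res Z ?n (V x) K (B' x) = 
          mat_mult (sec Z K) ?n (mat_res Z ?n (U x) K (B x)) (\<sigma>m ?n K (mat_res W ?n (U x \<inter> V x) K (c x)))"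
        using c[OF xy(1)] by (intro restr) (use o oN Ks mB mc in auto)
      show "mat_res Z ?n (V y) K (B' y) = 
          mat_mult (sec Z K) ?n (mat_res Z ?n (U y) K (B y)) (\<sigma>m ?n K (mat_res W ?n (U y \<inter> V y) K (c y)))"
        using c[OF xy(2)] by (intro restr) (use o oN Ks mB mc in auto)
      show "mat_res Z ?n (V y) K (B' y) = 
          mat_mult (sec Z K) ?n (mat_res Z ?n (V x) K (B' x)) (\<sigma>m ?n K (mat_res W ?n (V x \<inter> V y) K (h x y)))"
        using B'(2) xy by (intro restr) (use o oN Ks mB mc in \<open>auto simp: transitions_def\<close>)
      show "mat_res Z ?n (U y) K (B y) = 
          mat_mult (sec Z K) ?n (mat_res Z ?n (U x) K (B x)) (\<sigma>m ?n K (mat_res W ?n (U x \<inter> U y) K (g x y)))"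
        using B(2) xy by (intro restr) (use o oN Ks mB mc in \<open>auto simp: transitions_def\<close>)
    qed (use W.mat_res_mats mc oN Ks K(2) in auto)
    then show "mat_res W ?n (U x \<inter> V x) K (c x) \<otimes>\<^bsub>G K\<^esub> mat_res W ?n (V x \<inter> V y) K (h x y) =
         mat_res W ?n (U x \<inter> U y) K (g x y) \<otimes>\<^bsub>G K\<^esub> mat_res W ?n (U y \<inter> V y) K (c y)"
      by (simp add: Gm)
  qed (use c in auto)
qed

lemma presheaves:
  "group_presheaf (tsp Z) (GL W p q) (mat_res W (p + q))" "group_presheaf (tsp Z) (GL1 W p q) (mat_res W (p + q))"
  using W.GL_presheaf[of p q] W.GL1_presheaf[of p q] by simp_all

lemma frame_cocycles_cohomologous:
  assumes "a \<in> frame_cocycles" "b \<in> frame_cocycles"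
  shows "(a, b) \<in> cohomologous (tsp Z) (GL W p q) (mat_res W (p + q))"
proof -
  interpret G: group_presheaf "tsp Z" "GL W p q" "mat_res W (p + q)" by (rule presheaves(1))
  obtain U g V h where [simp]: "a = (U, g)" "b = (V, h)" by (cases a, cases b)
  obtain B B' where c: "(U, g) \<in> cocycles (tsp Z) (GL W p q) (mat_res W (p + q))" 
    "(V, h) \<in> cocycles (tsp Z) (GL W p q) (mat_res W (p + q))"
    and B: "\<And>x. x \<in> X \<Longrightarrow> frame_mat (U x) (B x)" "transitions U g B"
    and B': "\<And>x. x \<in> X \<Longrightarrow> frame_mat (V x) (B' x)" "transitions V h B'"
    using assms by (auto simp: frame_cocycles_def)
  have "((U, g), (V, h)) \<in> cohomologous (tsp Z) (GL W p q) (mat_res W (p + q))"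
  proof (rule cohomologous_choices[OF presheaves(1) _ _ c B B'])
    fix x assume x: "x \<in> X"
    have o: "op (U x)" "op (V x)" "op (U x \<inter> V x)" using G.cocyclesD(1)[OF c(1) x x] G.cocyclesD(1)[OF c(2) x x] by auto
    show "\<exists>c\<in>carrier (GL W p q (U x \<inter> V x)). mat_res Z (p + q) (V x) (U x \<inter> V x) (B' x) = 
        mat_mult (sec Z (U x \<inter> V x)) (p + q) (mat_res Z (p + q) (U x) (U x \<inter> V x) (B x)) (\<sigma>m (p + q) (U x \<inter> V x) c)"
      by (rule frame_transition[OF o(3) frame_mat_res[OF o(1,3) _ B(1)[OF x]] frame_mat_res[OF o(2,3) _ B'(1)[OF x]]]) auto
  qed (use W.GL_mult W.GL_mats in auto)
  then show ?thesis by simp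
qed

lemma solution_cocycles_cohomologous:
  assumes "a \<in> solution_cocycles" "b \<in> solution_cocycles"
  shows "(a, b) \<in> cohomologous (tsp Z) (GL1 W p q) (mat_res W (p + q))"
proof -
  interpret G: group_presheaf "tsp Z" "GL1 W p q" "mat_res W (p + q)" by (rule presheaves(2))
  obtain U g V h where [simp]: "a = (U, g)" "b = (V, h)" by (cases a, cases b)
  obtain B B' where c: "(U, g) \<in> cocycles (tsp Z) (GL1 W p q) (mat_res W (p + q))" 
    "(V, h) \<in> cocycles (tsp Z) (GL1 W p q) (mat_res W (p + q))"
    and B: "\<And>x. x \<in> X \<Longrightarrow> B x \<in> carrier (GL1 Z p q (U x)) \<and> B x \<in> flat_mats (U x)" "transitions U g B"
    and B': "\<And>x. x \<in> X \<Longrightarrow> B' x \<in> carrier (GL1 Z p q (V x)) \<and> B' x \<in> flat_mats (V x)" "transitions V h B'"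
    using assms by (auto simp: solution_cocycles_def)
  have o: "op (U x)" "op (V x)" "op (U x \<inter> V x)" if x: "x \<in> X" for x
    using G.cocyclesD(1)[OF c(1) x x] G.cocyclesD(1)[OF c(2) x x] by auto
  have "((U, g), (V, h)) \<in> cohomologous (tsp Z) (GL1 W p q) (mat_res W (p + q))"
  proof (rule cohomologous_choices[OF presheaves(2) _ _ c _ B(2) _ B'(2)])
    show "x \<in> X \<Longrightarrow> frame_mat (U x) (B x)" for x
      using solution_is_frame[OF o(1)] B(1) by simp
    show "x \<in> X \<Longrightarrow> frame_mat (V x) (B' x)" for x
      using solution_is_frame[OF o(2)] B'(1) by simp
    fix x assume x: "x \<in> X"
    show "\<exists>c\<in>carrier (GL1 W p q (U x \<inter> V x)). mat_res Z (p + q) (V x) (U x \<inter> V x) (B' x) = 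
        mat_mult (sec Z (U x \<inter> V x)) (p + q) (mat_res Z (p + q) (U x) (U x \<inter> V x) (B x)) (\<sigma>m (p + q) (U x \<inter> V x) c)"
      using B(1)[OF x] B'(1)[OF x] o[OF x]
      by (intro solution_transition GL1_res flat_mats_res[of "U x"] flat_mats_res[of "V x"]) auto
  qed (use W.GL1_mult W.GL1_in_GL W.GL_mats in auto)
  then show ?thesis by simp
qed

text \<open>This inclusion is what compares the two classes.\<close>

lemma solution_cocycles_subset: "solution_cocycles \<subseteq> frame_cocycles"
proof
  fix a assume a: "a \<in> solution_cocycles"
  obtain U g where [simp]: "a = (U, g)" by (cases a)
  obtain A where c: "(U, g) \<in> cocycles (tsp Z) (GL1 W p q) (mat_res W (p + q))" 
    and A: "\<And>x. x \<in> X \<Longrightarrow> A x \<in> carrier (GL1 Z p q (U x)) \<and> A x \<in> flat_mats (U x)" "transitions U g A"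
    using a by (auto simp: solution_cocycles_def)
  have "op (U x)" if "x \<in> X" for x using group_presheaf.cocyclesD(1)[OF presheaves(2) c that that] .
  then have "\<forall>x\<in>X. frame_mat (U x) (A x)" using A(1) solution_is_frame by blast
  moreover have "(U, g) \<in> cocycles (tsp Z) (GL W p q) (mat_res W (p + q))"
    using c W.cocycles_GL1_GL[of p q] by auto
  ultimately show "a \<in> frame_cocycles" using A(2) by (auto simp: frame_cocycles_def)
qed

lemma solution_cocycle_exists: "\<exists>a. a \<in> solution_cocycles"
proof -
  let ?n = "p + q"
  obtain U A where UA: "\<And>x. x \<in> X \<Longrightarrow> op (U x) \<and> x \<in> U x \<and> A x \<in> carrier (GL1 Z p q (U x)) \<and> A x \<in> flat_mats (U x)"
    using local_solution by metis
  have r: "mat_res Z ?n (U x) K (A x) \<in> carrier (GL1 Z p q K)" "mat_res Z ?n (U x) K (A x) \<in> flat_mats K"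
    "frame_mat K (mat_res Z ?n (U x) K (A x))"
    if "x \<in> X" "op K" "K \<subseteq> U x" for x K
  proof -
    note u = UA[OF that(1)]
    show "mat_res Z ?n (U x) K (A x) \<in> carrier (GL1 Z p q K)" using GL1_res[of "U x" K] u that by simp
    show "mat_res Z ?n (U x) K (A x) \<in> flat_mats K" using flat_mats_res[of "U x" K] u that by simp
    show "frame_mat K (mat_res Z ?n (U x) K (A x))"
      using frame_mat_res[of "U x" K] solution_is_frame[of "U x" "A x"] u that by simp
  qed
  have "\<exists>c\<in>carrier (GL1 W p q (U x \<inter> U y)). mat_res Z ?n (U y) (U x \<inter> U y) (A y) = 
     mat_mult (sec Z (U x \<inter> U y)) ?n (mat_res Z ?n (U x) (U x \<inter> U y) (A x)) (\<sigma>m ?n (U x \<inter> U y) c)"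
    if xy: "x \<in> X" "y \<in> X" for x y
  proof -
    have o: "op (U x \<inter> U y)" using UA xy by auto
    show ?thesis by (intro solution_transition[OF o] r xy o) auto
  qed
  then obtain g where g: "\<And>x y. x \<in> X \<Longrightarrow> y \<in> X \<Longrightarrow> g x y \<in> carrier (GL1 W p q (U x \<inter> U y)) \<and> 
     mat_res Z ?n (U y) (U x \<inter> U y) (A y) = 
     mat_mult (sec Z (U x \<inter> U y)) ?n (mat_res Z ?n (U x) (U x \<inter> U y) (A x)) (\<sigma>m ?n (U x \<inter> U y) (g x y))"
    by metis
  have gm: "g x y \<in> mats (sec W (U x \<inter> U y)) ?n" if "x \<in> X" "y \<in> X" for x y
  proof -
    have "W.op (U x \<inter> U y)" using UA that by auto
    then show ?thesis using g[OF that] W.GL1_in_GL W.GL_mats by blast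
  qed
  have "(U, g) \<in> cocycles (tsp Z) (GL1 W p q) (mat_res W ?n)"
    unfolding cocycles_def Let_def mem_Collect_eq prod.case
  proof (intro conjI ballI)
    show "point_cover (tsp Z) U" using UA by (simp add: point_cover_def)
    show "g x y \<in> carrier (GL1 W p q (U x \<inter> U y))" if "x \<in> X" "y \<in> X" for x y using g that by blast
    fix x y z assume x: "x \<in> X" and y: "y \<in> X" and z: "z \<in> X"
    define K where "K = U x \<inter> U y \<inter> U z"
    have o: "op (U x)" "op (U y)" "op (U z)" "op K" "op (U x \<inter> U y)" "op (U y \<inter> U z)" "op (U x \<inter> U z)"
      using UA x y z by (auto simp: K_def)
    have Ks: "K \<subseteq> U x" "K \<subseteq> U y" "K \<subseteq> U z" "K \<subseteq> U x \<inter> U y" "K \<subseteq> U y \<inter> U z" "K \<subseteq> U x \<inter> U z"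
      by (auto simp: K_def)
    have mA: "A x \<in> mats (sec Z (U x)) ?n" if "x \<in> X" for x using UA[OF that] flat_mats_mats[of "U x" "A x"] by simp
    let ?B = "\<lambda>x. mat_res Z ?n (U x) K (A x)"
    let ?g = "\<lambda>x y. mat_res W ?n (U x \<inter> U y) K (g x y)"
    have eq: "?B b = mat_mult (sec Z K) ?n (?B a) (\<sigma>m ?n K (?g a b))" 
      if "a \<in> X" "b \<in> X" "op (U a)" "op (U b)" "op (U a \<inter> U b)" "K \<subseteq> U a \<inter> U b" for a b
      using arg_cong[OF conjunct2[OF g[OF that(1,2)]], of "mat_res Z ?n (U a \<inter> U b) K"]
      unfolding product_restrict[OF that(5) o(4) that(6) mat_res_mats[OF that(3,5) Int_lower1 mA[OF that(1)]] gm[OF that(1,2)]]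
        mat_res_res[OF that(3,5) Int_lower1 o(4) that(6) mA[OF that(1)]] 
        mat_res_res[OF that(4,5) Int_lower2 o(4) that(6) mA[OF that(2)]] .
    have rm: "?g a b \<in> mats (sec W K) ?n" if "a \<in> X" "b \<in> X" "op (U a \<inter> U b)" "K \<subseteq> U a \<inter> U b" for a b
      using that gm o(4) by (intro W.mat_res_mats) auto
    have W1: "mat_one (sec W K) ?n \<in> mats (sec W K) ?n" 
      by (rule ring.mat_one_closed) (use W.sec_superalg[of K] o(4) superalg.superring superring_def in auto)
    interpret h: superalg_hom "sec W K" "sec Z K" "\<sigma> K" by (rule \<sigma>_hom[OF o(4)])
    have "mat_mult (sec W K) ?n (?g x y) (?g y z) = mat_mult (sec W K) ?n (?g x z) (mat_one (sec W K) ?n)"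
    proof (rule transition_compatible[OF o(4) r(3)[OF x o(4) Ks(1)] r(2)[OF z o(4) Ks(3)] _ W1])
      show "?B y = mat_mult (sec Z K) ?n (?B x) (\<sigma>m ?n K (?g x y))" by (rule eq) (use x y o Ks in auto)
      show "?B z = mat_mult (sec Z K) ?n (?B y) (\<sigma>m ?n K (?g y z))" by (rule eq) (use y z o Ks in auto)
      show "?B z = mat_mult (sec Z K) ?n (?B x) (\<sigma>m ?n K (?g x z))" by (rule eq) (use x z o Ks in auto)
      show "?B z = mat_mult (sec Z K) ?n (?B z) (\<sigma>m ?n K (mat_one (sec W K) ?n))"
        using h.R.mat_mult_one[OF mat_res_mats[OF o(3,4) Ks(3) mA[OF z]]] \<sigma>m_one[OF o(4)] by simp
    qed (use rm x y z o Ks in auto)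
    then have "mat_mult (sec W K) ?n (?g x y) (?g y z) = ?g x z"
      using h.C.mat_mult_one[OF rm[OF x z o(7) Ks(6)]] by simp
    then show "mat_res W ?n (U x \<inter> U y) (U x \<inter> U y \<inter> U z) (g x y) \<otimes>\<^bsub>GL1 W p q (U x \<inter> U y \<inter> U z)\<^esub>
        mat_res W ?n (U y \<inter> U z) (U x \<inter> U y \<inter> U z) (g y z) = mat_res W ?n (U x \<inter> U z) (U x \<inter> U y \<inter> U z) (g x z)"
      by (simp add: K_def W.GL1_mult)
  qed
  then have "(U, g) \<in> solution_cocycles" using UA g unfolding solution_cocycles_def transitions_def by auto
  then show ?thesis by blast
qed

text \<open>The local solutions are the flat matrices by \<open>neg_dlog_iff\<close>, and \<open>g\<^sub>i\<^sub>j = A\<^sub>i\<^sup>-\<^sup>1 A\<^sub>j\<close> is solved for \<open>A\<^sub>j\<close>.\<close>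

lemma connecting_map_eq:
  "connecting_map \<Lambda> Z W \<sigma> p q (form_restrict Z T X \<omega>) = 
   cohomologous (tsp Z) (GL1 W p q) (mat_res W (p + q)) `` solution_cocycles"
proof -
  let ?n = "p + q"
  have key: "(\<exists>A. (\<forall>x\<in>X. A x \<in> carrier (GL1 Z p q (U x)) \<and>
                neg_dlog Z T p q (U x) (A x) = form_restrict Z T (U x) (form_restrict Z T X \<omega>)) \<and>
          (\<forall>x\<in>X. \<forall>y\<in>X. map_mat ?n (\<sigma> (U x \<inter> U y)) (g x y) =
               inv\<^bsub>GL Z p q (U x \<inter> U y)\<^esub> (mat_res Z ?n (U x) (U x \<inter> U y) (A x)) 
               \<otimes>\<^bsub>GL Z p q (U x \<inter> U y)\<^esub> mat_res Z ?n (U y) (U x \<inter> U y) (A y))) \<longleftrightarrow>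
     (\<exists>A. (\<forall>x\<in>X. A x \<in> carrier (GL1 Z p q (U x)) \<and> A x \<in> flat_mats (U x)) \<and> transitions U g A)"
    if c: "(U, g) \<in> cocycles (tsp Z) (GL1 W p q) (mat_res W ?n)" for U g
  proof (rule ex_cong1, rule conj_cong)
    interpret G: group_presheaf "tsp Z" "GL1 W p q" "mat_res W ?n" by (rule presheaves(2))
    have oU: "op (U x)" if "x \<in> X" for x using G.cocyclesD[OF c that that] by auto
    fix A
    show "(\<forall>x\<in>X. A x \<in> carrier (GL1 Z p q (U x)) \<and>
                neg_dlog Z T p q (U x) (A x) = form_restrict Z T (U x) (form_restrict Z T X \<omega>)) \<longleftrightarrow> 
       (\<forall>x\<in>X. A x \<in> carrier (GL1 Z p q (U x)) \<and> A x \<in> flat_mats (U x))"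
      using oU by (intro ball_cong conj_cong refl neg_dlog_iff GL1_in_GL) auto
    assume A: "\<forall>x\<in>X. A x \<in> carrier (GL1 Z p q (U x)) \<and> A x \<in> flat_mats (U x)"
    show "(\<forall>x\<in>X. \<forall>y\<in>X. map_mat ?n (\<sigma> (U x \<inter> U y)) (g x y) =
               inv\<^bsub>GL Z p q (U x \<inter> U y)\<^esub> (mat_res Z ?n (U x) (U x \<inter> U y) (A x)) 
               \<otimes>\<^bsub>GL Z p q (U x \<inter> U y)\<^esub> mat_res Z ?n (U y) (U x \<inter> U y) (A y)) \<longleftrightarrow> transitions U g A"
      unfolding transitions_def
    proof (intro ball_cong refl)
      fix x y assume x: "x \<in> X" and y: "y \<in> X"
      let ?V = "U x \<inter> U y"
      have V: "op ?V" using oU x y by auto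
      interpret V: group "GL Z p q ?V" by (rule GL_group[OF V])
      have a: "mat_res Z ?n (U x) ?V (A x) \<in> carrier (GL Z p q ?V)" "mat_res Z ?n (U y) ?V (A y) \<in> carrier (GL Z p q ?V)"
        using GL_res[OF oU[OF x] V Int_lower1 GL1_in_GL[OF oU[OF x]]] GL_res[OF oU[OF y] V Int_lower2 GL1_in_GL[OF oU[OF y]]] A x y
        by auto
      interpret h: superalg_hom "sec W ?V" "sec Z ?V" "\<sigma> ?V" by (rule \<sigma>_hom[OF V])
      have "g x y \<in> carrier (GL W p q ?V)" using G.cocyclesD(3)[OF c x y] V by (intro W.GL1_in_GL) auto
      then obtain d where d: "g x y \<in> smat (sec W ?V) p q False" "d \<in> smat (sec W ?V) p q False" 
        "mat_mult (sec W ?V) ?n (g x y) d = mat_one (sec W ?V) ?n" "mat_mult (sec W ?V) ?n d (g x y) = mat_one (sec W ?V) ?n"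
        by (auto simp: W.GL_iff)
      have s: "\<sigma>m ?n ?V (g x y) \<in> carrier (GL Z p q ?V)"
        unfolding GL_iff using \<sigma>m_smat[OF V d(1)] \<sigma>m_smat[OF V d(2)] \<sigma>m_mult[OF V h.C.smat_mats[OF d(1)] h.C.smat_mats[OF d(2)]]
          \<sigma>m_mult[OF V h.C.smat_mats[OF d(2)] h.C.smat_mats[OF d(1)]] d(3,4) \<sigma>m_one[OF V, of ?n] 
        by (intro conjI bexI[of _ "\<sigma>m ?n ?V d"]) auto
      have "(\<sigma>m ?n ?V (g x y) = inv\<^bsub>GL Z p q ?V\<^esub> (mat_res Z ?n (U x) ?V (A x)) \<otimes>\<^bsub>GL Z p q ?V\<^esub> mat_res Z ?n (U y) ?V (A y))
         = (mat_res Z ?n (U y) ?V (A y) = mat_res Z ?n (U x) ?V (A x) \<otimes>\<^bsub>GL Z p q ?V\<^esub> \<sigma>m ?n ?V (g x y))"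
        using V.inv_solve_left[OF s a] by simp
      then show "(map_mat ?n (\<sigma> ?V) (g x y) =
               inv\<^bsub>GL Z p q ?V\<^esub> (mat_res Z ?n (U x) ?V (A x)) \<otimes>\<^bsub>GL Z p q ?V\<^esub> mat_res Z ?n (U y) ?V (A y)) \<longleftrightarrow>
           mat_res Z ?n (U y) ?V (A y) = mat_mult (sec Z ?V) ?n (mat_res Z ?n (U x) ?V (A x)) (\<sigma>m ?n ?V (g x y))"
        by (simp add: GL_mult)
    qed
  qed
  show ?thesis unfolding connecting_map_def Let_def solution_cocycles_def tsp_W
    by (intro arg_cong2[where f = Image] refl arg_cong[where f = Collect] arg_cong[where f = case_prod] ext conj_cong)
      (rule key)
qed

text \<open>A frame corresponds to the matrix which has its members as columns.\<close>

lemma bundle_class_eq: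
  "bundle_class W p q \<M> = cohomologous (tsp Z) (GL W p q) (mat_res W (p + q)) `` frame_cocycles"
proof -
  let ?n = "p + q"
  let ?trans = "\<lambda>U g f. \<forall>x\<in>X. \<forall>y\<in>X. \<forall>l<?n. mres \<M> (U y) (U x \<inter> U y) (f y l) =
     (\<Oplus>\<^bsub>msec \<M> (U x \<inter> U y)\<^esub>k\<in>{..<?n}. ract (msec \<M> (U x \<inter> U y)) (mres \<M> (U x) (U x \<inter> U y) (f x k)) (g x y k l))"
  have trans_iff: "?trans U g f \<longleftrightarrow> transitions U g B"
    if c: "(U, g) \<in> cocycles (tsp Z) (GL W p q) (mat_res W ?n)" and B: "\<And>x. x \<in> X \<Longrightarrow> B x \<in> flat_mats (U x)" 
      and f: "\<And>x k. x \<in> X \<Longrightarrow> k < ?n \<Longrightarrow> f x k = mcol ?n (B x) k" for U g f B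
    unfolding transitions_def
  proof (intro ball_cong refl)
    interpret G: group_presheaf "tsp Z" "GL W p q" "mat_res W ?n" by (rule presheaves(1))
    fix x y assume x: "x \<in> X" and y: "y \<in> X"
    let ?V = "U x \<inter> U y"
    have o: "op (U x)" "op (U y)" "op ?V" using G.cocyclesD(1)[OF c x x] G.cocyclesD(1)[OF c y y] by auto
    interpret R: superalg "sec Z ?V" by (rule sec_superalg[OF o(3)])
    have gm: "g x y \<in> mats (sec W ?V) ?n" using G.cocyclesD(3)[OF c x y] o by (intro W.GL_mats) auto
    have mB: "mat_res Z ?n (U x) ?V (B x) \<in> mats (sec Z ?V) ?n" "mat_res Z ?n (U y) ?V (B y) \<in> mats (sec Z ?V) ?n"
      using flat_mats_mats[OF o(1) B[OF x]] flat_mats_mats[OF o(2) B[OF y]] o by (auto intro!: mat_res_mats)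
    let ?P = "mat_mult (sec Z ?V) ?n (mat_res Z ?n (U x) ?V (B x)) (\<sigma>m ?n ?V (g x y))"
    have P: "?P \<in> mats (sec Z ?V) ?n" by (rule R.mat_mult_closed[OF mB(1) \<sigma>m_mats[OF o(3) gm]])
    have lhs: "mres \<M> (U y) ?V (f y l) = mcol ?n (mat_res Z ?n (U y) ?V (B y)) l" if "l < ?n" for l
      using f[OF y that] that by (auto simp: \<M>_simps mcol_def mat_res_simps intro!: restrict_ext)
    have rhs: "(\<Oplus>\<^bsub>msec \<M> ?V\<^esub>k\<in>{..<?n}. ract (msec \<M> ?V) (mres \<M> (U x) ?V (f x k)) (g x y k l)) = mcol ?n ?P l" if l: "l < ?n" for l
    proof -
      have "(\<Oplus>\<^bsub>msec \<M> ?V\<^esub>k\<in>{..<?n}. ract (msec \<M> ?V) (mres \<M> (U x) ?V (f x k)) (g x y k l)) = 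
          mat_vec (sec Z ?V) ?n (mat_res Z ?n (U x) ?V (B x)) (\<lambda>k. \<sigma> ?V (g x y k l))"
        using l matsD[OF gm] f[OF x] by (intro \<M>_combination[OF o(1,3)] B[OF x]) auto
      also have "\<dots> = mcol ?n ?P l"
        unfolding mcol_mat_mult[OF l] mat_vec_def using l matsD[OF mB(1)] matsD[OF \<sigma>m_mats[OF o(3) gm]]
        by (intro restrict_ext R.finsum_cong') auto
      finally show ?thesis .
    qed
    have "(\<forall>l<?n. mcol ?n (mat_res Z ?n (U y) ?V (B y)) l = mcol ?n ?P l) \<longleftrightarrow> mat_res Z ?n (U y) ?V (B y) = ?P"
    proof
      assume L: "\<forall>l<?n. mcol ?n (mat_res Z ?n (U y) ?V (B y)) l = mcol ?n ?P l"
      show "mat_res Z ?n (U y) ?V (B y) = ?P"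
      proof (rule mats_eqI[OF mB(2) P])
        fix k l assume kl: "k < ?n" "l < ?n"
        then have "mcol ?n (mat_res Z ?n (U y) ?V (B y)) l k = mcol ?n ?P l k" using L by simp
        then show "mat_res Z ?n (U y) ?V (B y) k l = ?P k l" using kl(1) by (simp only: mcol_simps)
      qed
    qed simp
    then show "(\<forall>l<?n. mres \<M> (U y) ?V (f y l) =
       (\<Oplus>\<^bsub>msec \<M> ?V\<^esub>k\<in>{..<?n}. ract (msec \<M> ?V) (mres \<M> (U x) ?V (f x k)) (g x y k l))) \<longleftrightarrow>
      mat_res Z ?n (U y) ?V (B y) = ?P" using lhs rhs by simp
  qed
  have key: "(\<exists>f. (\<forall>x\<in>X. frame W \<M> p q (U x) (f x)) \<and> ?trans U g f) \<longleftrightarrow>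
     (\<exists>B. (\<forall>x\<in>X. frame_mat (U x) (B x)) \<and> transitions U g B)"
    if c: "(U, g) \<in> cocycles (tsp Z) (GL W p q) (mat_res W ?n)" for U g
  proof
    interpret G: group_presheaf "tsp Z" "GL W p q" "mat_res W ?n" by (rule presheaves(1))
    have oU: "op (U x)" if "x \<in> X" for x using G.cocyclesD[OF c that that] by auto
    {
      assume "\<exists>f. (\<forall>x\<in>X. frame W \<M> p q (U x) (f x)) \<and> ?trans U g f"
      then obtain f where f: "\<And>x. x \<in> X \<Longrightarrow> frame W \<M> p q (U x) (f x)" "?trans U g f" by blast
      define B where "B x = mk_mat ?n (\<lambda>j k. f x k j)" for x
      have fc: "f x k \<in> cols (U x)" if "x \<in> X" "k < ?n" for x k
        using f(1)[OF that(1)] that(2) unfolding frame_def by (auto simp: \<M>_simps flat_cols_def)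
      have fB: "f x k = mcol ?n (B x) k" if "x \<in> X" "k < ?n" for x k
        using fc[OF that] that by (intro extensionalityI[of _ "{..<?n}"]) (auto simp: mcol_def B_def PiE_iff)
      have Bm: "B x \<in> mats (sec Z (U x)) ?n" if "x \<in> X" for x
        unfolding B_def using fc[OF that] by (intro mk_mat_in_mats) auto
      have fr: "frame_mat (U x) (B x)" if "x \<in> X" for x
        using frame_iff[OF oU[OF that] Bm[OF that] fB[OF that]] f(1)[OF that] by simp
      have "transitions U g B" using f(2) trans_iff[OF c _ fB] fr by (simp add: frame_mat_def)
      then show "\<exists>B. (\<forall>x\<in>X. frame_mat (U x) (B x)) \<and> transitions U g B" using fr by blast
    next
      assume "\<exists>B. (\<forall>x\<in>X. frame_mat (U x) (B x)) \<and> transitions U g B"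
      then obtain B where B: "\<And>x. x \<in> X \<Longrightarrow> frame_mat (U x) (B x)" "transitions U g B" by blast
      have "frame W \<M> p q (U x) (mcol ?n (B x))" if "x \<in> X" for x
        using frame_iff[OF oU[OF that] frame_mat_mats[OF oU[OF that] B(1)[OF that]]] B(1)[OF that] by simp
      then have "\<forall>x\<in>X. frame W \<M> p q (U x) (mcol ?n (B x))" by (rule ballI)
      moreover have "?trans U g (\<lambda>x. mcol ?n (B x))"
        using trans_iff[OF c, of B "\<lambda>x. mcol ?n (B x)"] B by (simp add: frame_mat_def)
      ultimately show "\<exists>f. (\<forall>x\<in>X. frame W \<M> p q (U x) (f x)) \<and> ?trans U g f"
        by (intro exI[of _ "\<lambda>x. mcol ?n (B x)"] conjI)
    }
  qed
  show ?thesis unfolding bundle_class_def Let_def frame_cocycles_def tsp_W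
    by (intro arg_cong2[where f = Image] refl arg_cong[where f = Collect] arg_cong[where f = case_prod] ext conj_cong)
      (rule key)
qed

theorem class_of_direct_image:
  "connecting_map \<Lambda> Z W \<sigma> p q (form_restrict Z T X \<omega>) \<in> H1_GL1 W p q"
  "bundle_class W p q \<M> \<in> H1_GL W p q"
  "bundle_class W p q \<M> = H1_incl W p q (connecting_map \<Lambda> Z W \<sigma> p q (form_restrict Z T X \<omega>))"
proof -
  let ?R1 = "cohomologous (tsp Z) (GL1 W p q) (mat_res W (p + q))"
  let ?R = "cohomologous (tsp Z) (GL W p q) (mat_res W (p + q))"
  interpret G: group_presheaf "tsp Z" "GL W p q" "mat_res W (p + q)" by (rule presheaves(1))
  interpret G1: group_presheaf "tsp Z" "GL1 W p q" "mat_res W (p + q)" by (rule presheaves(2))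
  obtain a where a: "a \<in> solution_cocycles" using solution_cocycle_exists by blast
  have a': "a \<in> frame_cocycles" using a solution_cocycles_subset by blast
  have S1: "solution_cocycles \<subseteq> cocycles (tsp Z) (GL1 W p q) (mat_res W (p + q))"
    by (auto simp: solution_cocycles_def)
  have S: "frame_cocycles \<subseteq> cocycles (tsp Z) (GL W p q) (mat_res W (p + q))"
    by (auto simp: frame_cocycles_def)
  note C1 = G1.class_of_choices[OF a S1 solution_cocycles_cohomologous]
  note C = G.class_of_choices[OF a' S frame_cocycles_cohomologous]
  show "connecting_map \<Lambda> Z W \<sigma> p q (form_restrict Z T X \<omega>) \<in> H1_GL1 W p q"
    using C1(2) connecting_map_eq by simp
  show "bundle_class W p q \<M> \<in> H1_GL W p q"
    using C(2) bundle_class_eq by simp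
  have sub: "?R1 \<subseteq> ?R" using W.cohomologous_GL1_GL[of p q] by simp
  have aa: "(a, a) \<in> ?R1" by (rule solution_cocycles_cohomologous[OF a a])
  have tr: "trans ?R" using G.cohomologous_equiv by (auto elim: equivE)
  \<comment> \<open>both classes are represented by the same cocycle \<open>a\<close>\<close>
  have "?R `` (?R1 `` {a}) = ?R `` {a}"
  proof
    show "?R `` (?R1 `` {a}) \<subseteq> ?R `` {a}" using sub transD[OF tr] by blast
    show "?R `` {a} \<subseteq> ?R `` (?R1 `` {a})" using aa by blast
  qed
  then show "bundle_class W p q \<M> = H1_incl W p q (connecting_map \<Lambda> Z W \<sigma> p q (form_restrict Z T X \<omega>))"
    using bundle_class_eq C(1) connecting_map_eq C1(1) by (simp add: H1_incl_def)
qed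

end

theorem corollary14:
  fixes \<tau> :: setting
    and \<Lambda> :: "'l base_alg"
    and Z :: "('x, 'a, 'l) superspace"
    and W :: "('x, 'b, 'l) superspace"
    and \<sigma> :: "'x set \<Rightarrow> 'b \<Rightarrow> 'a"
    and p q :: nat
    and \<omega> \<omega>\<^sub>\<sigma> :: "('x, 'a) mform"
    and F :: "('x, 'a, nat \<Rightarrow> 'a) conn_module"
  assumes "nilpotent_extension \<Lambda>"
    and "smooth_superscheme \<tau> \<Lambda> Z"
    and "smooth_superscheme \<tau> \<Lambda> W"
    and "purely_odd_submersion \<Lambda> Z W \<sigma>"
    and "\<omega> \<in> flat_forms Z (vfields \<Lambda> Z) p q (topspace (tsp Z))"
    and "F = free_conn_module Z p q \<omega>"
    and "\<omega>\<^sub>\<sigma> = form_restrict Z (rel_vfields \<Lambda> Z W \<sigma>) (topspace (tsp Z)) \<omega>"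
  shows "\<omega>\<^sub>\<sigma> \<in> flat_forms Z (rel_vfields \<Lambda> Z W \<sigma>) p q (topspace (tsp Z))
    \<and> connecting_map \<Lambda> Z W \<sigma> p q \<omega>\<^sub>\<sigma> \<in> H1_GL1 W p q
    \<and> bundle_class W p q (odd_pushforward \<Lambda> Z W \<sigma> F) \<in> H1_GL W p q
    \<and> bundle_class W p q (odd_pushforward \<Lambda> Z W \<sigma> F)
        = H1_incl W p q (connecting_map \<Lambda> Z W \<sigma> p q \<omega>\<^sub>\<sigma>)"
proof -
  interpret relative_connection \<Lambda> Z W \<sigma> p q \<omega>
    using assms(1-5) by unfold_locales (auto simp: smooth_superscheme_def)
  show ?thesis unfolding assms(6,7) using restricted_form_flat[OF assms(5)] class_of_direct_image by blast
qed

end
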